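(* Let $\theta$ be an inaccessible cardinal, $\mathcal K=(V_\theta,\in)$, $\mathcal S$ the set of all countable elementary submodels of $\mathcal K$, and $\mathcal T=\{V_\alpha:\alpha<\theta,\ \mathrm{cf}(\alpha)>\omega,\ V_\alpha\prec\mathcal K\}$. Let $G$ be $V$-generic over $\mathbb M^*_{\mathcal S,\mathcal T}$. Then in $V[G]$, $\theta=\omega_2$ and $\mathrm{NS}_{\omega_1}$ is not precipitous.
   Context: A side condition is a finite $\in$-chain $\mathcal M=\{M_0\in\dots\in M_{n-1}\}$ of elements of $\mathcal S\cup\mathcal T$ closed under pairwise intersections; members of $\mathcal S$ are countable nodes. For such $\mathcal M$, $h_{\mathcal M}$ is the partial function on $\theta\times\omega_1$ with domain the set of $(\alpha,\xi)$ such that some countable node $M$ has $M\cap\omega_1=\xi$, $\alpha\in M$, and $h_{\mathcal M}(\alpha,\xi)=\max\{\mathrm{otp}(M\cap\theta): M\text{ countable node},\ \alpha\in M,\ M\cap\omega_1=\xi\}$. $\mathbb M^*_{\mathcal S,\mathcal T}$ consists of pairs $p=(\mathcal M_p,d_p)$, $\mathcal M_p$ a side condition, $d_p$ assigning to each node $M$ a finite set $d_p(M)$ belonging to the successor of $M$ in $\mathcal M_p$ (or to $V_\theta$ if $M$ is the top node), such that for all countable nodes $M,N$ of $\mathcal M_p$, if $N\cap\omega_1\in M$ then $\mathrm{otp}(N\cap\theta)\in M$. With $h_p=h_{\mathcal M_p}$, $q\le p$ iff $\mathcal M_p\subseteq\mathcal M_q$, $d_p(M)\subseteq d_q(M)$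 for all $M\in\mathcal M_p$, and $h_p\subseteq h_q$. An ideal $\mathcal I$ on $\omega_1$ is precipitous if forcing with $\mathcal I$-positive sets yields a well-founded generic ultrapower. *)

theory Defs
  imports Main
begin

text \<open>
  A universe of sets is a type with a map \<open>elts\<close> sending each set to the collection of its
  elements.  All set-theoretic notions below are relative to \<open>elts\<close>, so that they can be read
  both in the ground model \<open>V\<close> and in its generic extension \<open>V[G]\<close>.
\<close>

text \<open>De Bruijn indices; \<open>All\<close> binds index 0.\<close>

datatype fm = Mem nat nat | Eq nat nat | Neg fm | Conj fm fm | All fm

primrec sat :: "('a \<Rightarrow> 'a set) \<Rightarrow> 'a set \<Rightarrow> (nat \<Rightarrow> 'a) \<Rightarrow> fm \<Rightarrow> bool" where
  "sat elts A e (Mem i j) \<longleftrightarrow> e i \<in> elts (e j)"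
| "sat elts A e (Eq i j) \<longleftrightarrow> e i = e j"
| "sat elts A e (Neg \<phi>) \<longleftrightarrow> \<not> sat elts A e \<phi>"
| "sat elts A e (Conj \<phi> \<psi>) \<longleftrightarrow> sat elts A e \<phi> \<and> sat elts A e \<psi>"
| "sat elts A e (All \<phi>) \<longleftrightarrow> (\<forall>x\<in>A. sat elts A (case_nat x e) \<phi>)"

context
  fixes elts :: "'a \<Rightarrow> 'a set"
begin

definition memrel :: "('a \<times> 'a) set" where
  "memrel = {(y, x). y \<in> elts x}"

text \<open>
  Well-founded (that is, up to isomorphism, transitive) models of ZFC.  Separation and
  Replacement are the first-order schemas; the parameters are supplied by the environment \<open>e\<close>.
\<close>

definition zfc_model :: bool where
  "zfc_model \<longleftrightarrow>
     inj elts \<and>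
     wf memrel \<and>
     (\<forall>a b. \<exists>c. elts c = {a, b}) \<and>
     (\<forall>a. \<exists>u. elts u = \<Union> (elts ` elts a)) \<and>
     (\<forall>a. \<exists>p. elts p = {x. elts x \<subseteq> elts a}) \<and>
     (\<exists>w z. elts z = {} \<and> z \<in> elts w \<and> (\<forall>x\<in>elts w. \<exists>y\<in>elts w. elts y = insert x (elts x))) \<and>
     (\<forall>\<phi> e a. \<exists>b. elts b = {x \<in> elts a. sat elts UNIV (case_nat x e) \<phi>}) \<and>
     (\<forall>\<phi> e a. (\<forall>x\<in>elts a. \<exists>!y. sat elts UNIV (case_nat x (case_nat y e)) \<phi>) \<longrightarrow>
        (\<exists>b. elts b = {y. \<exists>x\<in>elts a. sat elts UNIV (case_nat x (case_nat y e)) \<phi>})) \<and>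
     (\<forall>a. (\<forall>x\<in>elts a. elts x \<noteq> {}) \<and>
          (\<forall>x\<in>elts a. \<forall>y\<in>elts a. x \<noteq> y \<longrightarrow> elts x \<inter> elts y = {}) \<longrightarrow>
        (\<exists>c. \<forall>x\<in>elts a. \<exists>!y. y \<in> elts x \<inter> elts c))"

definition mkset :: "'a set \<Rightarrow> 'a" where
  "mkset A = (THE x. elts x = A)"

definition opair :: "'a \<Rightarrow> 'a \<Rightarrow> 'a" where
  "opair a b = mkset {mkset {a}, mkset {a, b}}"

text \<open>The set \<open>f\<close> of the universe is the graph of \<open>F\<close> restricted to \<open>a\<close>.\<close>

definition is_graph :: "'a \<Rightarrow> 'a \<Rightarrow> ('a \<Rightarrow> 'a) \<Rightarrow> bool" where
  "is_graph f a F \<longleftrightarrow> elts f = (\<lambda>x. opair x (F x)) ` elts a"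

definition app :: "'a \<Rightarrow> 'a \<Rightarrow> 'a" where
  "app f x = (THE y. opair x y \<in> elts f)"

definition injects :: "'a \<Rightarrow> 'a \<Rightarrow> bool" where
  "injects a b \<longleftrightarrow> (\<exists>f F. is_graph f a F \<and> inj_on F (elts a) \<and> F ` elts a \<subseteq> elts b)"

definition Ord :: "'a \<Rightarrow> bool" where
  "Ord \<alpha> \<longleftrightarrow> (\<forall>x\<in>elts \<alpha>. elts x \<subseteq> elts \<alpha> \<and> (\<forall>y\<in>elts x. elts y \<subseteq> elts x))"

definition Limit :: "'a \<Rightarrow> bool" where
  "Limit \<alpha> \<longleftrightarrow> Ord \<alpha> \<and> elts \<alpha> \<noteq> {} \<and> (\<forall>\<beta>\<in>elts \<alpha>. \<exists>\<gamma>\<in>elts \<alpha>. \<beta> \<in> elts \<gamma>)"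

definition least_ord :: "('a \<Rightarrow> bool) \<Rightarrow> 'a" where
  "least_ord Q = (THE \<alpha>. Ord \<alpha> \<and> Q \<alpha> \<and> (\<forall>\<beta>\<in>elts \<alpha>. \<not> Q \<beta>))"

definition omega :: 'a where
  "omega = least_ord Limit"

definition omega1 :: 'a where
  "omega1 = least_ord (\<lambda>\<alpha>. \<not> injects \<alpha> omega)"

definition omega2 :: 'a where
  "omega2 = least_ord (\<lambda>\<alpha>. \<not> injects \<alpha> omega1)"

definition ctbl :: "'a \<Rightarrow> bool" where
  "ctbl x \<longleftrightarrow> injects x omega"

definition cof :: "'a \<Rightarrow> 'a" where
  "cof \<alpha> = least_ord (\<lambda>\<beta>. \<exists>f F. is_graph f \<beta> F \<and> F ` elts \<beta> \<subseteq> elts \<alpha> \<and>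
     (\<forall>x\<in>elts \<alpha>. \<exists>y\<in>elts \<beta>. x = F y \<or> x \<in> elts (F y)))"

text \<open>Strongly inaccessible: uncountable, regular, strong limit.\<close>

definition inaccessible :: "'a \<Rightarrow> bool" where
  "inaccessible \<theta> \<longleftrightarrow> Ord \<theta> \<and> omega \<in> elts \<theta> \<and> cof \<theta> = \<theta> \<and>
     (\<forall>\<kappa>\<in>elts \<theta>. \<exists>\<mu>\<in>elts \<theta>. injects (mkset {x. elts x \<subseteq> elts \<kappa>}) \<mu>)"

text \<open>\<open>V\<^sub>x\<close> is the union of the power sets of \<open>V\<^sub>z\<close> for \<open>z \<in> x\<close>.\<close>

definition Vset :: "'a \<Rightarrow> 'a" where
  "Vset = wfrec memrel (\<lambda>v x. mkset (\<Union>z\<in>elts x. {y. elts y \<subseteq> elts (v z)}))"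

text \<open>
  The isomorphism witnessing an order type is unique and belongs to every model of ZFC containing
  \<open>X\<close> (it is the Mostowski collapse), so it need not be required to be a set of the universe.
\<close>

definition otp :: "'a set \<Rightarrow> 'a" where
  "otp X = (THE \<beta>. Ord \<beta> \<and> (\<exists>F. bij_betw F X (elts \<beta>) \<and>
     (\<forall>x\<in>X. \<forall>y\<in>X. x \<in> elts y \<longleftrightarrow> F x \<in> elts (F y))))"

definition max_ord :: "'a set \<Rightarrow> 'a" where
  "max_ord X = (THE m. m \<in> X \<and> (\<forall>x\<in>X. x = m \<or> x \<in> elts m))"

text \<open>
  Elementarity with respect to \<open>\<in>\<close>; as the universe is well-founded, its own formulas are exactly
  the elements of \<open>fm\<close>.  For the same reason \<open>finite\<close> below agrees with finiteness in the universe.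
\<close>

definition elementary_submodel :: "'a \<Rightarrow> 'a \<Rightarrow> bool" where
  "elementary_submodel M N \<longleftrightarrow> elts M \<noteq> {} \<and> elts M \<subseteq> elts N \<and>
     (\<forall>\<phi> e. range e \<subseteq> elts M \<longrightarrow> (sat elts (elts M) e \<phi> \<longleftrightarrow> sat elts (elts N) e \<phi>))"

definition countable_submodels :: "'a \<Rightarrow> 'a set" where
  "countable_submodels \<theta> = {M. ctbl M \<and> elementary_submodel M (Vset \<theta>)}"

definition transitive_submodels :: "'a \<Rightarrow> 'a set" where
  "transitive_submodels \<theta> = {Vset \<alpha> | \<alpha>. \<alpha> \<in> elts \<theta> \<and> omega \<in> elts (cof \<alpha>) \<and>
     elementary_submodel (Vset \<alpha>) (Vset \<theta>)}"

text \<open>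
  The list \<open>Ms\<close> is the increasing enumeration of the chain \<open>m\<close>.  By well-foundedness it is
  determined by \<open>m\<close> and has no repetitions.
\<close>

definition enumerates :: "'a list \<Rightarrow> 'a \<Rightarrow> bool" where
  "enumerates Ms m \<longleftrightarrow> set Ms = elts m \<and> successively (\<lambda>M N. M \<in> elts N) Ms"

definition side_condition :: "'a set \<Rightarrow> 'a set \<Rightarrow> 'a \<Rightarrow> bool" where
  "side_condition S T m \<longleftrightarrow> elts m \<subseteq> S \<union> T \<and> (\<exists>Ms. enumerates Ms m) \<and>
     (\<forall>M\<in>elts m. \<forall>N\<in>elts m. \<exists>K\<in>elts m. elts K = elts M \<inter> elts N)"

definition height_fun :: "'a \<Rightarrow> 'a set \<Rightarrow> 'a \<Rightarrow> 'a \<times> 'a \<rightharpoonup> 'a" where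
  "height_fun \<theta> S m = (\<lambda>(\<alpha>, \<xi>).
     let Ns = {M \<in> elts m \<inter> S. \<alpha> \<in> elts M \<and> elts M \<inter> elts omega1 = elts \<xi>}
     in if \<alpha> \<in> elts \<theta> \<and> \<xi> \<in> elts omega1 \<and> Ns \<noteq> {}
        then Some (max_ord ((\<lambda>M. otp (elts M \<inter> elts \<theta>)) ` Ns)) else None)"

definition decoration :: "'a \<Rightarrow> 'a \<Rightarrow> 'a \<Rightarrow> bool" where
  "decoration \<theta> m d \<longleftrightarrow> (\<exists>F. is_graph d m F) \<and>
     (\<forall>Ms i. enumerates Ms m \<and> i < length Ms \<longrightarrow>
        finite (elts (app d (Ms ! i))) \<and>
        app d (Ms ! i) \<in> elts (if Suc i < length Ms then Ms ! Suc i else Vset \<theta>))"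

definition Mstar :: "'a \<Rightarrow> 'a set \<Rightarrow> 'a set \<Rightarrow> 'a set" where
  "Mstar \<theta> S T = {opair m d | m d. side_condition S T m \<and> decoration \<theta> m d \<and>
     (\<forall>M\<in>elts m \<inter> S. \<forall>N\<in>elts m \<inter> S.
        mkset (elts N \<inter> elts omega1) \<in> elts M \<longrightarrow> otp (elts N \<inter> elts \<theta>) \<in> elts M)}"

definition Mstar_le :: "'a \<Rightarrow> 'a set \<Rightarrow> 'a set \<Rightarrow> 'a \<Rightarrow> 'a \<Rightarrow> bool" where
  "Mstar_le \<theta> S T q p \<longleftrightarrow> q \<in> Mstar \<theta> S T \<and> p \<in> Mstar \<theta> S T \<and>
     (\<exists>mq dq mp dp. q = opair mq dq \<and> p = opair mp dp \<and>
        elts mp \<subseteq> elts mq \<and>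
        (\<forall>M\<in>elts mp. elts (app dp M) \<subseteq> elts (app dq M)) \<and>
        height_fun \<theta> S mp \<subseteq>\<^sub>m height_fun \<theta> S mq)"

text \<open>
  A poset is a collection \<open>P\<close> of sets of the universe with an order \<open>le\<close> (\<open>le q p\<close>: the condition
  \<open>q\<close> is stronger).  Genericity only refers to dense sets belonging to the universe.
\<close>

definition generic :: "'a set \<Rightarrow> ('a \<Rightarrow> 'a \<Rightarrow> bool) \<Rightarrow> 'a set \<Rightarrow> bool" where
  "generic P le G \<longleftrightarrow> G \<subseteq> P \<and> G \<noteq> {} \<and>
     (\<forall>q\<in>G. \<forall>p\<in>P. le q p \<longrightarrow> p \<in> G) \<and>
     (\<forall>p\<in>G. \<forall>q\<in>G. \<exists>r\<in>G. le r p \<and> le r q) \<and>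
     (\<forall>D. elts D \<subseteq> P \<and> (\<forall>p\<in>P. \<exists>q\<in>elts D. le q p) \<longrightarrow> G \<inter> elts D \<noteq> {})"

text \<open>
  Every set is used as a name; only its elements of the form \<open>(\<sigma>, p)\<close> with \<open>p \<in> P\<close> matter.
  The canonical name of \<open>x\<close> uses all conditions, hence no largest condition is needed.
\<close>

definition check :: "'a set \<Rightarrow> 'a \<Rightarrow> 'a" where
  "check P = wfrec memrel (\<lambda>c x. mkset {opair (c z) q | z q. z \<in> elts x \<and> q \<in> P})"

text \<open>
  The forcing relation on atomic formulas.  The clauses are the usual recursion on names; since
  the universe is well-founded, the recursion has only one solution, so that reading it as an
  inductive definition is harmless.
\<close>

inductive forces_eq :: "'a set \<Rightarrow> ('a \<Rightarrow> 'a \<Rightarrow> bool) \<Rightarrow> 'a \<Rightarrow> 'a \<Rightarrow> 'a \<Rightarrow> bool"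
  and forces_mem :: "'a set \<Rightarrow> ('a \<Rightarrow> 'a \<Rightarrow> bool) \<Rightarrow> 'a \<Rightarrow> 'a \<Rightarrow> 'a \<Rightarrow> bool"
  for P :: "'a set" and le :: "'a \<Rightarrow> 'a \<Rightarrow> bool"
where
  "\<lbrakk>p \<in> P;
    \<forall>\<pi> s q. opair \<pi> s \<in> elts \<sigma> \<and> s \<in> P \<and> q \<in> P \<and> le q p \<and> le q s \<longrightarrow> forces_mem P le q \<pi> \<tau>;
    \<forall>\<pi> s q. opair \<pi> s \<in> elts \<tau> \<and> s \<in> P \<and> q \<in> P \<and> le q p \<and> le q s \<longrightarrow> forces_mem P le q \<pi> \<sigma>\<rbrakk>
   \<Longrightarrow> forces_eq P le p \<sigma> \<tau>"
| "\<lbrakk>p \<in> P;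
    \<forall>q\<in>P. le q p \<longrightarrow> (\<exists>r\<in>P. le r q \<and>
      (\<exists>\<rho> s. opair \<rho> s \<in> elts \<tau> \<and> s \<in> P \<and> le r s \<and> forces_eq P le r \<pi> \<rho>))\<rbrakk>
   \<Longrightarrow> forces_mem P le p \<pi> \<tau>"

text \<open>
  Compound sentences of the forcing language are represented by the predicate ``\<open>p\<close> forces it'';
  quantifiers range over a class \<open>A\<close>.
\<close>

definition f_not :: "'a set \<Rightarrow> ('a \<Rightarrow> 'a \<Rightarrow> bool) \<Rightarrow> ('a \<Rightarrow> bool) \<Rightarrow> 'a \<Rightarrow> bool" where
  "f_not P le \<phi> p \<longleftrightarrow> (\<forall>q\<in>P. le q p \<longrightarrow> \<not> \<phi> q)"

definition f_and :: "('a \<Rightarrow> bool) \<Rightarrow> ('a \<Rightarrow> bool) \<Rightarrow> 'a \<Rightarrow> bool" where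
  "f_and \<phi> \<psi> p \<longleftrightarrow> \<phi> p \<and> \<psi> p"

definition f_imp :: "'a set \<Rightarrow> ('a \<Rightarrow> 'a \<Rightarrow> bool) \<Rightarrow> ('a \<Rightarrow> bool) \<Rightarrow> ('a \<Rightarrow> bool) \<Rightarrow> 'a \<Rightarrow> bool" where
  "f_imp P le \<phi> \<psi> = f_not P le (f_and \<phi> (f_not P le \<psi>))"

definition f_all :: "'a set \<Rightarrow> ('a \<Rightarrow> 'a \<Rightarrow> bool) \<Rightarrow> 'a \<Rightarrow> bool" where
  "f_all A \<phi> p \<longleftrightarrow> (\<forall>x\<in>A. \<phi> x p)"

definition f_ex :: "'a set \<Rightarrow> ('a \<Rightarrow> 'a \<Rightarrow> bool) \<Rightarrow> 'a set \<Rightarrow> ('a \<Rightarrow> 'a \<Rightarrow> bool) \<Rightarrow> 'a \<Rightarrow> bool" where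
  "f_ex P le A \<phi> = f_not P le (f_all A (\<lambda>x. f_not P le (\<phi> x)))"

definition club :: "'a \<Rightarrow> bool" where
  "club c \<longleftrightarrow> elts c \<subseteq> elts omega1 \<and>
     (\<forall>\<alpha>\<in>elts omega1. \<exists>\<beta>\<in>elts c. \<alpha> \<in> elts \<beta>) \<and>
     (\<forall>\<delta>\<in>elts omega1. Limit \<delta> \<and> (\<forall>\<alpha>\<in>elts \<delta>. \<exists>\<beta>\<in>elts c \<inter> elts \<delta>. \<alpha> \<in> elts \<beta>) \<longrightarrow> \<delta> \<in> elts c)"

definition NS_omega1 :: "'a set" where
  "NS_omega1 = {x. elts x \<subseteq> elts omega1 \<and> (\<exists>c. club c \<and> elts c \<inter> elts x = {})}"

definition positive :: "'a set \<Rightarrow> 'a set" where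
  "positive I = {x. elts x \<subseteq> elts omega1} - I"

definition positive_le :: "'a set \<Rightarrow> 'a \<Rightarrow> 'a \<Rightarrow> bool" where
  "positive_le I y x \<longleftrightarrow> x \<in> positive I \<and> y \<in> positive I \<and> elts y \<subseteq> elts x"

text \<open>The canonical name of the generic ultrafilter on the ground model subsets of \<open>\<omega>\<^sub>1\<close>.\<close>

definition ultrafilter_name :: "'a set \<Rightarrow> 'a" where
  "ultrafilter_name I = mkset {opair (check (positive I) x) x | x. x \<in> positive I}"

text \<open>
  The generic ultrapower consists of the ground model functions on \<open>\<omega>\<^sub>1\<close>, with \<open>b\<close> an element
  of \<open>a\<close> iff \<open>{\<xi>. b(\<xi>) \<in> a(\<xi>)}\<close> lies in the generic ultrafilter.
\<close>

definition ultrapower_fun :: "'a set" where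
  "ultrapower_fun = {a. \<exists>F. is_graph a omega1 F}"

definition mem_set :: "'a \<Rightarrow> 'a \<Rightarrow> 'a" where
  "mem_set b a = mkset {\<xi> \<in> elts omega1. app b \<xi> \<in> elts (app a \<xi>)}"

text \<open>
  The sentence of the forcing language saying that every set \<open>X\<close> of the extension that
  contains elements of the ultrapower contains a minimal one, i.e. one without an element in \<open>X\<close>.
\<close>

definition forces_ultrapower_wf :: "'a set \<Rightarrow> 'a \<Rightarrow> bool" where
  "forces_ultrapower_wf I =
     (let P = positive I;
          le = positive_le I;
          isin = (\<lambda>x \<tau> p. forces_mem P le p (check P x) \<tau>)
      in f_all UNIV (\<lambda>X.
           f_imp P le
             (f_ex P le ultrapower_fun (\<lambda>a. isin a X))
             (f_ex P le ultrapower_fun (\<lambda>a.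
                f_and (isin a X)
                  (f_all ultrapower_fun (\<lambda>b.
                     f_imp P le (isin b X)
                       (f_not P le (isin (mem_set b a) (ultrafilter_name I)))))))))"

definition precipitous :: "'a set \<Rightarrow> bool" where
  "precipitous I \<longleftrightarrow> (\<forall>p\<in>positive I. forces_ultrapower_wf I p)"

end

text \<open>
  \<open>V[G]\<close>, with evaluation of names \<open>val\<close>: the extensional structure all of whose elements
  are values of names, where \<open>val \<tau> = {val \<sigma> | (\<sigma>, p) \<in> \<tau>, p \<in> G}\<close>.  As \<open>V\<close> is
  well-founded, this determines \<open>V[G]\<close> up to isomorphism; via canonical names \<open>V[G]\<close> is
  equinumerous with \<open>V\<close>, so the carrier can always be taken to be the type of \<open>V\<close>.
\<close>

definition generic_extension ::
    "('v \<Rightarrow> 'v set) \<Rightarrow> 'v set \<Rightarrow> ('w \<Rightarrow> 'w set) \<Rightarrow> ('v \<Rightarrow> 'w) \<Rightarrow> bool" where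
  "generic_extension eltsV G eltsW val \<longleftrightarrow> inj eltsW \<and> surj val \<and>
     (\<forall>\<tau>. eltsW (val \<tau>) = {val \<sigma> | \<sigma> p. p \<in> G \<and> opair eltsV \<sigma> p \<in> eltsV \<tau>})"

end

theory Submission
  imports Defs
begin

text \<open>
  Conditions are amalgamated in two ways: over a countable node, by adding the intersections of
  countable nodes of one condition with transitive nodes of the other, and over a transitive node,
  by taking the union.  The first kind of amalgamation preserves \<open>\<omega>\<^sub>1\<close>; the second kind,
  combined with a reflection argument, shows that \<open>\<theta>\<close> is not collapsed.  The countable nodes of
  the generic chain lying between two consecutive transitive nodes form a continuous
  \<open>\<in>\<close>-chain of length \<open>\<omega>\<^sub>1\<close>, so every \<open>\<gamma> < \<theta>\<close> is collapsed to \<open>\<omega>\<^sub>1\<close>, and the traces of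
  its members on \<open>\<omega>\<^sub>1\<close> form a club.  The order
  types recorded by the generic heights give functions \<open>h\<^sub>\<alpha>\<close> on \<open>\<omega>\<^sub>1\<close>, for \<open>\<alpha> < \<theta>\<close>, such that
  every stationary set has, for some \<open>\<beta>\<close>, a stationary subset on which \<open>h\<^sub>\<beta> < h\<^sub>\<alpha>\<close>: cutting a countable node down by a transitive one freezes \<open>h\<^sub>\<beta>\<close> at a
  smaller value.  Hence the ultrapower elements \<open>h\<^sub>\<alpha>\<close> have no minimal element.

  Definability is handled by predicates on environments instead of formulas, so that instances of
  Separation and Replacement, in the ground model and in the extension, reduce to closure rules.
\<close>

section \<open>Definability\<close>

text \<open>Nodes are elementary in \<open>V\<^sub>\<theta>\<close> only, while a forcing statement
  with a name as parameter need not be definable there. Each genericity argument therefore uses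
  nodes closed under a Skolem function for the one relation it reflects, in place of submodels of a
  larger structure. Amalgamation over a countable node \<open>K\<close> must keep the heights of
  both conditions. So what \<open>K\<close> remembers of a condition includes the order types of
  nodes \<open>X\<close> outside \<open>K\<close> with
  \<open>X \<inter> \<omega>\<^sub>1 \<in> K\<close>, and the clause of the forcing that links
  \<open>N \<inter> \<omega>\<^sub>1\<close> with the order type of \<open>N\<close> is what puts
  this memory into \<open>K\<close>. The descent from \<open>\<alpha>\<close> to
  \<open>\<beta>\<close> meets one more obstacle. A condition that has a node \<open>M\<close>,
  contains \<open>\<beta>\<close> in \<open>M\<close> and forces the trace of \<open>M\<close> into
  the stationary set already makes the height at \<open>\<beta>\<close> as large as the order type
  of \<open>M\<close>. Reflection replaces it by a condition with the same data in which no node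
  contains \<open>\<beta>\<close>, and only the cut-down node is added to that copy.\<close>

primrec ren :: "(nat => nat) => fm => fm" where
 "ren g (Mem i j) = Mem (g i) (g j)"
| "ren g (Eq i j) = Eq (g i) (g j)"
| "ren g (Neg ph) = Neg (ren g ph)"
| "ren g (Conj ph ps) = Conj (ren g ph) (ren g ps)"
| "ren g (All ph) = All (ren (case_nat 0 (%n. Suc (g n))) ph)"

lemma sat_ren: "sat E A e (ren g ph) = sat E A (%n. e (g n)) ph"
proof (induction ph arbitrary: e g)
 case (All ph)
 have "(%n. case_nat x e (case_nat 0 (%n. Suc (g n)) n)) = case_nat x (%n. e (g n))" for x
  by (rule ext) (simp split: nat.split)
 then show ?case by (simp add: All)
qed auto

text \<open>The first \<open>m\<close> slots hold parameters from \<open>B\<close>, the later ones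
  the variables. Separating \<open>A\<close> from \<open>B\<close> lets one set of rules serve
  twice: with \<open>A = B = UNIV\<close> for Separation and Replacement, and with \<open>A\<close>
  the elements of \<open>V\<^sub>\<theta>\<close> and \<open>B = elts K\<close> for elementarity of
  a submodel \<open>K\<close>.\<close>

definition dfn :: "('a => 'a set) => 'a set => 'a set => ((nat => 'a) => bool) => bool" where
 "dfn elts A B Q \<longleftrightarrow> (EX ph m c. (ALL k<m. c k : B) &
   (ALL e. range e \<subseteq> A --> (Q e \<longleftrightarrow> sat elts A (%k. if k < m then c k else e (k - m)) ph)))"

definition dt :: "('a => 'a set) => 'a set => 'a set => ((nat => 'a) => 'a) => bool" where
 "dt elts A B t \<longleftrightarrow> (ALL e. range e \<subseteq> A --> t e : A) & dfn elts A B (%e. e 0 = t (%n. e (Suc n)))"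

definition ds :: "('a => 'a set) => 'a set => 'a set => ((nat => 'a) => 'a set) => bool" where
 "ds elts A B S \<longleftrightarrow> (ALL e. range e \<subseteq> A --> S e \<subseteq> A) & dfn elts A B (%e. e 0 : S (%n. e (Suc n)))"

named_theorems dfn_intros

lemma dfnI: "(!!k. k < m ==> c k : B) ==> (!!e. range e \<subseteq> A ==> Q e \<longleftrightarrow> sat elts A (%k. if k < m then c k else e (k - m)) ph)
  ==> dfn elts A B Q"
 unfolding dfn_def by (intro exI[of _ ph] exI[of _ m] exI[of _ c] conjI allI impI)

lemma dfn_cong: "(!!e. range e \<subseteq> A ==> Q e = Q' e) ==> dfn E A B Q = dfn E A B Q'"
 unfolding dfn_def by (intro arg_cong[where f=Ex] ext conj_cong) auto

lemma dfn_ren: assumes "dfn E A B Q" shows "dfn E A B (%e. Q (%n. e (g n)))"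
proof -
 obtain ph m c where c: "ALL k<m. c k : B" and ph: "!!e. range e \<subseteq> A ==>
   Q e \<longleftrightarrow> sat E A (%k. if k < m then c k else e (k - m)) ph"
  using assms unfolding dfn_def by blast
 let ?r = "%k. if k < m then k else m + g (k - m)"
 have "(%n. (%k. if k < m then c k else e (k - m)) (?r n)) = (%k. if k < m then c k else e (g (k - m)))" for e
  by (rule ext) auto
 moreover have "range (%n. e (g n)) \<subseteq> A" if "range e \<subseteq> A" for e using that by auto
 ultimately have "ALL e. range e \<subseteq> A --> (Q (%n. e (g n)) \<longleftrightarrow>
   sat E A (%k. if k < m then c k else e (k - m)) (ren ?r ph))"
  by (auto simp: sat_ren ph)
 with c show ?thesis by (intro dfnI[of m c _ _ _ _ "ren ?r ph"]) auto
qed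

lemma dfn_not[dfn_intros]: assumes "dfn E A B Q" shows "dfn E A B (%e. ~ Q e)"
proof -
 obtain ph m c where c: "ALL k<m. c k : B" and ph: "!!e. range e \<subseteq> A ==>
   Q e \<longleftrightarrow> sat E A (%k. if k < m then c k else e (k - m)) ph"
  using assms unfolding dfn_def by blast
 then have "ALL e. range e \<subseteq> A --> (~ Q e \<longleftrightarrow> sat E A (%k. if k < m then c k else e (k - m)) (Neg ph))"
  by auto
 with c show ?thesis by (intro dfnI[of m c _ _ _ _ "Neg ph"]) auto
qed

lemma dfn_conj[dfn_intros]: assumes "dfn E A B Q" "dfn E A B R" shows "dfn E A B (%e. Q e & R e)"
proof -
 obtain ph m c where c: "ALL k<m. c k : B" and ph: "!!e. range e \<subseteq> A ==>
   Q e \<longleftrightarrow> sat E A (%k. if k < m then c k else e (k - m)) ph"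
  using assms unfolding dfn_def by blast
 obtain ps l d where d: "ALL k<l. d k : B" and ps: "!!e. range e \<subseteq> A ==>
   R e \<longleftrightarrow> sat E A (%k. if k < l then d k else e (k - l)) ps"
  using assms unfolding dfn_def by blast
 let ?c = "%k. if k < m then c k else d (k - m)"
 \<comment> \<open>The two parameter blocks are concatenated; \<open>?g\<close> and
   \<open>?h\<close> make each formula skip the block of the other.\<close>
 let ?g = "%k. if k < m then k else k + l"
 let ?h = "%k. k + m"
 have 1: "(%n. (%k. if k < m + l then ?c k else e (k - (m + l))) (?g n)) = (%k. if k < m then c k else e (k - m))" for e
  by (rule ext) auto
 have 2: "(%n. (%k. if k < m + l then ?c k else e (k - (m + l))) (?h n)) = (%k. if k < l then d k else e (k - l))" for e
  by (rule ext) auto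
 have "ALL e. range e \<subseteq> A --> (Q e & R e \<longleftrightarrow>
   sat E A (%k. if k < m + l then ?c k else e (k - (m + l))) (Conj (ren ?g ph) (ren ?h ps)))"
  unfolding sat.simps sat_ren 1 2 using ph ps by auto
 moreover have "ALL k<m+l. ?c k : B" using c d by auto
 ultimately show ?thesis by (intro dfnI[of "m + l" ?c _ _ _ _ "Conj (ren ?g ph) (ren ?h ps)"]) blast+
qed

lemma range_case_nat: "x : A ==> range e \<subseteq> A ==> range (case_nat x e) \<subseteq> A"
 by (auto simp: image_subset_iff split: nat.splits)

lemma nat_cases3: obtains "(n::nat) < m" | "n = m" | j where "n = m + Suc j"
 using less_imp_Suc_add[of m n] by fastforce

locale cls =
 fixes elts :: "'a => 'a set" and A B :: "'a set"
 assumes inj: "inj elts" and A_trans: "x : A ==> elts x \<subseteq> A" and BA: "B \<subseteq> A"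
begin

lemma dfn_par: assumes "dfn elts A B Q" "x : B" shows "dfn elts A B (%e. Q (case_nat x e))"
proof -
 obtain ph m c where c: "ALL k<m. c k : B" and ph: "!!e. range e \<subseteq> A ==>
   Q e \<longleftrightarrow> sat elts A (%k. if k < m then c k else e (k - m)) ph"
  using assms unfolding dfn_def by blast
 \<comment> \<open>The new parameter takes slot \<open>m\<close>, exactly where variable 0 used to
   be, so the formula itself does not change.\<close>
 let ?c = "%k. if k < m then c k else x"
 have eq: "(%k. if k < Suc m then ?c k else e (k - Suc m)) = (%k. if k < m then c k else case_nat x e (k - m))" for e
 proof (rule ext)
  fix n
  consider "n < m" | "n = m" | j where "n = m + Suc j" by (rule nat_cases3)
  then show "(if n < Suc m then ?c n else e (n - Suc m)) = (if n < m then c n else case_nat x e (n - m))"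
   by cases auto
 qed
 have "x : A" using assms(2) BA by blast
 then have "ALL e. range e \<subseteq> A --> (Q (case_nat x e) \<longleftrightarrow>
   sat elts A (%k. if k < Suc m then ?c k else e (k - Suc m)) ph)"
  unfolding eq by (intro allI impI ph range_case_nat)
 moreover have "ALL k<Suc m. ?c k : B" using c assms(2) by auto
 ultimately show ?thesis by (intro dfnI[of "Suc m" ?c _ _ _ _ ph]) blast+
qed

lemma dfn_all0: assumes "dfn elts A B Q" shows "dfn elts A B (%e. ALL x:A. Q (case_nat x e))"
proof -
 obtain ph m c where c: "ALL k<m. c k : B" and ph: "!!e. range e \<subseteq> A ==>
   Q e \<longleftrightarrow> sat elts A (%k. if k < m then c k else e (k - m)) ph"
  using assms unfolding dfn_def by blast
 \<comment> \<open>\<open>All\<close> binds index 0, but the variable to be bound sits behind the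
   parameters in slot \<open>m\<close>; \<open>?g\<close> rotates it to the front.\<close>
 let ?g = "%k. if k < m then Suc k else if k = m then 0 else k"
 have eq: "(%n. case_nat x (%k. if k < m then c k else e (k - m)) (?g n))
   = (%k. if k < m then c k else case_nat x e (k - m))" for e x
 proof (rule ext)
  fix n
  consider "n < m" | "n = m" | j where "n = m + Suc j" by (rule nat_cases3)
  then show "case_nat x (%k. if k < m then c k else e (k - m)) (?g n) = (if n < m then c n else case_nat x e (n - m))"
   by cases auto
 qed
 have "ALL e. range e \<subseteq> A --> ((ALL x:A. Q (case_nat x e)) \<longleftrightarrow>
   sat elts A (%k. if k < m then c k else e (k - m)) (All (ren ?g ph)))"
  unfolding sat.simps sat_ren eq by (intro allI impI ball_cong refl ph range_case_nat)
 with c show ?thesis by (intro dfnI[of m c _ _ _ _ "All (ren ?g ph)"]) blast+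
qed

lemma dfn_all[dfn_intros]: assumes "dfn elts A B (%e. Q (e 0) (%n. e (Suc n)))"
 shows "dfn elts A B (%e. ALL x:A. Q x e)"
 using dfn_all0[OF assms] unfolding nat.case .

lemma dfn_memv: "dfn elts A B (%e. e i : elts (e j))"
 unfolding dfn_def by (rule exI[of _ "Mem i j"], rule exI[of _ 0]) auto

lemma dfn_eqv: "dfn elts A B (%e. e i = e j)"
 unfolding dfn_def by (rule exI[of _ "Eq i j"], rule exI[of _ 0]) auto

lemma dfn_True: "dfn elts A B (%e. True)"
 using dfn_eqv[of 0 0] by simp

lemma dfn_const[dfn_intros]: "dfn elts A B (%e. P)"
proof (cases P)
 case True then show ?thesis using dfn_True by simp
next
 case False
 have "dfn elts A B (%e. ~ True)" by (rule dfn_not[OF dfn_True])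
 with False show ?thesis by simp
qed

lemma dfn_imp[dfn_intros]: assumes "dfn elts A B Q" "dfn elts A B R" shows "dfn elts A B (%e. Q e --> R e)"
proof -
 have "dfn elts A B (%e. ~ (Q e & ~ R e))" by (intro dfn_not dfn_conj assms)
 then show ?thesis by simp
qed
lemma dfn_disj[dfn_intros]: assumes "dfn elts A B Q" "dfn elts A B R" shows "dfn elts A B (%e. Q e | R e)"
proof -
 have "dfn elts A B (%e. ~ (~ Q e & ~ R e))" by (intro dfn_not dfn_conj assms)
 then show ?thesis by simp
qed
lemma dfn_iff[dfn_intros]: assumes "dfn elts A B Q" "dfn elts A B R" shows "dfn elts A B (%e. Q e = R e)"
 unfolding iff_conv_conj_imp by (intro dfn_conj dfn_imp assms)
lemma dfn_ex[dfn_intros]: assumes "dfn elts A B (%e. Q (e 0) (%n. e (Suc n)))"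
 shows "dfn elts A B (%e. EX x:A. Q x e)"
proof -
 have "dfn elts A B (%e. ~ (ALL x:A. ~ Q x e))" by (intro dfn_not dfn_all assms)
 then show ?thesis by simp
qed

lemma shift_range: "range e \<subseteq> A ==> range (%n. e (Suc n)) \<subseteq> A" by auto
lemma dt_in: "dt elts A B t ==> range e \<subseteq> A ==> t e : A" by (auto simp: dt_def)
lemma ds_in: "ds elts A B S ==> range e \<subseteq> A ==> S e \<subseteq> A" by (auto simp: ds_def)

lemma dt_var[dfn_intros]: "dt elts A B (%e. e i)"
 unfolding dt_def using dfn_eqv by auto

lemma dt_const[dfn_intros]: "c : B ==> dt elts A B (%e. c)"
 unfolding dt_def using dfn_par[OF dfn_eqv[of 1 0], of c] BA by auto

lemma dt_shift: assumes "dt elts A B t" shows "dt elts A B (%e. t (%n. e (Suc n)))"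
 unfolding dt_def
proof (intro conjI allI impI)
 show "t (%n. e (Suc n)) : A" if "range e \<subseteq> A" for e using dt_in[OF assms shift_range[OF that]] .
 have "dfn elts A B (%e. e 0 = t (%n. e (Suc n)))" using assms by (simp only: dt_def)
 from dfn_ren[OF this, of "case_nat 0 (%n. Suc (Suc n))"]
 show "dfn elts A B (%e. e 0 = t (%n. e (Suc (Suc n))))" unfolding nat.case .
qed

lemma ds_shift: assumes "ds elts A B t" shows "ds elts A B (%e. t (%n. e (Suc n)))"
 unfolding ds_def
proof (intro conjI allI impI)
 show "t (%n. e (Suc n)) \<subseteq> A" if "range e \<subseteq> A" for e using ds_in[OF assms shift_range[OF that]] .
 have "dfn elts A B (%e. e 0 : t (%n. e (Suc n)))" using assms by (simp only: ds_def)
 from dfn_ren[OF this, of "case_nat 0 (%n. Suc (Suc n))"]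
 show "dfn elts A B (%e. e 0 : t (%n. e (Suc (Suc n))))" unfolding nat.case .
qed

text \<open>Substituting a term means quantifying over its value, which is why definable terms must
  take values in \<open>A\<close>.\<close>

lemma dfn_let: assumes "dt elts A B t" "dfn elts A B (%e. Q (e 0) (%n. e (Suc n)))"
 shows "dfn elts A B (%e. Q (t e) e)"
proof -
 have "dfn elts A B (%e. EX x:A. x = t e & Q x e)"
  using assms by (intro dfn_ex dfn_conj) (auto simp: dt_def)
 also have "?this = ?thesis" using assms(1) by (intro dfn_cong) (auto simp: dt_def)
 finally show ?thesis .
qed

lemma dfn_rel1: assumes "dfn elts A B (%e. R (e 0))" "dt elts A B s" shows "dfn elts A B (%e. R (s e))"
 using dfn_let[OF assms(2), of "%x e. R x"] assms(1) by simp
lemma dfn_rel2: assumes "dfn elts A B (%e. R (e 0) (e 1))" "dt elts A B s" "dt elts A B t"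
 shows "dfn elts A B (%e. R (s e) (t e))"
proof -
 have "dfn elts A B (%e. R (e (Suc 0)) (e 0))"
  using dfn_ren[OF assms(1), of "%n. 1 - n"] by simp
 then have "dfn elts A B (%e. R (e 0) (t (%n. e (Suc n))))"
  using dfn_let[OF dt_shift[OF assms(3)], of "%y e. R (e 0) y"] by simp
 then show ?thesis using dfn_let[OF assms(2), of "%x e. R x (t e)"] by simp
qed
lemma dfn_rel3: assumes "dfn elts A B (%e. R (e 0) (e 1) (e 2))" "dt elts A B s" "dt elts A B t" "dt elts A B u"
 shows "dfn elts A B (%e. R (s e) (t e) (u e))"
proof -
 have "dfn elts A B (%e. R (e 2) (e 1) (e 0))"
  using dfn_ren[OF assms(1), of "%n. 2 - n"] by simp
 then have "dfn elts A B (%e. R (e 1) (e 0) (u (%n. e (Suc (Suc n)))))"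
  using dfn_let[OF dt_shift[OF dt_shift[OF assms(4)]], of "%y e. R (e 1) (e 0) y"] by (simp add: numeral_2_eq_2)
 then have "dfn elts A B (%e. R (e 0) (t (%n. e (Suc n))) (u (%n. e (Suc n))))"
  using dfn_let[OF dt_shift[OF assms(3)], of "%y e. R (e 0) y (u (%n. e (Suc n)))"] by simp
 then show ?thesis using dfn_let[OF assms(2), of "%x e. R x (t e) (u e)"] by simp
qed
lemma dfn_rel4: assumes "dfn elts A B (%e. R (e 0) (e 1) (e 2) (e 3))" "dt elts A B s" "dt elts A B t" "dt elts A B u" "dt elts A B v"
 shows "dfn elts A B (%e. R (s e) (t e) (u e) (v e))"
proof -
 have "dfn elts A B (%e. R (e 3) (e 2) (e 1) (e 0))"
  using dfn_ren[OF assms(1), of "%n. 3 - n"] by simp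
 then have "dfn elts A B (%e. R (e 2) (e 1) (e 0) (v (%n. e (Suc (Suc (Suc n))))))"
  using dfn_let[OF dt_shift[OF dt_shift[OF dt_shift[OF assms(5)]]], of "%y e. R (e 2) (e 1) (e 0) y"] by (simp add: numeral_2_eq_2 numeral_3_eq_3)
 then have "dfn elts A B (%e. R (e 1) (e 0) (u (%n. e (Suc (Suc n)))) (v (%n. e (Suc (Suc n)))))"
  using dfn_let[OF dt_shift[OF dt_shift[OF assms(4)]], of "%y e. R (e 1) (e 0) y (v (%n. e (Suc (Suc n))))"] by (simp add: numeral_2_eq_2)
 then have "dfn elts A B (%e. R (e 0) (t (%n. e (Suc n))) (u (%n. e (Suc n))) (v (%n. e (Suc n))))"
  using dfn_let[OF dt_shift[OF assms(3)], of "%y e. R (e 0) y (u (%n. e (Suc n))) (v (%n. e (Suc n)))"] by simp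
 then show ?thesis using dfn_let[OF assms(2), of "%x e. R x (t e) (u e) (v e)"] by simp
qed

lemma dfn_eq[dfn_intros]: "dt elts A B s ==> dt elts A B t ==> dfn elts A B (%e. s e = t e)"
 by (rule dfn_rel2[where R="(=)", OF dfn_eqv])

lemma ds_elts[dfn_intros]: assumes t: "dt elts A B t" shows "ds elts A B (%e. elts (t e))"
 unfolding ds_def
 using A_trans dt_in[OF t] dfn_rel2[where R="%x y. x : elts y", OF dfn_memv dt_var dt_shift[OF t], of 0]
 by simp

lemma dfn_mem[dfn_intros]: assumes "dt elts A B t" "ds elts A B S" shows "dfn elts A B (%e. t e : S e)"
 using dfn_let[OF assms(1), of "%x e. x : S e"] assms(2) by (simp add: ds_def)

lemma dfn_ball[dfn_intros]: assumes "ds elts A B S" "dfn elts A B (%e. Q (e 0) (%n. e (Suc n)))"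
 shows "dfn elts A B (%e. ALL x:S e. Q x e)"
proof -
 have "dfn elts A B (%e. ALL x:A. x : S e --> Q x e)"
  using assms by (intro dfn_all dfn_imp) (auto simp: ds_def)
 also have "?this = ?thesis" using assms(1) by (intro dfn_cong) (auto simp: ds_def)
 finally show ?thesis .
qed

lemma dfn_bex[dfn_intros]: assumes "ds elts A B S" "dfn elts A B (%e. Q (e 0) (%n. e (Suc n)))"
 shows "dfn elts A B (%e. EX x:S e. Q x e)"
proof -
 have "dfn elts A B (%e. ~ (ALL x:S e. ~ Q x e))" by (intro dfn_not dfn_ball assms)
 then show ?thesis by simp
qed

lemma dsI: "(!!e. range e \<subseteq> A ==> S e \<subseteq> A) ==> dfn elts A B (%e. e 0 : S (%n. e (Suc n))) ==> ds elts A B S"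
 by (auto simp: ds_def)

lemma ds_mem: "ds elts A B S ==> dfn elts A B (%e. e 0 : S (%n. e (Suc n)))" by (simp add: ds_def)

lemma dfn_subset[dfn_intros]: assumes "ds elts A B S" "ds elts A B T" shows "dfn elts A B (%e. S e \<subseteq> T e)"
 unfolding subset_iff Ball_def[symmetric] by (intro dfn_ball[OF assms(1)] ds_mem[OF assms(2)])

lemma dfn_seteq[dfn_intros]: assumes "ds elts A B S" "ds elts A B T" shows "dfn elts A B (%e. S e = T e)"
 unfolding set_eq_subset by (intro dfn_conj dfn_subset assms)

lemma ds_empty[dfn_intros]: "ds elts A B (%e. {})"
 by (rule dsI) (auto intro: dfn_const)
lemma ds_insert[dfn_intros]: assumes "dt elts A B t" "ds elts A B S" shows "ds elts A B (%e. insert (t e) (S e))"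
 using dt_in[OF assms(1)] ds_in[OF assms(2)]
 by (intro dsI, blast, unfold insert_iff, intro dfn_disj ds_mem[OF assms(2)] dfn_eq dt_var dt_shift[OF assms(1)])
lemma ds_Un[dfn_intros]: assumes "ds elts A B T" "ds elts A B S" shows "ds elts A B (%e. T e \<union> S e)"
 using ds_in[OF assms(1)] ds_in[OF assms(2)]
 by (intro dsI, blast, unfold Un_iff, intro dfn_disj ds_mem[OF assms(1)] ds_mem[OF assms(2)])
lemma ds_Int[dfn_intros]: assumes "ds elts A B T" "ds elts A B S" shows "ds elts A B (%e. T e \<inter> S e)"
 using ds_in[OF assms(1)] ds_in[OF assms(2)]
 by (intro dsI, blast, unfold Int_iff, intro dfn_conj ds_mem[OF assms(1)] ds_mem[OF assms(2)])
lemma ds_Diff[dfn_intros]: assumes "ds elts A B T" "ds elts A B S" shows "ds elts A B (%e. T e - S e)"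
 using ds_in[OF assms(1)] ds_in[OF assms(2)]
 by (intro dsI, blast, unfold Diff_iff, intro dfn_conj dfn_not ds_mem[OF assms(1)] ds_mem[OF assms(2)])
lemma ds_sep[dfn_intros]: assumes "ds elts A B S" "dfn elts A B (%e. Q (e 0) (%n. e (Suc n)))" shows "ds elts A B (%e. {x:S e. Q x e})"
 using ds_in[OF assms(1)]
 by (intro dsI, blast, unfold mem_Collect_eq, intro dfn_conj ds_mem[OF assms(1)] assms(2))
lemma swap_env: "dfn elts A B (%e. e 0 : R (e (Suc 0)) (%n. e (Suc (Suc n)))) ==>
  dfn elts A B (%e. e (Suc 0) : R (e 0) (%n. e (Suc (Suc n))))"
 by (drule dfn_ren[where g="case_nat 1 (case_nat 0 (%n. Suc (Suc n)))"]) simp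

lemma ds_UN[dfn_intros]: assumes S: "ds elts A B S" and R: "ds elts A B (%e. R (e 0) (%n. e (Suc n)))"
 shows "ds elts A B (%e. UN x:S e. R x e)"
 unfolding ds_def
proof (intro conjI allI impI)
 fix e :: "nat => 'a" assume e: "range e \<subseteq> A"
 have "R x e \<subseteq> A" if x: "x : S e" for x
 proof -
  have "x : A" using ds_in[OF S e] x by (rule subsetD)
  from ds_in[OF R range_case_nat[OF this e]] show ?thesis unfolding nat.case .
 qed
 then show "(UN x:S e. R x e) \<subseteq> A" by (rule UN_least)
next
 have "dfn elts A B (%e. e (Suc 0) : R (e 0) (%n. e (Suc (Suc n))))"
  by (rule swap_env) (rule ds_mem[OF R])
 then have "dfn elts A B (%e. EX x:S (%n. e (Suc n)). e 0 : R x (%n. e (Suc n)))"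
  by (rule dfn_bex[where Q="%x e. e 0 : R x (%n. e (Suc n))", OF ds_shift[OF S]])
 then show "dfn elts A B (%e. e 0 : (UN x:S (%n. e (Suc n)). R x (%n. e (Suc n))))"
  by simp
qed
lemma ds_singleton: "dt elts A B t ==> ds elts A B (%e. {t e})" by (intro dfn_intros)
lemma ds_image[dfn_intros]: assumes "ds elts A B S" "dt elts A B (%e. f (e 0) (%n. e (Suc n)))"
 shows "ds elts A B (%e. (%x. f x e) ` S e)"
proof -
 have "ds elts A B (%e. UN x:S e. {f x e})"
  by (intro ds_UN assms ds_singleton)
 then show ?thesis by (simp add: UNION_singleton_eq_range)
qed
lemma ds_const: "b : B ==> X = elts b ==> ds elts A B (%e. X)"
 using ds_elts[OF dt_const] by auto

lemma dt_fun2: assumes "!!x y. x : A ==> y : A ==> f x y : A" "dfn elts A B (%e. e 0 = f (e 1) (e 2))" "dt elts A B s" "dt elts A B t"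
 shows "dt elts A B (%e. f (s e) (t e))"
 unfolding dt_def
 using assms(1) dt_in[OF assms(3)] dt_in[OF assms(4)] dfn_rel3[where R="%z x y. z = f x y", OF assms(2) dt_var[of 0] dt_shift[OF assms(3)] dt_shift[OF assms(4)]] by simp

lemma dt_let: assumes "dt elts A B t" "dt elts A B (%e. f (e 0) (%n. e (Suc n)))" shows "dt elts A B (%e. f (t e) e)"
proof -
 have "dfn elts A B (%e. e 1 = f (e 0) (%n. e (Suc (Suc n))))"
  using dfn_ren[of elts A B "%e. e 0 = f (e (Suc 0)) (%n. e (Suc (Suc n)))" "case_nat 1 (case_nat 0 (%n. Suc (Suc n)))"] assms(2)
  by (auto simp: dt_def)
 then have "dfn elts A B (%e. e 0 = f (t (%n. e (Suc n))) (%n. e (Suc n)))"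
  using dfn_let[OF dt_shift[OF assms(1)], of "%x e. e 0 = f x (%n. e (Suc n))"] by simp
 moreover have "f (t e) e : A" if "range e \<subseteq> A" for e
 proof -
  from dt_in[OF assms(2) range_case_nat[OF dt_in[OF assms(1) that] that]] show ?thesis unfolding nat.case .
 qed
 ultimately show ?thesis by (simp add: dt_def)
qed

lemma elts_eqD: "elts x = elts y ==> x = y" using inj by (simp add: inj_eq)

lemma mksetI: "elts x = X ==> mkset elts X = x"
 unfolding mkset_def by (rule the_equality) (auto intro: elts_eqD)

text \<open>The equation \<open>z = mkset elts S\<close> is expressed as \<open>elts z = S\<close>;
  the two agree because the set exists in \<open>A\<close>.\<close>

lemma dt_mkset0: assumes "ds elts A B S" "!!e. range e \<subseteq> A ==> EX x:A. elts x = S e" shows "dt elts A B (%e. mkset elts (S e))"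
proof -
 have "dfn elts A B (%e. elts (e 0) = S (%n. e (Suc n)))"
  by (intro dfn_seteq ds_elts dt_var ds_shift[OF assms(1)])
 also have "?this = dfn elts A B (%e. e 0 = mkset elts (S (%n. e (Suc n))))"
  using assms(2)[OF shift_range] by (intro dfn_cong) (metis mksetI)
 finally show ?thesis unfolding dt_def using assms(2) mksetI by blast
qed

end

locale cls2 = cls +
 assumes pairing: "x : A ==> y : A ==> EX z:A. elts z = {x, y}"
begin

lemma pr_in: "x : A ==> y : A ==> opair elts x y : A & elts (opair elts x y) = {mkset elts {x}, mkset elts {x, y}}
  & elts (mkset elts {x}) = {x} & elts (mkset elts {x, y}) = {x, y} & mkset elts {x} : A & mkset elts {x, y} : A"
proof -
 assume xy: "x : A" "y : A"
 obtain a where a: "a : A" "elts a = {x}" using pairing[OF xy(1) xy(1)] by auto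
 obtain b where b: "b : A" "elts b = {x, y}" using pairing[OF xy] by auto
 obtain c where c: "c : A" "elts c = {a, b}" using pairing[OF a(1) b(1)] by auto
 have 1: "mkset elts {x} = a" "mkset elts {x, y} = b" using mksetI[OF a(2)] mksetI[OF b(2)] by auto
 then have "opair elts x y = c" unfolding opair_def using mksetI[OF c(2)] by simp
 with 1 a b c show ?thesis by simp
qed

lemma pr_inject: assumes "x : A" "y : A" "x' : A" "y' : A" shows "opair elts x y = opair elts x' y' \<longleftrightarrow> x = x' & y = y'"
proof
 assume *: "opair elts x y = opair elts x' y'"
 have "{mkset elts {x}, mkset elts {x, y}} = {mkset elts {x'}, mkset elts {x', y'}}"
  using pr_in[OF assms(1,2)] pr_in[OF assms(3,4)] * by metis
 then have "elts ` {mkset elts {x}, mkset elts {x, y}} = elts ` {mkset elts {x'}, mkset elts {x', y'}}" by simp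
 then have "{{x}, {x, y}} = {{x'}, {x', y'}}" using pr_in[OF assms(1,2)] pr_in[OF assms(3,4)] by simp
 then show "x = x' & y = y'" by (metis doubleton_eq_iff insert_absorb2)
qed simp

lemma dt_pr[dfn_intros]: assumes "dt elts A B s" "dt elts A B t" shows "dt elts A B (%e. opair elts (s e) (t e))"
proof -
 have 1: "dt elts A B (%e. mkset elts {t e, u e})" if "dt elts A B t" "dt elts A B u" for t u
  by (rule dt_mkset0) (intro dfn_intros that, use pairing dt_in[OF that(1)] dt_in[OF that(2)] in blast)
 have 2: "dt elts A B (%e. mkset elts {t e})" if "dt elts A B t" for t
  using 1[OF that that] by simp
 show ?thesis unfolding opair_def by (rule 1[OF 2[OF assms(1)] 1[OF assms]])
qed

end

section \<open>Sets, functions and recursion in a model of ZFC\<close>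

locale zfc =
 fixes elts :: "'a => 'a set"
 assumes zfc: "zfc_model elts"
begin

lemma z_inj: "inj elts" by (rule zfc[unfolded zfc_model_def, THEN conjunct1])
lemma z_wf: "wf (memrel elts)" by (rule zfc[unfolded zfc_model_def, THEN conjunct2, THEN conjunct1])
lemma z_pair: "EX c. elts c = {a, b}" by (rule zfc[unfolded zfc_model_def, THEN conjunct2, THEN conjunct2, THEN conjunct1, THEN spec, THEN spec])
lemma z_union: "EX u. elts u = \<Union> (elts ` elts a)" by (rule zfc[unfolded zfc_model_def, THEN conjunct2, THEN conjunct2, THEN conjunct2, THEN conjunct1, THEN spec])
lemma z_pow: "EX p. elts p = {x. elts x \<subseteq> elts a}" by (rule zfc[unfolded zfc_model_def, THEN conjunct2, THEN conjunct2, THEN conjunct2, THEN conjunct2, THEN conjunct1, THEN spec])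
lemma z_inf: "EX w z. elts z = {} & z : elts w & (ALL x:elts w. EX y:elts w. elts y = insert x (elts x))" by (rule zfc[unfolded zfc_model_def, THEN conjunct2, THEN conjunct2, THEN conjunct2, THEN conjunct2, THEN conjunct2, THEN conjunct1])
lemma z_sep: "EX b. elts b = {x : elts a. sat elts UNIV (case_nat x e) ph}" by (rule zfc[unfolded zfc_model_def, THEN conjunct2, THEN conjunct2, THEN conjunct2, THEN conjunct2, THEN conjunct2, THEN conjunct2, THEN conjunct1, THEN spec, THEN spec, THEN spec])
lemma z_rep: "(ALL x:elts a. EX! y. sat elts UNIV (case_nat x (case_nat y e)) ph) ==>
    (EX b. elts b = {y. EX x:elts a. sat elts UNIV (case_nat x (case_nat y e)) ph})"
 by (rule zfc[unfolded zfc_model_def, THEN conjunct2, THEN conjunct2, THEN conjunct2, THEN conjunct2, THEN conjunct2, THEN conjunct2, THEN conjunct2, THEN conjunct1, THEN spec, THEN spec, THEN spec, THEN mp])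
lemma z_ac: "(ALL x:elts a. elts x ~= {}) & (ALL x:elts a. ALL y:elts a. x ~= y --> elts x \<inter> elts y = {}) ==>
    (EX c. ALL x:elts a. EX! y. y : elts x \<inter> elts c)"
 by (rule zfc[unfolded zfc_model_def, THEN conjunct2, THEN conjunct2, THEN conjunct2, THEN conjunct2, THEN conjunct2, THEN conjunct2, THEN conjunct2, THEN conjunct2, THEN spec, THEN mp])

sublocale cls2 elts UNIV UNIV
 using z_inj z_pair by unfold_locales auto

abbreviation "D \<equiv> dfn elts UNIV UNIV"
abbreviation "F \<equiv> dt elts UNIV UNIV"
abbreviation "DS \<equiv> ds elts UNIV UNIV"
abbreviation "mk \<equiv> mkset elts"
abbreviation "pr \<equiv> opair elts"
abbreviation "R \<equiv> memrel elts"

definition small :: "'a set => bool" where "small X \<longleftrightarrow> (EX x. elts x = X)"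

lemma small_elts[simp, intro]: "small (elts x)" by (auto simp: small_def)
lemma elts_mk[simp]: "small X ==> elts (mk X) = X" using mksetI by (auto simp: small_def)
lemma mk_elts[simp]: "mk (elts x) = x" by (rule mksetI) simp
lemma smallE: assumes "small X" obtains x where "elts x = X" using assms by (auto simp: small_def)
lemma elts_inject[simp]: "elts x = elts y \<longleftrightarrow> x = y" using elts_eqD by auto

lemma dfn_allU[dfn_intros]: "D (%e. Q (e 0) (%n. e (Suc n))) ==> D (%e. ALL x. Q x e)"
 using dfn_all[of Q] by simp
lemma dfn_exU[dfn_intros]: "D (%e. Q (e 0) (%n. e (Suc n))) ==> D (%e. EX x. Q x e)"
 using dfn_ex[of Q] by simp
lemma ds_Collect[dfn_intros]: "D (%e. Q (e 0) (%n. e (Suc n))) ==> DS (%e. {x. Q x e})"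
 by (rule dsI) simp_all
lemma ds_UNIV[dfn_intros]: "DS (%e. UNIV)"
 by (rule dsI) (simp_all add: dfn_const)

lemma ds_small: "small X ==> DS (%e. X)"
 using ds_const[OF UNIV_I] by (auto simp: small_def)

lemma D_small: "small X ==> F t ==> D (%e. t e : X)"
 by (rule dfn_mem[OF _ ds_small])

text \<open>\<open>mkset\<close> applied to a proper class is a fixed junk value, so this needs no smallness.\<close>

lemma dt_mk[dfn_intros]: assumes "DS S" shows "F (%e. mk (S e))"
proof -
 have eq: "y = mk X \<longleftrightarrow> elts y = X | ~ (EX z. elts z = X) & y = (THE x. False)" for y X
 proof (cases "EX z. elts z = X")
  case True then obtain z where z: "elts z = X" by (rule exE)
  show ?thesis unfolding mksetI[OF z] z[symmetric] by auto
 next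
  case False then have "mk X = (THE x. False)" unfolding mkset_def by simp
  with False show ?thesis by auto
 qed
 have "D (%e. elts (e 0) = S (%n. e (Suc n)) | ~ (EX z. elts z = S (%n. e (Suc n))) & e 0 = (THE x. False))"
  by (intro dfn_disj dfn_conj dfn_not dfn_exU dfn_seteq dfn_eq ds_elts dt_var dt_const UNIV_I ds_shift[OF assms] ds_shift[OF ds_shift[OF assms]])
 then show ?thesis unfolding dt_def eq[symmetric] by simp
qed

text \<open>Moves the parameters behind the variable, the shape in which \<open>zfc_model\<close>
  states Separation; \<open>D2E\<close> does the same for Replacement.\<close>

lemma D1E: assumes "D (%e. Q (e 0))" obtains ph e where "!!x. Q x \<longleftrightarrow> sat elts UNIV (case_nat x e) ph"
proof -
 obtain ph m c where ph: "!!e. Q (e 0) \<longleftrightarrow> sat elts UNIV (%k. if k < m then c k else e (k - m)) ph"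
  using assms unfolding dfn_def by auto
 let ?r = "%k. if k < m then Suc k else 0"
 have "(%n. case_nat x c (?r n)) = (%k. if k < m then c k else (%_. x) (k - m))" for x
  by (rule ext) auto
 then have "Q x \<longleftrightarrow> sat elts UNIV (case_nat x c) (ren ?r ph)" for x
  unfolding sat_ren using ph[of "%_. x"] by simp
 then show ?thesis by (rule that)
qed

lemma D2E: assumes "D (%e. Q (e 0) (e 1))" obtains ph e where "!!x y. Q x y \<longleftrightarrow> sat elts UNIV (case_nat x (case_nat y e)) ph"
proof -
 obtain ph m c where ph: "!!e. Q (e 0) (e 1) \<longleftrightarrow> sat elts UNIV (%k. if k < m then c k else e (k - m)) ph"
  using assms unfolding dfn_def by auto
 let ?r = "%k. if k < m then Suc (Suc k) else if k = m then 0 else 1"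
 have "(%n. case_nat x (case_nat y c) (?r n)) = (%k. if k < m then c k else case_nat x (%_. y) (k - m))" for x y
  by (rule ext) (auto split: nat.split)
 then have "Q x y \<longleftrightarrow> sat elts UNIV (case_nat x (case_nat y c)) (ren ?r ph)" for x y
  unfolding sat_ren using ph[of "case_nat x (%_. y)"] by simp
 then show ?thesis by (rule that)
qed

lemma small_sep: assumes "small X" "D (%e. Q (e 0))" shows "small {x:X. Q x}"
proof -
 obtain a where a: "elts a = X" using assms(1) by (rule smallE)
 obtain ph e where "!!x. Q x \<longleftrightarrow> sat elts UNIV (case_nat x e) ph" by (rule D1E[OF assms(2)]) (erule that)
 with z_sep[of a e ph] a show ?thesis by (simp add: small_def)
qed

lemma small_subset: assumes "small X" "Y \<subseteq> X" "D (%e. e 0 : Y)" shows "small Y"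
proof -
 have "Y = {x:X. x : Y}" using assms(2) by auto
 with small_sep[OF assms(1,3)] show ?thesis by simp
qed

text \<open>Here \<open>Q\<close> describes \<open>f\<close> on \<open>X\<close> only, so
  Replacement becomes available inside inductions in which the definability of \<open>f\<close> is
  still to be shown.\<close>

lemma small_rel: assumes "small X" "D (%e. Q (e 0) (e 1))" "!!x y. x : X ==> Q x y \<longleftrightarrow> y = f x" shows "small (f ` X)"
proof -
 obtain a where a: "elts a = X" using assms(1) by (rule smallE)
 obtain ph e where ph: "!!x y. Q x y \<longleftrightarrow> sat elts UNIV (case_nat x (case_nat y e)) ph" by (rule D2E[OF assms(2)]) (erule that)
 have "ALL x:elts a. EX! y. sat elts UNIV (case_nat x (case_nat y e)) ph"
  unfolding ph[symmetric] a using assms(3) by (simp add: Ex1_def)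
 from z_rep[OF this] obtain b where "elts b = {y. EX x:elts a. sat elts UNIV (case_nat x (case_nat y e)) ph}" by blast
 then have "elts b = {y. EX x:X. Q x y}" unfolding ph[symmetric] a .
 also have "\<dots> = f ` X" using assms(3) by (simp add: image_def)
 finally have "elts b = f ` X" .
 then show ?thesis by (auto simp: small_def)
qed

lemma dt_rel: "F (%e. f (e 0)) ==> D (%e. e 1 = f (e 0))"
 unfolding dt_def using dfn_ren[of elts UNIV UNIV "%e. e 0 = f (e (Suc 0))" "%n. 1 - n"] by simp

lemma small_image: "small X ==> F (%e. f (e 0)) ==> small (f ` X)"
 by (rule small_rel[of X "%x y. y = f x"]) (simp_all add: dt_rel[of f, simplified])

lemma small_Union: "small X ==> small (\<Union> (elts ` X))"
 using z_union by (auto simp: small_def)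

lemma small_UN: assumes "small X" "F (%e. f (e 0))" shows "small (UN x:X. elts (f x))"
 using small_Union[OF small_image[OF assms]] by (simp add: image_image)

lemma small_pair[simp]: "small {x, y}" using z_pair by (auto simp: small_def)
lemma small_single[simp]: "small {x}" using small_pair[of x x] by simp
lemma small_Un[intro]: assumes "small X" "small Y" shows "small (X \<union> Y)"
proof -
 obtain x y where "elts x = X" "elts y = Y" using assms by (auto simp: small_def)
 then show ?thesis using small_Union[OF small_pair[of x y]] by simp
qed
lemma small_empty[simp]: "small {}" using z_inf by (auto simp: small_def)
lemma small_insert[intro]: "small X ==> small (insert x X)"
 using small_Un[OF small_single[of x]] by simp
lemma small_finite: "finite X ==> small X" by (induction rule: finite_induct) (simp_all add: small_insert)
lemma small_Pow: "small X ==> small {y. elts y \<subseteq> X}" using z_pow by (auto simp: small_def)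
lemma small_Int: assumes "small X" "small Y" shows "small (X \<inter> Y)"
 using small_sep[OF assms(1) D_small[OF assms(2) dt_var]] by (simp add: Int_def)
lemma small_Diff: assumes "small X" "small Y" shows "small (X - Y)"
 using small_sep[OF assms(1) dfn_not[OF D_small[OF assms(2) dt_var]]] by (simp add: set_diff_eq)

lemma pr_eq[simp]: "pr x y = pr x' y' \<longleftrightarrow> x = x' & y = y'" by (rule pr_inject) auto

definition "zero = mk {}"
lemma elts_zero[simp]: "elts zero = {}" by (simp add: zero_def)

definition prod :: "'a set => 'a set => 'a set" where "prod X Y = {pr x y | x y. x : X & y : Y}"
lemma pr_prod[simp]: "pr x y : prod X Y \<longleftrightarrow> x : X & y : Y" by (auto simp: prod_def)

lemma small_prod: assumes "small X" "small Y" shows "small (prod X Y)"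
proof -
 have 1: "small ((%y. pr x y) ` Y)" for x by (rule small_image[OF assms(2)]) (intro dfn_intros UNIV_I)
 have "F (%e. mk ((%y. pr (e 0) y) ` Y))"
  by (intro dfn_intros UNIV_I ds_small assms)
 from small_UN[OF assms(1) this] show ?thesis unfolding elts_mk[OF 1]
  by (rule arg_cong[where f=small, THEN iffD1, rotated]) (auto simp: prod_def)
qed

text \<open>A component is recovered as the set of its own elements. This avoids a description
  operator, so the term is total and covered by the closure rules; \<open>psnd\<close> and
  \<open>ap\<close> use the same device.\<close>

definition pfst :: "'a => 'a" where "pfst p = mk {z. EX a b. p = pr a b & z : elts a}"
definition psnd :: "'a => 'a" where "psnd p = mk {z. EX a b. p = pr a b & z : elts b}"
definition ap :: "'a => 'a => 'a" where "ap f x = mk {z. EX y. pr x y : elts f & z : elts y}"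
lemma pfst[simp]: "pfst (pr a b) = a" by (simp add: pfst_def)
lemma psnd[simp]: "psnd (pr a b) = b" by (simp add: psnd_def)
lemma dt_pfst[dfn_intros]: "F s ==> F (%e. pfst (s e))"
 by (rule dt_let[where f="%x e. pfst x"], assumption) (unfold pfst_def, intro dfn_intros UNIV_I)
lemma dt_psnd[dfn_intros]: "F s ==> F (%e. psnd (s e))"
 by (rule dt_let[where f="%x e. psnd x"], assumption) (unfold psnd_def, intro dfn_intros UNIV_I)

lemma dt_2: assumes "F (%e. f (e 0) (e 1))" "F s" "F t" shows "F (%e. f (s e) (t e))"
proof -
 have "D (%e. e 0 = f (e 1) (e 2))" using assms(1) by (simp add: dt_def numeral_2_eq_2)
 from dt_fun2[OF _ this assms(2,3)] show ?thesis by simp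
qed
lemma dt_1: assumes "F (%e. f (e 0))" "F s" shows "F (%e. f (s e))"
 using dt_let[OF assms(2), of "%x e. f x"] assms(1) by simp
lemma dt_3: assumes "F (%e. f (e 0) (e 1) (e 2))" "F s" "F t" "F u" shows "F (%e. f (s e) (t e) (u e))"
proof -
 have "F (%e. f (pfst (e 0)) (pfst (psnd (e 0))) (psnd (psnd (e 0))))"
 proof -
  have "D (%e. e 0 = f (e 1) (e 2) (e 3))" using assms(1) by (simp add: dt_def numeral_2_eq_2 numeral_3_eq_3)
  from dfn_rel4[where R="%z x y w. z = f x y w", OF this, of "%e. e 0" "%e. pfst (e 1)" "%e. pfst (psnd (e 1))" "%e. psnd (psnd (e 1))"]
  show ?thesis unfolding dt_def by (simp add: dfn_intros)
 qed
 from dt_1[OF this, of "%e. pr (s e) (pr (t e) (u e))"] assms(2-4) show ?thesis by (simp add: dt_pr)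
qed

lemma dt_ap[dfn_intros]: "F s ==> F t ==> F (%e. ap (s e) (t e))"
 by (rule dt_2[where f=ap]) (unfold ap_def, intro dfn_intros UNIV_I)

definition graph :: "('a => 'a) => 'a set => 'a set" where "graph f X = (%x. pr x (f x)) ` X"
lemma ap_graph[simp]: "elts g = graph f X ==> x : X ==> ap g x = f x"
 by (auto simp: ap_def graph_def intro!: mksetI)
lemma pr_graph[simp]: "pr x y : graph f X \<longleftrightarrow> x : X & y = f x" by (auto simp: graph_def)
lemma small_graph: "small X ==> F (%e. f (e 0)) ==> small (graph f X)"
 unfolding graph_def by (rule small_image) (auto intro: dfn_intros)

lemma dt_if[dfn_intros]: assumes "D Q" "F s" "F t" shows "F (%e. if Q e then s e else t e)"
proof -
 have "F (%e. mk {z. Q e & z : elts (s e) | ~ Q e & z : elts (t e)})"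
  by (intro dfn_intros dt_shift assms dfn_ren[OF assms(1)])
 moreover have "mk {z. Q e & z : elts (s e) | ~ Q e & z : elts (t e)} = (if Q e then s e else t e)" for e
  by simp
 ultimately show ?thesis by simp
qed

lemma wfR: "wf R" by (rule z_wf)
lemma wfRp: "wf (R\<^sup>+)" by (rule wf_trancl[OF z_wf])
lemma R_iff: "(y, x) : R \<longleftrightarrow> y : elts x" by (simp add: memrel_def)
lemma mem_irrefl: "x ~: elts x" using wfR by (auto simp: R_iff[symmetric])
lemma Rp_irrefl: "(x, x) ~: R\<^sup>+" using wfRp by auto
lemma elts_Rp: "y : elts x ==> (y, x) : R\<^sup>+" by (auto simp: R_iff[symmetric])

definition below :: "'a => 'a set" where "below x = {y. (y, x) : R\<^sup>+}"
lemma below_unfold: "below x = elts x \<union> (UN z:elts x. below z)"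
 by (auto simp: below_def R_iff[symmetric] elim: tranclE intro: trancl_into_trancl)

lemma below_trans: "y : below x ==> elts y \<subseteq> below x"
 by (auto simp: below_def R_iff[symmetric] intro: trancl_into_trancl2)
lemma below_least: assumes "elts x \<subseteq> T" "!!y. y : T ==> elts y \<subseteq> T" shows "below x \<subseteq> T"
proof
 fix y assume "y : below x"
 then have "(y, x) : R\<^sup>+" by (simp add: below_def)
 then show "y : T" by (induction rule: converse_trancl_induct) (use assms in \<open>auto simp: R_iff\<close>)
qed

text \<open>By induction the closures of the elements of \<open>x\<close> are sets. The formula
  \<open>?Q\<close> describes them as least transitive supersets, so Replacement collects them
  before \<open>R\<^sup>+\<close> is known to be definable.\<close>

lemma small_below[simp]: "small (below x)"
proof (induction x rule: wf_induct_rule[OF wfR])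
 case (1 x)
 let ?Q = "%z t. elts z \<subseteq> elts t & (ALL y:elts t. elts y \<subseteq> elts t) & (ALL s. elts z \<subseteq> elts s & (ALL y:elts s. elts y \<subseteq> elts s) --> elts t \<subseteq> elts s)"
 have "?Q z t \<longleftrightarrow> t = mk (below z)" if "z : elts x" for z t
 proof -
  have s: "small (below z)" using 1[of z] that by (simp add: R_iff)
  have z: "elts z \<subseteq> below z" using below_unfold[of z] by blast
  have q: "?Q z (mk (below z))" using s z below_trans below_least by auto
  show ?thesis
  proof
   assume a: "?Q z t"
   have "elts t = elts (mk (below z))" using a q by (meson subset_antisym)
   then show "t = mk (below z)" by simp
  qed (use q in simp)
 qed
 from small_rel[OF small_elts, of ?Q x "%z. mk (below z)", OF _ this]
 have "small ((%z. mk (below z)) ` elts x)" by (simp add: dfn_intros)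
 from small_Union[OF this] have "small (UN z:elts x. below z)" using 1 by (simp add: image_image R_iff)
 with below_unfold[of x] show ?case by (metis small_Un small_elts)
qed

text \<open>Membership in all transitive supersets is first order, and by \<open>small_below\<close>
  the closure itself is one of these supersets.\<close>

lemma ds_below[dfn_intros]: assumes "F t" shows "DS (%e. below (t e))"
proof -
 have eq: "below x = {y. ALL s. elts x \<subseteq> elts s & (ALL y:elts s. elts y \<subseteq> elts s) --> y : elts s}" for x
 proof (intro equalityI subsetI CollectI allI impI)
  fix y s assume "y : below x" "elts x \<subseteq> elts s & (ALL y:elts s. elts y \<subseteq> elts s)"
  then show "y : elts s" using below_least[of x "elts s"] by auto
 next
  fix y assume "y : {y. ALL s. elts x \<subseteq> elts s & (ALL y:elts s. elts y \<subseteq> elts s) --> y : elts s}"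
  then have "elts x \<subseteq> elts (mk (below x)) & (ALL y:elts (mk (below x)). elts y \<subseteq> elts (mk (below x))) --> y : elts (mk (below x))"
   by (elim CollectE allE)
  then have "elts x \<subseteq> below x & (ALL y:below x. elts y \<subseteq> below x) --> y : below x"
   unfolding elts_mk[OF small_below] .
  then show "y : below x" using below_unfold[of x] below_trans by blast
 qed
 show ?thesis unfolding eq
  by (intro dfn_intros dt_shift[OF assms] dt_shift[OF dt_shift[OF assms]])
qed

lemma dfn_Rp[dfn_intros]: "F s ==> F t ==> D (%e. (s e, t e) : R\<^sup>+)"
 using dfn_mem[OF _ ds_below, of s t] by (simp add: below_def)

text \<open>A value of \<open>f\<close> is certified by an approximation: a set of pairs that obeys
  the equation for \<open>H\<close> and has values on all of \<open>below z\<close> for each of its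
  arguments \<open>z\<close>. By \<open>sound\<close> approximations agree with \<open>f\<close>, by
  \<open>compl\<close> they exist, and so their existence defines \<open>f\<close> by a
  formula.\<close>

theorem recursion:
 assumes H: "F (%e. H (e 0) (e 1))" and f: "!!x. f x = H x (mk (graph f (below x)))"
 shows "F (%e. f (e 0))"
proof -
 let ?res = "%g z. {u:elts g. EX z':below z. EX v'. u = pr z' v'}"
 let ?A = "%g. ALL w:elts g. EX z v. w = pr z v & v = H z (mk (?res g z)) & (ALL z':below z. EX v'. pr z' v' : elts g)"
 let ?Rel = "%x y. EX g. ?A g & pr x y : elts g"
 have sound: "v = f z" if A: "?A g" and "pr z v : elts g" for g z v
  using that(2)
 proof (induction z arbitrary: v rule: wf_induct_rule[OF wfRp])
  case (1 z)
  have v: "v = H z (mk (?res g z))" "ALL z':below z. EX v'. pr z' v' : elts g" using A 1(2) by fastforce+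
  have "?res g z = graph f (below z)"
  proof (intro equalityI subsetI)
   fix u assume "u : ?res g z"
   then obtain z' v' where u: "z' : below z" "u = pr z' v'" "u : elts g" by blast
   then have "v' = f z'" using 1(1)[of z' v'] by (simp add: below_def)
   with u show "u : graph f (below z)" by simp
  next
   fix u assume "u : graph f (below z)"
   then obtain z' where u: "z' : below z" "u = pr z' (f z')" by (auto simp: graph_def)
   then obtain v' where v': "pr z' v' : elts g" using v(2) by blast
   then have "v' = f z'" using 1(1)[of z' v'] u(1) by (simp add: below_def)
   with u v' show "u : ?res g z" by blast
  qed
  with v f show ?case by simp
 qed
 have DRel: "D (%e. ?Rel (e 0) (e 1))"
  by (intro dfn_intros dt_2[OF H] UNIV_I)
 have compl: "?Rel x (f x)" for x
 proof (induction x rule: wf_induct_rule[OF wfRp])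
  case (1 x)
  have IH: "?Rel z v \<longleftrightarrow> v = f z" if "z : below x" for z v
   using 1[of z] that sound by (auto simp: below_def)
  have sm: "small (graph f (below x))" unfolding graph_def
  proof (rule small_rel[OF small_below, of "%z w. EX v. ?Rel z v & w = pr z v"])
   show "D (%e. EX v. ?Rel (e 0) v & e 1 = pr (e 0) v)"
    by (intro dfn_intros dt_2[OF H] UNIV_I)
   show "(EX v. ?Rel z v & w = pr z v) \<longleftrightarrow> w = pr z (f z)" if "z : below x" for z w
    unfolding IH[OF that] by simp
  qed
  \<comment> \<open>The certificate for \<open>x\<close>: the restriction of \<open>f\<close> to
    \<open>below x\<close>, a set by the induction hypothesis, together with the pair at
    \<open>x\<close>.\<close>
  let ?g = "mk (insert (pr x (f x)) (graph f (below x)))"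
  have g: "elts ?g = insert (pr x (f x)) (graph f (below x))" using sm by (simp add: small_insert)
  have r: "?res ?g z = graph f (below z)" and c: "ALL z':below z. EX v'. pr z' v' : elts ?g" if "z : below x | z = x" for z
  proof -
   have 1: "below z \<subseteq> below x" using that by (auto simp: below_def)
   have 2: "x ~: below z" using that Rp_irrefl by (auto simp: below_def dest: trancl_trans)
   show "?res ?g z = graph f (below z)" unfolding g using 1 2 by (auto simp: graph_def)
   show "ALL z':below z. EX v'. pr z' v' : elts ?g" unfolding g using 1 by auto
  qed
  have "?A ?g"
  proof
   fix w assume "w : elts ?g"
   then obtain z where z: "z : below x | z = x" "w = pr z (f z)" unfolding g by (auto simp: graph_def)
   show "EX z v. w = pr z v & v = H z (mk (?res ?g z)) & (ALL z':below z. EX v'. pr z' v' : elts ?g)"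
    using z(2) f[of z] r[OF z(1)] c[OF z(1)] by auto
  qed
  moreover have "pr x (f x) : elts ?g" unfolding g by simp
  ultimately show ?case by blast
 qed
 have "y = f x \<longleftrightarrow> ?Rel x y" for x y using compl[of x] sound by blast
 with dfn_ren[OF DRel, of "%n. 1 - n"] show ?thesis by (simp add: dt_def)
qed

text \<open>Recursion along \<open>R\<^sup>+\<close> instead of \<open>R\<close> lets the step see
  all of \<open>below x\<close>, the form that \<open>recursion\<close> asks for.\<close>

lemma rec_def: assumes "f = wfrec (R\<^sup>+) (%f x. H x (mk (graph f (below x))))"
 shows "f x = H x (mk (graph f (below x)))"
proof -
 have "graph (cut f (R\<^sup>+) x) (below x) = graph f (below x)"
  by (auto simp: graph_def below_def cut_apply intro!: image_cong)
 then show ?thesis using wfrec[OF wfRp, of "%f x. H x (mk (graph f (below x)))" x] assms by simp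
qed

end

context zfc begin

section \<open>Ordinals, ranks and the cumulative hierarchy\<close>

abbreviation "Or \<equiv> Ord elts"

lemma D_Or[dfn_intros]: "F t ==> D (%e. Or (t e))"
 by (rule dfn_rel1[where R=Or], unfold Ord_def, intro dfn_intros UNIV_I)

lemma Ord_mem: "Or a ==> x : elts a ==> Or x" unfolding Ord_def by blast
lemma Ord_trans: "Or a ==> x : elts y ==> y : elts a ==> x : elts a" unfolding Ord_def by blast
lemma OrdI: "(!!x. x : elts a ==> Or x) ==> (!!x. x : elts a ==> elts x \<subseteq> elts a) ==> Or a"
 unfolding Ord_def by blast

lemma Ord_linear: "Or a ==> Or b ==> a : elts b | a = b | b : elts a"
proof (induction a arbitrary: b rule: wf_induct_rule[OF wfR])
 case (1 a)
 note IHa = 1(1) and a = 1(2)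
 from 1(3) show ?case
 proof (induction b rule: wf_induct_rule[OF wfR])
  case (1 b)
  note IHb = 1(1) and b = 1(2)
  show ?case
  proof (rule ccontr)
   assume n: "~ ?case"
   have "x : elts b" if x: "x : elts a" for x
    using IHa[of x b] x n Ord_mem[OF a x] b Ord_trans[OF a _ x] by (auto simp: R_iff)
   moreover have "y : elts a" if y: "y : elts b" for y
    using IHb[of y] y n Ord_mem[OF b y] Ord_trans[OF b _ y] by (auto simp: R_iff)
   ultimately have "elts a = elts b" by blast
   with n show False by simp
  qed
 qed
qed

lemma Ord_subset: "Or a ==> Or b ==> elts a \<subseteq> elts b \<longleftrightarrow> a = b | a : elts b"
 using Ord_linear[of a b] Ord_trans[of b _ a] mem_irrefl by blast
lemma Ord_not_mem: "Or a ==> Or b ==> a ~: elts b \<longleftrightarrow> elts b \<subseteq> elts a"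
 using Ord_linear[of a b] Ord_subset[of b a] Ord_trans[of b a b] mem_irrefl Ord_trans by metis

definition "sc x = mk (insert x (elts x))"
lemma elts_sc[simp]: "elts (sc x) = insert x (elts x)" by (simp add: sc_def small_insert)
lemma dt_sc[dfn_intros]: "F t ==> F (%e. sc (t e))"
 unfolding sc_def by (intro dfn_intros)
lemma Ord_sc: "Or a ==> Or (sc a)" unfolding Ord_def by auto
lemma Ord_zero: "Or zero" by (rule OrdI) auto
lemma Ord_Union: "small X ==> (!!x. x : X ==> Or x) ==> Or (mk (\<Union> (elts ` X)))"
 by (rule OrdI) (auto simp: small_Union dest: Ord_mem Ord_trans)

lemma least_ord: assumes "Or a" "Q a"
 shows "Or (least_ord elts Q) & Q (least_ord elts Q) & (ALL b:elts (least_ord elts Q). ~ Q b) & (least_ord elts Q = a | least_ord elts Q : elts a)"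
proof -
 have "a : {a. Or a & Q a}" using assms by simp
 then obtain m where m0: "m : {a. Or a & Q a}" and min: "!!y. (y, m) : R ==> y ~: {a. Or a & Q a}"
  by (rule wfE_min[OF wfR]) (rule that)
 then have m: "Or m" "Q m" by simp_all
 have min': "ALL b:elts m. ~ Q b" using min Ord_mem[OF m(1)] by (auto simp: R_iff)
 have "least_ord elts Q = m" unfolding least_ord_def
 proof (rule the_equality)
  show "Or m & Q m & (ALL be:elts m. ~ Q be)" using m min' by simp
  fix b assume b: "Or b & Q b & (ALL be:elts b. ~ Q be)"
  from b have bO: "Or b" by simp
  from Ord_linear[OF bO m(1)] show "b = m"
  proof (elim disjE)
   assume "b : elts m" with min' b show ?thesis by simp
  next
   assume "m : elts b" with b m(2) show ?thesis by simp
  qed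
 qed
 moreover have "m = a | m : elts a" using Ord_linear[OF assms(1) m(1)]
 proof (elim disjE)
  assume "a : elts m" with min' assms(2) show ?thesis by simp
 qed simp_all
 ultimately show ?thesis using m min' by simp
qed

lemma least_ordI: assumes "Or m" "Q m" "!!b. b : elts m ==> ~ Q b" shows "least_ord elts Q = m"
 using least_ord[where Q=Q and a=m, OF assms(1,2)] assms(3)[of "least_ord elts Q"] by auto

primrec num :: "nat => 'a" where "num 0 = zero" | "num (Suc n) = sc (num n)"

lemma num_mem: "x : elts (num n) \<longleftrightarrow> (EX m<n. x = num m)"
 by (induction n) (auto simp: less_Suc_eq)
lemma Ord_num: "Or (num n)" by (induction n) (simp_all add: Ord_zero Ord_sc)
lemma num_inj: "num m = num n \<longleftrightarrow> m = n"
proof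
 assume "num m = num n"
 then show "m = n" using num_mem[of "num m" n] num_mem[of "num n" m] mem_irrefl[of "num m"]
  by (metis linorder_neqE_nat)
qed simp
lemma num_less: "num m : elts (num n) \<longleftrightarrow> m < n"
 by (auto simp: num_mem num_inj)

text \<open>Finite ordinals are those for which neither they nor their members are limits. As this
  is a formula, Separation cuts \<open>range num\<close> out of any inductive set.\<close>

lemma num_char: "(EX n. x = num n) \<longleftrightarrow> Or x & (ALL y:insert x (elts x). y = zero | (EX z. y = sc z))"
proof
 assume "EX n. x = num n"
 then obtain n where x: "x = num n" ..
 have *: "num n = zero | (EX z. num n = sc z)" for n by (cases n) auto
 show "Or x & (ALL y:insert x (elts x). y = zero | (EX z. y = sc z))"
 proof (intro conjI ballI)
  show "Or x" using x Ord_num by simp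
  fix y assume "y : insert x (elts x)"
  then obtain k where "y = num k" using x num_mem by auto
  then show "y = zero | (EX z. y = sc z)" using * by simp
 qed
next
 show "Or x & (ALL y:insert x (elts x). y = zero | (EX z. y = sc z)) ==> EX n. x = num n"
 proof (induction x rule: wf_induct_rule[OF wfR])
  case (1 x)
  then consider "x = zero" | z where "x = sc z" by blast
  then show ?case
  proof cases
   case 1 then show ?thesis using num.simps(1) by metis
  next
   case (2 z)
   have "Or z" using Ord_mem[of x z] 1(2) 2 by auto
   moreover have "ALL y:insert z (elts z). y = zero | (EX z. y = sc z)" using 1(2) 2 by auto
   ultimately obtain n where "z = num n" using 1(1)[of z] 2 by (auto simp: R_iff)
   then have "x = num (Suc n)" using 2 by simp
   then show ?thesis ..
  qed
 qed
qed

lemma small_nums: "small (range num)"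
proof -
 obtain w z where w: "elts z = {}" "z : elts w" "ALL x:elts w. EX y:elts w. elts y = insert x (elts x)" using z_inf by blast
 have "num n : elts w" for n
 proof (induction n)
  case 0 show ?case using w(1,2) by (metis elts_zero elts_inject num.simps(1))
 next
  case (Suc n) then show ?case using w(3) by (metis elts_sc elts_inject num.simps(2))
 qed
 then have "range num \<subseteq> elts w" by auto
 moreover have "D (%e. e 0 : range num)"
 proof -
  have "x : range num \<longleftrightarrow> Or x & (ALL y:insert x (elts x). y = zero | (EX z. y = sc z))" for x
   using num_char[of x] by auto
  then show ?thesis by (simp only:) (intro dfn_intros UNIV_I)
 qed
 ultimately show ?thesis using small_subset[OF small_elts] by blast
qed

abbreviation "om \<equiv> omega elts"

lemma elts_omega: "elts om = range num"
proof -
 let ?w = "mk (range num)"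
 have w: "elts ?w = range num" by (simp add: small_nums)
 have O: "Or ?w" by (rule OrdI) (auto simp: w Ord_num num_mem)
 have "om = ?w" unfolding omega_def
 proof (rule least_ordI[OF O])
  have "ALL be:range num. EX ga:range num. be : elts ga"
  proof
   fix b assume "b : range num" then obtain n where "b = num n" by blast
   then have "b : elts (num (Suc n))" by simp
   then show "EX ga:range num. b : elts ga" by blast
  qed
  then show "Limit elts ?w" unfolding Limit_def w using O by auto
  fix b assume "b : elts ?w"
  then obtain n where b: "b = num n" unfolding w by blast
  show "~ Limit elts b"
  proof
   assume L: "Limit elts b"
   then obtain m where n: "n = Suc m" using b unfolding Limit_def by (cases n) auto
   then have "num m : elts b" using b by simp
   then obtain c where "c : elts b" "num m : elts c" using L unfolding Limit_def by blast
   then show False using n b by (auto simp: num_mem num_inj)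
  qed
 qed
 then show ?thesis using w by simp
qed

lemma Ord_omega: "Or om" by (rule OrdI) (auto simp: elts_omega Ord_num num_mem)
lemma num_in[simp]: "num n : elts om" by (simp add: elts_omega)

text \<open>The von Neumann rank, with recursion along \<open>R\<^sup>+\<close> so that
  \<open>recursion\<close> yields its definability.\<close>

definition rk :: "'a => 'a" where
 "rk = wfrec (R\<^sup>+) (%f x. mk (UN z:elts x. insert (ap (mk (graph f (below x))) z) (elts (ap (mk (graph f (below x))) z))))"

lemma ap_rec: "F (%e. f (e 0)) ==> z : below x ==> ap (mk (graph f (below x))) z = f z"
 by (rule ap_graph) (simp_all add: small_graph)
lemma elts_below: "z : elts x ==> z : below x" by (simp add: below_def elts_Rp)

lemma dt_rk0: "F (%e. rk (e 0))"
 by (rule recursion[where H="%x g. mk (UN z:elts x. insert (ap g z) (elts (ap g z)))", OF _ rec_def[OF rk_def]])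
   (intro dfn_intros UNIV_I)
lemma dt_rk[dfn_intros]: "F t ==> F (%e. rk (t e))" by (rule dt_1[OF dt_rk0])

lemma small_UN_ins: assumes "F (%e. f (e 0))" "small X" shows "small (UN z:X. insert (f z) (elts (f z)))"
 using small_UN[OF assms(2) dt_sc[OF assms(1)]] unfolding elts_sc .

lemma elts_rk: "elts (rk x) = (UN z:elts x. insert (rk z) (elts (rk z)))"
proof -
 have "rk x = mk (UN z:elts x. insert (rk z) (elts (rk z)))"
  by (subst rec_def[OF rk_def]) (simp add: ap_rec[OF dt_rk0] elts_below)
 then show ?thesis using small_UN_ins[OF dt_rk0 small_elts] by simp
qed

lemma Ord_rk: "Or (rk x)"
proof (induction x rule: wf_induct_rule[OF wfR])
 case (1 x)
 then have IH: "!!z. z : elts x ==> Or (rk z)" by (simp add: R_iff)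
 have "Or w & elts w \<subseteq> elts (rk x)" if w: "w : elts (rk x)" for w
 proof -
  obtain z where z: "z : elts x" "w : insert (rk z) (elts (rk z))" using w unfolding elts_rk[of x] by (rule UN_E)
  have "elts w \<subseteq> elts (rk z)" using z(2) Ord_trans[OF IH[OF z(1)]] by blast
  moreover have "elts (rk z) \<subseteq> elts (rk x)" unfolding elts_rk[of x] using z(1) by blast
  moreover have "Or w" using z(2) IH[OF z(1)] Ord_mem[OF IH[OF z(1)]] by blast
  ultimately show ?thesis by simp
 qed
 note w = this
 show ?case by (rule OrdI) (use w in simp_all)
qed
lemma rk_mem: "z : elts x ==> rk z : elts (rk x)" by (subst elts_rk) blast
lemma rk_Rp: "(z, x) : R\<^sup>+ ==> rk z : elts (rk x)"
 by (induction rule: trancl_induct) (auto simp: R_iff rk_mem intro: Ord_trans[OF Ord_rk])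
lemma rk_least: assumes "Or a" "!!z. z : elts x ==> rk z : elts a" shows "elts (rk x) \<subseteq> elts a"
 using assms(2) Ord_trans[OF assms(1)] by (subst elts_rk) blast
lemma rk_subset: "elts x \<subseteq> elts y ==> elts (rk x) \<subseteq> elts (rk y)"
 by (rule rk_least[OF Ord_rk]) (auto intro: rk_mem)
lemma rk_Ord: "Or a ==> rk a = a"
proof (induction a rule: wf_induct_rule[OF wfR])
 case (1 a)
 then have "!!z. z : elts a ==> rk z = z" using Ord_mem by (auto simp: R_iff)
 then have "elts (rk a) = elts a" using Ord_trans[OF 1(2)] unfolding elts_rk[of a] by auto
 then show ?case by simp
qed

abbreviation "Vs \<equiv> Vset elts"

text \<open>A copy of \<open>Vset\<close> with recursion along \<open>R\<^sup>+\<close>; only this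
  form falls under \<open>recursion\<close>, and \<open>Vs_Vr\<close> carries definability over to
  \<open>Vset\<close>.\<close>

definition Vr :: "'a => 'a" where
 "Vr = wfrec (R\<^sup>+) (%f x. mk (UN z:elts x. {y. elts y \<subseteq> elts (ap (mk (graph f (below x))) z)}))"
lemma dt_Vr0: "F (%e. Vr (e 0))"
 by (rule recursion[where H="%x g. mk (UN z:elts x. {y. elts y \<subseteq> elts (ap g z)})", OF _ rec_def[OF Vr_def]])
   (intro dfn_intros UNIV_I)
lemma Vr: "Vr x = mk (UN z:elts x. {y. elts y \<subseteq> elts (Vr z)})"
  by (subst rec_def[OF Vr_def]) (simp add: ap_rec[OF dt_Vr0] elts_below)
lemma Vs: "Vs x = mk (UN z:elts x. {y. elts y \<subseteq> elts (Vs z)})"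
 unfolding Vset_def by (subst wfrec[OF wfR]) (simp add: cut_apply R_iff)
lemma Vs_Vr: "Vs x = Vr x"
proof (induction x rule: wf_induct_rule[OF wfR])
 case (1 x)
 then have "(UN z:elts x. {y. elts y \<subseteq> elts (Vs z)}) = (UN z:elts x. {y. elts y \<subseteq> elts (Vr z)})"
  by (auto simp: R_iff)
 then show ?case by (subst Vs, subst Vr) simp
qed
lemma dt_Vs[dfn_intros]: "F t ==> F (%e. Vs (t e))" unfolding Vs_Vr by (rule dt_1[OF dt_Vr0])

lemma elts_Vs: "elts (Vs x) = (UN z:elts x. {y. elts y \<subseteq> elts (Vs z)})"
proof -
 have "F (%e. mk {y. elts y \<subseteq> elts (Vs (e 0))})" by (intro dfn_intros UNIV_I)
 from small_UN[OF small_elts this] have "small (UN z:elts x. {y. elts y \<subseteq> elts (Vs z)})" by (simp add: small_Pow)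
 then show ?thesis using Vs[of x] elts_mk by metis
qed

lemma Vs_iff: "Or a ==> x : elts (Vs a) \<longleftrightarrow> rk x : elts a"
proof (induction a arbitrary: x rule: wf_induct_rule[OF wfR])
 case (1 a)
 have "x : elts (Vs a) \<longleftrightarrow> (EX b:elts a. ALL z:elts x. z : elts (Vs b))" by (subst elts_Vs) auto
 also have "\<dots> \<longleftrightarrow> (EX b:elts a. ALL z:elts x. rk z : elts b)" using 1 Ord_mem by (auto simp: R_iff)
 also have "\<dots> \<longleftrightarrow> rk x : elts a"
 proof
  assume "EX b:elts a. ALL z:elts x. rk z : elts b"
  then obtain b where b: "b : elts a" "ALL z:elts x. rk z : elts b" by blast
  then have "elts (rk x) \<subseteq> elts b" using rk_least[of b x] Ord_mem[OF 1(2)] by blast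
  then have "rk x = b | rk x : elts b" using Ord_subset[OF Ord_rk] Ord_mem[OF 1(2) b(1)] by blast
  then show "rk x : elts a" using b(1) Ord_trans[OF 1(2)] by blast
 qed (auto intro: rk_mem)
 finally show ?case .
qed

lemma Vs_trans: "Or a ==> x : elts (Vs a) ==> elts x \<subseteq> elts (Vs a)"
 using Ord_trans[OF _ rk_mem] by (auto simp: Vs_iff)
lemma Vs_sub: "Or a ==> x : elts (Vs a) ==> elts y \<subseteq> elts x ==> y : elts (Vs a)"
 using rk_subset[of y x] Ord_subset[OF Ord_rk Ord_rk, of y x] Ord_trans[of a "rk y" "rk x"] by (auto simp: Vs_iff)
lemma Vs_sc: "Or a ==> y : elts (Vs (sc a)) \<longleftrightarrow> elts y \<subseteq> elts (Vs a)"
proof -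
 assume a: "Or a"
 have "y : elts (Vs (sc a)) \<longleftrightarrow> rk y = a | rk y : elts a" using Vs_iff[OF Ord_sc[OF a]] by simp
 also have "\<dots> \<longleftrightarrow> elts (rk y) \<subseteq> elts a" using Ord_subset[OF Ord_rk a] by simp
 also have "\<dots> \<longleftrightarrow> elts y \<subseteq> elts (Vs a)"
 proof -
  have "elts (rk y) \<subseteq> elts a \<longleftrightarrow> (ALL z:elts y. rk z : elts a)" using rk_least[OF a, of y] rk_mem[of _ y] by blast
  then show ?thesis unfolding subset_iff[of "elts y"] Vs_iff[OF a] by blast
 qed
 finally show ?thesis .
qed
lemma in_Vs_rk: "x : elts (Vs (sc (rk x)))"
 using Vs_iff[OF Ord_sc[OF Ord_rk]] by simp
lemma rk_Vs: "Or a ==> rk (Vs a) = a"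
proof -
 assume a: "Or a"
 have "elts (rk (Vs a)) \<subseteq> elts a" using rk_least[OF a, of "Vs a"] by (auto simp: Vs_iff[OF a])
 moreover have "b : elts (rk (Vs a))" if b: "b : elts a" for b
  using rk_mem[of b "Vs a"] Vs_iff[OF a, of b] rk_Ord[OF Ord_mem[OF a b]] b by simp
 ultimately have "elts (rk (Vs a)) = elts a" by blast
 then show ?thesis by simp
qed
lemma Vs_mono: "Or a ==> b : elts a ==> elts (Vs b) \<subseteq> elts (Vs a) & Vs b : elts (Vs a)"
 using Vs_iff[of a] Vs_iff[of b] Ord_mem[of a b] Ord_trans[of a _ b] rk_Vs[of b] by auto

text \<open>Scott's trick: for each \<open>x\<close> one keeps the least level of the hierarchy that
  contains a witness, and this level depends definably on \<open>x\<close>.\<close>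

lemma collection: assumes "small X" "D (%e. Q (e 0) (e 1))"
 shows "EX Y. small Y & (ALL x:X. (EX y. Q x y) --> (EX y:Y. Q x y))"
proof -
 let ?P = "%x a. Or a & (EX y:elts (Vs a). Q x y)"
 let ?f = "%x. mk {b. EX a. ?P x a & (ALL c:elts a. ~ ?P x c) & b : elts a}"
 have Q1: "D (%e. Q (e (Suc (Suc (Suc 0)))) (e 0))" "D (%e. Q (e (Suc (Suc (Suc (Suc 0))))) (e 0))"
  by (rule dfn_rel2[OF assms(2)]; rule dt_var)+
 have f: "F (%e. ?f (e 0))"
  by (intro dfn_intros UNIV_I Q1)
 have ex: "?P x (?f x)" if y: "Q x y" for x y
 proof -
  have "?P x (sc (rk y))" using y in_Vs_rk[of y] Ord_sc[OF Ord_rk, of y] by blast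
  then have "EX a. ?P x a & (ALL c:elts a. ~ ?P x c)"
   using least_ord[of "sc (rk y)" "?P x"] by blast
  then obtain a where a: "?P x a & (ALL c:elts a. ~ ?P x c)" ..
  have "b = a" if "?P x b & (ALL c:elts b. ~ ?P x c)" for b
   using a that Ord_linear[of a b] by blast
  then have "{b. EX a. ?P x a & (ALL c:elts a. ~ ?P x c) & b : elts a} = elts a" using a by blast
  then have "?f x = a" by simp
  with a show ?thesis by simp
 qed
 have "F (%e. Vs (?f (e 0)))" by (rule dt_Vs[OF f])
 from small_UN[OF assms(1) this] have "small (UN x:X. elts (Vs (?f x)))" .
 moreover have "ALL x:X. (EX y. Q x y) --> (EX y:(UN x:X. elts (Vs (?f x))). Q x y)" using ex by blast
 ultimately show ?thesis by blast
qed

section \<open>Choice and cardinality\<close>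

text \<open>The axiom of choice speaks of disjoint families. Tagging each witness \<open>y\<close>
  with its \<open>x\<close> makes the sets of witnesses disjoint, and the choice function is read
  off from the transversal \<open>c\<close>.\<close>

lemma choice_set: assumes X: "small X" and Y: "small Y" and Q: "D (%e. Q (e 0) (e 1))"
 obtains f where "F (%e. f (e 0))" "!!x. x : X ==> EX y:Y. Q x y ==> f x : Y & Q x (f x)"
proof -
 let ?p = "%x. mk ((%y. pr x y) ` {y:Y. Q x y})"
 have Q1: "D (%e. Q (e (Suc 0)) (e 0))" "D (%e. Q (e (Suc (Suc 0))) (e 0))"
  by (rule dfn_rel2[OF Q]; rule dt_var)+
 have F1: "F (%e. ?p (e 0))" by (intro dfn_intros UNIV_I Q1 ds_small[OF Y])
 have sm: "small {y:Y. Q x y}" for x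
  by (rule small_sep[OF Y]) (rule dfn_rel2[OF Q]; intro dfn_intros UNIV_I)
 have p: "elts (?p x) = (%y. pr x y) ` {y:Y. Q x y}" for x
  by (rule elts_mk, rule small_image[OF sm]) (intro dfn_intros UNIV_I)
 let ?X = "{x:X. EX y:Y. Q x y}"
 have "small ?X"
  by (rule small_sep[OF X]) (intro dfn_intros ds_small[OF Y] Q1)
 from small_image[OF this F1] obtain a where a: "elts a = ?p ` ?X" by (rule smallE)
 have "ALL x:elts a. elts x ~= {}" unfolding a using p by auto
 moreover have "ALL x:elts a. ALL y:elts a. x ~= y --> elts x \<inter> elts y = {}"
 proof (intro ballI impI)
  fix u v assume "u : elts a" "v : elts a" "u ~= v"
  then obtain x x' where x: "u = ?p x" "v = ?p x'" "x ~= x'" unfolding a by blast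
  show "elts u \<inter> elts v = {}" unfolding x(1,2) p using x(3) by auto
 qed
 ultimately obtain c where c: "ALL x:elts a. EX! y. y : elts x \<inter> elts c" using z_ac[of a] by blast
 let ?f = "%x. mk {z. EX y:Y. Q x y & pr x y : elts c & z : elts y}"
 have Q2: "D (%e. Q (e (Suc (Suc 0))) (e 0))" by (rule dfn_rel2[OF Q]; rule dt_var)
 have f: "F (%e. ?f (e 0))" by (intro dfn_intros UNIV_I Q2 ds_small[OF Y])
 have "?f x : Y & Q x (?f x)" if x: "x : X" "EX y:Y. Q x y" for x
 proof -
  have "?p x : elts a" unfolding a using x by blast
  then obtain w where w: "w : elts (?p x)" "w : elts c" and u: "!!w'. w' : elts (?p x) ==> w' : elts c ==> w' = w"
   using c by blast
  from w(1) obtain y where y: "y : Y" "Q x y" "w = pr x y" unfolding p by blast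
  have "y' = y" if "y' : Y" "Q x y'" "pr x y' : elts c" for y'
   using u[of "pr x y'"] that y(3) unfolding p by auto
  then have "{z. EX y:Y. Q x y & pr x y : elts c & z : elts y} = elts y" using y w(2) by blast
  then have "?f x = y" by simp
  with y show ?thesis by simp
 qed
 note h = this
 show ?thesis by (rule that[OF f h])
qed

lemma choice: assumes X: "small X" and Q: "D (%e. Q (e 0) (e 1))"
 obtains f where "F (%e. f (e 0))" "!!x y. x : X ==> Q x y ==> Q x (f x)"
proof -
 obtain Y where Y: "small Y" "ALL x:X. (EX y. Q x y) --> (EX y:Y. Q x y)" using collection[OF assms] by blast
 obtain f where f: "F (%e. f (e 0))" "!!x. x : X ==> EX y:Y. Q x y ==> f x : Y & Q x (f x)"
  by (rule choice_set[OF X Y(1) Q]) (rule that)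
 show ?thesis by (rule that[OF f(1)]) (use f(2) Y(2) in blast)
qed

text \<open>The injection is a definable class function, which composes without coding; for sets
  this agrees with injections that are sets by \<open>injects_lep\<close>.\<close>

definition lep :: "'a set => 'a set => bool" where
 "lep X Y \<longleftrightarrow> (EX f. F (%e. f (e 0)) & inj_on f X & f ` X \<subseteq> Y)"

lemma lepI: "F (%e. f (e 0)) ==> inj_on f X ==> f ` X \<subseteq> Y ==> lep X Y"
 unfolding lep_def by (rule exI[of _ f]) simp
lemma lepE: assumes "lep X Y" obtains f where "F (%e. f (e 0))" "inj_on f X" "f ` X \<subseteq> Y"
 using assms unfolding lep_def by blast

lemma graph_dt: assumes "small (graph f X)" obtains g where "F (%e. g (e 0))" "!!x. x : X ==> g x = f x"
proof -
 obtain a where a: "elts a = graph f X" using assms by (rule smallE)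
 show ?thesis by (rule that[of "ap a"]) (intro dfn_intros UNIV_I, simp add: ap_graph[OF a])
qed

lemma injects_lep: "injects elts a b \<longleftrightarrow> lep (elts a) (elts b)"
proof
 assume "injects elts a b"
 then obtain f G where f: "elts f = graph G (elts a)" "inj_on G (elts a)" "G ` elts a \<subseteq> elts b"
  unfolding injects_def is_graph_def graph_def by blast
 have "small (graph G (elts a))" using f(1) small_elts by metis
 from graph_dt[OF this] obtain g where g: "F (%e. g (e 0))" "!!x. x : elts a ==> g x = G x" by blast
 have "inj_on g (elts a)" using f(2) g(2) by (simp add: inj_on_def)
 moreover have "g ` elts a \<subseteq> elts b" using f(3) g(2) by auto
 ultimately show "lep (elts a) (elts b)" by (rule lepI[OF g(1)])
next
 assume "lep (elts a) (elts b)"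
 then obtain f where f: "F (%e. f (e 0))" "inj_on f (elts a)" "f ` elts a \<subseteq> elts b" unfolding lep_def by blast
 have "is_graph elts (mk (graph f (elts a))) a f" unfolding is_graph_def
  using elts_mk[OF small_graph[OF small_elts f(1)]] by (simp add: graph_def)
 with f(2,3) show "injects elts a b" unfolding injects_def by blast
qed

lemma lep_mono: assumes "X \<subseteq> X'" "lep X' Y" "Y \<subseteq> Y'" shows "lep X Y'"
 using assms(2) by (rule lepE) (rule lepI, assumption, use assms(1,3) in \<open>auto intro: inj_on_subset\<close>)
lemma lep_id: "X \<subseteq> Y ==> lep X Y"
 by (rule lepI[of "%x. x"]) (simp_all add: dt_var)
lemma lep_trans: assumes "lep X Y" "lep Y Z" shows "lep X Z"
proof -
 obtain f where f: "F (%e. f (e 0))" "inj_on f X" "f ` X \<subseteq> Y" using assms(1) by (rule lepE)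
 obtain g where g: "F (%e. g (e 0))" "inj_on g Y" "g ` Y \<subseteq> Z" using assms(2) by (rule lepE)
 have "F (%e. g (f (e 0)))" by (rule dt_1[OF g(1) f(1)])
 moreover have "inj_on (%x. g (f x)) X" using f(2,3) g(2) unfolding inj_on_def by blast
 moreover have "(%x. g (f x)) ` X \<subseteq> Z" using f(3) g(3) by blast
 ultimately show ?thesis by (rule lepI)
qed

lemma lep_image: assumes "small X" "F (%e. f (e 0))" shows "lep (f ` X) X"
proof -
 have sm: "small (f ` X)" by (rule small_image[OF assms])
 have d: "D (%e. f (e 1) = e 0)" using assms(2) by (simp add: dt_def eq_commute)
 obtain g where g: "F (%e. g (e 0))" "!!y. y : f`X ==> EX x:X. f x = y ==> g y : X & f (g y) = y"
  by (rule choice_set[OF sm assms(1), of "%y x. f x = y", OF d]) (rule that)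
 then have g2: "!!x. x : X ==> g (f x) : X & f (g (f x)) = f x" by blast
 have "inj_on g (f ` X)" by (rule inj_onI) (metis g2 image_iff)
 moreover have "g ` f ` X \<subseteq> X" using g2 by blast
 ultimately show ?thesis by (rule lepI[OF g(1)])
qed

text \<open>Cantor's diagonal argument, with the diagonal set \<open>?d\<close> formed along the
  values of the supposed injection.\<close>

lemma not_lep_Pow: assumes "small X" shows "~ lep {y. elts y \<subseteq> X} X"
proof
 assume "lep {y. elts y \<subseteq> X} X"
 then obtain f where f: "F (%e. f (e 0))" "inj_on f {y. elts y \<subseteq> X}" "f ` {y. elts y \<subseteq> X} \<subseteq> X" unfolding lep_def by blast
 let ?d = "{x:X. EX y. elts y \<subseteq> X & x = f y & x ~: elts y}"
 have "small ?d"
  by (rule small_sep[OF assms]) (intro dfn_intros ds_small[OF assms] dt_1[OF f(1)])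
 then have d: "elts (mk ?d) = ?d" by simp
 have dX: "elts (mk ?d) \<subseteq> X" unfolding d by blast
 then have fX: "f (mk ?d) : X" using f(3) by blast
 have "y = mk ?d" if "elts y \<subseteq> X" "f (mk ?d) = f y" for y
  using inj_onD[OF f(2), of "mk ?d" y] that dX by simp
 then have "f (mk ?d) : ?d \<longleftrightarrow> f (mk ?d) ~: elts (mk ?d)"
  using fX dX by blast
 then show False unfolding d by blast
qed

text \<open>Zermelo's argument: \<open>g\<close> lists \<open>X\<close> by choosing from what is
  left. If it never ran out, it would be injective on the ordinals, and Collection would put all
  ordinals into one set, whose rank would then belong to it.\<close>

lemma wellorder: assumes "small X" obtains a f where "Or a" "F (%e. f (e 0))" "inj_on f X" "f ` X \<subseteq> elts a"
proof -
 have d: "D (%e. e 1 : elts (e 0))" by (intro dfn_intros)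
 obtain ch where ch: "F (%e. ch (e 0))"
  and ch0: "!!x. x : {y. elts y \<subseteq> X} ==> EX y:X. y : elts x ==> ch x : X & ch x : elts x"
  by (rule choice_set[OF small_Pow[OF assms] assms d]) (rule that)
 have ch2: "!!x. elts x \<subseteq> X ==> elts x ~= {} ==> ch x : elts x" using ch0 by blast
 define g where "g = wfrec (R\<^sup>+) (%f x. ch (mk (X - ap (mk (graph f (below x))) ` elts x)))"
 have gdt: "F (%e. g (e 0))"
  by (rule recursion[where H="%x g. ch (mk (X - ap g ` elts x))", OF _ rec_def[OF g_def]])
    (intro dfn_intros UNIV_I dt_1[OF ch] ds_small[OF assms])
 have g: "g x = ch (mk (X - g ` elts x))" for x
 proof -
  have "ap (mk (graph g (below x))) ` elts x = g ` elts x"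
   by (intro image_cong refl ap_rec[OF gdt]) (simp add: elts_below)
  then show ?thesis by (subst rec_def[OF g_def]) simp
 qed
 have gin: "g a : X - g ` elts a" if "X - g ` elts a ~= {}" for a
 proof -
  have "small (X - g ` elts a)" by (intro small_Diff assms small_image gdt small_elts)
  then show ?thesis using ch2[of "mk (X - g ` elts a)"] that by (subst g) simp
 qed
 have "EX a. Or a & X - g ` elts a = {}"
 proof (rule ccontr)
  assume "~ ?thesis"
  then have n: "!!a. Or a ==> g a : X - g ` elts a" using gin by blast
  have inj: "a = b" if "Or a" "Or b" "g a = g b" for a b
   using Ord_linear[OF that(1,2)]
  proof (elim disjE)
   assume "a : elts b" then have "g a : g ` elts b" by (rule imageI)
   then show ?thesis using n[OF that(2)] unfolding that(3) by blast
  next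
   assume "b : elts a" then have "g b : g ` elts a" by (rule imageI)
   then show ?thesis using n[OF that(1)] unfolding that(3)[symmetric] by blast
  qed
  have "D (%e. Or (e 1) & g (e 1) = e 0)" by (intro dfn_intros dt_1[OF gdt])
  from collection[OF assms this] obtain Y where Y: "small Y" "ALL x:X. (EX a. Or a & g a = x) --> (EX a:Y. Or a & g a = x)" by (elim exE conjE)
  have w: "a : elts (mk Y)" if a: "Or a" for a
  proof -
   obtain b where "b : Y" "Or b" "g b = g a" using Y(2) n[OF a] a by blast
   with inj[of b a] a show ?thesis using Y(1) by simp
  qed
  let ?w = "mk Y"
  have "rk ?w : elts ?w" using Ord_rk w by blast
  then show False using rk_mem[of "rk ?w" ?w] rk_Ord[OF Ord_rk, of ?w] mem_irrefl by simp
 qed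
 then obtain a where a: "Or a" "X \<subseteq> g ` elts a" by blast
 have d: "D (%e. e 0 = g (e 1))" using gdt by (simp add: dt_def)
 obtain f where f: "F (%e. f (e 0))" "!!x. x : X ==> EX b:elts a. x = g b ==> f x : elts a & x = g (f x)"
  by (rule choice_set[OF assms small_elts d]) (rule that)
 have f2: "!!x. x : X ==> f x : elts a & x = g (f x)" using f(2) a(2) by blast
 have "inj_on f X" by (rule inj_onI) (metis f2)
 then show ?thesis by (rule that[OF a(1) f(1)]) (use f2 in blast)
qed

end

context zfc begin

text \<open>The union, which on a successor among the numbers is the predecessor.\<close>

definition "pd x = mk (UN y:elts x. elts y)"
lemma dt_pd[dfn_intros]: "F t ==> F (%e. pd (t e))" unfolding pd_def by (intro dfn_intros)
lemma pd_num: "pd (num (Suc n)) = num n"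
proof -
 have "(UN y:elts (num (Suc n)). elts y) = elts (num n)"
  using Ord_trans[OF Ord_num] by auto
 then show ?thesis by (simp add: pd_def)
qed
lemma num_below: "num n : below (num (Suc n))" by (rule elts_below) simp

lemma iterate: assumes g: "F (%e. g (e 0))"
 obtains h where "F (%e. h (e 0))" "!!n. h (num n) = (g ^^ n) x0"
proof -
 define h where "h = wfrec (R\<^sup>+) (%f x. if x = zero then x0 else g (ap (mk (graph f (below x))) (pd x)))"
 have h: "F (%e. h (e 0))"
  by (rule recursion[where H="%x f. if x = zero then x0 else g (ap f (pd x))", OF _ rec_def[OF h_def]])
    (intro dfn_intros UNIV_I dt_1[OF g])
 have r: "h x = (if x = zero then x0 else g (ap (mk (graph h (below x))) (pd x)))" for x
  using rec_def[OF h_def] .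
 have "h (num n) = (g ^^ n) x0" for n
 proof (induction n)
  case 0 show ?case by (subst r) simp
 next
  case (Suc n)
  have "num (Suc n) ~= zero" using num_inj[of "Suc n" 0] by simp
  then have "h (num (Suc n)) = g (h (num n))"
   by (subst r) (simp only: if_False pd_num ap_rec[OF h num_below])
  with Suc show ?case by simp
 qed
 with h show ?thesis by (rule that)
qed

abbreviation "ctb X \<equiv> lep X (elts om)"

text \<open>A walk through all pairs of numbers along the finite antidiagonals. Iterating it
  enumerates \<open>\<omega> \<times> \<omega>\<close> by one definable recursion, without ordinal
  arithmetic.\<close>

definition walk :: "nat \<times> nat => nat \<times> nat" where
 "walk p = (if fst p = 0 then (Suc (snd p), 0) else (fst p - 1, Suc (snd p)))"
lemma walk_pow: "k \<le> s ==> (walk ^^ k) (s, 0) = (s - k, k)"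
 by (induction k) (auto simp: walk_def)
lemma walk_surj: "EX n. (walk ^^ n) (0, 0) = (a, b)"
proof -
 have "EX n. (walk ^^ n) (0, 0) = (s, 0)" for s
 proof (induction s)
  case 0 show ?case by (rule exI[of _ 0]) simp
 next
  case (Suc s)
  then obtain n where n: "(walk ^^ n) (0, 0) = (s, 0)" ..
  have "(walk ^^ (s + n)) (0, 0) = (0, s)" unfolding funpow_add comp_apply n using walk_pow[of s s] by simp
  then have "(walk ^^ Suc (s + n)) (0, 0) = (Suc s, 0)" by (simp add: walk_def)
  then show ?case ..
 qed
 then obtain n where n: "(walk ^^ n) (0, 0) = (a + b, 0)" by blast
 have "(walk ^^ (b + n)) (0, 0) = (a, b)" unfolding funpow_add comp_apply n using walk_pow[of b "a + b"] by simp
 then show ?thesis ..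
qed

lemma lep_prod_om: "ctb (prod (elts om) (elts om))"
proof -
 let ?g = "%p. if pfst p = zero then pr (sc (psnd p)) zero else pr (pd (pfst p)) (sc (psnd p))"
 have g: "F (%e. ?g (e 0))" by (intro dfn_intros UNIV_I)
 obtain h where h: "F (%e. h (e 0))" "!!n. h (num n) = (?g ^^ n) (pr zero zero)"
  by (rule iterate[OF g, of "pr zero zero"]) (rule that)
 let ?p = "%q. pr (num (fst q)) (num (snd q))"
 have st: "?g (?p q) = ?p (walk q)" for q
 proof (cases q)
  case (Pair a b)
  show ?thesis
  proof (cases a)
   case 0 then show ?thesis using Pair by (simp add: walk_def)
  next
   case (Suc m)
   then have "num a ~= zero" using num_inj[of a 0] by simp
   then show ?thesis using Pair Suc pd_num[of m] by (simp add: walk_def)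
  qed
 qed
 have w: "(?g ^^ n) (pr zero zero) = ?p ((walk ^^ n) (0, 0))" for n
  by (induction n) (simp_all only: funpow.simps comp_apply st id_apply fst_conv snd_conv num.simps)
 have "prod (elts om) (elts om) \<subseteq> h ` elts om"
 proof
  fix x assume "x : prod (elts om) (elts om)"
  then obtain a b where x: "x = pr (num a) (num b)" by (auto simp: prod_def elts_omega)
  obtain n where "(walk ^^ n) (0, 0) = (a, b)" using walk_surj by blast
  then have "h (num n) = x" unfolding h(2) w x by simp
  then show "x : h ` elts om" by (metis imageI num_in)
 qed
 from lep_mono[OF this lep_image[OF small_elts h(1)] subset_refl] show ?thesis .
qed

lemma lep_prod: assumes "lep X X'" "lep Y Y'" shows "lep (prod X Y) (prod X' Y')"
proof -
 obtain f where f: "F (%e. f (e 0))" "inj_on f X" "f ` X \<subseteq> X'" using assms(1) by (rule lepE)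
 obtain g where g: "F (%e. g (e 0))" "inj_on g Y" "g ` Y \<subseteq> Y'" using assms(2) by (rule lepE)
 have "F (%e. pr (f (pfst (e 0))) (g (psnd (e 0))))" by (intro dfn_intros dt_1[OF f(1)] dt_1[OF g(1)])
 then show ?thesis
  by (rule lepI) (use f(2,3) g(2,3) in \<open>auto simp: prod_def inj_on_def image_subset_iff\<close>)
qed

text \<open>Coding the injection by one set \<open>j\<close> turns \<open>lep\<close> into a
  formula.\<close>

lemma lep_ap: "small X ==> lep X Y \<longleftrightarrow> (EX j. (ALL x:X. ap j x : Y) & (ALL x:X. ALL x':X. ap j x = ap j x' --> x = x'))"
proof
 assume X: "small X" and "lep X Y"
 then obtain f where f: "F (%e. f (e 0))" "inj_on f X" "f ` X \<subseteq> Y" by (elim lepE)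
 have "elts (mk (graph f X)) = graph f X" using small_graph[OF X f(1)] by simp
 then have "!!x. x : X ==> ap (mk (graph f X)) x = f x" by (rule ap_graph)
 with f show "EX j. (ALL x:X. ap j x : Y) & (ALL x:X. ALL x':X. ap j x = ap j x' --> x = x')"
  by (intro exI[of _ "mk (graph f X)"]) (auto simp: inj_on_def)
next
 assume "EX j. (ALL x:X. ap j x : Y) & (ALL x:X. ALL x':X. ap j x = ap j x' --> x = x')"
 then obtain j where j: "ALL x:X. ap j x : Y" "ALL x:X. ALL x':X. ap j x = ap j x' --> x = x'" by blast
 have "F (%e. ap j (e 0))" by (intro dfn_intros UNIV_I)
 then show "lep X Y" by (rule lepI) (use j in \<open>auto simp: inj_on_def\<close>)
qed

lemma D_lep[dfn_intros]: "F s ==> F t ==> D (%e. lep (elts (s e)) (elts (t e)))"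
 by (rule dfn_rel2[where R="%x y. lep (elts x) (elts y)"], unfold lep_ap[OF small_elts], intro dfn_intros UNIV_I)

lemma lep_UN: assumes X: "small X" and f: "F (%e. f (e 0))" and k: "!!x. x : X ==> lep (elts (f x)) (elts k)"
 shows "lep (UN x:X. elts (f x)) (prod X (elts k))"
proof -
 let ?Q = "%x j. (ALL y:elts (f x). ap j y : elts k) & (ALL y:elts (f x). ALL y':elts (f x). ap j y = ap j y' --> y = y')"
 have Q: "D (%e. ?Q (e 0) (e 1))" by (intro dfn_intros UNIV_I dt_1[OF f])
 obtain J where J: "F (%e. J (e 0))" and J1: "!!x y. x : X ==> ?Q x y ==> ?Q x (J x)"
  by (rule choice[OF X Q]) (rule that)
 have J2: "?Q x (J x)" if x: "x : X" for x
 proof -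
  obtain j where "?Q x j" using k[OF x] unfolding lep_ap[OF small_elts] by (rule exE)
  then show ?thesis by (rule J1[OF x])
 qed
 let ?U = "UN x:X. elts (f x)"
 have U: "small ?U" by (rule small_UN[OF X f])
 have d: "D (%e. e 0 : elts (f (e 1)))" by (intro dfn_intros dt_1[OF f])
 obtain c where c: "F (%e. c (e 0))" and c1: "!!y. y : ?U ==> EX x:X. y : elts (f x) ==> c y : X & y : elts (f (c y))"
  by (rule choice_set[OF U X d]) (rule that)
 have c2: "!!y. y : ?U ==> c y : X & y : elts (f (c y))" using c1 by blast
 have "F (%e. pr (c (e 0)) (ap (J (c (e 0))) (e 0)))"
  by (intro dfn_intros dt_1[OF c] dt_1[OF J])
 then show ?thesis
 proof (rule lepI)
  show "inj_on (%y. pr (c y) (ap (J (c y)) y)) ?U"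
  proof (rule inj_onI)
   fix y y' assume y: "y : ?U" "y' : ?U" and e0: "pr (c y) (ap (J (c y)) y) = pr (c y') (ap (J (c y')) y')"
   from e0 have e: "c y = c y'" by simp
   from e0[unfolded e] have e: "c y = c y'" "ap (J (c y)) y = ap (J (c y)) y'" using e by simp_all
   show "y = y'" using J2[of "c y"] c2[OF y(1)] c2[OF y(2)] e by simp
  qed
  show "(%y. pr (c y) (ap (J (c y)) y)) ` ?U \<subseteq> prod X (elts k)"
  proof (rule image_subsetI)
   fix y assume y: "y : ?U"
   show "pr (c y) (ap (J (c y)) y) : prod X (elts k)" using J2[of "c y"] c2[OF y] by simp
  qed
 qed
qed

lemma ctb_UN: assumes "small X" "F (%e. f (e 0))" "ctb X" "!!x. x : X ==> ctb (elts (f x))" shows "ctb (UN x:X. elts (f x))"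
 by (rule lep_trans[OF lep_UN[OF assms(1,2,4)]], assumption) (rule lep_trans[OF lep_prod[OF assms(3) lep_id[OF subset_refl]] lep_prod_om])

lemma ctb_image: "small X ==> F (%e. f (e 0)) ==> ctb X ==> ctb (f ` X)"
 using lep_image lep_trans by blast
lemma ctb_Un: assumes "small X" "small Y" "ctb X" "ctb Y" shows "ctb (X \<union> Y)"
proof -
 have f: "F (%e. if e 0 = zero then mk X else mk Y)" by (intro dfn_intros UNIV_I ds_small assms)
 have z: "num 1 ~= zero" using num_inj[of 1 0] by simp
 have "ctb {num 0, num 1}" by (rule lep_id) (simp add: elts_omega del: num.simps)
 from ctb_UN[OF _ f this] have "ctb (UN x:{num 0, num 1}. elts (if x = zero then mk X else mk Y))"
  using assms by simp
 then show ?thesis using z assms by simp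
qed
lemma ctb_finite: "finite X ==> ctb X"
proof (induction rule: finite_induct)
 case empty show ?case by (rule lep_id) simp
next
 case (insert x X)
 have "F (%e. x)" by (intro dfn_intros UNIV_I)
 from ctb_image[OF small_single[of zero] this] have "ctb {x}" using lep_id[of "{zero}" "elts om"] num_in[of 0] by simp
 from ctb_Un[OF small_single small_finite[OF insert(1)] this insert(3)] show ?case by simp
qed

text \<open>The number argument packs countably many binary operations into the single definable
  \<open>g\<close>, so one iteration along \<open>\<omega>\<close> closes under all of them.\<close>

lemma countable_closure: assumes Y0: "small Y0" "ctb Y0" and g: "F (%e. g (e 0) (e 1) (e 2))"
 obtains Y where "small Y" "ctb Y" "Y0 \<subseteq> Y" "!!n x y. x : Y ==> y : Y ==> g (num n) x y : Y"
proof -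
 let ?q = "%p. g (pfst p) (pfst (psnd p)) (psnd (psnd p))"
 have q: "F (%e. ?q (e 0))" by (rule dt_3[OF g]) (intro dfn_intros)+
 let ?im = "%Z. ?q ` prod (elts om) (prod Z Z)"
 have sim: "small (?im (elts Z))" for Z by (intro small_image small_prod small_elts q)
 let ?st = "%Z. mk (elts Z \<union> ?im (elts Z))"
 have est: "elts (?st Z) = elts Z \<union> ?im (elts Z)" for Z using sim[of Z] by (simp add: small_Un)
 have dst: "F (%e. ?st (e 0))" unfolding prod_def
  by (intro dfn_intros UNIV_I dt_1[OF q])
 obtain h where h: "F (%e. h (e 0))" "!!n. h (num n) = (?st ^^ n) (mk Y0)"
  by (rule iterate[OF dst, of "mk Y0"]) (rule that)
 have hS: "elts (h (num (Suc n))) = elts (h (num n)) \<union> ?im (elts (h (num n)))" for n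
  unfolding h(2) funpow.simps comp_apply est ..
 have ct: "ctb (elts (h (num n)))" for n
 proof (induction n)
  case 0 show ?case unfolding h(2) using Y0 by simp
 next
  case (Suc n)
  have "ctb (prod (elts om) (prod (elts (h (num n))) (elts (h (num n)))))"
   by (rule lep_trans[OF lep_prod[OF lep_id[OF subset_refl] lep_trans[OF lep_prod[OF Suc Suc] lep_prod_om]] lep_prod_om])
  from ctb_image[OF _ q this] have "ctb (?im (elts (h (num n))))" by (simp add: small_prod)
  from ctb_Un[OF small_elts sim Suc this] show ?case unfolding hS .
 qed
 let ?Y = "UN n:elts om. elts (h n)"
 have mono: "elts (h (num n)) \<subseteq> elts (h (num (n + k)))" for n k
  by (induction k) (use hS in auto)
 show ?thesis
 proof (rule that[of ?Y])
  show "small ?Y" by (rule small_UN[OF small_elts h(1)])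
  show "ctb ?Y" by (rule ctb_UN[OF small_elts h(1) lep_id[OF subset_refl]]) (use ct in \<open>auto simp: elts_omega\<close>)
  have "elts (h (num 0)) = Y0" unfolding h(2) using Y0 by simp
  then show "Y0 \<subseteq> ?Y" using num_in[of 0] by blast
  fix n x y assume "x : ?Y" "y : ?Y"
  then obtain a b where ab: "x : elts (h (num a))" "y : elts (h (num b))" by (auto simp: elts_omega)
  have x: "x : elts (h (num (a + b)))" using ab(1) mono[of a b] by blast
  have y: "y : elts (h (num (a + b)))" using ab(2) mono[of b a] by (auto simp: add.commute)
  have "?q (pr (num n) (pr x y)) : ?im (elts (h (num (a + b))))" by (rule imageI) (use x y in simp)
  then have "g (num n) x y : elts (h (num (Suc (a + b))))" unfolding hS by simp
  then show "g (num n) x y : ?Y" using num_in by blast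
 qed
qed

end

section \<open>Inaccessible cardinals\<close>

locale inacc = zfc + fixes th assumes inac: "inaccessible elts th"
begin

lemma Oth: "Or th" and omth: "om : elts th" and cofth: "cof elts th = th"
 and strong0: "ka : elts th ==> EX mu:elts th. injects elts (mk {x. elts x \<subseteq> elts ka}) mu"
 using inac unfolding inaccessible_def by simp_all

lemma th_trans: "x : elts y ==> y : elts th ==> x : elts th" by (rule Ord_trans[OF Oth])
lemma th_Or: "x : elts th ==> Or x" by (rule Ord_mem[OF Oth])
lemma numth: "num n : elts th" by (rule th_trans[OF num_in omth])

end

context zfc begin

definition cofm :: "'a => 'a => bool" where
 "cofm al be \<longleftrightarrow> (EX f G. is_graph elts f be G & G ` elts be \<subseteq> elts al &
   (ALL x:elts al. EX y:elts be. x = G y | x : elts (G y)))"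

lemma cofmI: assumes f: "F (%e. f (e 0))" "f ` elts be \<subseteq> elts al" "!!x. x : elts al ==> EX y:elts be. x = f y | x : elts (f y)" shows "cofm al be"
proof -
 have "is_graph elts (mk (graph f (elts be))) be f"
  unfolding is_graph_def using elts_mk[OF small_graph[OF small_elts f(1)]] by (simp add: graph_def)
 with assms show ?thesis unfolding cofm_def by blast
qed

lemma cof_cofm: "cof elts al = least_ord elts (cofm al)"
 unfolding cof_def cofm_def ..

lemma cof_min: assumes "Or be" "cofm al be" shows "cof elts al = be | cof elts al : elts be"
 using least_ord[of be "cofm al", OF assms] unfolding cof_cofm by simp

lemma cof_cofm2: assumes "Or al" shows "Or (cof elts al) & cofm al (cof elts al)"
proof -
 have "cofm al al" by (rule cofmI[of "%x. x"]) (auto intro: dt_var)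
 from least_ord[of al "cofm al", OF assms this] show ?thesis unfolding cof_cofm by simp
qed

end

context inacc begin

lemma reg0: assumes "be : elts th" "F (%e. f (e 0))" "f ` elts be \<subseteq> elts th" shows "EX ga:elts th. f ` elts be \<subseteq> elts ga"
proof (rule ccontr)
 assume n: "~ ?thesis"
 have "cofm th be"
 proof (rule cofmI[OF assms(2,3)])
  fix x assume x: "x : elts th"
  then obtain y where y: "y : elts be" "f y ~: elts x" using n by blast
  then show "EX y:elts be. x = f y | x : elts (f y)"
   using Ord_linear[OF th_Or[OF x] th_Or[of "f y"]] assms(3) by blast
 qed
 from cof_min[OF th_Or[OF assms(1)] this] show False
  unfolding cofth using assms(1) mem_irrefl th_trans by blast
qed

lemma th_sc: assumes "be : elts th" shows "sc be : elts th"
proof -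
 have "F (%e. be)" by (intro dfn_intros UNIV_I)
 from reg0[OF numth[of 1] this] obtain ga where g: "ga : elts th" "be : elts ga" using assms by auto
 then have "elts (sc be) \<subseteq> elts ga" using Ord_trans[OF th_Or[OF g(1)]] by auto
 then have "sc be = ga | sc be : elts ga" using Ord_subset[OF Ord_sc th_Or[OF g(1)]] th_Or[OF assms] by blast
 then show ?thesis using g(1) th_trans by blast
qed

definition "tiny X \<longleftrightarrow> (EX mu:elts th. lep X (elts mu))"

lemma tiny_lep: "lep X Y ==> tiny Y ==> tiny X" unfolding tiny_def using lep_trans by blast
lemma tiny_sub: "X \<subseteq> Y ==> tiny Y ==> tiny X" using tiny_lep[OF lep_id] .
lemma tiny_mem: "mu : elts th ==> tiny (elts mu)" unfolding tiny_def using lep_id by blast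
lemma tiny_ctb: "ctb X ==> tiny X" using tiny_lep[OF _ tiny_mem[OF omth]] .

lemma reg: assumes X: "small X" "tiny X" and f: "F (%e. f (e 0))" "f ` X \<subseteq> elts th" shows "EX ga:elts th. f ` X \<subseteq> elts ga"
proof -
 obtain mu where m: "mu : elts th" "lep X (elts mu)" using X(2) unfolding tiny_def by blast
 obtain j where j: "F (%e. j (e 0))" "inj_on j X" "j ` X \<subseteq> elts mu" using m(2) by (rule lepE)
 have d: "D (%e. j (e 1) = e 0)" by (intro dfn_intros dt_1[OF j(1)])
 obtain g where g: "F (%e. g (e 0))" and g1: "!!b. b : elts mu ==> EX x:X. j x = b ==> g b : X & j (g b) = b"
  by (rule choice_set[OF small_elts X(1), of "%b x. j x = b" mu, OF d]) (rule that)
 \<comment> \<open>The family indexed by \<open>X\<close> is pulled back to the ordinal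
   \<open>mu\<close> along an inverse of the injection, with \<open>zero\<close> as the value where
   the inverse does not land in \<open>X\<close>.\<close>
 let ?h = "%b. if g b : X then f (g b) else zero"
 have h: "F (%e. ?h (e 0))" by (intro dfn_intros dt_1[OF f(1)] dt_1[OF g] ds_small[OF X(1)] UNIV_I)
 have "?h ` elts mu \<subseteq> elts th" using f(2) numth[of 0] by auto
 from reg0[OF m(1) h this] obtain ga where g2: "ga : elts th" "?h ` elts mu \<subseteq> elts ga" by blast
 have "f x : elts ga" if x: "x : X" for x
 proof -
  have jx: "j x : elts mu" using j(3) x by blast
  have "g (j x) : X & j (g (j x)) = j x" using g1[OF jx] x by blast
  then have "g (j x) = x" using inj_onD[OF j(2)] x by blast
  then have e: "?h (j x) = f x" using x by simp
  have "?h (j x) : ?h ` elts mu" using jx by (rule imageI)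
  from subsetD[OF g2(2) this] show ?thesis unfolding e .
 qed
 with g2(1) show ?thesis by blast
qed

lemma tiny_Pow: assumes X: "small X" "tiny X" shows "tiny {y. elts y \<subseteq> X}"
proof -
 obtain mu where m: "mu : elts th" "lep X (elts mu)" using X(2) unfolding tiny_def by blast
 obtain j where j: "F (%e. j (e 0))" "inj_on j X" "j ` X \<subseteq> elts mu" using m(2) by (rule lepE)
 have J: "F (%e. mk (j ` elts (e 0)))" by (intro dfn_intros dt_1[OF j(1)])
 have e: "elts (mk (j ` elts y)) = j ` elts y" for y using small_image[OF small_elts j(1)] by simp
 have "lep {y. elts y \<subseteq> X} {y. elts y \<subseteq> elts mu}"
 proof (rule lepI[OF J])
  show "inj_on (%y. mk (j ` elts y)) {y. elts y \<subseteq> X}"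
  proof (rule inj_onI, unfold mem_Collect_eq)
   fix y y' assume y: "elts y \<subseteq> X" "elts y' \<subseteq> X" "mk (j ` elts y) = mk (j ` elts y')"
   then have "j ` elts y = j ` elts y'" using e by metis
   then have "elts y = elts y'" using inj_on_image_eq_iff[OF j(2) y(1,2)] by simp
   then show "y = y'" by simp
  qed
  show "(%y. mk (j ` elts y)) ` {y. elts y \<subseteq> X} \<subseteq> {y. elts y \<subseteq> elts mu}" using e j(3) by fastforce
 qed
 moreover have "tiny {y. elts y \<subseteq> elts mu}"
  using strong0[OF m(1)] unfolding tiny_def injects_lep by (simp add: small_Pow)
 ultimately show ?thesis by (rule tiny_lep)
qed

text \<open>Pairs over a common bound \<open>d\<close> belong to the second power set of
  \<open>d\<close>, so that strong limitness suffices.\<close>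

lemma tiny_prod: assumes "a : elts th" "b : elts th" shows "tiny (prod (elts a) (elts b))"
proof -
 obtain d where d: "d : elts th" "elts a \<subseteq> elts d" "elts b \<subseteq> elts d"
  using Ord_linear[OF th_Or[OF assms(1)] th_Or[OF assms(2)]] assms Ord_trans[OF th_Or[OF assms(1)]] Ord_trans[OF th_Or[OF assms(2)]] by blast
 have "tiny {z. elts z \<subseteq> {w. elts w \<subseteq> elts d}}"
  by (intro tiny_Pow small_Pow small_elts tiny_mem d(1))
 moreover have "prod (elts a) (elts b) \<subseteq> {z. elts z \<subseteq> {w. elts w \<subseteq> elts d}}"
  using subsetD[OF d(2)] subsetD[OF d(3)] pr_in by (auto simp: prod_def)
 ultimately show ?thesis by (rule tiny_sub[rotated])
qed

abbreviation "Vth \<equiv> elts (Vs th)"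

text \<open>By induction the power sets of the lower levels have sizes below
  \<open>\<theta>\<close>. Regularity bounds these sizes by one \<open>k\<close>, and a union of
  \<open>a\<close> many sets of size at most \<open>k\<close> embeds into a product that is small by
  \<open>tiny_prod\<close>.\<close>

lemma tiny_Vs: "a : elts th ==> tiny (elts (Vs a))"
proof (induction a rule: wf_induct_rule[OF wfR])
 case (1 a)
 let ?Q = "%b m. m : elts th & lep (elts (mk {y. elts y \<subseteq> elts (Vs b)})) (elts m)"
 have Q: "D (%e. ?Q (e 0) (e 1))" by (intro dfn_intros UNIV_I)
 obtain f where f: "F (%e. f (e 0))" and f1: "!!b m. b : elts a ==> ?Q b m ==> ?Q b (f b)"
  by (rule choice[OF small_elts Q]) (rule that)
 have f2: "?Q b (f b)" if b: "b : elts a" for b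
 proof -
  have "tiny (elts (Vs b))" using 1(1)[of b] b th_trans[OF b 1(2)] by (simp add: R_iff)
  then have "tiny {y. elts y \<subseteq> elts (Vs b)}" by (intro tiny_Pow small_elts)
  then obtain m where "?Q b m" unfolding tiny_def by (auto simp: small_Pow)
  then show ?thesis by (rule f1[OF b])
 qed
 then have "f ` elts a \<subseteq> elts th" by blast
 from reg0[OF 1(2) f this] obtain k where k: "k : elts th" "f ` elts a \<subseteq> elts k" by blast
 have P: "F (%e. mk {y. elts y \<subseteq> elts (Vs (e 0))})" by (intro dfn_intros)
 have "lep (UN b:elts a. elts (mk {y. elts y \<subseteq> elts (Vs b)})) (prod (elts a) (elts k))"
 proof (rule lep_UN[OF small_elts P])
  fix b assume b: "b : elts a"
  have "elts (f b) \<subseteq> elts k" using k b Ord_trans[OF th_Or[OF k(1)]] by blast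
  then show "lep (elts (mk {y. elts y \<subseteq> elts (Vs b)})) (elts k)" using f2[OF b] lep_mono by blast
 qed
 then have "lep (elts (Vs a)) (prod (elts a) (elts k))" by (subst elts_Vs) (simp add: small_Pow)
 then show ?case using tiny_prod[OF 1(2) k(1)] by (rule tiny_lep)
qed

lemma Vth_iff: "x : Vth \<longleftrightarrow> rk x : elts th" by (rule Vs_iff[OF Oth])
lemma Vth_trans: "x : Vth ==> elts x \<subseteq> Vth" by (rule Vs_trans[OF Oth])
lemma Vth_sub: "x : Vth ==> elts y \<subseteq> elts x ==> y : Vth" by (rule Vs_sub[OF Oth])
lemma Vth_Vs: "a : elts th ==> Vs a : Vth" using Vs_mono[OF Oth] by blast
lemma Vth_lev: "x : Vth ==> EX a:elts th. x : elts (Vs a)"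
 using in_Vs_rk[of x] th_sc Vth_iff by blast
lemma tiny_Vth: "x : Vth ==> tiny (elts x)"
 by (drule Vth_lev, elim bexE) (rule tiny_sub[OF Vs_trans[OF th_Or] tiny_Vs])
lemma thVth: "a : elts th ==> a : Vth" using Vth_iff[of a] rk_Ord[OF th_Or, of a] by metis

lemma Vth_mk: assumes X: "small X" "tiny X" "X \<subseteq> Vth" shows "mk X : Vth"
proof -
 have "rk ` X \<subseteq> elts th" using X(3) Vth_iff by blast
 from reg[OF X(1,2) dt_rk0 this] obtain g where g: "g : elts th" "rk ` X \<subseteq> elts g" by blast
 have "elts (rk (mk X)) \<subseteq> elts g" by (rule rk_least[OF th_Or[OF g(1)]]) (use g(2) X(1) in auto)
 then have "rk (mk X) = g | rk (mk X) : elts g" using Ord_subset[OF Ord_rk th_Or[OF g(1)]] by blast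
 then show ?thesis using g(1) th_trans Vth_iff by blast
qed
lemma Vth_finite: "finite X ==> X \<subseteq> Vth ==> mk X : Vth"
 by (rule Vth_mk) (auto intro: small_finite tiny_ctb ctb_finite)
lemma Vth_pr: "pr x y : Vth \<longleftrightarrow> x : Vth & y : Vth"
proof
 assume "pr x y : Vth"
 from Vth_trans[OF this] have "mk {x, y} : Vth" using pr_in[of x y] by simp
 from Vth_trans[OF this] show "x : Vth & y : Vth" by simp
next
 assume "x : Vth & y : Vth" then show "pr x y : Vth" unfolding opair_def by (intro Vth_finite) (simp_all add: Vth_finite)
qed
lemma Vth_rk: "elts y \<subseteq> Vth ==> tiny (elts y) ==> y : Vth"
 using Vth_mk[of "elts y"] by simp

lemma th_not_lep: "a : elts th ==> ~ lep (elts th) (elts a)"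
proof
 assume "a : elts th" "lep (elts th) (elts a)"
 then have "tiny (elts th)" unfolding tiny_def by blast
 from reg[OF small_elts this dt_var[of 0]] obtain g where "g : elts th" "elts th \<subseteq> elts g" by auto
 then show False using mem_irrefl by blast
qed

abbreviation "om1 \<equiv> omega1 elts"

text \<open>The value \<open>\<theta>\<close> is excluded because the power set of
  \<open>\<omega>\<close> embeds into an ordinal below \<open>\<theta>\<close>, and by Cantor that
  ordinal is uncountable.\<close>

lemma om1_props: "Or om1 & ~ ctb (elts om1) & (ALL b:elts om1. ctb (elts b)) & om1 : elts th"
proof -
 have e1: "om1 = least_ord elts (%al. ~ ctb (elts al))" unfolding omega1_def injects_lep ..
 have "~ ctb (elts th)" by (rule th_not_lep[OF omth])
 from least_ord[of th "%al. ~ ctb (elts al)", OF Oth this]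
 have l: "Or om1" "~ ctb (elts om1)" "ALL b:elts om1. ctb (elts b)" "om1 = th | om1 : elts th"
  unfolding e1 by simp_all
 have "om1 ~= th"
 proof
  assume e: "om1 = th"
  obtain m where m: "m : elts th" "lep {x. elts x \<subseteq> elts om} (elts m)"
   using strong0[OF omth] unfolding injects_lep by (auto simp: small_Pow)
  have "ctb (elts m)" using l(3) m(1) e by simp
  from lep_trans[OF m(2) this] show False using not_lep_Pow[OF small_elts] by blast
 qed
 with l show ?thesis by simp
qed
lemma O1: "Or om1" and n1: "~ ctb (elts om1)" and om1th: "om1 : elts th" using om1_props by simp_all
lemma om1_iff: "a : elts om1 \<longleftrightarrow> Or a & ctb (elts a)"
proof
 assume "Or a & ctb (elts a)"
 then show "a : elts om1" using Ord_not_mem[of a om1] O1 n1 lep_mono[of "elts om1" "elts a"] by blast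
qed (use om1_props Ord_mem in blast)
lemma om1_sup: assumes "small X" "ctb X" "X \<subseteq> elts om1" shows "mk (\<Union>(elts ` X)) : elts om1"
proof -
 have "ctb (UN x:X. elts x)" by (rule ctb_UN[OF assms(1) dt_var assms(2)]) (use assms(3) om1_iff in blast)
 moreover have "Or (mk (\<Union>(elts ` X)))" by (rule Ord_Union[OF assms(1)]) (use assms(3) Ord_mem[OF O1] in blast)
 ultimately show ?thesis unfolding om1_iff using small_Union[OF assms(1)] by simp
qed

end

section \<open>Elementary submodels\<close>

primrec fb :: "fm => nat" where
 "fb (Mem i j) = Suc (max i j)" | "fb (Eq i j) = Suc (max i j)" | "fb (Neg ph) = fb ph"
| "fb (Conj ph ps) = max (fb ph) (fb ps)" | "fb (All ph) = fb ph"

lemma sat_fb: "(!!n. n < fb ph ==> e n = e' n) ==> sat E A e ph = sat E A e' ph"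
proof (induction ph arbitrary: e e')
 case (Conj ph ps)
 have "sat E A e ph = sat E A e' ph" "sat E A e ps = sat E A e' ps"
  by (rule Conj.IH, rule Conj.prems, simp)+
 then show ?case by simp
next
 case (All ph)
 have "sat E A (case_nat x e) ph = sat E A (case_nat x e') ph" for x
  by (rule All.IH) (use All.prems in \<open>simp split: nat.split\<close>)
 then show ?case by simp
next
 case (Neg ph)
 have "sat E A e ph = sat E A e' ph" by (rule Neg.IH, rule Neg.prems, simp)
 then show ?case by simp
qed simp_all

lemma tarski_vaught: assumes MN: "M \<subseteq> N"
 and tv: "!!ph e. range e \<subseteq> M ==> EX x:N. sat E N (case_nat x e) ph ==> EX x:M. sat E N (case_nat x e) ph"
 shows "range e \<subseteq> M ==> sat E M e ph = sat E N e ph"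
proof (induction ph arbitrary: e)
 case (All ph)
 have "sat E M (case_nat x e) ph = sat E N (case_nat x e) ph" if "x : M" for x
  by (rule All.IH[OF range_case_nat[OF that All.prems]])
 moreover have "EX x:N. sat E N (case_nat x e) (Neg ph) ==> EX x:M. sat E N (case_nat x e) (Neg ph)"
  by (rule tv[OF All.prems])
 ultimately show ?case using MN by auto
qed simp_all

context zfc begin

lemma ap_unique: "pr x y : elts f ==> (!!y'. pr x y' : elts f ==> y' = y) ==> ap f x = y"
 unfolding ap_def by (rule mksetI) blast

text \<open>Assignments are coded as sets of pairs indexed by \<open>\<omega>\<close>:
  \<open>cons x s\<close> pushes \<open>s\<close> back by one slot and \<open>Kc x\<close> is
  constant. Eventually constant sequences play the part of finite ones, so one domain serves all
  formulas.\<close>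

definition "cons x s = mk (insert (pr zero x) ((%n. pr (sc n) (ap s n)) ` elts om))"
definition "Kc x = mk ((%n. pr n x) ` elts om)"
lemma dt_cons[dfn_intros]: "F s ==> F t ==> F (%e. cons (s e) (t e))"
 by (rule dt_2[where f=cons]) (unfold cons_def, intro dfn_intros UNIV_I)
lemma dt_Kc[dfn_intros]: "F s ==> F (%e. Kc (s e))"
 by (rule dt_1[where f=Kc]) (unfold Kc_def, intro dfn_intros UNIV_I)

lemma elts_cons: "elts (cons x s) = insert (pr zero x) ((%n. pr (sc n) (ap s n)) ` elts om)"
proof -
 have "F (%e. pr (sc (e 0)) (ap s (e 0)))" by (intro dfn_intros UNIV_I)
 from small_image[OF small_elts this] show ?thesis unfolding cons_def by (simp add: small_insert)
qed
lemma elts_Kc: "elts (Kc x) = (%n. pr n x) ` elts om"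
proof -
 have "F (%e. pr (e 0) x)" by (intro dfn_intros UNIV_I)
 from small_image[OF small_elts this] show ?thesis unfolding Kc_def by simp
qed

definition evn :: "'a => nat => 'a" where "evn s i = ap s (num i)"

lemma evn_Kc: "evn (Kc x) = (%_. x)"
 unfolding evn_def by (intro ext ap_unique) (auto simp: elts_Kc)

lemma evn_cons: "evn (cons x s) = case_nat x (evn s)"
proof
 fix i
 have z: "zero ~= sc n" for n by (metis elts_sc elts_zero insert_not_empty)
 have i: "sc (num a) = sc (num b) \<longleftrightarrow> a = b" for a b using num_inj[of "Suc a" "Suc b"] by simp
 show "evn (cons x s) i = case_nat x (evn s) i"
 proof (cases i)
  case 0
  have "ap (cons x s) zero = x" by (rule ap_unique) (auto simp: elts_cons z)
  with 0 show ?thesis by (simp add: evn_def)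
 next
  case (Suc j)
  have "ap (cons x s) (sc (num j)) = ap s (num j)"
   by (rule ap_unique) (auto simp: elts_cons elts_omega z[symmetric] i)
  with Suc show ?thesis by (simp add: evn_def)
 qed
qed

text \<open>The assignment frozen from slot \<open>k\<close> on. It is built from finitely many
  values by \<open>cons\<close> and \<open>Kc\<close>, hence stays inside every submodel closed
  under these two.\<close>

primrec sq :: "(nat => 'a) => nat => 'a" where
 "sq e 0 = Kc (e 0)" | "sq e (Suc k) = cons (e 0) (sq (%n. e (Suc n)) k)"

lemma evn_sq: "evn (sq e k) n = e (min n k)"
proof (induction k arbitrary: e n)
 case (Suc k) then show ?case by (cases n) (simp_all add: evn_cons)
qed (simp add: evn_Kc)

definition En :: "'a => 'a set" where
 "En n = {s. elts s \<subseteq> prod (elts om) (elts n) & (ALL k:elts om. ap s k : elts n)}"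

lemma small_En: "small (En n)"
proof -
 have "small {s. elts s \<subseteq> prod (elts om) (elts n)}" by (intro small_Pow small_prod small_elts)
 moreover have "D (%e. ALL k:elts om. ap (e 0) k : elts n)" by (intro dfn_intros UNIV_I)
 ultimately have "small {s:{s. elts s \<subseteq> prod (elts om) (elts n)}. ALL k:elts om. ap s k : elts n}" by (rule small_sep)
 then show ?thesis unfolding En_def mem_Collect_eq .
qed

lemma En_evn: "s : En n ==> range (evn s) \<subseteq> elts n" by (auto simp: En_def evn_def)
lemma Kc_En: "x : elts n ==> Kc x : En n"
 using fun_cong[OF evn_Kc[of x]] by (auto simp: En_def elts_Kc elts_omega evn_def)
lemma cons_En: "x : elts n ==> s : En n ==> cons x s : En n"
proof -
 assume a: "x : elts n" "s : En n"
 have "ap (cons x s) (num i) : elts n" for i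
  using fun_cong[OF evn_cons[of x s], of i] a En_evn[OF a(2)] by (auto simp: evn_def split: nat.splits)
 moreover have "sc k : elts om" if "k : elts om" for k using that num_in by (auto simp: elts_omega) (metis num.simps(2) rangeI)
 moreover have "zero : elts om" using num_in[of 0] by simp
 ultimately show ?thesis using a by (auto simp: En_def elts_cons) (auto simp: elts_omega)
qed
lemma sq_En: "range e \<subseteq> elts n ==> sq e k : En n"
proof (induction k arbitrary: e)
 case 0 then show ?case by (auto intro!: Kc_En)
next
 case (Suc k)
 have "range (%n. e (Suc n)) \<subseteq> elts n" using Suc(2) by auto
 from Suc(1)[OF this] show ?case using Suc(2) by (auto intro!: cons_En)
qed

text \<open>One recursion step of an internal satisfaction predicate: \<open>g\<close> holds the
  satisfaction sets of smaller codes, and the tags 0 to 4 stand for the constructors of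
  \<open>fm\<close>. Anything of another form is satisfied by no assignment.\<close>

definition Hs :: "'a => 'a => 'a => 'a" where
 "Hs n c g = mk {s:En n. (EX i:elts om. EX j:elts om. c = pr (num 0) (pr i j) & ap s i : elts (ap s j)) |
   (EX i:elts om. EX j:elts om. c = pr (num 1) (pr i j) & ap s i = ap s j) |
   (EX b. c = pr (num 2) b & s ~: elts (ap g b)) |
   (EX a b. c = pr (num 3) (pr a b) & s : elts (ap g a) & s : elts (ap g b)) |
   (EX b. c = pr (num 4) b & (ALL x:elts n. cons x s : elts (ap g b)))}"

definition Sat :: "'a => 'a => 'a" where
 "Sat n = wfrec (R\<^sup>+) (%f c. Hs n c (mk (graph f (below c))))"

lemma dt_Sat0: "F (%e. Sat n (e 0))"
 by (rule recursion[where H="Hs n", OF _ rec_def[OF Sat_def]])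
   (unfold Hs_def, intro dfn_intros UNIV_I ds_small[OF small_En])
lemma dt_Sat[dfn_intros]: "F t ==> F (%e. Sat n (t e))" by (rule dt_1[OF dt_Sat0])

lemma below_pr: "a : below (pr a b)" "b : below (pr a b)"
proof -
 have "mk {a, b} : elts (pr a b)" "a : elts (mk {a, b})" "b : elts (mk {a, b})" using pr_in[of a b] by auto
 then show "a : below (pr a b)" "b : below (pr a b)"
  unfolding below_def mem_Collect_eq by (meson elts_Rp trancl_trans)+
qed
lemma below_tr: "a : below b ==> b : below c ==> a : below c" unfolding below_def by (auto intro: trancl_trans)

lemma Sat: "s : elts (Sat n c) \<longleftrightarrow> s : En n & ((EX i:elts om. EX j:elts om. c = pr (num 0) (pr i j) & ap s i : elts (ap s j)) |
   (EX i:elts om. EX j:elts om. c = pr (num 1) (pr i j) & ap s i = ap s j) |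
   (EX b. c = pr (num 2) b & s ~: elts (Sat n b)) |
   (EX a b. c = pr (num 3) (pr a b) & s : elts (Sat n a) & s : elts (Sat n b)) |
   (EX b. c = pr (num 4) b & (ALL x:elts n. cons x s : elts (Sat n b))))" (is "_ \<longleftrightarrow> s : En n & ?P s")
proof -
 let ?g = "mk (graph (Sat n) (below c))"
 have g1: "c = pr k b ==> ap ?g b = Sat n b" for k b by (rule ap_rec[OF dt_Sat0]) (simp add: below_pr)
 have g2: "c = pr k (pr a b) ==> ap ?g a = Sat n a" "c = pr k (pr a b) ==> ap ?g b = Sat n b" for k a b
  by (rule ap_rec[OF dt_Sat0], use below_tr[OF below_pr(1) below_pr(2)] below_tr[OF below_pr(2) below_pr(2)] in blast)+
 have "Sat n c = Hs n c ?g" by (rule rec_def[OF Sat_def])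
 also have "\<dots> = mk {s:En n. ?P s}" unfolding Hs_def
  by (intro arg_cong[where f=mk] Collect_cong conj_cong refl disj_cong ex_cong1) (use g1 g2 in auto)
 finally have "Sat n c = mk {s:En n. ?P s}" .
 moreover have "small {s:En n. ?P s}"
  by (rule small_sep[OF small_En]) (intro dfn_intros UNIV_I)
 ultimately show ?thesis by simp
qed

primrec code :: "fm => 'a" where
 "code (Mem i j) = pr (num 0) (pr (num i) (num j))"
| "code (Eq i j) = pr (num 1) (pr (num i) (num j))"
| "code (Neg ph) = pr (num 2) (code ph)"
| "code (Conj ph ps) = pr (num 3) (pr (code ph) (code ps))"
| "code (All ph) = pr (num 4) (code ph)"

lemma Sat_code: "s : En n ==> s : elts (Sat n (code ph)) \<longleftrightarrow> sat elts (elts n) (evn s) ph"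
proof (induction ph arbitrary: s)
 case (Mem i j) then show ?case by (subst Sat) (simp add: num_inj evn_def del: num.simps)
next
 case (Eq i j) then show ?case by (subst Sat) (simp add: num_inj evn_def del: num.simps)
next
 case (Neg ph) then show ?case by (subst Sat) (simp add: num_inj del: num.simps)
next
 case (Conj ph ps) then show ?case by (subst Sat) (simp add: num_inj del: num.simps)
next
 case (All ph) then show ?case by (subst Sat) (simp add: num_inj cons_En evn_cons del: num.simps)
qed

text \<open>The code \<open>c\<close> is an arbitrary set. Malformed parts have empty satisfaction
  sets and so act like a false formula; hence quantifying over all \<open>c\<close>, as in
  \<open>elementary_iff\<close>, expresses elementarity for the formulas in \<open>fm\<close> by a
  single first-order formula.\<close>

lemma Sat_formula: "EX ph. ALL s:En n. s : elts (Sat n c) \<longleftrightarrow> sat elts (elts n) (evn s) ph"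
proof (induction c rule: wf_induct_rule[OF wfRp])
 case (1 c)
 have IH: "EX ph. ALL s:En n. s : elts (Sat n b) \<longleftrightarrow> sat elts (elts n) (evn s) ph" if "b : below c" for b
  using 1 that by (simp add: below_def)
 have S: "(EX i j. c = pr (num 0) (pr (num i) (num j))) | (EX i j. c = pr (num 1) (pr (num i) (num j))) |
   (EX b. c = pr (num 2) b) | (EX a b. c = pr (num 3) (pr a b)) | (EX b. c = pr (num 4) b)" if "s : elts (Sat n c)" for s
  using that[unfolded Sat[of s n c]] unfolding elts_omega by blast
 consider i j where "c = pr (num 0) (pr (num i) (num j))" | i j where "c = pr (num 1) (pr (num i) (num j))"
  | b where "c = pr (num 2) b" | a b where "c = pr (num 3) (pr a b)" | b where "c = pr (num 4) b"
  | "!!s. s ~: elts (Sat n c)"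
  using S by blast
 then show ?case
 proof cases
  case (1 i j) then show ?thesis
   by (intro exI[of _ "Mem i j"] ballI) (subst Sat, simp add: num_inj evn_def del: num.simps)
 next
  case (2 i j) then show ?thesis
   by (intro exI[of _ "Eq i j"] ballI) (subst Sat, simp add: num_inj evn_def del: num.simps)
 next
  case (3 b)
  from IH[of b] obtain ph where "ALL s:En n. s : elts (Sat n b) \<longleftrightarrow> sat elts (elts n) (evn s) ph" using 3 below_pr(2)[of b "num 2"] by auto
  with 3 show ?thesis by (intro exI[of _ "Neg ph"] ballI) (subst Sat, simp add: num_inj del: num.simps)
 next
  case (4 a b)
  have ab: "a : below c" "b : below c" using 4 below_tr[OF below_pr(1) below_pr(2)] below_tr[OF below_pr(2) below_pr(2)] by simp_all
  from IH[OF ab(1)] obtain ph where f: "ALL s:En n. s : elts (Sat n a) \<longleftrightarrow> sat elts (elts n) (evn s) ph" ..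
  from IH[OF ab(2)] obtain ps where g: "ALL s:En n. s : elts (Sat n b) \<longleftrightarrow> sat elts (elts n) (evn s) ps" ..
  from f g 4 show ?thesis by (intro exI[of _ "Conj ph ps"] ballI) (subst Sat, simp add: num_inj del: num.simps)
 next
  case (5 b)
  from IH[of b] obtain ph where "ALL s:En n. s : elts (Sat n b) \<longleftrightarrow> sat elts (elts n) (evn s) ph" using 5 below_pr(2)[of b "num 4"] by auto
  with 5 show ?thesis by (intro exI[of _ "All ph"] ballI) (subst Sat, simp add: num_inj cons_En evn_cons del: num.simps)
 next
  case 6 then show ?thesis by (intro exI[of _ "Neg (Eq 0 0)"]) simp
 qed
qed

lemma elementaryI: assumes m: "elts m ~= {}" "elts m \<subseteq> elts n"
 and tv: "!!ph k e. range e \<subseteq> elts m ==> EX x:elts n. cons x (sq e k) : elts (Sat n (code ph)) ==> EX x:elts m. cons x (sq e k) : elts (Sat n (code ph))"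
 shows "elementary_submodel elts m n"
proof -
 have tv': "EX x:elts m. sat elts (elts n) (case_nat x e) ph" if e: "range e \<subseteq> elts m" and ex: "EX x:elts n. sat elts (elts n) (case_nat x e) ph" for e ph
 proof -
  have en: "range e \<subseteq> elts n" using e m(2) by blast
  let ?s = "sq e (fb ph)"
  have eq: "cons x ?s : elts (Sat n (code ph)) \<longleftrightarrow> sat elts (elts n) (case_nat x e) ph" if "x : elts n" for x
  proof -
   have "cons x ?s : elts (Sat n (code ph)) \<longleftrightarrow> sat elts (elts n) (case_nat x (evn ?s)) ph"
    using Sat_code[OF cons_En[OF that sq_En[OF en]]] unfolding evn_cons .
   also have "\<dots> \<longleftrightarrow> sat elts (elts n) (case_nat x e) ph"
    by (rule sat_fb) (auto simp: evn_sq min_def split: nat.split)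
   finally show ?thesis .
  qed
  have "EX x:elts n. cons x ?s : elts (Sat n (code ph))" using ex eq by blast
  from tv[OF e this] show ?thesis using eq m(2) by blast
 qed
 show ?thesis unfolding elementary_submodel_def
  using m tarski_vaught[OF m(2) tv'] by blast
qed

lemma elementary_iff: "elementary_submodel elts m n \<longleftrightarrow> elts m ~= {} & elts m \<subseteq> elts n &
 (ALL c. ALL s:En n. (ALL k:elts om. ap s k : elts m) & (EX x:elts n. cons x s : elts (Sat n c)) --> (EX x:elts m. cons x s : elts (Sat n c)))" (is "?L \<longleftrightarrow> ?R")
proof
 assume el: ?L
 then have m: "elts m ~= {}" "elts m \<subseteq> elts n" and eq: "!!ph e. range e \<subseteq> elts m ==> sat elts (elts m) e ph \<longleftrightarrow> sat elts (elts n) e ph"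
  unfolding elementary_submodel_def by blast+
 have "EX x:elts m. cons x s : elts (Sat n c)" if s: "s : En n" "ALL k:elts om. ap s k : elts m" and ex: "EX x:elts n. cons x s : elts (Sat n c)" for c s
 proof -
  obtain ph where ph: "!!s. s : En n ==> s : elts (Sat n c) \<longleftrightarrow> sat elts (elts n) (evn s) ph" using Sat_formula by blast
  have r: "range (evn s) \<subseteq> elts m" using s(2) by (auto simp: evn_def)
  have c: "cons x s : elts (Sat n c) \<longleftrightarrow> sat elts (elts n) (case_nat x (evn s)) ph" if "x : elts n" for x
   using ph[OF cons_En[OF that s(1)]] unfolding evn_cons .
  have "sat elts (elts n) (evn s) (Neg (All (Neg ph)))" using ex c by auto
  then have "sat elts (elts m) (evn s) (Neg (All (Neg ph)))" using eq[OF r] by blast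
  then obtain x where x: "x : elts m" "sat elts (elts m) (case_nat x (evn s)) ph" by auto
  then have "sat elts (elts n) (case_nat x (evn s)) ph" using eq[OF range_case_nat[OF x(1) r]] by blast
  with c x(1) m(2) show ?thesis by blast
 qed
 with m show ?R by blast
next
 assume R: ?R
 show ?L
 proof (rule elementaryI)
  fix ph k e assume e: "range e \<subseteq> elts m" and ex: "EX x:elts n. cons x (sq e k) : elts (Sat n (code ph))"
  have "sq e k : En n" by (rule sq_En) (use e R in blast)
  moreover have "ALL i:elts om. ap (sq e k) i : elts m" using evn_sq[of e k] e by (auto simp: elts_omega evn_def)
  ultimately show "EX x:elts m. cons x (sq e k) : elts (Sat n (code ph))" using R ex by blast
 qed (use R in blast)+
qed

lemma D_elementary: "F t ==> D (%e. elementary_submodel elts (t e) n)"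
 by (rule dfn_rel1[where R="%m. elementary_submodel elts m n"]) (unfold elementary_iff, intro dfn_intros UNIV_I ds_small[OF small_En])

lemma cofm_iff: "cofm al be \<longleftrightarrow> (EX f. (ALL y:elts be. ap f y : elts al) & (ALL x:elts al. EX y:elts be. x = ap f y | x : elts (ap f y)))"
proof
 assume "cofm al be"
 then obtain f G where f: "is_graph elts f be G" "G ` elts be \<subseteq> elts al"
   "ALL x:elts al. EX y:elts be. x = G y | x : elts (G y)" unfolding cofm_def by blast
 have "ap f y = G y" if "y : elts be" for y
  using f(1) that unfolding is_graph_def by (intro ap_graph[of f G]) (simp_all add: graph_def)
 with f(2,3) show "EX f. (ALL y:elts be. ap f y : elts al) & (ALL x:elts al. EX y:elts be. x = ap f y | x : elts (ap f y))"
  by (intro exI[of _ f]) auto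
next
 assume "EX f. (ALL y:elts be. ap f y : elts al) & (ALL x:elts al. EX y:elts be. x = ap f y | x : elts (ap f y))"
 then obtain f where f: "ALL y:elts be. ap f y : elts al" "ALL x:elts al. EX y:elts be. x = ap f y | x : elts (ap f y)" by blast
 show "cofm al be" by (rule cofmI[of "ap f"]) (intro dfn_intros UNIV_I, use f in auto)
qed

text \<open>Free of \<open>least_ord\<close>, this form can be written as a formula, so that
  Separation collects \<open>TT\<close>.\<close>

lemma uncountable_cof: assumes "Or al" shows "om : elts (cof elts al) \<longleftrightarrow> ~ (EX be:elts (sc om). cofm al be)"
proof
 assume a: "om : elts (cof elts al)"
 show "~ (EX be:elts (sc om). cofm al be)"
 proof
  assume "EX be:elts (sc om). cofm al be"
  then obtain be where b: "be : elts (sc om)" "cofm al be" by blast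
  have O: "Or be" by (rule Ord_mem[OF Ord_sc[OF Ord_omega] b(1)])
  have "cof elts al : elts (sc om)" using cof_min[OF O b(2)] b(1) Ord_trans[OF Ord_sc[OF Ord_omega] _ b(1)] by auto
  then show False using a Ord_trans[OF Ord_omega a] mem_irrefl[of om] mem_irrefl[of "cof elts al"] by auto
 qed
next
 assume n: "~ (EX be:elts (sc om). cofm al be)"
 then have "cof elts al ~: elts (sc om)" using cof_cofm2[OF assms] by blast
 then show "om : elts (cof elts al)" using Ord_linear[OF Ord_omega, of "cof elts al"] cof_cofm2[OF assms] by auto
qed

end

section \<open>The sets of nodes and Skolem hulls\<close>

context inacc begin

abbreviation "SS \<equiv> countable_submodels elts th"
abbreviation "TT \<equiv> transitive_submodels elts th"

lemma SS_iff: "K : SS \<longleftrightarrow> ctb (elts K) & elementary_submodel elts K (Vs th)"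
 unfolding countable_submodels_def ctbl_def injects_lep by simp

lemma small_SS: "small SS"
proof -
 have "SS = {K:{y. elts y \<subseteq> Vth}. ctb (elts K) & elementary_submodel elts K (Vs th)}"
  unfolding set_eq_iff SS_iff elementary_submodel_def by blast
 moreover have "small {K:{y. elts y \<subseteq> Vth}. ctb (elts K) & elementary_submodel elts K (Vs th)}"
  by (rule small_sep) (intro small_Pow small_elts, intro dfn_intros D_elementary UNIV_I)
 ultimately show ?thesis by simp
qed

lemma small_TT: "small TT"
proof -
 have "TT = Vs ` {al:elts th. ~ (EX be:elts (sc om). cofm al be) & elementary_submodel elts (Vs al) (Vs th)}"
  unfolding transitive_submodels_def using uncountable_cof th_Or by auto
 moreover have "small {al:elts th. ~ (EX be:elts (sc om). cofm al be) & elementary_submodel elts (Vs al) (Vs th)}"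
  by (rule small_sep[OF small_elts]) (unfold cofm_iff, intro dfn_intros D_elementary UNIV_I)
 ultimately show ?thesis using small_image[OF _ dt_Vs[OF dt_var]] by simp
qed

lemma Kc_Vth: assumes "x : Vth" shows "Kc x : Vth"
proof (rule Vth_rk)
 have "F (%e. pr (e 0) x)" by (intro dfn_intros UNIV_I)
 from ctb_image[OF small_elts this lep_id[OF subset_refl]] show "tiny (elts (Kc x))" unfolding elts_Kc by (rule tiny_ctb)
 show "elts (Kc x) \<subseteq> Vth" unfolding elts_Kc elts_omega using assms thVth[OF numth] by (auto simp: Vth_pr)
qed

lemma cons_Vth: assumes "x : Vth" "range (evn s) \<subseteq> Vth" shows "cons x s : Vth"
proof (rule Vth_rk)
 have f: "F (%e. pr (sc (e 0)) (ap s (e 0)))" by (intro dfn_intros UNIV_I)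
 have "ctb ({pr zero x} \<union> (%n. pr (sc n) (ap s n)) ` elts om)"
  by (intro ctb_Un small_image[OF small_elts f] ctb_image[OF small_elts f] small_single ctb_finite lep_id) auto
 then show "tiny (elts (cons x s))" unfolding elts_cons by (intro tiny_ctb) simp
 show "elts (cons x s) \<subseteq> Vth"
  unfolding elts_cons elts_omega using assms thVth[OF numth[of 0]] thVth[OF th_sc[OF numth]] by (auto simp: Vth_pr evn_def)
qed

lemma sq_Vth: "range e \<subseteq> Vth ==> sq e k : Vth"
proof (induction k arbitrary: e)
 case 0 then show ?case by (auto intro: Kc_Vth)
next
 case (Suc k)
 have r: "range (%n. e (Suc n)) \<subseteq> Vth" using Suc(2) by auto
 then have "range (evn (sq (%n. e (Suc n)) k)) \<subseteq> Vth" by (auto simp: evn_sq)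
 then show ?case unfolding sq.simps by (rule cons_Vth[rotated]) (use Suc(2) in auto)
qed

text \<open>A class containing the natural numbers and closed under these operations is an elementary
 submodel of \<open>V\<^sub>\<theta>\<close>: the fourth is a Skolem function.\<close>

lemma skolem_ops: assumes Ph: "F (%e. Ph (e 0))" "!!x. x : Vth ==> Ph x : Vth"
 obtains g where "F (%e. g (e 0) (e 1) (e 2))" "!!i x y. g i x y : Vth"
  "!!M. elts M \<subseteq> Vth ==> range num \<subseteq> elts M ==> ALL i. ALL x:elts M. ALL y:elts M. g (num i) x y : elts M ==>
   elementary_submodel elts M (Vs th) & (ALL x:elts M. Ph x : elts M)"
proof -
 let ?Q = "%p x. cons x (psnd p) : elts (Sat (Vs th) (pfst p))"
 have Q: "D (%e. ?Q (e 0) (e 1))" by (intro dfn_intros UNIV_I)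
 obtain Sk where Sk: "F (%e. Sk (e 0))" and Sk1: "!!p. p : Vth ==> EX x:Vth. ?Q p x ==> Sk p : Vth & ?Q p (Sk p)"
  by (rule choice_set[OF small_elts small_elts Q]) (rule that)
 define r where "r i x y = (if i = num 1 then pr x y else if i = num 2 then cons x y else if i = num 3 then Kc x else if i = num 4 then Sk (pr x y) else Ph x)" for i x y
 have r: "F (%e. r (e 0) (e 1) (e 2))" unfolding r_def
  by (intro dfn_intros UNIV_I dt_1[OF Sk] dt_1[OF Ph(1)])
 define g where "g i x y = (if r i x y : Vth then r i x y else zero)" for i x y
 have g: "F (%e. g (e 0) (e 1) (e 2))" unfolding g_def
  by (intro dfn_intros UNIV_I r)
 have z: "zero : Vth" using thVth[OF numth[of 0]] by simp
 show ?thesis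
 proof (rule that[OF g])
  show "g i x y : Vth" for i x y using z by (simp add: g_def)
  fix M assume M: "elts M \<subseteq> Vth" "range num \<subseteq> elts M" and cl0: "ALL i. ALL x:elts M. ALL y:elts M. g (num i) x y : elts M"
  have cl: "!!i x y. x : elts M ==> y : elts M ==> g (num i) x y : elts M" using cl0 by blast
  have cl': "r (num i) x y : elts M" if "x : elts M" "y : elts M" "r (num i) x y : Vth" for i x y
   using cl[OF that(1,2), of i] that(3) by (simp add: g_def)
  note ni = num_inj
  have cpr: "pr x y : elts M" if "x : elts M" "y : elts M" for x y
   using cl'[OF that, of 1] that M(1) by (auto simp: r_def Vth_pr ni simp del: num.simps)
  have ccode: "code ph : elts M" for ph by (induction ph) (use M(2) in \<open>auto intro!: cpr simp del: num.simps\<close>)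
  have csq: "sq e k : elts M" if "range e \<subseteq> elts M" for e k using that
  proof (induction k arbitrary: e)
   case 0
   then have "e 0 : elts M" by auto
   then show ?case using cl'[of "e 0" "e 0" 3] Kc_Vth[of "e 0"] M(1) by (auto simp: r_def ni simp del: num.simps)
  next
   case (Suc k)
   have e: "e 0 : elts M" "range (%n. e (Suc n)) \<subseteq> elts M" using Suc(2) by auto
   have "sq e (Suc k) : Vth" by (rule sq_Vth) (use Suc(2) M(1) in blast)
   then show ?case using cl'[OF e(1) Suc(1)[OF e(2)], of 2] by (simp add: r_def ni del: num.simps)
  qed
  have "elementary_submodel elts M (Vs th)"
  proof (rule elementaryI)
   fix ph k e assume e: "range e \<subseteq> elts M" and ex: "EX x:Vth. cons x (sq e k) : elts (Sat (Vs th) (code ph))"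
   have p: "pr (code ph) (sq e k) : Vth" using M(1) ccode csq[OF e] by (auto simp: Vth_pr)
   have S: "Sk (pr (code ph) (sq e k)) : Vth & ?Q (pr (code ph) (sq e k)) (Sk (pr (code ph) (sq e k)))"
    by (rule Sk1[OF p]) (use ex in simp)
   have "Sk (pr (code ph) (sq e k)) : elts M"
    using cl'[OF ccode csq[OF e], of 4 ph] S by (simp add: r_def ni del: num.simps)
   with S show "EX x:elts M. cons x (sq e k) : elts (Sat (Vs th) (code ph))" by auto
  qed (use M in auto)
  moreover have "Ph x : elts M" if "x : elts M" for x
   using cl'[OF that that, of 5] Ph(2)[of x] that M(1) by (auto simp: r_def ni simp del: num.simps)
  ultimately show "elementary_submodel elts M (Vs th) & (ALL x:elts M. Ph x : elts M)" by blast
 qed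
qed

text \<open>The extra operation \<open>Ph\<close> is the entry point for closure conditions that
  elementarity in \<open>V\<^sub>\<theta>\<close> does not provide.\<close>

lemma loewenheim_skolem: assumes Ph: "F (%e. Ph (e 0))" "!!x. x : Vth ==> Ph x : Vth" and a: "a : Vth"
 obtains K where "K : SS" "a : elts K" "!!x. x : elts K ==> Ph x : elts K"
proof -
 obtain g where g: "F (%e. g (e 0) (e 1) (e 2))" "!!i x y. g i x y : Vth"
  and el: "!!M. elts M \<subseteq> Vth ==> range num \<subseteq> elts M ==> ALL i. ALL x:elts M. ALL y:elts M. g (num i) x y : elts M ==>
   elementary_submodel elts M (Vs th) & (ALL x:elts M. Ph x : elts M)"
  by (rule skolem_ops[OF Ph(1)], rule Ph(2), assumption, rule that)
 have "ctb ({a} \<union> elts om)" by (intro ctb_Un small_single small_elts ctb_finite lep_id) auto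
 then have c: "ctb (insert a (elts om))" by simp
 obtain Y where
  Y: "small Y" "ctb Y" "insert a (elts om) \<subseteq> Y" "!!n x y. x : Y ==> y : Y ==> g (num n) x y : Y"
  by (rule countable_closure[OF small_insert[OF small_elts] c g(1)]) (rule that)
 let ?M = "mk (Y \<inter> Vth)"
 have M: "elts ?M = Y \<inter> Vth" using small_Int[OF Y(1) small_elts] by simp
 have "elementary_submodel elts ?M (Vs th) & (ALL x:elts ?M. Ph x : elts ?M)"
  by (rule el) (use Y(3,4) g(2) thVth[OF numth] in \<open>auto simp: M elts_omega simp del: num.simps\<close>)
 moreover have "ctb (elts ?M)" unfolding M by (rule lep_mono[OF _ Y(2) subset_refl]) blast
 moreover have "a : elts ?M" unfolding M using Y(3) a by blast
 ultimately show ?thesis by (intro that[of ?M]) (simp_all add: SS_iff)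
qed

lemma ub2: assumes "a : elts th" "b : elts th" shows "EX d:elts th. elts a \<subseteq> elts d & elts b \<subseteq> elts d"
 using Ord_linear[OF th_Or[OF assms(1)] th_Or[OF assms(2)]]
proof (elim disjE)
 assume "a : elts b" then show ?thesis using assms(2) Ord_trans[OF th_Or[OF assms(2)]] by blast
next
 assume "b : elts a" then show ?thesis using assms(1) Ord_trans[OF th_Or[OF assms(1)]] by blast
qed (use assms in blast)

text \<open>The ordinal \<open>b al\<close> bounds the ranks of the values of \<open>g\<close> on
  level \<open>al\<close>. Iterating \<open>b\<close> along \<open>\<omega>\<^sub>1\<close> gives a
  level \<open>h om1\<close> closed under \<open>g\<close>, and the length
  \<open>\<omega>\<^sub>1\<close> makes its cofinality uncountable.\<close>

lemma TT_reflect: assumes Ph: "F (%e. Ph (e 0))" "!!x. x : Vth ==> Ph x : Vth" and a: "a : Vth"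
 obtains W where "W : TT" "a : elts W" "!!x. x : elts W ==> Ph x : elts W"
proof -
 obtain g where g: "F (%e. g (e 0) (e 1) (e 2))" "!!i x y. g i x y : Vth"
  and el: "!!M. elts M \<subseteq> Vth ==> range num \<subseteq> elts M ==> ALL i. ALL x:elts M. ALL y:elts M. g (num i) x y : elts M ==>
   elementary_submodel elts M (Vs th) & (ALL x:elts M. Ph x : elts M)"
  by (rule skolem_ops[OF Ph(1)], rule Ph(2), assumption, rule that)
 let ?q = "%p. rk (g (pfst p) (pfst (psnd p)) (psnd (psnd p)))"
 have q: "F (%e. ?q (e 0))" by (intro dfn_intros dt_3[OF g(1)])
 let ?Q = "%al ga. ga : elts th & al : elts ga & (ALL x:elts (Vs al). ALL y:elts (Vs al). ALL i:elts (Vs al). ?q (pr i (pr x y)) : elts ga)"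
 have Q: "D (%e. ?Q (e 0) (e 1))" by (intro dfn_intros dt_1[OF q] UNIV_I)
 obtain b where b: "F (%e. b (e 0))" and b1: "!!x y. x : elts th ==> ?Q x y ==> ?Q x (b x)"
  by (rule choice[OF small_elts Q]) (rule that)
 have b2: "?Q al (b al)" if al: "al : elts th" for al
 proof -
  \<comment> \<open>Each pairing climbs two levels, and the arguments of \<open>g\<close> are
    triples coded by two pairings.\<close>
  let ?dl = "sc (sc (sc (sc al)))"
  have pV: "pr x y : elts (Vs (sc (sc be)))" if "Or be" "x : elts (Vs be)" "y : elts (Vs be)" for x y be
   using that pr_in[of x y] by (simp add: Vs_sc Ord_sc)
  have up: "x : elts (Vs (sc (sc al)))" if "x : elts (Vs al)" for x
   using that Vs_mono[OF Ord_sc[OF th_Or[OF al]], of al] Vs_mono[OF Ord_sc[OF Ord_sc[OF th_Or[OF al]]], of "sc al"] by auto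
  have D: "?dl : elts th" by (intro th_sc al)
  have "?q ` elts (Vs ?dl) \<subseteq> elts th" using g(2) Vth_iff by blast
  from reg[OF small_elts tiny_Vs[OF D] q this] obtain c where c: "c : elts th" "?q ` elts (Vs ?dl) \<subseteq> elts c" by blast
  have O: "Or c" "Or al" using c(1) al th_Or by auto
  have cup: "EX d:elts th. elts c \<subseteq> elts d & al : elts d"
   using Ord_linear[OF O]
  proof (elim disjE)
   assume "al : elts c" then show ?thesis using c(1) by blast
  next
   assume "c = al" then show ?thesis by (intro bexI[of _ "sc al"]) (use th_sc[OF al] in auto)
  next
   assume "c : elts al" then show ?thesis by (intro bexI[of _ "sc al"]) (use th_sc[OF al] Ord_trans[OF O(2)] in auto)
  qed
  then obtain d where d: "d : elts th" "elts c \<subseteq> elts d" "al : elts d" by blast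
  have "?q (pr i (pr x y)) : elts d" if "x : elts (Vs al)" "y : elts (Vs al)" "i : elts (Vs al)" for x y i
  proof -
   have "pr i (pr x y) : elts (Vs ?dl)" by (intro pV Ord_sc O up that)
   then show ?thesis using c(2) d(2) by blast
  qed
  with d(1,3) have "?Q al d" by blast
  then show ?thesis by (rule b1[OF al])
 qed
 obtain a0 where a0: "a0 : elts th" "a : elts (Vs a0)" using Vth_lev[OF a] by blast
 define h where "h = wfrec (R\<^sup>+) (%f x. mk (elts a0 \<union> elts om \<union> (UN z:elts x. insert (b (ap (mk (graph f (below x))) z)) (elts (b (ap (mk (graph f (below x))) z))))))"
 have h: "F (%e. h (e 0))"
  by (rule recursion[where H="%x f. mk (elts a0 \<union> elts om \<union> (UN z:elts x. insert (b (ap f z)) (elts (b (ap f z)))))", OF _ rec_def[OF h_def]])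
    (intro dfn_intros UNIV_I dt_1[OF b])
 have bh: "F (%e. b (h (e 0)))" by (rule dt_1[OF b h])
 have eh: "elts (h x) = elts a0 \<union> elts om \<union> (UN z:elts x. insert (b (h z)) (elts (b (h z))))" for x
 proof -
  have "h x = mk (elts a0 \<union> elts om \<union> (UN z:elts x. insert (b (h z)) (elts (b (h z)))))"
   by (subst rec_def[OF h_def]) (simp add: ap_rec[OF h] elts_below)
  then show ?thesis using small_UN_ins[OF bh small_elts, of x] by (simp add: small_Un)
 qed
 have hO: "Or (h x)" and hth: "h x : elts th" if x: "x : elts th" for x
 proof -
  have "Or (h x) & h x : elts th" using x
  proof (induction x rule: wf_induct_rule[OF wfR])
   case (1 x)
   have IH: "h z : elts th" if "z : elts x" for z using 1(1)[of z] that th_trans[OF that 1(2)] by (simp add: R_iff)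
   have bz: "b (h z) : elts th" if "z : elts x" for z using b2[OF IH[OF that]] by blast
   then have "(%z. b (h z)) ` elts x \<subseteq> elts th" by blast
   from reg0[OF 1(2) bh this] obtain c where c: "c : elts th" "(%z. b (h z)) ` elts x \<subseteq> elts c" by blast
   have fam: "elts (h x) = \<Union> (elts ` ({a0, om} \<union> (%z. sc (b (h z))) ` elts x))" unfolding eh by auto
   have "small ({a0, om} \<union> (%z. sc (b (h z))) ` elts x)"
    by (intro small_Un small_pair small_image[OF small_elts] dt_sc bh)
   then have "Or (mk (elts (h x)))" unfolding fam
    by (rule Ord_Union) (use th_Or[OF a0(1)] Ord_omega Ord_sc[OF th_Or[OF bz]] in blast)
   then have O: "Or (h x)" by simp
   have "h x : elts th"
   proof (rule ccontr)
    assume "h x ~: elts th"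
    then have "elts th \<subseteq> elts (h x)" using Ord_not_mem[OF O Oth] by simp
    then have s: "elts th \<subseteq> elts a0 \<union> elts om \<union> elts (sc c)" unfolding eh using c(2) Ord_trans[OF th_Or[OF c(1)]] by auto
    obtain d where d: "d : elts th" "elts a0 \<subseteq> elts d" "elts om \<subseteq> elts d" using ub2[OF a0(1) omth] by blast
    obtain d' where d': "d' : elts th" "elts d \<subseteq> elts d'" "elts (sc c) \<subseteq> elts d'" using ub2[OF d(1) th_sc[OF c(1)]] by blast
    have "d' : elts d'" using s d d' by blast
    then show False using mem_irrefl by blast
   qed
   with O show ?case by blast
  qed
  then show "Or (h x)" "h x : elts th" by auto
 qed
 let ?et = "h om1"
 have eth: "?et : elts th" and eO: "Or ?et" using hth[OF om1th] hO[OF om1th] .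
 have step: "b (h z) : elts (h x)" if "z : elts x" for z x using that unfolding eh[of x] by blast
 have hb: "h z : elts (b (h z))" if "z : elts th" for z using b2[OF hth[OF that]] by blast
 have hh: "h z : elts (h x)" if "z : elts x" "x : elts th" for z x
  using Ord_trans[OF hO[OF that(2)] hb[OF th_trans[OF that]] step[OF that(1)]] .
 have om1th': "z : elts om1 ==> z : elts th" for z using th_trans om1th by blast
 have sc1: "sc z : elts om1" if "z : elts om1" for z
  using that ctb_Un[OF small_single small_elts ctb_finite, of z z] by (simp add: om1_iff Ord_sc)
 have z1: "zero : elts om1" using Ord_zero by (simp add: om1_iff lep_id)
 have lev: "EX z:elts om1. w : elts (h z)" if w: "w : elts ?et" for w
 proof -
  consider "w : elts a0 \<union> elts om" | z where "z : elts om1" "w = b (h z) | w : elts (b (h z))" using w unfolding eh[of om1] by blast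
  then show ?thesis
  proof cases
   case 1 then have "w : elts (h zero)" unfolding eh[of zero] by blast
   then show ?thesis using z1 by blast
  next
   case (2 z) then have "w : elts (h (sc z))" unfolding eh[of "sc z"] by auto
   then show ?thesis using sc1[OF 2(1)] by blast
  qed
 qed
 have hmono: "elts (h z) \<subseteq> elts (h x)" if "z : elts x" "x : elts th" for z x
  using Ord_trans[OF hO[OF that(2)] _ hh[OF that]] by blast
 have lev2: "EX z:elts om1. w : elts (h z) & w' : elts (h z)" if ww: "w : elts ?et" "w' : elts ?et" for w w'
 proof -
  obtain z z' where z: "z : elts om1" "w : elts (h z)" "z' : elts om1" "w' : elts (h z')" using lev ww by blast
  show ?thesis using Ord_linear[OF Ord_mem[OF O1 z(1)] Ord_mem[OF O1 z(3)]] z hmono om1th' by blast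
 qed
 have lev3: "EX z:elts om1. w : elts (h z) & w' : elts (h z) & w'' : elts (h z)" if ww: "w : elts ?et" "w' : elts ?et" "w'' : elts ?et" for w w' w''
 proof -
  obtain z z' where z: "z : elts om1" "w : elts (h z)" "w' : elts (h z)" "z' : elts om1" "w'' : elts (h z')" using lev2[OF ww(1,2)] lev[OF ww(3)] by blast
  show ?thesis using Ord_linear[OF Ord_mem[OF O1 z(1)] Ord_mem[OF O1 z(4)]] z hmono om1th' by blast
 qed
 let ?W = "Vs ?et"
 have cl: "g i x y : elts ?W" if xyi: "x : elts ?W" "y : elts ?W" "i : elts ?W" for i x y
 proof -
  obtain z where z: "z : elts om1" "rk x : elts (h z)" "rk y : elts (h z)" "rk i : elts (h z)"
   using lev3[of "rk x" "rk y" "rk i"] xyi unfolding Vs_iff[OF eO] by blast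
  note O = hO[OF om1th'[OF z(1)]]
  have xyz: "x : elts (Vs (h z))" "y : elts (Vs (h z))" "i : elts (Vs (h z))" using z unfolding Vs_iff[OF O] by simp_all
  have "?q (pr i (pr x y)) : elts (b (h z))" using b2[OF hth[OF om1th'[OF z(1)]]] xyz by blast
  then have "rk (g i x y) : elts ?et" using Ord_trans[OF eO _ step[OF z(1)]] by simp
  then show ?thesis unfolding Vs_iff[OF eO] .
 qed
 have numW: "num n : elts ?W" for n unfolding Vs_iff[OF eO] rk_Ord[OF Ord_num] eh[of om1] using num_in by blast
 have WV: "elts ?W \<subseteq> Vth" by (rule Vth_trans[OF Vth_Vs[OF eth]])
 have EL: "elementary_submodel elts ?W (Vs th) & (ALL x:elts ?W. Ph x : elts ?W)"
  by (rule el[OF WV]) (use numW cl in blast)+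
 have "~ (EX be:elts (sc om). cofm ?et be)"
 proof
  assume "EX be:elts (sc om). cofm ?et be"
  then obtain be f where be: "be : elts (sc om)" and f: "ALL y:elts be. ap f y : elts ?et" "ALL x:elts ?et. EX y:elts be. x = ap f y | x : elts (ap f y)"
   unfolding cofm_iff by blast
  have bom: "elts be \<subseteq> elts om" using be Ord_trans[OF Ord_omega] by auto
  let ?Z = "%y z. ap f y : elts (h z)"
  have Z: "D (%e. ?Z (e 0) (e 1))" by (intro dfn_intros UNIV_I dt_1[OF h])
  obtain c where c: "F (%e. c (e 0))" and c1: "!!y. y : elts be ==> EX z:elts om1. ?Z y z ==> c y : elts om1 & ?Z y (c y)"
   by (rule choice_set[OF small_elts small_elts Z]) (rule that)
  have c2: "c y : elts om1 & ?Z y (c y)" if "y : elts be" for y by (rule c1[OF that]) (use lev f(1) that in blast)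
  have sm: "small (c ` elts be)" by (rule small_image[OF small_elts c])
  have "ctb (c ` elts be)" by (rule ctb_image[OF small_elts c lep_id[OF bom]])
  then have u: "mk (\<Union>(elts ` c ` elts be)) : elts om1" by (intro om1_sup[OF sm]) (use c2 in auto)
  \<comment> \<open>The countably many stages \<open>c y\<close> have a bound below
    \<open>\<omega>\<^sub>1\<close>, so every value of the supposed cofinal map already lies in
    \<open>h ?u\<close>.\<close>
  let ?u = "sc (mk (\<Union>(elts ` c ` elts be)))"
  have u1: "?u : elts om1" by (rule sc1[OF u])
  have cu: "elts (c y) \<subseteq> elts (mk (\<Union>(elts ` c ` elts be)))" if "y : elts be" for y using small_Union[OF sm] that by auto
  have "c y : elts ?u" if "y : elts be" for y
   using cu[OF that] Ord_subset[OF Ord_mem[OF O1] Ord_mem[OF O1 u], of "c y"] c2[OF that] by auto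
  then have fu: "ap f y : elts (h ?u)" if "y : elts be" for y using c2[OF that] hmono[OF _ om1th'[OF u1], of "c y"] that by blast
  have "h ?u : elts ?et" by (rule hh[OF u1 om1th])
  then obtain y where "y : elts be" "h ?u = ap f y | h ?u : elts (ap f y)" using f(2) by blast
  with fu[of y] show False using mem_irrefl[of "h ?u"] Ord_trans[OF hO[OF om1th'[OF u1]]] by metis
 qed
 then have "?W : TT" unfolding transitive_submodels_def using eth EL uncountable_cof[OF eO] by blast
 moreover have "a : elts ?W"
 proof -
  have "rk a : elts a0" using a0(2) Vs_iff[OF th_Or[OF a0(1)]] by blast
  then show ?thesis unfolding Vs_iff[OF eO] eh[of om1] by blast
 qed
 ultimately show ?thesis using EL by (intro that[of ?W]) blast+
qed

end

text \<open>Quantifiers over the set \<open>W\<close> are bounded, so satisfaction in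
  \<open>W\<close> is definable over the ambient structure with \<open>W\<close> as a
  parameter.\<close>

lemma (in cls) sat_dfn: "W : B ==> (!!n. dt elts A B (%e. t e n)) ==> dfn elts A B (%e. sat elts (elts W) (t e) ph)"
proof (induction ph arbitrary: t)
 case (Mem i j) show ?case unfolding sat.simps by (intro dfn_mem ds_elts Mem(2))
next
 case (Eq i j) show ?case unfolding sat.simps by (intro dfn_eq Eq(2))
next
 case (Neg ph) show ?case unfolding sat.simps by (intro dfn_not Neg)
next
 case (Conj ph ps) show ?case unfolding sat.simps by (intro dfn_conj Conj)
next
 case (All ph)
 have "dt elts A B (%e. case_nat (e 0) (t (%n. e (Suc n))) n)" for n
  by (cases n) (simp_all add: dt_var dt_shift[OF All(3)])
 from All(1)[OF All(2) this] have "dfn elts A B (%e. sat elts (elts W) (case_nat (e 0) (t (%n. e (Suc n)))) ph)" .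
 then show ?case unfolding sat.simps
  by (intro dfn_ball[where Q="%x e. sat elts (elts W) (case_nat x (t e)) ph"] ds_elts dt_const All(2))
qed

context inacc begin

abbreviation "el K \<equiv> elementary_submodel elts K (Vs th)"

lemma el_sub: "el K ==> elts K \<subseteq> Vth" unfolding elementary_submodel_def by blast

lemma el_cls2: assumes "el K" shows "cls2 elts Vth (elts K)"
proof unfold_locales
 fix x y assume "x : Vth" "y : Vth"
 then have "mk {x, y} : Vth" by (intro Vth_finite) simp_all
 moreover have "elts (mk {x, y}) = {x, y}" by simp
 ultimately show "EX z:Vth. elts z = {x, y}" by blast
qed (use z_inj Vth_trans el_sub[OF assms] in auto)

text \<open>Elementarity in the form used below, with predicates instead of formulas: anything that
  exists in \<open>V\<^sub>\<theta>\<close> and is described with parameters from \<open>K\<close>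
  has a witness in \<open>K\<close>.\<close>

lemma el_ex: assumes el: "el K" and Q: "dfn elts Vth (elts K) (%e. Q (e 0))" and ex: "EX x:Vth. Q x"
 shows "EX x:elts K. Q x"
proof -
 obtain ph m c where c: "!!k. k < m ==> c k : elts K" and ph: "!!e. range e \<subseteq> Vth ==>
   Q (e 0) \<longleftrightarrow> sat elts Vth (%k. if k < m then c k else e (k - m)) ph"
  using Q unfolding dfn_def by blast
 obtain k0 where k0: "k0 : elts K" using el unfolding elementary_submodel_def by blast
 let ?c = "%k. if k < m then c k else k0"
 let ?r = "%k. if k < m then Suc k else if k = m then 0 else Suc k"
 have rc: "range ?c \<subseteq> elts K" using c k0 by auto
 have KV: "elts K \<subseteq> Vth" by (rule el_sub[OF el])
 have eq: "Q x \<longleftrightarrow> sat elts Vth (case_nat x ?c) (ren ?r ph)" if x: "x : Vth" for x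
 proof -
  have "(%n. case_nat x ?c (?r n)) = (%k. if k < m then c k else case_nat x (%_. k0) (k - m))"
   by (rule ext) (auto split: nat.split)
  moreover have "range (case_nat x (%_. k0)) \<subseteq> Vth" by (rule range_case_nat[OF x]) (use k0 KV in auto)
  ultimately show ?thesis using ph[of "case_nat x (%_. k0)"] unfolding sat_ren by simp
 qed
 have e: "sat elts (elts K) e ps \<longleftrightarrow> sat elts Vth e ps" if "range e \<subseteq> elts K" for e ps
  using el that unfolding elementary_submodel_def by blast
 have "sat elts Vth ?c (Neg (All (Neg (ren ?r ph))))" using ex eq by auto
 then have "sat elts (elts K) ?c (Neg (All (Neg (ren ?r ph))))" using e[OF rc] by blast
 then obtain x where x: "x : elts K" "sat elts (elts K) (case_nat x ?c) (ren ?r ph)" by auto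
 then have "sat elts Vth (case_nat x ?c) (ren ?r ph)" using e[OF range_case_nat[OF x(1) rc]] by blast
 with eq x(1) KV show ?thesis by blast
qed

lemma el_dt: assumes el: "el K" and t: "dt elts Vth (elts K) (%e. t)" shows "t : elts K"
proof -
 have "dfn elts Vth (elts K) (%e. e 0 = t)" using t unfolding dt_def by blast
 moreover have "zero : Vth" using thVth[OF numth[of 0]] by simp
 then have "t : Vth" using t unfolding dt_def by (auto dest!: spec[of _ "%_. zero"])
 ultimately show ?thesis using el_ex[OF el, of "%x. x = t"] by blast
qed

lemma el_mk: assumes el: "el K" and X: "ds elts Vth (elts K) (%e. X)" and s: "small X" "mk X : Vth" shows "mk X : elts K"
proof -
 interpret I: cls2 elts Vth "elts K" by (rule el_cls2[OF el])
 show ?thesis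
  by (rule el_dt[OF el], rule I.dt_mkset0[OF X]) (use s in \<open>auto intro!: bexI[of _ "mk X"]\<close>)
qed

lemma el_insert: assumes el: "el K" and "x : elts K" "y : elts K" shows "mk (insert x (elts y)) : elts K"
proof -
 interpret I: cls2 elts Vth "elts K" by (rule el_cls2[OF el])
 have V: "x : Vth" "y : Vth" using assms el_sub[OF el] by auto
 obtain m where m: "m : elts th" "x : elts (Vs m)" "y : elts (Vs m)"
 proof -
  obtain a b where "a : elts th" "x : elts (Vs a)" "b : elts th" "y : elts (Vs b)" using Vth_lev V by blast
  then show ?thesis using ub2[of a b] that Vs_iff[OF th_Or] by blast
 qed
 have "elts (mk (insert x (elts y))) \<subseteq> elts (Vs m)" using m Vs_trans[OF th_Or[OF m(1)] m(3)] by (simp add: small_insert)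
 then have "mk (insert x (elts y)) : Vth" using Vth_sub[OF Vth_Vs[OF m(1)]] by blast
 then show ?thesis
  by (intro el_mk[OF el] I.ds_insert I.ds_elts I.dt_const assms small_insert small_elts)
qed

lemma el_Int: assumes el: "el K" and "x : elts K" "y : elts K" shows "mk (elts x \<inter> elts y) : elts K"
proof -
 interpret I: cls2 elts Vth "elts K" by (rule el_cls2[OF el])
 have "mk (elts x \<inter> elts y) : Vth"
  by (rule Vth_sub[of x]) (use assms el_sub[OF el] in \<open>auto simp: small_Int\<close>)
 then show ?thesis
  by (intro el_mk[OF el] I.ds_Int I.ds_elts I.dt_const assms small_Int small_elts)
qed

lemma el_zero: assumes el: "el K" shows "zero : elts K"
proof -
 interpret I: cls2 elts Vth "elts K" by (rule el_cls2[OF el])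
 have "mk {} : elts K" by (rule el_mk[OF el I.ds_empty]) (use thVth[OF numth[of 0]] in \<open>auto simp: zero_def\<close>)
 then show ?thesis by (simp add: zero_def)
qed

lemma el_finite: assumes el: "el K" shows "finite X ==> X \<subseteq> elts K ==> mk X : elts K"
proof (induction rule: finite_induct)
 case empty show ?case using el_zero[OF el] by (simp add: zero_def)
next
 case (insert x X)
 then have "mk X : elts K" "x : elts K" by auto
 from el_insert[OF el this(2,1)] show ?case using small_finite[OF insert(1)] by simp
qed

lemma el_sc: "el K ==> x : elts K ==> sc x : elts K"
 unfolding sc_def by (rule el_insert)
lemma el_num: "el K ==> num n : elts K"
 by (induction n) (simp_all add: el_zero el_sc)

lemma el_pr: assumes "el K" "x : elts K" "y : elts K" shows "pr x y : elts K"
 unfolding opair_def by (intro el_finite assms) (auto intro!: el_finite assms)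

text \<open>\<open>\<omega>\<close> is the only limit ordinal with no limit ordinal below it, hence
  definable in \<open>V\<^sub>\<theta>\<close>.\<close>

lemma el_om: assumes el: "el K" shows "om : elts K"
proof -
 interpret I: cls2 elts Vth "elts K" by (rule el_cls2[OF el])
 let ?Q = "%x. Limit elts x & (ALL y:elts x. ~ Limit elts y)"
 have L: "Limit elts om"
 proof -
  have "EX ga:elts om. be : elts ga" if b: "be : elts om" for be
  proof -
   obtain n where "be = num n" using b by (auto simp: elts_omega)
   then have "be : elts (num (Suc n))" by simp
   then show ?thesis using num_in by blast
  qed
  then show ?thesis unfolding Limit_def using Ord_omega num_in[of 0] by blast
 qed
 have nl: "~ Limit elts (num n)" for n
 proof (cases n)
  case (Suc m)
  show ?thesis
  proof
   assume "Limit elts (num n)"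
   then obtain c where c: "c : elts (num n)" "num m : elts c" unfolding Limit_def Suc by auto
   then obtain k where "k < n" "c = num k" by (auto simp: num_mem)
   then show False using c(2) Suc by (simp add: num_less)
  qed
 qed (simp add: Limit_def)
 have u: "x = om" if "?Q x" for x
 proof -
  have "Or x" using that by (simp add: Limit_def)
  from Ord_linear[OF this Ord_omega] show ?thesis
  proof (elim disjE)
   assume "x : elts om"
   then obtain n where "x = num n" unfolding elts_omega by blast
   then show ?thesis using that nl by blast
  next
   assume "om : elts x" then show ?thesis using that L by blast
  qed
 qed
 have "dfn elts Vth (elts K) (%e. ?Q (e 0))" unfolding Limit_def Ord_def
  by (intro dfn_conj I.dfn_ball I.dfn_bex dfn_not I.dfn_subset I.dfn_mem I.ds_elts I.dt_var I.dfn_seteq I.ds_empty)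
 moreover have "?Q om" using L nl by (auto simp: elts_omega)
 ultimately show ?thesis using el_ex[OF el, of ?Q] u thVth[OF omth] by blast
qed

text \<open>By elementarity \<open>K\<close> contains some \<open>j\<close> that numbers
  \<open>x\<close> injectively, and it contains every natural number; each element of
  \<open>x\<close> is then definable from \<open>j\<close> and its number.\<close>

lemma el_ctb_sub: assumes el: "el K" and x: "x : elts K" "ctb (elts x)" shows "elts x \<subseteq> elts K"
proof -
 interpret I: cls2 elts Vth "elts K" by (rule el_cls2[OF el])
 have KV: "elts K \<subseteq> Vth" by (rule el_sub[OF el])
 obtain f where f: "F (%e. f (e 0))" "inj_on f (elts x)" "f ` elts x \<subseteq> elts om" using x(2) by (rule lepE)
 let ?Q = "%j. ALL y:elts x. EX n:elts om. pr y n : elts j & (ALL y':elts x. pr y' n : elts j --> y' = y)"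
 let ?j = "mk (graph f (elts x))"
 have j: "elts ?j = graph f (elts x)" using small_graph[OF small_elts f(1)] by simp
 have xV: "elts x \<subseteq> Vth" using Vth_trans KV x(1) by blast
 have pf: "F (%e. pr (e 0) (f (e 0)))" by (intro dfn_intros f(1))
 have "ctb (graph f (elts x))" unfolding graph_def by (rule ctb_image[OF small_elts pf x(2)])
 then have "?j : Vth"
  by (intro Vth_mk tiny_ctb) (use xV f(3) Vth_trans[OF thVth[OF omth]] in \<open>auto simp: graph_def Vth_pr subset_iff image_subset_iff small_graph[OF small_elts f(1), unfolded graph_def]\<close>)
 moreover have "?Q ?j" unfolding j using f(2,3) by (auto simp: inj_on_def)
 moreover have "dfn elts Vth (elts K) (%e. ?Q (e 0))"
  by (intro I.dfn_ball I.dfn_bex dfn_conj I.dfn_imp I.dfn_mem I.dfn_eq I.dt_pr I.dt_var I.ds_elts I.dt_const x(1) el_om[OF el])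
 ultimately obtain j where jK: "j : elts K" "?Q j" using el_ex[OF el, of ?Q] by blast
 show ?thesis
 proof
  fix y assume y: "y : elts x"
  then obtain n where n: "n : elts om" "pr y n : elts j" "ALL y':elts x. pr y' n : elts j --> y' = y" using jK(2) by blast
  have nK: "n : elts K" using n(1) el_num[OF el] by (auto simp: elts_omega)
  have "dfn elts Vth (elts K) (%e. e 0 : elts x & pr (e 0) n : elts j)"
   by (intro dfn_conj I.dfn_mem I.dt_pr I.dt_var I.ds_elts I.dt_const x(1) nK jK(1))
  from el_ex[OF el this] have "EX y':elts K. y' : elts x & pr y' n : elts j" using y n(2) xV by blast
  with n(3) show "y : elts K" by blast
 qed
qed

lemma el_finite_sub: "el K ==> x : elts K ==> finite (elts x) ==> elts x \<subseteq> elts K"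
 by (rule el_ctb_sub) (auto intro: ctb_finite)

lemma el_prD: assumes el: "el K" and p: "pr a b : elts K" shows "a : elts K" "b : elts K"
proof -
 have "elts (pr a b) \<subseteq> elts K" by (rule el_finite_sub[OF el p]) (use pr_in[of a b] in simp)
 then have "mk {a, b} : elts K" using pr_in[of a b] by simp
 from el_finite_sub[OF el this] show "a : elts K" "b : elts K" by simp_all
qed

lemma TT_E: assumes "W : TT" obtains al where "al : elts th" "W = Vs al" "~ (EX be:elts (sc om). cofm al be)" "el W" "Or al"
 using assms unfolding transitive_submodels_def using uncountable_cof th_Or by blast

lemma TT_el: "W : TT ==> el W" by (erule TT_E)
lemma SS_el: "K : SS ==> el K" by (simp add: SS_iff)
lemma SS_ctb: "K : SS ==> ctb (elts K)" by (simp add: SS_iff)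
lemma TT_trans: "W : TT ==> x : elts W ==> elts x \<subseteq> elts W"
 by (erule TT_E) (auto dest: Vs_trans)
lemma TT_sub: "W : TT ==> x : elts W ==> elts y \<subseteq> elts x ==> y : elts W"
 by (erule TT_E) (auto dest: Vs_sub)
lemma TT_Vth: "W : TT ==> W : Vth"
 by (erule TT_E) (simp add: Vth_Vs)

text \<open>Countably many ranks below an ordinal of uncountable cofinality are bounded below
  it.\<close>

lemma TT_ctb: assumes W: "W : TT" and X: "small X" "ctb X" "X \<subseteq> elts W" shows "mk X : elts W"
proof -
 obtain al where a: "al : elts th" "W = Vs al" "~ (EX be:elts (sc om). cofm al be)" "Or al" using TT_E[OF W] by metis
 have rX: "rk x : elts al" if "x : X" for x using X(3) that Vs_iff[OF a(4)] a(2) by blast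
 have z: "zero : elts al"
 proof (rule ccontr)
  assume n: "zero ~: elts al"
  have "elts al = {}" using n Ord_not_mem[OF Ord_zero a(4)] by simp
  then have "cofm al zero" by (intro cofmI[of "%x. x"] dt_var) auto
  then show False using a(3) num_in[of 0] by auto
 qed
 have "EX be:elts al. rk ` X \<subseteq> elts be"
 proof (rule ccontr)
  assume n: "~ ?thesis"
  obtain j where j: "F (%e. j (e 0))" "inj_on j X" "j ` X \<subseteq> elts om" using X(2) by (rule lepE)
  have d: "D (%e. j (e 1) = e 0)" by (intro dfn_intros dt_1[OF j(1)])
  obtain g where g: "F (%e. g (e 0))" and g1: "!!b. b : elts om ==> EX x:X. j x = b ==> g b : X & j (g b) = b"
   by (rule choice_set[OF small_elts X(1), of "%b x. j x = b" om, OF d]) (rule that)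
  let ?h = "%b. if g b : X then rk (g b) else zero"
  have h: "F (%e. ?h (e 0))" by (intro dfn_intros dt_1[OF g] ds_small[OF X(1)] UNIV_I)
  have "cofm al om"
  proof (rule cofmI[OF h])
   show "?h ` elts om \<subseteq> elts al" using rX z by auto
   fix b assume b: "b : elts al"
   then obtain x where x: "x : X" "rk x ~: elts b" using n by blast
   have jx: "j x : elts om" using j(3) x by blast
   have "g (j x) : X & j (g (j x)) = j x" using g1[OF jx] x by blast
   then have "g (j x) = x" using inj_onD[OF j(2)] x by blast
   then have e: "?h (j x) = rk x" using x by simp
   have "b = ?h (j x) | b : elts (?h (j x))" unfolding e
    using Ord_linear[OF Ord_mem[OF a(4) b] Ord_rk[of x]] x(2) by blast
   then show "EX y:elts om. b = ?h y | b : elts (?h y)" using jx by blast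
  qed
  then show False using a(3) by simp
 qed
 then obtain be where b: "be : elts al" "rk ` X \<subseteq> elts be" by blast
 have Ob: "Or be" by (rule Ord_mem[OF a(4) b(1)])
 have "elts (rk (mk X)) \<subseteq> elts be" by (rule rk_least[OF Ob]) (use b(2) X(1) in auto)
 then have "rk (mk X) = be | rk (mk X) : elts be" using Ord_subset[OF Ord_rk Ob] by blast
 then have "rk (mk X) : elts al" using b(1) Ord_trans[OF a(4)] by blast
 then show ?thesis unfolding a(2) Vs_iff[OF a(4)] .
qed

text \<open>Truth in \<open>W\<close> is definable from the parameter \<open>W \<in> K\<close>, so
  \<open>K \<inter> W\<close> passes the Tarski-Vaught test inside \<open>W\<close>, and
  \<open>W\<close> is itself elementary in \<open>V\<^sub>\<theta>\<close>.\<close>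

lemma el_inter: assumes el: "el K" and W: "W : TT" "W : elts K" shows "el (mk (elts K \<inter> elts W))"
proof -
 let ?M = "elts K \<inter> elts W"
 have M: "elts (mk ?M) = ?M" by (simp add: small_Int)
 interpret I: cls2 elts Vth "elts K" by (rule el_cls2[OF el])
 have elW: "el W" by (rule TT_el[OF W(1)])
 have tv: "EX x:?M. sat elts (elts W) (case_nat x e) ph" if e: "range e \<subseteq> ?M" and ex: "EX x:elts W. sat elts (elts W) (case_nat x e) ph" for e ph
 proof -
  have "dt elts Vth (elts K) (%e'. case_nat (e' 0) e n)" for n
   by (cases n) (use e in \<open>auto intro: I.dt_var I.dt_const\<close>)
  from I.sat_dfn[OF W(2), of "%e'. case_nat (e' 0) e", OF this]
  have "dfn elts Vth (elts K) (%e'. e' 0 : elts W & sat elts (elts W) (case_nat (e' 0) e) ph)"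
   by (intro I.dfn_mem I.dt_var I.ds_elts I.dt_const W(2) dfn_conj)
  from el_ex[OF el this] have "EX x:elts K. x : elts W & sat elts (elts W) (case_nat x e) ph"
   using ex el_sub[OF elW] by blast
  then show ?thesis by blast
 qed
 have "sat elts ?M e ph \<longleftrightarrow> sat elts Vth e ph" if e: "range e \<subseteq> ?M" for e ph
 proof -
  have "sat elts ?M e ph \<longleftrightarrow> sat elts (elts W) e ph"
   by (rule tarski_vaught[OF _ tv e]) auto
  also have "\<dots> \<longleftrightarrow> sat elts Vth e ph" using elW e unfolding elementary_submodel_def by blast
  finally show ?thesis .
 qed
 moreover have "zero : ?M" using el_zero[OF el] el_zero[OF elW] by blast
 ultimately show ?thesis unfolding elementary_submodel_def M using el_sub[OF el] by blast
qed

lemma SS_inter: "K : SS ==> W : TT ==> W : elts K ==> mk (elts K \<inter> elts W) : SS"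
 unfolding SS_iff using el_inter[of K W] lep_mono[of "elts K \<inter> elts W" "elts K" "elts om" "elts om"] by (simp add: small_Int)

text \<open>A countable member of \<open>TT\<close> would be an element of itself, by closure under
  countable subsets.\<close>

lemma SS_TT_disj: "K : SS ==> K : TT ==> False"
 using TT_ctb[of K "elts K"] SS_ctb mem_irrefl[of K] by auto

end

section \<open>Order types\<close>

context zfc begin

text \<open>The Mostowski collapse of \<open>X\<close>, extended to arguments outside
  \<open>X\<close>.\<close>

definition cl :: "'a set => 'a => 'a" where
 "cl X = wfrec (R\<^sup>+) (%f x. mk (ap (mk (graph f (below x))) ` (elts x \<inter> X)))"

lemma dt_cl: "small X ==> F (%e. cl X (e 0))"
 by (rule recursion[where H="%x g. mk (ap g ` (elts x \<inter> X))", OF _ rec_def[OF cl_def]])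
   (intro dfn_intros UNIV_I ds_small)

lemma elts_cl: assumes X: "small X" shows "elts (cl X x) = cl X ` (elts x \<inter> X)"
proof -
 have "ap (mk (graph (cl X) (below x))) ` (elts x \<inter> X) = cl X ` (elts x \<inter> X)"
  by (intro image_cong refl ap_rec[OF dt_cl[OF X]]) (simp add: elts_below)
 then have "cl X x = mk (cl X ` (elts x \<inter> X))" by (subst rec_def[OF cl_def]) simp
 then show ?thesis using small_image[OF small_Int[OF small_elts X] dt_cl[OF X]] by simp
qed

definition "ords X \<longleftrightarrow> small X & (ALL x:X. Or x)"
lemma ords_small: "ords X ==> small X" by (simp add: ords_def)
lemma ords_Or: "ords X ==> x : X ==> Or x" by (simp add: ords_def)

lemma Ord_cl: assumes X0: "ords X" shows "Or x ==> Or (cl X x)"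
proof (induction x rule: wf_induct_rule[OF wfR])
 case (1 x)
 note X = ords_small[OF X0] ords_Or[OF X0]
 show ?case
 proof (rule OrdI)
  fix w assume "w : elts (cl X x)"
  then obtain y where y: "y : elts x" "y : X" "w = cl X y" unfolding elts_cl[OF X(1)] by blast
  then show "Or w" using 1(1)[of y] X(2) by (simp add: R_iff)
  have "elts y \<subseteq> elts x" using Ord_trans[OF 1(2) _ y(1)] by blast
  then show "elts w \<subseteq> elts (cl X x)" unfolding y(3) elts_cl[OF X(1)] by blast
 qed
qed

lemma cl_iff: assumes X0: "ords X" and xy: "x : X" "y : X" shows "x : elts y \<longleftrightarrow> cl X x : elts (cl X y)"
proof -
 note X = ords_small[OF X0] ords_Or[OF X0]
 show ?thesis
 proof
 assume "x : elts y" then show "cl X x : elts (cl X y)" unfolding elts_cl[OF X(1)] using xy by blast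
next
 assume a: "cl X x : elts (cl X y)"
 have "cl X y : elts (cl X x)" if "y : elts x" unfolding elts_cl[OF X(1), of x] using xy that by blast
 then show "x : elts y" using a Ord_linear[OF X(2)[OF xy(1)] X(2)[OF xy(2)]] mem_irrefl Ord_trans[OF Ord_cl[OF X0 X(2)[OF xy(1)]] a] by blast
 qed
qed

lemma iso_unique: assumes X: "small X" and b: "Or be" "f ` X = elts be" "!!x y. x : X ==> y : X ==> x : elts y \<longleftrightarrow> f x : elts (f y)"
 shows "x : X ==> f x = cl X x"
proof (induction x rule: wf_induct_rule[OF wfR])
 case (1 x)
 have "elts (f x) = f ` (elts x \<inter> X)"
 proof (intro equalityI subsetI)
  fix z assume z: "z : elts (f x)"
  have "f x : elts be" using b(2) 1(2) by blast
  then have "z : elts be" using Ord_trans[OF b(1) z] by blast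
  then obtain w where "w : X" "z = f w" using b(2) by blast
  then show "z : f ` (elts x \<inter> X)" using b(3)[of w x] 1(2) z by blast
 qed (use b(3) 1(2) in blast)
 also have "\<dots> = cl X ` (elts x \<inter> X)" by (rule image_cong) (use 1(1) in \<open>auto simp: R_iff\<close>)
 also have "\<dots> = elts (cl X x)" using elts_cl[OF X] by simp
 finally show ?case by simp
qed

lemma otp: assumes X0: "ords X"
 shows "otp elts X = mk (cl X ` X)" "elts (otp elts X) = cl X ` X" "Or (otp elts X)"
  "Or be ==> f ` X = elts be ==> (!!x y. x : X ==> y : X ==> x : elts y \<longleftrightarrow> f x : elts (f y)) ==> be = otp elts X"
proof -
 note X = ords_small[OF X0] ords_Or[OF X0]
 let ?b = "mk (cl X ` X)"
 have e: "elts ?b = cl X ` X" using small_image[OF X(1) dt_cl[OF X(1)]] by simp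
 have O: "Or ?b"
 proof (rule OrdI)
  fix w assume "w : elts ?b"
  then obtain x where x: "x : X" "w = cl X x" unfolding e by blast
  show "Or w" unfolding x(2) by (rule Ord_cl[OF X0 X(2)[OF x(1)]])
  show "elts w \<subseteq> elts ?b" unfolding x(2) e elts_cl[OF X(1)] by blast
 qed
 have inj: "inj_on (cl X) X"
 proof (rule inj_onI)
  fix x y assume xy: "x : X" "y : X" "cl X x = cl X y"
  show "x = y" using Ord_linear[OF X(2)[OF xy(1)] X(2)[OF xy(2)]] cl_iff[OF X0 xy(1,2)] cl_iff[OF X0 xy(2,1)] mem_irrefl[of "cl X y"] xy(3) by auto
 qed
 have uniq: "be = ?b" if "Or be" "f ` X = elts be" "!!x y. x : X ==> y : X ==> x : elts y \<longleftrightarrow> f x : elts (f y)" for be f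
 proof -
  have "elts be = cl X ` X" unfolding that(2)[symmetric] by (rule image_cong[OF refl iso_unique[OF X(1) that]])
  then have "elts be = elts ?b" unfolding e .
  then show ?thesis by simp
 qed
 show eq: "otp elts X = ?b" unfolding otp_def
 proof (rule the_equality)
  show "Or ?b & (EX f. bij_betw f X (elts ?b) & (ALL x:X. ALL y:X. x : elts y \<longleftrightarrow> f x : elts (f y)))"
   by (intro conjI O exI[of _ "cl X"] ballI cl_iff[OF X0]) (simp_all add: bij_betw_def inj e)
  fix be assume "Or be & (EX f. bij_betw f X (elts be) & (ALL x:X. ALL y:X. x : elts y \<longleftrightarrow> f x : elts (f y)))"
  then obtain f where "Or be" "f ` X = elts be" "ALL x:X. ALL y:X. x : elts y \<longleftrightarrow> f x : elts (f y)" unfolding bij_betw_def by blast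
  then show "be = ?b" by (intro uniq) blast+
 qed
 show "elts (otp elts X) = cl X ` X" "Or (otp elts X)" unfolding eq using e O .
 show "Or be ==> f ` X = elts be ==> (!!x y. x : X ==> y : X ==> x : elts y \<longleftrightarrow> f x : elts (f y)) ==> be = otp elts X"
  unfolding eq by (rule uniq)
qed

lemma cl_mono: assumes X0: "ords X" and Y0: "ords Y" and XY: "X \<subseteq> Y"
 shows "Or x ==> elts (cl X x) \<subseteq> elts (cl Y x)"
proof (induction x rule: wf_induct_rule[OF wfR])
 case (1 x)
 note X = ords_small[OF X0] ords_Or[OF X0]
 note Y = ords_small[OF Y0] ords_Or[OF Y0]
 show ?case
 proof
  fix w assume "w : elts (cl X x)"
  then obtain y where y: "y : elts x" "y : X" "w = cl X y" unfolding elts_cl[OF X(1)] by blast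
  have O: "Or y" by (rule X(2)[OF y(2)])
  have "elts (cl X y) \<subseteq> elts (cl Y y)" using 1(1)[of y] y(1) O by (simp add: R_iff)
  then have "w = cl Y y | w : elts (cl Y y)" unfolding y(3) using Ord_subset[OF Ord_cl[OF X0 O] Ord_cl[OF Y0 O]] by blast
  moreover have "cl Y y : elts (cl Y x)" unfolding elts_cl[OF Y(1), of x] using y XY by blast
  ultimately show "w : elts (cl Y x)" using Ord_trans[OF Ord_cl[OF Y0 1(2)]] by blast
 qed
qed

text \<open>Collapsing along the larger set never gives a smaller ordinal. An element
  \<open>y\<close> of \<open>Y\<close> above all of \<open>X\<close> therefore collapses to an
  ordinal \<open>cl Y y\<close> that already bounds the order type of \<open>X\<close>.\<close>

lemma otp_mono: assumes X0: "ords X" and Y0: "ords Y" and XY: "X \<subseteq> Y"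
 shows "elts (otp elts X) \<subseteq> elts (otp elts Y)" "y : Y ==> X \<subseteq> elts y ==> otp elts X : elts (otp elts Y)"
proof -
 note X = ords_small[OF X0] ords_Or[OF X0]
 note Y = ords_small[OF Y0] ords_Or[OF Y0]
 have mem: "cl Y x : elts (otp elts Y)" if "x : Y" for x using otp(2)[OF Y0] that by blast
 have le: "cl X x = cl Y x | cl X x : elts (cl Y x)" if "x : X" for x
  using cl_mono[OF X0 Y0 XY X(2)[OF that]] Ord_subset[OF Ord_cl[OF X0 X(2)[OF that]] Ord_cl[OF Y0 X(2)[OF that]]] by blast
 show "elts (otp elts X) \<subseteq> elts (otp elts Y)"
 proof
  fix w assume "w : elts (otp elts X)"
  then obtain x where x: "x : X" "w = cl X x" unfolding otp(2)[OF X0] by blast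
  have xY: "x : Y" using x(1) XY by blast
  show "w : elts (otp elts Y)" using le[OF x(1)] unfolding x(2)
  proof
   assume "cl X x = cl Y x" then show "cl X x : elts (otp elts Y)" using mem[OF xY] by simp
  next
   assume "cl X x : elts (cl Y x)" then show "cl X x : elts (otp elts Y)" using mem[OF xY] Ord_trans[OF otp(3)[OF Y0]] by blast
  qed
 qed
 assume y: "y : Y" "X \<subseteq> elts y"
 have "cl X x : elts (cl Y y)" if x: "x : X" for x
 proof -
  have "cl Y x : elts (cl Y y)" unfolding elts_cl[OF Y(1), of y] using x XY y(2) by blast
  then show ?thesis using le[OF x] by (elim disjE) (simp, rule Ord_trans[OF Ord_cl[OF Y0 Y(2)[OF y(1)]]])
 qed
 then have "elts (otp elts X) \<subseteq> elts (cl Y y)" unfolding otp(2)[OF X0] by blast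
 then have "otp elts X = cl Y y | otp elts X : elts (cl Y y)" using Ord_subset[OF otp(3)[OF X0] Ord_cl[OF Y0 Y(2)[OF y(1)]]] by blast
 then show "otp elts X : elts (otp elts Y)" using mem[OF y(1)]
  by (elim disjE) (simp, rule Ord_trans[OF otp(3)[OF Y0]])
qed

end

context inacc begin

definition "ot N = otp elts (elts N \<inter> elts th)"
definition "dl N = mk (elts N \<inter> elts om1)"

lemma Xth: "ords (elts N \<inter> elts th)"
 unfolding ords_def using th_Or by (auto intro: small_Int)
lemma elts_dl: "elts (dl N) = elts N \<inter> elts om1" by (simp add: dl_def small_Int)
lemma dt_dl[dfn_intros]: "F t ==> F (%e. dl (t e))"
 unfolding dl_def by (intro dfn_intros UNIV_I)
lemma ot_Or: "Or (ot N)" unfolding ot_def by (rule otp(3)[OF Xth])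

text \<open>The isomorphism can be taken to be a set, the graph of the collapse, so having a given
  order type is a formula.\<close>

lemma dt_ot[dfn_intros]: "F t ==> F (%e. ot (t e))"
proof (rule dt_1[where f=ot])
 let ?P = "%y N. Or y & (EX j. (ALL x:elts N \<inter> elts th. ap j x : elts y) & (ALL z:elts y. EX x:elts N \<inter> elts th. z = ap j x) &
   (ALL x:elts N \<inter> elts th. ALL x':elts N \<inter> elts th. x : elts x' \<longleftrightarrow> ap j x : elts (ap j x')))"
 have "y = ot N \<longleftrightarrow> ?P y N" for y N
 proof
  let ?X = "elts N \<inter> elts th"
  assume y: "y = ot N"
  let ?j = "mk (graph (cl ?X) ?X)"
  have "elts ?j = graph (cl ?X) ?X" using small_graph[OF ords_small[OF Xth] dt_cl[OF ords_small[OF Xth]]] by simp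
  then have j: "ap ?j x = cl ?X x" if "x : ?X" for x using ap_graph that by blast
  have e: "elts y = cl ?X ` ?X" unfolding y ot_def by (rule otp(2)[OF Xth])
  have "ALL x:?X. ALL x':?X. x : elts x' \<longleftrightarrow> ap ?j x : elts (ap ?j x')"
  proof (intro ballI)
   fix x x' assume x: "x : ?X" "x' : ?X"
   show "x : elts x' \<longleftrightarrow> ap ?j x : elts (ap ?j x')" unfolding j[OF x(1)] j[OF x(2)] by (rule cl_iff[OF Xth x])
  qed
  moreover have "ALL x:?X. ap ?j x : elts y" unfolding e using j by simp
  moreover have "ALL z:elts y. EX x:?X. z = ap ?j x" unfolding e using j by fastforce
  moreover have "Or y" unfolding y by (rule ot_Or)
  ultimately show "?P y N" by blast
 next
  assume "?P y N"
  then obtain j where j: "Or y" "ALL x:elts N \<inter> elts th. ap j x : elts y" "ALL z:elts y. EX x:elts N \<inter> elts th. z = ap j x"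
   "ALL x:elts N \<inter> elts th. ALL x':elts N \<inter> elts th. x : elts x' \<longleftrightarrow> ap j x : elts (ap j x')" by blast
  have "ap j ` (elts N \<inter> elts th) = elts y" using j(2,3) by blast
  from otp(4)[OF Xth j(1) this] j(4) show "y = ot N" unfolding ot_def by blast
 qed
 moreover have "D (%e. ?P (e 0) (e 1))" by (intro dfn_intros UNIV_I)
 ultimately show "F (%e. ot (e 0))" unfolding dt_def by simp
qed

lemma ot_mono: "elts N \<subseteq> elts M ==> elts (ot N) \<subseteq> elts (ot M)"
 unfolding ot_def by (rule otp_mono(1)[OF Xth Xth]) auto
text \<open>This strictness is what makes the order type drop when a node is cut down by a
  transitive element of itself.\<close>

lemma ot_less: "elts N \<subseteq> elts M ==> y : elts M ==> y : elts th ==> elts N \<inter> elts th \<subseteq> elts y ==> ot N : elts (ot M)"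
 unfolding ot_def by (rule otp_mono(2)[OF Xth Xth, where y=y]) auto
lemma ot_om1: "N : SS ==> ot N : elts om1"
proof -
 assume "N : SS"
 then have "ctb (elts N \<inter> elts th)" using lep_mono[of "elts N \<inter> elts th" "elts N" "elts om" "elts om"] SS_ctb by blast
 then have "ctb (elts (ot N))" unfolding ot_def otp(2)[OF Xth] by (rule ctb_image[OF ords_small[OF Xth] dt_cl[OF ords_small[OF Xth]]])
 then show ?thesis unfolding om1_iff using ot_Or by blast
qed
lemma om1_sub: "el K ==> x : elts K ==> x : elts om1 ==> elts x \<subseteq> elts K"
 by (rule el_ctb_sub) (auto simp: om1_iff)
lemma dl_om1: assumes "N : SS" shows "dl N : elts om1"
proof -
 have "Or (dl N)"
 proof (rule OrdI)
  fix x assume x: "x : elts (dl N)"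
  then show "Or x" unfolding elts_dl using Ord_mem[OF O1] by blast
  show "elts x \<subseteq> elts (dl N)" using x om1_sub[OF SS_el[OF assms]] Ord_trans[OF O1] unfolding elts_dl by blast
 qed
 moreover have "ctb (elts (dl N))" unfolding elts_dl using lep_mono[of "elts N \<inter> elts om1" "elts N" "elts om" "elts om"] SS_ctb[OF assms] by blast
 ultimately show ?thesis unfolding om1_iff by blast
qed

end

section \<open>Side conditions\<close>

context inacc begin

abbreviation lt :: "'a => 'a => bool" where "lt x y \<equiv> (x, y) : R\<^sup>+"
abbreviation cap :: "'a => 'a => 'a" (infixl "\<sqinter>" 70) where "x \<sqinter> y \<equiv> mk (elts x \<inter> elts y)"

lemma elts_cap[simp]: "elts (x \<sqinter> y) = elts x \<inter> elts y" by (simp add: small_Int)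
lemma lt_trans: "lt x y ==> lt y z ==> lt x z" by (rule trancl_trans)
lemma mem_lt: "x : elts y ==> lt x y" by (rule elts_Rp)
lemma lt_irrefl: "~ lt x x" by (rule Rp_irrefl)
lemma lt_asym: "lt x y ==> ~ lt y x" using lt_trans lt_irrefl by blast

lemma sub_not_lt: "elts y \<subseteq> elts x ==> ~ lt x y"
proof
 assume "elts y \<subseteq> elts x" "lt x y"
 then have "rk x : elts (rk y)" "elts (rk y) \<subseteq> elts (rk x)" using rk_Rp rk_subset by auto
 then show False using mem_irrefl by blast
qed

lemma lt_TT: "W : TT ==> lt x W \<longleftrightarrow> x : elts W"
proof
 assume W: "W : TT" and l: "lt x W"
 from l show "x : elts W"
  by (induction rule: converse_trancl_induct) (use TT_trans[OF W] in \<open>auto simp: R_iff\<close>)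
qed (rule mem_lt)

lemma TT_linear: "U : TT ==> W : TT ==> U : elts W | U = W | W : elts U"
proof -
 assume "U : TT" "W : TT"
 then obtain a b where a: "U = Vs a" "Or a" and b: "W = Vs b" "Or b" using TT_E by metis
 show ?thesis using Ord_linear[OF a(2) b(2)] Vs_mono[OF a(2)] Vs_mono[OF b(2)] unfolding a(1) b(1) by blast
qed

text \<open>Induction using closure under countable subsets. Consequently cutting a node by a
  transitive one leaves its trace on \<open>\<omega>\<^sub>1\<close> unchanged.\<close>

lemma TT_om1: "W : TT ==> elts om1 \<subseteq> elts W"
proof
 fix x assume W: "W : TT" and "x : elts om1"
 then show "x : elts W"
 proof (induction x rule: wf_induct_rule[OF wfR])
  case (1 x)
  have "y : elts W" if "y : elts x" for y using 1(1)[of y] that W Ord_trans[OF O1 that 1(3)] by (simp add: R_iff)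
  then have "mk (elts x) : elts W" using 1(3) by (intro TT_ctb[OF W]) (auto simp: om1_iff)
  then show ?case by simp
 qed
qed

text \<open>How an earlier node relates to a later one in an \<open>\<in>\<close>-chain. Past a
  countable node membership is inherited, since a countable element of a node is a subset of it;
  past a transitive node \<open>U\<close> it may be lost, and then \<open>U\<close> itself records
  the order.\<close>

definition "ll m N M \<longleftrightarrow> N : elts M | (EX U:m \<inter> TT. N : elts U & lt U M)"
text \<open>An \<open>\<in>\<close>-chain described without its enumeration, which makes unions of
  chains easy to check; \<open>enum_chain\<close> and \<open>chain_enum\<close> show the
  equivalence.\<close>

definition "chain m \<longleftrightarrow> finite m & m \<subseteq> SS \<union> TT & (ALL N:m. ALL M:m. N = M | ll m N M | ll m M N)"
definition "nice m \<longleftrightarrow> chain m & (ALL M:m. ALL N:m. M \<sqinter> N : m)"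
definition "isucc m M N \<longleftrightarrow> N : m & lt M N & ~ (EX K:m. lt M K & lt K N)"
definition "star m \<longleftrightarrow> (ALL M:m \<inter> SS. ALL N:m \<inter> SS. dl N : elts M --> ot N : elts M)"
text \<open>The clause \<open>d M : Vth\<close> speaks for the top node; elsewhere it agrees with
  membership in the successor, a subset of \<open>V\<^sub>\<theta>\<close>.\<close>

definition "deco m d \<longleftrightarrow> (ALL M:m. finite (elts (d M)) & d M : Vth & (ALL N. isucc m M N --> d M : elts N))"
definition "cond m d \<longleftrightarrow> nice m & star m & deco m d"
text \<open>For \<open>m \<subseteq> m'\<close> this is the inclusion of the height functions
  (\<open>height_hle\<close>): at a point where the height was already defined, no node of
  \<open>m'\<close> may exceed the old nodes.\<close>

definition "hle m m' \<longleftrightarrow> (ALL N:m' \<inter> SS. ALL a:elts N \<inter> elts th. (EX K:m \<inter> SS. a : elts K & dl K = dl N) -->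
  (EX K:m \<inter> SS. a : elts K & dl K = dl N & elts (ot N) \<subseteq> elts (ot K)))"

lemma ll_lt: "ll m N M ==> lt N M"
 unfolding ll_def using mem_lt lt_trans by blast
lemma node_el: "M : SS \<union> TT ==> el M" using SS_el TT_el by blast
lemma node_Vth: "M : SS \<union> TT ==> M : Vth"
proof -
 assume "M : SS \<union> TT"
 moreover have "M : Vth" if M: "M : SS" using Vth_rk[OF el_sub[OF SS_el[OF M]] tiny_ctb[OF SS_ctb[OF M]]] .
 ultimately show ?thesis using TT_Vth by blast
qed

lemma chainD: "chain m ==> N : m ==> M : m ==> N = M | ll m N M | ll m M N" unfolding chain_def by blast
lemma chain_lin: "chain m ==> N : m ==> M : m ==> N = M | lt N M | lt M N"
 using chainD ll_lt by blast
lemma chain_ll: "chain m ==> N : m ==> M : m ==> lt N M ==> ll m N M"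
 using chainD[of m N M] ll_lt lt_asym lt_irrefl by blast
lemma chain_node: "chain m ==> M : m ==> M : SS \<union> TT" unfolding chain_def by blast
lemma chain_finite: "chain m ==> finite m" unfolding chain_def by blast
lemma SS_sub: "M : SS \<union> TT ==> N : SS ==> N : elts M ==> elts N \<subseteq> elts M"
 using el_ctb_sub[OF node_el] SS_ctb by blast

lemma niceD: "nice m ==> chain m" "nice m ==> M : m ==> N : m ==> M \<sqinter> N : m" unfolding nice_def by blast+

lemma ctb_node: assumes "M : SS \<union> TT" "ctb (elts M)" shows "M : SS"
 using assms TT_ctb[of M "elts M"] mem_irrefl[of M] by auto

lemma cap_SS: assumes "nice m" "M : m" "N : m" "M : SS" shows "M \<sqinter> N : m \<inter> SS" "N \<sqinter> M : m \<inter> SS"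
proof -
 have 1: "M \<sqinter> N : m" by (rule niceD(2)[OF assms(1-3)])
 have "ctb (elts (M \<sqinter> N))" by (rule lep_mono[OF _ SS_ctb[OF assms(4)] subset_refl]) simp
 then have "M \<sqinter> N : SS" by (rule ctb_node[OF chain_node[OF niceD(1)[OF assms(1)] 1]])
 with 1 show "M \<sqinter> N : m \<inter> SS" "N \<sqinter> M : m \<inter> SS" by (simp_all add: Int_commute)
qed

text \<open>Induction along the list. A countable \<open>Ms ! j\<close> is a subset of its successor
  and passes membership on; a transitive \<open>Ms ! j\<close> becomes the separating node in the
  second alternative of \<open>ll\<close>.\<close>

lemma enum_chain: assumes e: "enumerates elts Ms m" and n: "elts m \<subseteq> SS \<union> TT"
 shows "chain (elts m)" "sorted_wrt lt Ms"
proof -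
 have s: "successively (%M N. M : elts N) Ms" and set: "set Ms = elts m" using e unfolding enumerates_def by auto
 have nth: "Ms ! i : elts (Ms ! Suc i)" if "Suc i < length Ms" for i using s that by (simp add: successively_conv_nth)
 have node: "Ms ! i : SS \<union> TT" "Ms ! i : elts m" if "i < length Ms" for i using that n set by auto
 have L: "ll (elts m) (Ms ! i) (Ms ! j)" if "i < j" "j < length Ms" for i j
  using that
 proof (induction j)
  case (Suc j)
  show ?case
  proof (cases "i = j")
   case True then show ?thesis using nth[of j] Suc(3) by (simp add: ll_def)
  next
   case False
   then have ih: "ll (elts m) (Ms ! i) (Ms ! j)" using Suc by simp
   have m: "Ms ! j : elts (Ms ! Suc j)" using nth Suc(3) by simp
   show ?thesis
   proof (cases "EX U:elts m \<inter> TT. Ms ! i : elts U & lt U (Ms ! j)")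
    case True then show ?thesis unfolding ll_def using lt_trans[OF _ mem_lt[OF m]] by blast
   next
    case False
    then have ij: "Ms ! i : elts (Ms ! j)" using ih unfolding ll_def by blast
    show ?thesis
    proof (cases "Ms ! j : SS")
     case True
     then have "elts (Ms ! j) \<subseteq> elts (Ms ! Suc j)" using SS_sub[OF node(1)[OF Suc(3)] _ m] by blast
     then show ?thesis using ij unfolding ll_def by blast
    next
     case False
     then have "Ms ! j : elts m \<inter> TT" using node[of j] Suc(3) by auto
     then show ?thesis unfolding ll_def using ij mem_lt[OF m] by blast
    qed
   qed
  qed
 qed simp
 show "sorted_wrt lt Ms" unfolding sorted_wrt_iff_nth_less using L ll_lt by blast
 have "N = M | ll (elts m) N M | ll (elts m) M N" if NM: "N : elts m" "M : elts m" for N M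
 proof -
  obtain i j where ij: "i < length Ms" "N = Ms ! i" "j < length Ms" "M = Ms ! j" using NM set by (metis in_set_conv_nth)
  show ?thesis using L[of i j] L[of j i] ij by (cases i j rule: linorder_cases) auto
 qed
 then show "chain (elts m)" unfolding chain_def using n set[symmetric] by simp
qed

text \<open>Remove the \<open>lt\<close>-greatest node \<open>M\<close>. No transitive node lies
  strictly between the last remaining node and \<open>M\<close>, so the second alternative of
  \<open>ll\<close> is impossible and the last node is an element of \<open>M\<close>.\<close>

lemma chain_enum: "chain m ==> EX Ms. set Ms = m & sorted_wrt lt Ms & successively (%M N. M : elts N) Ms"
proof (induction "card m" arbitrary: m)
 case 0
 then have "m = {}" using chain_finite by auto
 then show ?case by (intro exI[of _ "[]"]) auto
next
 case (Suc n)
 have fin: "finite m" by (rule chain_finite[OF Suc(3)])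
 have ne: "m ~= {}" using Suc(2) by auto
 have "EX M:m. ALL N:m. ~ lt M N"
 proof (rule finite_acyclic_wf_converse[THEN wfE_min, of "R\<^sup>+ \<inter> m \<times> m"])
  show "finite (R\<^sup>+ \<inter> m \<times> m)" using fin by auto
  show "acyclic (R\<^sup>+ \<inter> m \<times> m)" by (rule acyclic_subset[OF wf_acyclic[OF wfRp]]) auto
  show "(SOME x. x : m) : m" using ne some_in_eq by blast
  fix z assume "z : m" and z: "!!y. (y, z) : (R\<^sup>+ \<inter> m \<times> m)\<inverse> ==> y ~: m"
  then show "EX M:m. ALL N:m. ~ lt M N" by blast
 qed
 then obtain M where M: "M : m" and max: "!!N. N : m ==> ~ lt M N" by blast
 let ?m = "m - {M}"
 have "ll ?m N K" if "ll m N K" "K : m" for N K using that max[OF that(2)] unfolding ll_def by blast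
 then have ch: "chain ?m" using Suc(3) unfolding chain_def by blast
 have "n = card ?m" using Suc(2) M fin by simp
 from Suc(1)[OF this ch] obtain Ms where Ms: "set Ms = ?m" "sorted_wrt lt Ms" "successively (%M N. M : elts N) Ms" by blast
 have below: "lt N M" if "N : ?m" for N using chain_lin[OF Suc(3), of N M] that M max by blast
 have "last Ms : elts M" if Mse: "Ms ~= []"
 proof -
  have lm: "last Ms : ?m" using last_in_set[OF Mse] unfolding Ms(1) .
  then have lm': "last Ms : m" by (rule DiffD1)
  have "ll m (last Ms) M" by (rule chain_ll[OF Suc(3) lm' M below[OF lm]])
  moreover have False if U: "U : m" "last Ms : elts U" "lt U M" for U
  proof -
   have "U ~= M" using U(3) lt_irrefl by metis
   then have "U : set Ms" unfolding Ms(1) using U(1) by simp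
   then obtain i where i: "i < length Ms" "U = Ms ! i" by (metis in_set_conv_nth)
   have l: "last Ms = Ms ! (length Ms - 1)" using Mse by (rule last_conv_nth)
   have "U = last Ms | lt U (last Ms)"
   proof (cases "i = length Ms - 1")
    case False then have "i < length Ms - 1" using i(1) by simp
    then show ?thesis using Ms(2) i(2) l Mse unfolding sorted_wrt_iff_nth_less by simp
   qed (use i l in simp)
   then show False
   proof
    assume "U = last Ms" then show False using U(2) mem_irrefl by simp
   next
    assume "lt U (last Ms)" then show False using lt_asym[OF mem_lt[OF U(2)]] by simp
   qed
  qed
  ultimately show ?thesis unfolding ll_def by (meson IntE)
 qed
 then have "successively (%M N. M : elts N) (Ms @ [M])" using Ms(3) by (auto simp: successively_append_iff)
 moreover have "sorted_wrt lt (Ms @ [M])" using Ms(1,2) below by (auto simp: sorted_wrt_append)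
 moreover have "set (Ms @ [M]) = m" using Ms(1) M by auto
 ultimately show ?case by blast
qed

lemma isucc_nth: assumes s: "sorted_wrt lt Ms" "set Ms = m" and i: "i < length Ms"
 shows "isucc m (Ms ! i) N \<longleftrightarrow> Suc i < length Ms & N = Ms ! Suc i"
proof -
 have L: "lt (Ms ! a) (Ms ! b)" if "a < b" "b < length Ms" for a b using s(1) that unfolding sorted_wrt_iff_nth_less by blast
 have I: "a < b" if "lt (Ms ! a) (Ms ! b)" "a < length Ms" "b < length Ms" for a b
  using that L[of b a] lt_asym lt_irrefl by (metis linorder_neqE_nat)
 show ?thesis
 proof
  assume a: "isucc m (Ms ! i) N"
  then obtain j where j: "j < length Ms" "N = Ms ! j" unfolding isucc_def s(2)[symmetric] by (metis in_set_conv_nth)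
  have ij: "i < j" using I[of i j] a j i unfolding isucc_def by blast
  have "j = Suc i"
  proof (rule ccontr)
   assume "j ~= Suc i"
   then have "Suc i < j" using ij by simp
   moreover have "Ms ! Suc i : m" using s(2) \<open>Suc i < j\<close> j(1) by auto
   ultimately show False using a L[of i "Suc i"] L[of "Suc i" j] j unfolding isucc_def by auto
  qed
  then show "Suc i < length Ms & N = Ms ! Suc i" using j by simp
 next
  assume a: "Suc i < length Ms & N = Ms ! Suc i"
  have "~ (lt (Ms ! i) K & lt K N)" if K: "K : m" for K
  proof
   assume l: "lt (Ms ! i) K & lt K N"
   obtain j where j: "j < length Ms" "K = Ms ! j" using K unfolding s(2)[symmetric] by (metis in_set_conv_nth)
   have "i < j" "j < Suc i" using I[of i j] I[of j "Suc i"] l j a i by auto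
   then show False by simp
  qed
  then show "isucc m (Ms ! i) N" unfolding isucc_def using a L[of i "Suc i"] s(2) by auto
 qed
qed

definition "cd m d = pr (mk m) (mk (graph d m))"

lemma small_fgraph: "finite m ==> small (graph d m)" unfolding graph_def by (rule small_finite) simp
lemma elts_fgraph: "finite m ==> elts (mk (graph d m)) = graph d m" by (simp add: small_fgraph)
lemma ap_fgraph: "finite m ==> M : m ==> ap (mk (graph d m)) M = d M" by (rule ap_graph[OF elts_fgraph])
lemma app_fgraph: "finite m ==> M : m ==> app elts (mk (graph d m)) M = d M"
 unfolding app_def elts_fgraph by (rule the_equality) simp_all

lemma side_condition_iff: "side_condition elts SS TT m \<longleftrightarrow> nice (elts m)"
proof
 assume a: "side_condition elts SS TT m"
 then have n: "elts m \<subseteq> SS \<union> TT" and "EX Ms. enumerates elts Ms m" and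
  c: "ALL M:elts m. ALL N:elts m. EX K:elts m. elts K = elts M \<inter> elts N" unfolding side_condition_def by blast+
 then obtain Ms where "enumerates elts Ms m" by blast
 from enum_chain(1)[OF this n] have "chain (elts m)" .
 moreover have "M \<sqinter> N : elts m" if "M : elts m" "N : elts m" for M N using c that by (metis mk_elts)
 ultimately show "nice (elts m)" unfolding nice_def by blast
next
 assume a: "nice (elts m)"
 obtain Ms where "set Ms = elts m & sorted_wrt lt Ms & successively (%M N. M : elts N) Ms" using chain_enum[OF niceD(1)[OF a]] by blast
 then have "enumerates elts Ms m" unfolding enumerates_def by blast
 moreover have "EX K:elts m. elts K = elts M \<inter> elts N" if "M : elts m" "N : elts m" for M N
  using niceD(2)[OF a that] elts_cap by blast
 ultimately show "side_condition elts SS TT m" unfolding side_condition_def using chain_node[OF niceD(1)[OF a]] by blast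
qed

lemma decoration_iff: assumes m: "nice m" shows "decoration elts th (mk m) (mk (graph d m)) \<longleftrightarrow> deco m d"
proof -
 have fin: "finite m" by (rule chain_finite[OF niceD(1)[OF m]])
 have em: "elts (mk m) = m" by (simp add: small_finite fin)
 have node: "m \<subseteq> SS \<union> TT" using chain_node[OF niceD(1)[OF m]] by blast
 have g: "EX f. is_graph elts (mk (graph d m)) (mk m) f" unfolding is_graph_def em elts_fgraph[OF fin] by (auto simp: graph_def)
 let ?c = "%Ms i. finite (elts (app elts (mk (graph d m)) (Ms ! i))) &
    app elts (mk (graph d m)) (Ms ! i) : elts (if Suc i < length Ms then Ms ! Suc i else Vs th)"
 have c: "?c Ms i \<longleftrightarrow> finite (elts (d (Ms ! i))) & d (Ms ! i) : Vth & (ALL N. isucc m (Ms ! i) N --> d (Ms ! i) : elts N)"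
  if Ms: "set Ms = m" "sorted_wrt lt Ms" and i: "i < length Ms" for Ms i
 proof -
  have mi: "Ms ! i : m" using Ms(1) i by auto
  have "elts (Ms ! Suc i) \<subseteq> Vth" if si: "Suc i < length Ms"
  proof -
   have "Ms ! Suc i : SS \<union> TT" using nth_mem[OF si] Ms(1) node by blast
   then show ?thesis by (rule el_sub[OF node_el])
  qed
  then show ?thesis unfolding app_fgraph[OF fin mi] isucc_nth[OF Ms(2,1) i] by auto
 qed
 show ?thesis
 proof
  assume a: "decoration elts th (mk m) (mk (graph d m))"
  obtain Ms where Ms: "set Ms = m" "sorted_wrt lt Ms" "successively (%M N. M : elts N) Ms" using chain_enum[OF niceD(1)[OF m]] by blast
  have "enumerates elts Ms (mk m)" unfolding enumerates_def em using Ms by simp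
  then have "?c Ms i" if "i < length Ms" for i using a that unfolding decoration_def by blast
  then have "ALL i<length Ms. finite (elts (d (Ms ! i))) & d (Ms ! i) : Vth & (ALL N. isucc m (Ms ! i) N --> d (Ms ! i) : elts N)" using c[OF Ms(1,2)] by blast
  then show "deco m d" unfolding deco_def Ms(1)[symmetric] by (metis in_set_conv_nth)
 next
  assume a: "deco m d"
  have "?c Ms i" if e: "enumerates elts Ms (mk m)" and i: "i < length Ms" for Ms i
  proof -
   have Ms: "set Ms = m" "sorted_wrt lt Ms" using e enum_chain(2)[OF e] node em unfolding enumerates_def by auto
   have "Ms ! i : m" using Ms(1) i by auto
   then show ?thesis unfolding c[OF Ms i] using a unfolding deco_def by blast
  qed
  then show "decoration elts th (mk m) (mk (graph d m))" unfolding decoration_def using g by blast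
 qed
qed

abbreviation "PP \<equiv> Mstar elts th SS TT"
abbreviation "PL \<equiv> Mstar_le elts th SS TT"

lemma condD: "cond m d ==> nice m" "cond m d ==> chain m" "cond m d ==> star m" "cond m d ==> deco m d" "cond m d ==> finite m"
 unfolding cond_def using niceD chain_finite by blast+

lemma PP_iff: "p : PP \<longleftrightarrow> (EX m d. cond m d & p = cd m d)"
proof
 assume "p : PP"
 then obtain m d where md: "p = pr m d" "side_condition elts SS TT m" "decoration elts th m d"
  and st: "ALL M:elts m \<inter> SS. ALL N:elts m \<inter> SS. mk (elts N \<inter> elts om1) : elts M --> otp elts (elts N \<inter> elts th) : elts M"
  unfolding Mstar_def by blast
 have n: "nice (elts m)" using md(2) side_condition_iff by blast
 obtain f where f: "is_graph elts d m f" using md(3) unfolding decoration_def by blast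
 then have d: "d = mk (graph f (elts m))" unfolding is_graph_def by (metis graph_def mk_elts)
 have "deco (elts m) f" using decoration_iff[OF n, of f] md(3) d by simp
 moreover have "star (elts m)" using st unfolding star_def dl_def ot_def .
 ultimately have "cond (elts m) f" using n unfolding cond_def by blast
 moreover have "p = cd (elts m) f" using md(1) d by (simp add: cd_def)
 ultimately show "EX m d. cond m d & p = cd m d" by blast
next
 assume "EX m d. cond m d & p = cd m d"
 then obtain m d where md: "cond m d" "p = cd m d" by blast
 have em: "elts (mk m) = m" by (simp add: small_finite condD(5)[OF md(1)])
 have 1: "side_condition elts SS TT (mk m)" unfolding side_condition_iff em by (rule condD(1)[OF md(1)])
 have 2: "decoration elts th (mk m) (mk (graph d m))" using decoration_iff[OF condD(1)[OF md(1)]] condD(4)[OF md(1)] by blast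
 have 3: "ALL M:m \<inter> SS. ALL N:m \<inter> SS. mk (elts N \<inter> elts om1) : elts M --> otp elts (elts N \<inter> elts th) : elts M"
  using condD(3)[OF md(1)] unfolding star_def dl_def ot_def .
 show "p : PP" unfolding Mstar_def using 1 2 3 md(2) em unfolding cd_def by blast
qed

lemma max_ord_eq: assumes "!!x. x : X ==> Or x" "m : X" "!!x. x : X ==> elts x \<subseteq> elts m" shows "max_ord elts X = m"
 unfolding max_ord_def
proof (rule the_equality)
 show "m : X & (ALL x:X. x = m | x : elts m)" using assms Ord_subset by blast
 fix k assume k: "k : X & (ALL x:X. x = k | x : elts k)"
 then have "m = k | m : elts k" using assms(2) by blast
 then show "k = m" using assms(3)[of k] k mem_irrefl by blast
qed

lemma fin_max: "finite X ==> X ~= {} ==> (!!x. x : X ==> Or x) ==> EX m:X. ALL x:X. elts x \<subseteq> elts m"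
proof (induction rule: finite_ne_induct)
 case (insert x X)
 then obtain m where m: "m : X" "ALL x:X. elts x \<subseteq> elts m" by blast
 have "elts x \<subseteq> elts m | elts m \<subseteq> elts x" using Ord_not_mem[of x m] Ord_subset[of x m] insert(5) m(1) by blast
 then show ?case using m by blast
qed blast

definition "HN m a x = {N:m \<inter> SS. a : elts N & dl N = x}"

lemma height: assumes m: "finite (elts m)"
 shows "height_fun elts th SS m (a, x) = Some y \<longleftrightarrow> a : elts th & x : elts om1 & (EX N:HN (elts m) a x. y = ot N & (ALL K:HN (elts m) a x. elts (ot K) \<subseteq> elts y))"
proof -
 have e: "{M : elts m \<inter> SS. a : elts M & elts M \<inter> elts om1 = elts x} = HN (elts m) a x"
  unfolding HN_def using elts_dl by (metis elts_inject)
 have f: "height_fun elts th SS m (a, x) = (if a : elts th & x : elts om1 & HN (elts m) a x ~= {} then Some (max_ord elts (ot ` HN (elts m) a x)) else None)"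
  unfolding height_fun_def ot_def[symmetric] by (simp only: prod.case Let_def e)
 show ?thesis
 proof (cases "HN (elts m) a x = {}")
  case True then show ?thesis unfolding f by simp
 next
  case False
  have "finite (ot ` HN (elts m) a x)" using m unfolding HN_def by simp
  from fin_max[OF this] False obtain k where k: "k : ot ` HN (elts m) a x" "ALL x:ot ` HN (elts m) a x. elts x \<subseteq> elts k" using ot_Or by blast
  have mo: "max_ord elts (ot ` HN (elts m) a x) = k" by (rule max_ord_eq) (use k ot_Or in auto)
  have "(EX N:HN (elts m) a x. y = ot N & (ALL K:HN (elts m) a x. elts (ot K) \<subseteq> elts y)) \<longleftrightarrow> k = y"
  proof
   assume "EX N:HN (elts m) a x. y = ot N & (ALL K:HN (elts m) a x. elts (ot K) \<subseteq> elts y)"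
   then have "elts k \<subseteq> elts y" "elts y \<subseteq> elts k" using k by blast+
   then have "elts k = elts y" by blast
   then show "k = y" by simp
  qed (use k in blast)
  then show ?thesis unfolding f mo using False by auto
 qed
qed

lemma height_hle: assumes m: "finite (elts m)" "finite (elts m')" "elts m \<subseteq> elts m'"
 shows "height_fun elts th SS m \<subseteq>\<^sub>m height_fun elts th SS m' \<longleftrightarrow> hle (elts m) (elts m')"
proof
 assume a: "height_fun elts th SS m \<subseteq>\<^sub>m height_fun elts th SS m'"
 show "hle (elts m) (elts m')" unfolding hle_def
 proof (intro ballI impI)
  fix N a assume N: "N : elts m' \<inter> SS" "a : elts N \<inter> elts th" and "EX K:elts m \<inter> SS. a : elts K & dl K = dl N"
  then have ne: "HN (elts m) a (dl N) ~= {}" unfolding HN_def by blast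
  have "finite (ot ` HN (elts m) a (dl N))" using m unfolding HN_def by simp
  from fin_max[OF this] ne obtain k where k: "k : ot ` HN (elts m) a (dl N)" "ALL x:ot ` HN (elts m) a (dl N). elts x \<subseteq> elts k" using ot_Or by blast
  have "height_fun elts th SS m (a, dl N) = Some k" unfolding height[OF m(1)] using k N dl_om1[of N] by blast
  then have "height_fun elts th SS m' (a, dl N) = Some k" using a unfolding map_le_def by (metis domI)
  then have "ALL K:HN (elts m') a (dl N). elts (ot K) \<subseteq> elts k" unfolding height[OF m(2)] by blast
  moreover have "N : HN (elts m') a (dl N)" using N unfolding HN_def by blast
  ultimately show "EX K:elts m \<inter> SS. a : elts K & dl K = dl N & elts (ot N) \<subseteq> elts (ot K)" using k(1) unfolding HN_def by blast
 qed
next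
 assume a: "hle (elts m) (elts m')"
 have "height_fun elts th SS m' (b, x) = Some y" if h: "height_fun elts th SS m (b, x) = Some y" for b x y
 proof -
  obtain N where N: "b : elts th" "x : elts om1" "N : HN (elts m) b x" "y = ot N" "ALL K:HN (elts m) b x. elts (ot K) \<subseteq> elts y"
   using h unfolding height[OF m(1)] by blast
  have "elts (ot K) \<subseteq> elts y" if K: "K : HN (elts m') b x" for K
  proof -
   have K2: "K : elts m' \<inter> SS" "b : elts K \<inter> elts th" "dl K = x" using K N(1) unfolding HN_def by auto
   have "EX L:elts m \<inter> SS. b : elts L & dl L = dl K" using N(3) unfolding HN_def K2(3) by blast
   then obtain L where L: "L : elts m \<inter> SS" "b : elts L" "dl L = dl K" "elts (ot K) \<subseteq> elts (ot L)" using a K2(1,2) unfolding hle_def by blast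
   then have "L : HN (elts m) b x" unfolding HN_def K2(3) by blast
   then show ?thesis using N(5) L(4) by blast
  qed
  moreover have "N : HN (elts m') b x" using N(3) m(3) unfolding HN_def by blast
  ultimately show ?thesis unfolding height[OF m(2)] using N(1,2,4) by blast
 qed
 then show "height_fun elts th SS m \<subseteq>\<^sub>m height_fun elts th SS m'" unfolding map_le_def dom_def by force
qed

definition "cle m' d' m d \<longleftrightarrow> cond m' d' & cond m d & m \<subseteq> m' & (ALL M:m. elts (d M) \<subseteq> elts (d' M)) & hle m m'"

lemma cd_inj: assumes "finite m" "finite m'" shows "cd m d = cd m' d' \<longleftrightarrow> m = m' & (ALL M:m. d M = d' M)"
proof
 assume "cd m d = cd m' d'"
 then have e: "mk m = mk m'" "mk (graph d m) = mk (graph d' m')" by (simp_all add: cd_def)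
 have "elts (mk m) = elts (mk m')" "elts (mk (graph d m)) = elts (mk (graph d' m'))" using e by simp_all
 then have "m = m'" "graph d m = graph d' m'" using assms by (simp_all add: small_finite small_fgraph)
 moreover have "d M = d' M" if "M : m" for M
 proof -
  have "pr M (d M) : graph d' m'" using that calculation(2)[symmetric] by simp
  then show ?thesis by simp
 qed
 ultimately show "m = m' & (ALL M:m. d M = d' M)" by blast
next
 assume "m = m' & (ALL M:m. d M = d' M)"
 then have "m = m'" "graph d m = graph d' m'" by (auto simp: graph_def)
 then show "cd m d = cd m' d'" by (simp add: cd_def)
qed

lemma PL_iff: assumes c: "cond m' d'" "cond m d" shows "PL (cd m' d') (cd m d) \<longleftrightarrow> cle m' d' m d"
proof -
 have f: "finite m" "finite m'" using condD(5) c by auto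
 have e: "elts (mk m) = m" "elts (mk m') = m'" using f by (simp_all add: small_finite)
 have P: "cd m' d' : PP" "cd m d : PP" using c PP_iff by blast+
 let ?b = "elts (mk m) \<subseteq> elts (mk m') & (ALL M:elts (mk m). elts (app elts (mk (graph d m)) M) \<subseteq> elts (app elts (mk (graph d' m')) M)) &
   height_fun elts th SS (mk m) \<subseteq>\<^sub>m height_fun elts th SS (mk m')"
 have "PL (cd m' d') (cd m d) \<longleftrightarrow> ?b"
  unfolding Mstar_le_def using P unfolding cd_def by auto
 also have "\<dots> \<longleftrightarrow> m \<subseteq> m' & (ALL M:m. elts (d M) \<subseteq> elts (d' M)) & hle m m'"
  using height_hle[of "mk m" "mk m'"] unfolding e using f app_fgraph[OF f(1)] app_fgraph[OF f(2)] by (auto simp: subset_iff)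
 finally show ?thesis unfolding cle_def using c by blast
qed

end

context inacc begin

section \<open>Amalgamation\<close>

lemma cap_lt: assumes "K : SS" "U : TT" shows "K \<sqinter> U : elts U" "lt (K \<sqinter> U) U"
proof -
 have "ctb (elts K \<inter> elts U)" by (rule lep_mono[OF _ SS_ctb[OF assms(1)] subset_refl]) simp
 then show "K \<sqinter> U : elts U" by (intro TT_ctb[OF assms(2)]) (simp_all add: small_Int)
 then show "lt (K \<sqinter> U) U" by (rule mem_lt)
qed

text \<open>A node below a countable node \<open>K\<close> that is not an element of \<open>K\<close> lies in an interval
 \<open>[K \<inter> U, U)\<close> with \<open>U \<in> K\<close> transitive.\<close>

lemma gap: assumes m: "nice m"
 shows "K : m \<inter> SS ==> Z : m ==> lt Z K ==> Z ~: elts K ==>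
  EX U:m \<inter> TT. U : elts K & Z : elts U & (Z = K \<sqinter> U | lt (K \<sqinter> U) Z)"
proof (induction K rule: wf_induct_rule[OF wfRp])
 case (1 K)
 note ch = niceD(1)[OF m]
 let ?A = "{U:m \<inter> TT. Z : elts U & lt U K}"
 have "ll m Z K" using chain_ll[OF ch 1(3) _ 1(4)] 1(2) by blast
 then have ne: "?A ~= {}" using 1(5) unfolding ll_def by blast
 have "finite ?A" using chain_finite[OF ch] by simp
 have "EX U:?A. ALL U':?A. ~ lt U U'"
 proof -
  let ?r = "(R\<^sup>+ \<inter> ?A \<times> ?A)\<inverse>"
  have "wf ?r" by (rule finite_acyclic_wf_converse) (use \<open>finite ?A\<close> in simp, rule acyclic_subset[OF wf_acyclic[OF wfRp]], auto)
  moreover obtain U0 where "U0 : ?A" using ne by blast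
  ultimately obtain U where "U : ?A" "!!y. (y, U) : ?r ==> y ~: ?A" by (rule wfE_min) (rule that)
  then show ?thesis by blast
 qed
 then obtain U where U: "U : m" "U : TT" "Z : elts U" "lt U K" and max: "!!U'. U' : ?A ==> ~ lt U U'" by blast
 have UK: "U : elts K"
 proof (rule ccontr)
  assume "U ~: elts K"
  moreover have "ll m U K" by (rule chain_ll[OF ch U(1) _ U(4)]) (use 1(2) in blast)
  ultimately obtain U' where U': "U' : m" "U' : TT" "U : elts U'" "lt U' K" unfolding ll_def by blast
  then have "U' : ?A" using TT_trans[OF U'(2,3)] U(3) by blast
  then show False using max mem_lt[OF U'(3)] by blast
 qed
 let ?L = "K \<sqinter> U"
 have L: "?L : m \<inter> SS" by (rule cap_SS(1)[OF m]) (use 1(2) U(1) in auto)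
 have LU: "lt ?L U" using cap_lt(2)[of K U] 1(2) U(2) by blast
 consider "Z = ?L" | "lt ?L Z" | "lt Z ?L" using chain_lin[OF ch 1(3), of ?L] L by blast
 then show ?case
 proof cases
  case 3
  have "Z ~: elts ?L" using 1(5) by simp
  moreover have "lt ?L K" using LU U(4) lt_trans by blast
  ultimately obtain U' where U': "U' : m" "U' : TT" "U' : elts ?L" "Z : elts U'" "Z = ?L \<sqinter> U' | lt (?L \<sqinter> U') Z"
   using 1(1)[of ?L] L 1(3) 3 by blast
  have "elts U' \<subseteq> elts U" using TT_trans[OF U(2)] U'(3) by simp
  then have "elts ?L \<inter> elts U' = elts K \<inter> elts U'" by auto
  then have "?L \<sqinter> U' = K \<sqinter> U'" by simp
  with U' show ?thesis by auto
 qed (use U UK in blast)+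
qed

text \<open>By \<open>gap\<close> any other node below \<open>K\<close> lies in an interval
  \<open>[K \<inter> U, U)\<close>. A subset of both \<open>K\<close> and \<open>U\<close> cannot
  rank above \<open>K \<inter> U\<close>, so it is the left end point.\<close>

lemma subset_node: assumes m: "nice m" and K: "K : m \<inter> SS" and Z: "Z : m" "elts Z \<subseteq> elts K"
 shows "Z : elts K | Z = K | (EX U:m \<inter> TT. U : elts K & Z = K \<sqinter> U)"
proof (cases "Z : elts K | Z = K")
 case False
 have "lt Z K" using chain_lin[OF niceD(1)[OF m] Z(1), of K] K False sub_not_lt[OF Z(2)] by blast
 then obtain U where U: "U : m \<inter> TT" "U : elts K" "Z : elts U" "Z = K \<sqinter> U | lt (K \<sqinter> U) Z" using gap[OF m K Z(1)] False by blast
 have "elts Z \<subseteq> elts (K \<sqinter> U)" using Z(2) TT_trans[of U Z] U by auto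
 then have "~ lt (K \<sqinter> U) Z" by (rule sub_not_lt)
 then show ?thesis using U by blast
qed blast

lemma TT_cap: assumes "U : TT" "W : TT" shows "U \<sqinter> W = U | U \<sqinter> W = W"
 using TT_linear[OF assms] TT_trans[OF assms(1)] TT_trans[OF assms(2)]
proof (elim disjE)
 assume "U : elts W" then have "elts U \<inter> elts W = elts U" using TT_trans[OF assms(2)] by blast
 then show ?thesis by simp
next
 assume "W : elts U" then have "elts U \<inter> elts W = elts W" using TT_trans[OF assms(1)] by blast
 then show ?thesis by simp
qed simp

lemma dl_cap: assumes "U : TT" shows "dl (X \<sqinter> U) = dl X"
proof -
 have "elts (dl (X \<sqinter> U)) = elts (dl X)" unfolding elts_dl using TT_om1[OF assms] by auto
 then show ?thesis by simp
qed

text \<open>Traces and order types are countable ordinals, so the order-type clause of the forcing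
  sees a node \<open>M\<close> only through its trace \<open>dl M\<close>.\<close>

lemma dl_mem: "N : SS ==> dl N : elts M \<longleftrightarrow> dl N : elts (dl M)" using dl_om1[of N] by (simp add: elts_dl)
lemma ot_mem: "N : SS ==> ot N : elts M \<longleftrightarrow> ot N : elts (dl M)" using ot_om1[of N] by (simp add: elts_dl)
lemma dl_Or: "N : SS ==> Or (dl N)" using dl_om1 Ord_mem[OF O1] by blast
lemma ot_down: "N : SS ==> M : SS ==> elts (ot N) \<subseteq> elts (ot L) ==> ot L : elts (dl M) ==> ot N : elts (dl M)"
 using Ord_subset[OF ot_Or[of N] ot_Or[of L]] Ord_trans[OF dl_Or[of M], of "ot N" "ot L"] by auto

lemma starD: "star m ==> M : m ==> M : SS ==> N : m ==> N : SS ==> dl N : elts (dl M) ==> ot N : elts (dl M)"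
 unfolding star_def using dl_mem ot_mem by blast
lemma starI: "(!!M N. M : m ==> M : SS ==> N : m ==> N : SS ==> dl N : elts (dl M) ==> ot N : elts (dl M)) ==> star m"
 unfolding star_def using dl_mem ot_mem by blast

lemma zero_th: "zero : elts th" using numth[of 0] by simp

text \<open>Here \<open>q\<close> lives in \<open>K\<close> and extends what \<open>p\<close> has in
  \<open>K\<close>. Their union need not be closed under intersections, so all
  \<open>X \<inter> Y\<close> are added. Heights are compared at points seen by both conditions:
  \<open>H1\<close> keeps nodes of \<open>p\<close> from raising the heights of \<open>q\<close>,
  and \<open>H2\<close> the reverse.\<close>

theorem amalgamate_countable:
 assumes p: "cond p dp" and K: "K : p" "K : SS" and q: "cond q dq"
  and qK: "!!N. N : q ==> N : elts K & dq N : elts K"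
  and qot: "!!N. N : q ==> N : SS ==> dl N : elts K & ot N : elts K"
  and pq: "!!N. N : p ==> N : elts K ==> N : q & elts (dp N) \<subseteq> elts (dq N)"
  and H1: "!!X a. X : p ==> X : SS ==> dl X : elts K ==> a : elts th ==> a : elts X ==> a : elts K ==>
    EX N:q \<inter> SS. a : elts N & dl N = dl X & elts (ot X) \<subseteq> elts (ot N)"
  and H2: "!!N X a. N : q ==> N : SS ==> X : p ==> X : SS ==> a : elts th ==> a : elts N ==> a : elts X ==> dl X = dl N ==>
    EX Y:p \<inter> SS. a : elts Y & dl Y = dl N & elts (ot N) \<subseteq> elts (ot Y)"
 shows "EX r dr. cle r dr p dp & cle r dr q dq"
proof -
 note pn = condD(1)[OF p] and qn = condD(1)[OF q]
 note pc = condD(2)[OF p] and qc = condD(2)[OF q]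
 note ps = condD(3)[OF p] and qs = condD(3)[OF q]
 note pd = condD(4)[OF p] and qd = condD(4)[OF q]
 note elK = SS_el[OF K(2)]
 have pnode: "!!X. X : p ==> X : SS \<union> TT" and qnode: "!!X. X : q ==> X : SS \<union> TT" using chain_node pc qc by blast+
 have KpS: "K : p \<inter> SS" using K by blast
 have ltK: "lt N K" if "N : q" for N using qK[OF that] mem_lt by blast
 define E where "E = (%(X, Y). X \<sqinter> Y) ` (p \<times> q)"
 define r where "r = p \<union> q \<union> E"
 have fin: "finite r" unfolding r_def E_def using chain_finite pc qc by blast
 \<comment> \<open>By \<open>subset_node\<close> such a \<open>Z\<close> is a node of
   \<open>q\<close>, or it is \<open>K\<close> or \<open>K \<inter> U\<close> with \<open>U\<close>
   in \<open>q\<close>; below \<open>Y \<subseteq> K\<close> the factor \<open>K\<close>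
   disappears.\<close>
 have small_in: "Z \<sqinter> Y : q" if Z: "Z : p" "elts Z \<subseteq> elts K" and Y: "Y : q" "elts Y \<subseteq> elts K" for Z Y
  using subset_node[OF pn KpS Z]
 proof (elim disjE bexE conjE)
  assume "Z : elts K" then show ?thesis using pq[OF Z(1)] niceD(2)[OF qn] Y(1) by blast
 next
  assume "Z = K" then have "elts Z \<inter> elts Y = elts Y" using Y(2) by blast
  then show ?thesis using Y(1) by simp
 next
  fix U assume U: "U : p \<inter> TT" "U : elts K" "Z = K \<sqinter> U"
  then have "elts Z \<inter> elts Y = elts U \<inter> elts Y" using Y(2) by auto
  then show ?thesis using pq[of U] U niceD(2)[OF qn, of U Y] Y(1) by auto
 qed
 have capS: "X \<sqinter> Y : q" if X: "X : p" and Y: "Y : q" "Y : SS" for X Y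
 proof -
  have YK: "elts Y \<subseteq> elts K" using SS_sub[of K Y] K(2) Y qK by blast
  have "X \<sqinter> K : p" by (rule niceD(2)[OF pn X K(1)])
  from small_in[OF this _ Y(1) YK] have "(X \<sqinter> K) \<sqinter> Y : q" by simp
  moreover have "elts (X \<sqinter> K) \<inter> elts Y = elts X \<inter> elts Y" using YK by auto
  ultimately show ?thesis by simp
 qed
 \<comment> \<open>A new node \<open>X \<inter> Q\<close> is presented with the
   \<open>lt\<close>-least \<open>X\<close> that has this intersection with \<open>Q\<close>. By
   \<open>red\<close>, no transitive node of \<open>p\<close> containing \<open>Q\<close> lies below
   this \<open>X\<close>, since cutting by it would give a smaller one; so, unless the node is old,
   \<open>X\<close> contains \<open>Q\<close> and all of \<open>K \<inter> Q\<close>.\<close>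
 have good0: "EX X':p \<inter> SS. X' \<sqinter> Q = X \<sqinter> Q & (X \<sqinter> Q : p \<union> q | Q : elts X' & elts K \<inter> elts Q \<subseteq> elts X')"
  if X: "X : p \<inter> SS" and Q: "Q : q" "Q : TT" for X Q
 proof -
  have QK: "Q : elts K" using qK[OF Q(1)] by blast
  let ?A = "{X':p \<inter> SS. X' \<sqinter> Q = X \<sqinter> Q}"
  have "X : ?A" using X by blast
  with wfRp obtain Y where Y: "Y : ?A" and ymin: "!!y. lt y Y ==> y ~: ?A" by (rule wfE_min) (rule that)
  have Yp: "Y : p" "Y : SS" and YX: "Y \<sqinter> Q = X \<sqinter> Q" using Y by auto
  have red: False if Z: "Z : p" "Z : TT" "Q : elts Z" "lt Z Y" for Z
  proof -
   have "Y \<sqinter> Z : p \<inter> SS" by (rule cap_SS(1)[OF pn Yp(1) Z(1) Yp(2)])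
   moreover have "elts (Y \<sqinter> Z) \<inter> elts Q = elts Y \<inter> elts Q" using TT_trans[OF Z(2,3)] by auto
   ultimately have "Y \<sqinter> Z : ?A" using YX by simp
   moreover have "lt (Y \<sqinter> Z) Y" using cap_lt(2)[OF Yp(2) Z(2)] Z(4) lt_trans by blast
   ultimately show False using ymin by blast
  qed
  have step: "elts B \<subseteq> elts Y" if B: "B : p" "B : SS" "Q : elts B" "lt B Y" for B
  proof (cases "B : elts Y")
   case True then show ?thesis using SS_sub[of Y B] B(2) Yp by blast
  next
   case False
   have "ll p B Y" by (rule chain_ll[OF pc B(1) Yp(1) B(4)])
   then obtain Z where Z: "Z : p" "Z : TT" "B : elts Z" "lt Z Y" using False unfolding ll_def by blast
   have "Q : elts Z" using TT_trans[OF Z(2,3)] B(3) by blast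
   then show ?thesis using red Z by blast
  qed
  have "X \<sqinter> Q : p \<union> q | Q : elts Y & elts K \<inter> elts Q \<subseteq> elts Y"
  proof (cases "Y : elts K")
   case True then have "Y : q" using pq[OF Yp(1)] by blast
   then have "Y \<sqinter> Q : q" using niceD(2)[OF qn] Q(1) by blast
   then show ?thesis using YX by simp
  next
   case notK: False
   consider "Y = K" | "lt K Y" | "lt Y K" using chain_lin[OF pc Yp(1) K(1)] by blast
   then show ?thesis
   proof cases
    case 1 then show ?thesis using QK by blast
   next
    case 2 then show ?thesis using step[OF K QK] QK by blast
   next
    case 3
    obtain U where U: "U : p" "U : TT" "U : elts K" "Y : elts U" "Y = K \<sqinter> U | lt (K \<sqinter> U) Y"
     using gap[OF pn KpS Yp(1) 3 notK] by blast
    show ?thesis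
    proof (cases "Q : elts U")
     case False
     have "elts U \<subseteq> elts Q" using TT_linear[OF U(2) Q(2)] False TT_trans[OF Q(2)] by blast
     then have "elts Y \<inter> elts Q = elts Y" using TT_trans[OF U(2,4)] by blast
     then have "X \<sqinter> Q = Y" using YX by simp
     then show ?thesis using Yp by blast
    next
     case True
     have Q2: "Q : elts (K \<sqinter> U)" using QK True by simp
     have L: "K \<sqinter> U : p \<inter> SS" by (rule cap_SS(1)[OF pn K(1) U(1) K(2)])
     have "elts (K \<sqinter> U) \<subseteq> elts Y" using U(5) step[of "K \<sqinter> U"] L Q2 by blast
     moreover have "elts K \<inter> elts Q \<subseteq> elts (K \<sqinter> U)" using TT_trans[OF U(2) True] by auto
     ultimately show ?thesis using Q2 by blast
    qed
   qed
  qed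
  then show ?thesis using Yp YX by blast
 qed
 let ?gd = "%N X Q. X : p & X : SS & Q : q & Q : TT & N = X \<sqinter> Q & Q : elts X & elts K \<inter> elts Q \<subseteq> elts X"
 have rcases: "N : p | N : q | (EX X Q. ?gd N X Q)" if N: "N : r" for N
 proof (cases "N : p \<union> q")
  case False
  then obtain X Y where XY: "X : p" "Y : q" "N = X \<sqinter> Y" using N unfolding r_def E_def by auto
  have YT: "Y : TT" using qnode[OF XY(2)] capS[OF XY(1,2)] XY(3) False by blast
  have XS: "X : SS"
  proof (rule ccontr)
   assume "X ~: SS" then have "X : TT" using pnode[OF XY(1)] by blast
   from TT_cap[OF this YT] show False using XY(1,2) False unfolding XY(3) by (elim disjE) simp_all
  qed
  obtain X' where "X' : p \<inter> SS" "X' \<sqinter> Y = X \<sqinter> Y" "X \<sqinter> Y : p \<union> q | Y : elts X' & elts K \<inter> elts Y \<subseteq> elts X'"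
   using good0[of X Y] XS XY(1,2) YT by blast
  then have "?gd N X' Y" using False XY YT by simp
  then show ?thesis by blast
 qed blast
 have newSS: "N : SS" "dl N = dl X" "elts (ot N) \<subseteq> elts (ot X)" "elts N \<subseteq> elts X" if "?gd N X Q" for N X Q
  using that SS_inter[of X Q] dl_cap[of Q X] ot_mono[of N X] by auto
 have rnode: "N : SS \<union> TT" if "N : r" for N using rcases[OF that] pnode qnode newSS(1) by blast
 have pr: "p \<subseteq> r" and qr: "q \<subseteq> r" unfolding r_def by blast+
 have llp: "N = M | ll r N M | ll r M N" if "N : p" "M : p" for N M using chainD[OF pc that] pr unfolding ll_def by blast
 have llq: "N = M | ll r N M | ll r M N" if "N : q" "M : q" for N M using chainD[OF qc that] qr unfolding ll_def by blast

 \<comment> \<open>Locates a node of \<open>p\<close> relative to a transitive node of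
   \<open>q\<close>. Transitive nodes of \<open>p\<close> inside \<open>K\<close> belong to
   \<open>q\<close>, and \<open>gap\<close> sorts the nodes of \<open>p\<close> below
   \<open>K\<close> but outside \<open>K\<close> into the intervals they determine.\<close>
 have posQ: "Z = Q | lt Q Z | Z : elts Q & (Z : elts K | Q : p | (EX U:q \<inter> TT. U : elts Q & U : elts K & Z : elts U & (Z = K \<sqinter> U | lt (K \<sqinter> U) Z)))"
  if Z: "Z : p" and Q: "Q : q" "Q : TT" for Z Q
 proof (cases "Z : elts K")
  case True then have "Z : q" using pq[OF Z] by blast
  then show ?thesis using chain_lin[OF qc _ Q(1), of Z] lt_TT[OF Q(2)] True by blast
 next
  case notK: False
  consider "lt K Z | K = Z" | "lt Z K" using chain_lin[OF pc Z K(1)] by blast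
  then show ?thesis
  proof cases
   case 1 then show ?thesis using ltK[OF Q(1)] lt_trans by blast
  next
   case 2
   obtain U where U: "U : p" "U : TT" "U : elts K" "Z : elts U" "Z = K \<sqinter> U | lt (K \<sqinter> U) Z"
    using gap[OF pn KpS Z 2 notK] by blast
   have Uq: "U : q" using pq[OF U(1,3)] by blast
   consider "Q : elts U" | "U = Q" | "U : elts Q" using TT_linear[OF Q(2) U(2)] by blast
   then show ?thesis
   proof cases
    case 1
    then have "lt Q (K \<sqinter> U)" using qK[OF Q(1)] by (intro mem_lt) simp
    then show ?thesis using U(5) lt_trans by blast
   next
    case 2 then show ?thesis using U by blast
   next
    case 3 then show ?thesis using U Uq TT_trans[OF Q(2) 3] by blast
   qed
  qed
 qed

 \<comment> \<open>New against old. A node of \<open>q\<close> below \<open>Q\<close> lies in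
   \<open>K \<inter> Q\<close> and hence in \<open>N\<close>; a node of \<open>p\<close> is located
   by \<open>posQ\<close>, where \<open>Q : p\<close> cannot occur because then \<open>N\<close>
   would be old.\<close>
 have chn: "N = M | ll r N M | ll r M N" if N: "N : r" "?gd N X Q" "N ~: p \<union> q" and M: "M : p \<union> q" for N X Q M
 proof -
  have Qr: "Q : r \<inter> TT" using N(2) qr by blast
  have NQ: "N : elts Q" using N(2) cap_lt(1)[of X Q] by blast
  have qcase: ?thesis if Mq: "M : q"
  proof -
   consider "M = Q" | "lt M Q" | "lt Q M" using chain_lin[OF qc Mq, of Q] N(2) by blast
   then show "N = M | ll r N M | ll r M N"
   proof cases
    case 1 then show ?thesis using NQ unfolding ll_def by blast
   next
    case 2 then have "M : elts K \<inter> elts Q" using lt_TT[of Q M] N(2) qK[OF Mq] by blast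
    then have "M : elts N" using N(2) by auto
    then show ?thesis unfolding ll_def by blast
   next
    case 3 then show ?thesis using NQ Qr unfolding ll_def by blast
   qed
  qed
  show ?thesis
  proof (cases "M : q")
   case False
   then have Mp: "M : p" and MK: "M ~: elts K" using M pq by blast+
   have Qp: "Q ~: p"
   proof
    assume "Q : p" then have "X \<sqinter> Q : p" using niceD(2)[OF pn] N(2) by blast
    then show False using N(2,3) by blast
   qed
   have "M ~= Q" using Mp Qp by blast
   then consider "lt Q M" | U where "U : q \<inter> TT" "U : elts Q" "U : elts K" "M : elts U"
    using posQ[OF Mp, of Q] N(2) MK Qp by blast
   then show ?thesis
   proof cases
    case 1 then show ?thesis using NQ Qr unfolding ll_def by blast
   next
    case (2 U)
    then have "U : elts N" using N(2) by auto
    then show ?thesis using 2 qr mem_lt unfolding ll_def by blast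
   qed
  qed (rule qcase)
 qed
 \<comment> \<open>Old against old. The cases follow the position of \<open>N\<close> relative to
   \<open>K\<close>; below \<open>K\<close>, the transitive \<open>U\<close> found by
   \<open>gap\<close> is a node of \<open>q\<close> and can be compared with \<open>M\<close>
   there.\<close>
 have pqc: "N = M | ll r N M | ll r M N" if N: "N : p" and M: "M : q" for N M
 proof (cases "N : elts K")
  case True then show ?thesis using pq[OF N] llq M by blast
 next
  case notK: False
  have MK: "M : elts K" using qK[OF M] by blast
  consider "N = K" | "lt K N" | "lt N K" using chain_lin[OF pc N K(1)] by blast
  then show ?thesis
  proof cases
   case 1 then show ?thesis using MK unfolding ll_def by blast
  next
   case 2
   then have "ll p K N" by (rule chain_ll[OF pc K(1) N])
   then consider "K : elts N" | (U) U where "U : p \<inter> TT" "K : elts U" "lt U N" unfolding ll_def by blast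
   then show ?thesis
   proof cases
    case 1 then have "M : elts N" using SS_sub[OF pnode[OF N] K(2)] MK by blast
    then show ?thesis unfolding ll_def by blast
   next
    case U
    then have "M : elts U" using TT_trans[of U K] MK by blast
    then show ?thesis using U pr unfolding ll_def by blast
   qed
  next
   case 3
   obtain U where U: "U : p" "U : TT" "U : elts K" "N : elts U" "N = K \<sqinter> U | lt (K \<sqinter> U) N"
    using gap[OF pn KpS N 3 notK] by blast
   have Uq: "U : q" using pq[OF U(1,3)] by blast
   consider "M = U" | "lt U M" | "lt M U" using chain_lin[OF qc M Uq] by blast
   then show ?thesis
   proof cases
    case 1 then show ?thesis using U(4) unfolding ll_def by blast
   next
    case 2 then show ?thesis using U Uq qr unfolding ll_def by blast
   next
    case 3
    then have mL: "M : elts (K \<sqinter> U)" using lt_TT[OF U(2)] MK by simp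
    have L: "K \<sqinter> U : p \<inter> SS" by (rule cap_SS(1)[OF pn K(1) U(1) K(2)])
    show ?thesis
    proof (cases "N = K \<sqinter> U")
     case True then show ?thesis using mL unfolding ll_def by blast
    next
     case False
     then have "ll p (K \<sqinter> U) N" using chain_ll[OF pc _ N] U(5) L by blast
     then consider "K \<sqinter> U : elts N" | (V) V where "V : p \<inter> TT" "K \<sqinter> U : elts V" "lt V N" unfolding ll_def by blast
     then show ?thesis
     proof cases
      case 1 then have "M : elts N" using SS_sub[OF pnode[OF N]] L mL by blast
      then show ?thesis unfolding ll_def by blast
     next
      case V
      then have "M : elts V" using TT_trans[of V "K \<sqinter> U"] mL by blast
      then show ?thesis using V pr unfolding ll_def by blast
     qed
    qed
   qed
  qed
 qed
 \<comment> \<open>Two new nodes cut by the same \<open>Q\<close> are compared through their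
   \<open>p\<close>-nodes. With least presentations, a transitive node separating \<open>X\<close>
   from \<open>Y\<close> would yield the smaller presentation \<open>Y \<inter> Z\<close>, so
   \<open>X\<close> must be an element of \<open>Y\<close>.\<close>
 have newgood: "EX X Q. ?gd N X Q & (ALL X'. lt X' X --> ~ ?gd N X' Q)" if ex: "EX X Q. ?gd N X Q" for N
 proof -
  obtain X0 Q where g: "?gd N X0 Q" using ex by blast
  then have "X0 : {X. ?gd N X Q}" by blast
  with wfRp obtain X where "X : {X. ?gd N X Q}" "!!y. lt y X ==> y ~: {X. ?gd N X Q}" by (rule wfE_min) (rule that)
  then show ?thesis by blast
 qed
 have nn: "N = M | ll r N M | ll r M N" if N: "EX X Q. ?gd N X Q" and M: "EX X Q. ?gd M X Q" for N M
 proof -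
  obtain X Q where g: "?gd N X Q" "!!X'. lt X' X ==> ~ ?gd N X' Q" using newgood[OF N] by blast
  obtain Y Q' where g': "?gd M Y Q'" "!!X'. lt X' Y ==> ~ ?gd M X' Q'" using newgood[OF M] by blast
  have diff: "ll r N M" if "?gd N X Q" "?gd M Y Q'" "Q : elts Q'" for N M X Y Q Q'
  proof -
   have "N : elts Q" using that(1) cap_lt(1)[of X Q] by blast
   moreover have "Q : elts M" using that qK[of Q] by auto
   ultimately show ?thesis unfolding ll_def using that(1) qr mem_lt by blast
  qed
  have same: "ll r N M" if gN: "?gd N X Q" and gM: "?gd M Y Q" and mn: "!!X'. lt X' Y ==> ~ ?gd M X' Q" and l: "lt X Y" for N M X Y Q
  proof (cases "X : elts Y")
   case True
   have "X \<sqinter> Q : elts Y" by (rule el_Int[OF SS_el]) (use gM True in auto)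
   moreover have "X \<sqinter> Q : elts Q" using gN cap_lt(1)[of X Q] by blast
   ultimately show ?thesis unfolding ll_def using gN gM by simp
  next
   case False
   have "ll p X Y" by (rule chain_ll[OF pc _ _ l]) (use gN gM in blast)+
   then obtain Z where Z: "Z : p" "Z : TT" "X : elts Z" "lt Z Y" using False unfolding ll_def by blast
   have QZ: "Q : elts Z" using TT_trans[OF Z(2,3)] gN by blast
   have QsubZ: "elts Q \<subseteq> elts Z" by (rule TT_trans[OF Z(2) QZ])
   have "Y \<sqinter> Z : p \<inter> SS" by (rule cap_SS(1)[OF pn]) (use gM Z in auto)
   moreover have "elts (Y \<sqinter> Z) \<inter> elts Q = elts Y \<inter> elts Q" using QsubZ by auto
   moreover have "elts K \<inter> elts Q \<subseteq> elts (Y \<sqinter> Z)" using gM QsubZ by auto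
   ultimately have "?gd M (Y \<sqinter> Z) Q" using gM QZ by auto
   moreover have "lt (Y \<sqinter> Z) Y" using cap_lt(2)[of Y Z] gM Z(2,4) lt_trans by blast
   ultimately show ?thesis using mn by blast
  qed
  consider "Q : elts Q'" | "Q = Q'" | "Q' : elts Q" using TT_linear[of Q Q'] g(1) g'(1) by blast
  then show ?thesis
  proof cases
   case 1 then show ?thesis using diff[OF g(1) g'(1)] by blast
  next
   case 3 then show ?thesis using diff[OF g'(1) g(1)] by blast
  next
   case 2
   consider "X = Y" | "lt X Y" | "lt Y X" using chain_lin[OF pc, of X Y] g(1) g'(1) by blast
   then show ?thesis
   proof cases
    case 1 then show ?thesis using g(1) g'(1) 2 by blast
   next
    case b: 2 then show ?thesis using same[OF g(1), of Y M] g' 2 by blast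
   next
    case 3 then show ?thesis using same[OF g'(1), of X N] g 2 by blast
   qed
  qed
 qed
 have "N = M | ll r N M | ll r M N" if NM: "N : r" "M : r" for N M
 proof (cases "N : p \<union> q")
  case N: True
  show ?thesis
  proof (cases "M : p \<union> q")
   case True then show ?thesis using N llp llq pqc by blast
  next
   case False
   then obtain X Q where "?gd M X Q" using rcases[OF NM(2)] by blast
   from chn[OF NM(2) this False N] show ?thesis by blast
  qed
 next
  case N: False
  then have gN: "EX X Q. ?gd N X Q" using rcases[OF NM(1)] by blast
  then obtain X Q where g: "?gd N X Q" by blast
  show ?thesis
  proof (cases "M : p \<union> q")
   case True then show ?thesis using chn[OF NM(1) g N True] by blast
  next
   case False
   then have "EX X Q. ?gd M X Q" using rcases[OF NM(2)] by blast
   then show ?thesis using nn[OF gN] by blast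
  qed
 qed
 then have rc: "chain r" unfolding chain_def using fin rnode by blast
 have rI: "X \<sqinter> Y : r" if "X : p" "Y : q" for X Y using that unfolding r_def E_def by auto
 have rep: "(EX X:p. N = X) | (EX Y:q. N = Y) | (EX X:p. EX Y:q. N = X \<sqinter> Y)" if "N : r" for N using that unfolding r_def E_def by auto
 have rcap: "N \<sqinter> M : r" if N: "N : r" and M: "M : r" for N M
 proof -
  have c: "(X \<sqinter> Y) \<sqinter> (X' \<sqinter> Y') = (X \<sqinter> X') \<sqinter> (Y \<sqinter> Y')" "(X \<sqinter> Y) \<sqinter> X' = (X \<sqinter> X') \<sqinter> Y" "(X \<sqinter> Y) \<sqinter> Y' = X \<sqinter> (Y \<sqinter> Y')"
   "X' \<sqinter> (X \<sqinter> Y) = (X' \<sqinter> X) \<sqinter> Y" "Y' \<sqinter> (X \<sqinter> Y) = X \<sqinter> (Y' \<sqinter> Y)" "Y \<sqinter> X = X \<sqinter> Y" for X Y X' Y'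
   by (simp_all add: Int_ac)
  note pI = niceD(2)[OF pn] and qI = niceD(2)[OF qn]
  show ?thesis using rep[OF N] rep[OF M]
  proof (elim disjE bexE)
   fix X X' assume "X : p" "N = X" "X' : p" "M = X'" then show ?thesis using pI pr by blast
  next
   fix X Y assume "X : p" "N = X" "Y : q" "M = Y" then show ?thesis using rI by blast
  next
   fix X X' Y' assume a: "X : p" "N = X" "X' : p" "Y' : q" "M = X' \<sqinter> Y'"
   show ?thesis unfolding a(2,5) c(4) by (rule rI[OF pI[OF a(1,3)] a(4)])
  next
   fix Y X' assume a: "Y : q" "N = Y" "X' : p" "M = X'"
   show ?thesis unfolding a(2,4) c(6)[of Y] by (rule rI[OF a(3,1)])
  next
   fix Y Y' assume "Y : q" "N = Y" "Y' : q" "M = Y'" then show ?thesis using qI qr by blast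
  next
   fix Y X' Y' assume a: "Y : q" "N = Y" "X' : p" "Y' : q" "M = X' \<sqinter> Y'"
   show ?thesis unfolding a(2,5) c(5) by (rule rI[OF a(3) qI[OF a(1,4)]])
  next
   fix X Y X' assume a: "X : p" "Y : q" "N = X \<sqinter> Y" "X' : p" "M = X'"
   show ?thesis unfolding a(3,5) c(2) by (rule rI[OF pI[OF a(1,4)] a(2)])
  next
   fix X Y Y' assume a: "X : p" "Y : q" "N = X \<sqinter> Y" "Y' : q" "M = Y'"
   show ?thesis unfolding a(3,5) c(3) by (rule rI[OF a(1) qI[OF a(2,4)]])
  next
   fix X Y X' Y' assume a: "X : p" "Y : q" "N = X \<sqinter> Y" "X' : p" "Y' : q" "M = X' \<sqinter> Y'"
   show ?thesis unfolding a(3,6) c(1) by (rule rI[OF pI[OF a(1,4)] qI[OF a(2,5)]])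
  qed
 qed
 have rn: "nice r" unfolding nice_def using rc rcap by blast

 \<comment> \<open>A new node has the trace of the \<open>p\<close>-node it is cut from and no
   larger order type, so the order-type clause and the heights need be checked on old nodes
   only.\<close>
 have old: "EX L:(p \<union> q) \<inter> SS. dl L = dl N & elts (ot N) \<subseteq> elts (ot L) & elts N \<subseteq> elts L & (N ~: q --> L : p)" if N: "N : r" "N : SS" for N
 proof (cases "N : p \<union> q")
  case True then show ?thesis using N by blast
 next
  case False
  then obtain X Q where g: "?gd N X Q" using rcases[OF N(1)] by blast
  show ?thesis using newSS[OF g] g by (intro bexI[of _ X]) auto
 qed
 have st1: "ot N : elts (dl M)" if N: "N : p \<union> q" "N : SS" and M: "M : p \<union> q" "M : SS" and d: "dl N : elts (dl M)" for N M
 proof -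
  have dlK: "dl N : elts (dl K) & ot N : elts (dl K)" if "N : q" "N : SS" for N using qot[OF that] dl_mem[OF that(2)] ot_mem[OF that(2)] by blast
  consider "N : p" "M : p" | "N : q" "M : q" | "N : q" "M : p" | "N : p" "M : q" using N M by blast
  then show ?thesis
  proof cases
   case 1 then show ?thesis using starD[OF ps] N M d by blast
  next
   case 2 then show ?thesis using starD[OF qs] N M d by blast
  next
   case 3
   show ?thesis
   proof (cases "dl M : elts (dl K)")
    case False
    then have "elts (dl K) \<subseteq> elts (dl M)" using Ord_not_mem[OF dl_Or[OF M(2)] dl_Or[OF K(2)]] by simp
    then show ?thesis using dlK[OF 3(1) N(2)] by blast
   next
    case True
    \<comment> \<open>As \<open>dl M\<close> is below \<open>dl K\<close>, this node has the trace
      of \<open>M\<close>, so it is neither \<open>K\<close> nor some \<open>K \<inter> U\<close>,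
      whose traces are \<open>dl K\<close>. It is therefore an element of \<open>K\<close> and a
      node of \<open>q\<close>, where the clause applies.\<close>
    let ?Z = "M \<sqinter> K"
    have Z: "?Z : p \<inter> SS" by (rule cap_SS(1)[OF pn 3(2) K(1) M(2)])
    have "elts (dl M) \<subseteq> elts (dl K)" using Ord_trans[OF dl_Or[OF K(2)] _ True] by blast
    then have "elts (dl ?Z) = elts (dl M)" unfolding elts_dl elts_cap by blast
    then have dlZ: "dl ?Z = dl M" by simp
    have "dl M ~= dl K" using True mem_irrefl by metis
    then have "?Z ~= K" "!!U. U : TT ==> ?Z ~= K \<sqinter> U" using dlZ dl_cap by metis+
    then have "?Z : elts K" using subset_node[OF pn KpS, of ?Z] Z by auto
    then have "?Z : q" using pq Z by blast
    then show ?thesis using starD[OF qs _ _ 3(1) N(2), of ?Z] Z d dlZ by simp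
   qed
  next
   case 4
   have "dl N : elts (dl K)" using d dlK[OF 4(2) M(2)] Ord_trans[OF dl_Or[OF K(2)]] by blast
   then have nK: "dl N : elts K" using dl_mem[OF N(2)] by blast
   \<comment> \<open>Every node contains \<open>zero\<close>, so \<open>H1\<close> at this one point
     already gives a node of \<open>q\<close> with the trace of \<open>N\<close> and at least its
     order type.\<close>
   obtain L where L: "L : q" "L : SS" "dl L = dl N" "elts (ot N) \<subseteq> elts (ot L)"
    using H1[OF 4(1) N(2) nK zero_th el_zero[OF SS_el[OF N(2)]] el_zero[OF elK]] by blast
   have "ot L : elts (dl M)" using starD[OF qs 4(2) M(2) L(1,2)] d L(3) by simp
   then show ?thesis by (rule ot_down[OF N(2) M(2) L(4)])
  qed
 qed
 have rs: "star r"
 proof (rule starI)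
  fix M N assume M: "M : r" "M : SS" and N: "N : r" "N : SS" and d: "dl N : elts (dl M)"
  obtain L where L: "L : p \<union> q" "L : SS" "dl L = dl N" "elts (ot N) \<subseteq> elts (ot L)" using old[OF N] by blast
  obtain L' where L': "L' : p \<union> q" "L' : SS" "dl L' = dl M" using old[OF M] by blast
  have "ot L : elts (dl M)" using st1[OF L(1,2) L'(1,2)] d L(3) L'(3) by simp
  then show "ot N : elts (dl M)" by (rule ot_down[OF N(2) M(2) L(4)])
 qed

 \<comment> \<open>Nodes that are new to both conditions get the empty set.\<close>
 define dr where "dr M = (if M : q then dq M else if M : p then dp M else zero)" for M
 have zV: "zero : Vth" by (rule thVth[OF zero_th])
 have isr: "M : elts N" if M: "M : r" and s: "isucc r M N" for M N
 proof -
  have "ll r M N" by (rule chain_ll[OF rc M]) (use s in \<open>auto simp: isucc_def\<close>)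
  then show ?thesis using s mem_lt unfolding ll_def isucc_def by blast
 qed
 have exsucc: "EX N'. isucc m M N'" if m: "chain m" and M: "M : m" "B : m" "lt M B" for m M B
 proof -
  have "B : {N:m. lt M N}" using M by blast
  with wfRp obtain N' where "N' : {N:m. lt M N}" "!!y. lt y N' ==> y ~: {N:m. lt M N}" by (rule wfE_min) (rule that)
  then show ?thesis unfolding isucc_def by blast
 qed
 \<comment> \<open>The successor \<open>N\<close> may be new or come from \<open>p\<close>. In the
   cases covered by \<open>leU\<close> no node of \<open>q\<close> separates \<open>M\<close> from
   the transitive node \<open>U\<close>, so \<open>U\<close> is its successor in \<open>q\<close>
   and the decoration lies in \<open>K \<inter> U\<close>, a subset of \<open>N\<close>.\<close>
 have dq_ok: "dq M : elts N" if M: "M : q" and s: "isucc r M N" for M N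
 proof -
  have MN: "M : elts N" by (rule isr[OF _ s]) (use M qr in blast)
  have Nr: "N : r" and MltN: "lt M N" and nob: "!!B. B : r ==> lt M B ==> ~ lt B N" using s unfolding isucc_def by blast+
  have dK: "dq M : elts K" and MK: "M : elts K" using qK[OF M] by blast+
  have NK: "N = K | lt N K" using nob[of K] chain_lin[OF rc Nr, of K] pr K(1) mem_lt[OF MK] by blast
  have leU: "dq M : elts N" if U: "U : q" "U : TT" "M : elts U" "N : elts U" and sub: "elts K \<inter> elts U \<subseteq> elts N" for U
  proof -
   obtain N' where N': "isucc q M N'" using exsucc[OF qc M U(1) mem_lt[OF U(3)]] by blast
   have d: "dq M : elts N'" using qd M N' unfolding deco_def by blast
   have N'q: "N' : q" and MN': "lt M N'" using N' unfolding isucc_def by blast+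
   have "~ lt U N'" using N' U mem_lt unfolding isucc_def by blast
   then have "N' = U | N' : elts U" using chain_lin[OF qc N'q U(1)] lt_TT[OF U(2)] by blast
   moreover have "N' ~: elts U"
   proof
    assume "N' : elts U" then have "N' : elts N" using sub qK[OF N'q] by blast
    then show False using nob[of N'] N'q qr MN' mem_lt by blast
   qed
   ultimately show ?thesis using d dK sub by blast
  qed
  show ?thesis
  proof (cases "N : q")
   case True
   then have "isucc q M N" using s qr unfolding isucc_def by blast
   then show ?thesis using qd M unfolding deco_def by blast
  next
   case Nq: False
   show ?thesis
   proof (cases "N : p")
    case True
    have "N ~: elts K" using pq[OF True] Nq by blast
    show ?thesis
    proof (cases "N = K")
     case False
     then obtain U where U: "U : p" "U : TT" "U : elts K" "N : elts U" "N = K \<sqinter> U | lt (K \<sqinter> U) N"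
      using gap[OF pn KpS True] NK \<open>N ~: elts K\<close> by blast
     have MU: "M : elts U" using lt_TT[OF U(2)] lt_trans[OF MltN mem_lt[OF U(4)]] by blast
     have "lt M (K \<sqinter> U)" by (rule mem_lt) (use MU MK in simp)
     moreover have "K \<sqinter> U : r" using niceD(2)[OF pn K(1) U(1)] pr by blast
     ultimately have "N = K \<sqinter> U" using U(5) nob by blast
     then show ?thesis using leU[of U] pq[OF U(1,3)] U MU by simp
    qed (use dK in simp)
   next
    case False
    then obtain X Q where g: "?gd N X Q" using rcases[OF Nr] Nq by blast
    have "N : elts Q" using g cap_lt(1)[of X Q] by blast
    moreover have "M : elts Q" using MN g by auto
    moreover have "elts K \<inter> elts Q \<subseteq> elts N" using g by auto
    ultimately show ?thesis using leU[of Q] g by blast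
   qed
  qed
 qed
 \<comment> \<open>A node of \<open>p\<close> outside \<open>q\<close> keeps its successor. If
   \<open>N\<close> were not in \<open>p\<close>, then either \<open>N\<close> would lie below
   \<open>M\<close>, or a transitive node of \<open>q\<close> would lie strictly between
   \<open>M\<close> and \<open>N\<close>.\<close>
 have dp_ok: "dp M : elts N" if M: "M : p" "M ~: q" and s: "isucc r M N" for M N
 proof -
  have MN: "M : elts N" by (rule isr[OF _ s]) (use M pr in blast)
  have Nr: "N : r" and MltN: "lt M N" and nob: "!!B. B : r ==> lt M B ==> ~ lt B N" using s unfolding isucc_def by blast+
  have MK: "M ~: elts K" using pq[OF M(1)] M(2) by blast
  have "N : p"
  proof (rule ccontr)
   assume Np: "N ~: p"
   show False
   proof (cases "N : q")
    case True
    have "lt M K" using lt_trans[OF MltN ltK[OF True]] .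
    then obtain U where U: "U : p" "U : TT" "U : elts K" "M : elts U" "M = K \<sqinter> U | lt (K \<sqinter> U) M"
     using gap[OF pn KpS M(1)] MK by blast
    have Uq: "U : q" using pq[OF U(1,3)] by blast
    have "N ~= U" using U(1) Np by blast
    then consider "lt N U" | "lt U N" using chain_lin[OF qc True Uq] by blast
    then show False
    proof cases
     case 1
     then have "N : elts (K \<sqinter> U)" using lt_TT[OF U(2)] qK[OF True] by simp
     then have "lt N M" using U(5) mem_lt lt_trans by blast
     then show False using MltN lt_asym by blast
    next
     case 2 then show False using nob[of U] Uq qr mem_lt[OF U(4)] by blast
    qed
   next
    case False
    then obtain X Q where g: "?gd N X Q" using rcases[OF Nr] Np by blast
    have Qp: "Q ~: p" using niceD(2)[OF pn, of X Q] g Np by blast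
    have MQ: "M : elts Q" using MN g by auto
    then have "~ lt Q M" "M ~= Q" using mem_lt lt_asym mem_irrefl by blast+
    then obtain U where U: "U : q" "U : TT" "U : elts Q" "U : elts K" "M : elts U" using posQ[OF M(1), of Q] g MK Qp by blast
    then have "U : elts N" using g by auto
    then show False using nob[of U] U(1) qr mem_lt[OF U(5)] mem_lt by blast
   qed
  qed
  then have "isucc p M N" using s pr unfolding isucc_def by blast
  then show ?thesis using pd M(1) unfolding deco_def by blast
 qed
 have rd: "deco r dr" unfolding deco_def
 proof (intro ballI conjI allI impI)
  fix M assume M: "M : r"
  show "finite (elts (dr M))" "dr M : Vth" using pd qd zV unfolding deco_def dr_def by auto
  fix N assume s: "isucc r M N"
  have "el N" using rnode node_el s unfolding isucc_def by blast
  then show "dr M : elts N" unfolding dr_def using dq_ok dp_ok s el_zero by auto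
 qed
 have rcond: "cond r dr" unfolding cond_def using rn rs rd by blast
 have hp: "hle p r" unfolding hle_def
 proof (intro ballI impI)
  fix N a assume N: "N : r \<inter> SS" "a : elts N \<inter> elts th" and ex: "EX X:p \<inter> SS. a : elts X & dl X = dl N"
  show "EX X:p \<inter> SS. a : elts X & dl X = dl N & elts (ot N) \<subseteq> elts (ot X)"
  proof (cases "N : q")
   case True then show ?thesis using H2[OF True] N ex by blast
  next
   case False
   then obtain L where "L : p" "L : SS" "dl L = dl N" "elts (ot N) \<subseteq> elts (ot L)" "elts N \<subseteq> elts L" using old[of N] N(1) by blast
   then show ?thesis using N(2) by blast
  qed
 qed
 have hq: "hle q r" unfolding hle_def
 proof (intro ballI impI)
  fix N a assume N: "N : r \<inter> SS" "a : elts N \<inter> elts th" and ex: "EX X:q \<inter> SS. a : elts X & dl X = dl N"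
  show "EX X:q \<inter> SS. a : elts X & dl X = dl N & elts (ot N) \<subseteq> elts (ot X)"
  proof (cases "N : q")
   case True then show ?thesis using N by blast
  next
   case False
   then obtain L where L: "L : p" "L : SS" "dl L = dl N" "elts (ot N) \<subseteq> elts (ot L)" "elts N \<subseteq> elts L" using old[of N] N(1) by blast
   obtain X where X: "X : q" "X : SS" "a : elts X" "dl X = dl N" using ex by blast
   have "a : elts K" using SS_sub[of K X] K(2) X qK by blast
   moreover have "dl L : elts K" using qot[OF X(1,2)] X(4) L(3) by simp
   moreover have "a : elts L" "a : elts th" using L(5) N(2) by blast+
   ultimately obtain Y where "Y : q \<inter> SS" "a : elts Y" "dl Y = dl L" "elts (ot L) \<subseteq> elts (ot Y)" using H1[OF L(1,2)] by blast
   then show ?thesis using L(3,4) by (intro bexI[of _ Y]) auto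
  qed
 qed
 have "ALL M:p. elts (dp M) \<subseteq> elts (dr M)" unfolding dr_def using pq qK by auto
 then have "cle r dr p dp" unfolding cle_def using rcond p pr hp by blast
 moreover have "cle r dr q dq" unfolding cle_def using rcond q qr hq by (auto simp: dr_def)
 ultimately show ?thesis by blast
qed

text \<open>No intersections have to be added: cutting a node of \<open>p\<close> by
  \<open>W\<close> gives \<open>W\<close> or a node of \<open>q\<close>. The order-type clause has
  to be assumed for the union, because it compares traces on \<open>\<omega>\<^sub>1\<close>, which
  lie below every transitive node.\<close>

theorem amalgamate_transitive:
 assumes p: "cond p dp" and W: "W : p" "W : TT" and q: "cond q dq"
  and qW: "!!N. N : q ==> N : elts W & dq N : elts W"
  and pq: "!!N. N : p ==> N : elts W ==> N : q"
  and st: "star (p \<union> q)"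
 shows "cond (p \<union> q) (%M. if M : q then dq M else dp M)"
proof -
 note pn = condD(1)[OF p] and qn = condD(1)[OF q]
 note pc = condD(2)[OF p] and qc = condD(2)[OF q]
 note pd = condD(4)[OF p] and qd = condD(4)[OF q]
 let ?r = "p \<union> q"
 have up: "N = W | lt W N" if "N : p" "N ~: q" for N
  using chain_lin[OF pc that(1) W(1)] lt_TT[OF W(2)] pq[OF that(1)] that(2) by blast
 have llp: "N = M | ll ?r N M | ll ?r M N" if "N : p" "M : p" for N M using chainD[OF pc that] unfolding ll_def by blast
 have llq: "N = M | ll ?r N M | ll ?r M N" if "N : q" "M : q" for N M using chainD[OF qc that] unfolding ll_def by blast
 have pqc: "ll ?r M N" if "N : p" "N ~: q" "M : q" for N M
  using up[OF that(1,2)] qW[OF that(3)] W unfolding ll_def by blast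
 have c1: "N = M | ll ?r N M | ll ?r M N" if "N : ?r" "M : ?r" for N M using that llp llq pqc by blast
 have nodes: "?r \<subseteq> SS \<union> TT" using chain_node pc qc by blast
 have fin: "finite ?r" using chain_finite pc qc by blast
 have rc: "chain ?r" unfolding chain_def by (intro conjI fin nodes ballI c1)
 have cp: "X \<sqinter> Y : q" if X: "X : p" and Y: "Y : q" for X Y
 proof -
  have YW: "elts Y \<subseteq> elts W" using TT_trans[OF W(2)] qW[OF Y] by blast
  have XW: "X \<sqinter> W : p" by (rule niceD(2)[OF pn X W(1)])
  have e: "elts X \<inter> elts Y = elts (X \<sqinter> W) \<inter> elts Y" using YW by auto
  have "X \<sqinter> W = W | X \<sqinter> W : elts W"
  proof (cases "X : TT")
   case True
   then show ?thesis using TT_cap[OF True W(2)] TT_linear[OF True W(2)] TT_trans[OF True, of W]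
   proof (elim disjE)
    assume "X \<sqinter> W = X" "W : elts X"
    then have "elts X \<inter> elts W = elts X" "elts W \<subseteq> elts X" using TT_trans[OF True, of W] elts_cap by (metis, blast)
    then have "elts X = elts W" using TT_trans[OF W(2)] \<open>W : elts X\<close> by blast
    then have "X = W" by (simp only: elts_inject)
    then show ?thesis by simp
   qed auto
  next
   case False
   then have "X : SS" using chain_node[OF pc X] by blast
   then show ?thesis using cap_lt(1)[OF _ W(2)] by blast
  qed
  then show ?thesis
  proof
   assume a: "X \<sqinter> W = W"
   have "elts X \<inter> elts Y = elts Y" unfolding e a using YW by blast
   then show ?thesis using Y by simp
  next
   assume "X \<sqinter> W : elts W"
   then have "X \<sqinter> W : q" using pq XW by blast
   from niceD(2)[OF qn this Y] show ?thesis unfolding e .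
  qed
 qed
 have cp': "Y \<sqinter> X : q" if "X : p" "Y : q" for X Y using cp[OF that] by (simp add: Int_commute)
 have rn: "nice ?r" unfolding nice_def using rc cp cp' niceD(2)[OF pn] niceD(2)[OF qn] by blast
 have "deco ?r (%M. if M : q then dq M else dp M)" unfolding deco_def
 proof (intro ballI conjI allI impI)
  fix M assume M: "M : ?r"
  show "finite (elts (if M : q then dq M else dp M))" "(if M : q then dq M else dp M) : Vth" using M pd qd unfolding deco_def by auto
  fix N assume s: "isucc ?r M N"
  show "(if M : q then dq M else dp M) : elts N"
  proof (cases "M : q")
   case True
   show ?thesis
   proof (cases "N : q")
    case Nq: True
    then have "isucc q M N" using s unfolding isucc_def by blast
    then show ?thesis using qd True unfolding deco_def by auto
   next
    case False
    then have "N = W | lt W N" using up[of N] s unfolding isucc_def by blast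
    then have "N = W" using s W mem_lt qW[OF True] unfolding isucc_def by blast
    then show ?thesis using True qW[OF True] by simp
   qed
  next
   case False
   then have Mp: "M : p" using M by blast
   have "N : p"
   proof (rule ccontr)
    assume "N ~: p" then have "N : q" using s unfolding isucc_def by blast
    then have "lt N W" using qW mem_lt by blast
    then have "lt N M" using up[OF Mp False] lt_trans by blast
    then show False using s lt_asym unfolding isucc_def by blast
   qed
   then have "isucc p M N" using s unfolding isucc_def by blast
   then show ?thesis using pd Mp False unfolding deco_def by auto
  qed
 qed
 then show ?thesis unfolding cond_def using rn st by blast
qed

lemma cond_single: assumes "M : SS \<union> TT" shows "cond {M} (%_. zero)"
proof -
 have "nice {M}" unfolding nice_def chain_def using assms by simp
 moreover have "star {M}" by (rule starI) (use mem_irrefl in auto)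
 moreover have "deco {M} (%_. zero)" unfolding deco_def isucc_def using lt_irrefl thVth[OF zero_th] by auto
 ultimately show ?thesis unfolding cond_def by blast
qed

text \<open>The two countable nodes have the same trace on \<open>\<omega>\<^sub>1\<close>, so the
  order-type clause is vacuous.\<close>

lemma cond_triple: assumes K: "K : SS" and W: "W : TT" "W : elts K" shows "cond {K \<sqinter> W, W, K} (%_. zero)"
proof -
 let ?A = "K \<sqinter> W"
 have A: "?A : SS" by (rule SS_inter[OF K W])
 have AW: "?A : elts W" by (rule cap_lt(1)[OF K W(1)])
 have nodes: "{?A, W, K} \<subseteq> SS \<union> TT" using A K W by blast
 have c: "?A \<sqinter> W = ?A" "W \<sqinter> ?A = ?A" "?A \<sqinter> K = ?A" "K \<sqinter> ?A = ?A" "W \<sqinter> K = ?A"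
 proof -
  have "elts ?A \<inter> elts W = elts ?A" "elts W \<inter> elts ?A = elts ?A" "elts ?A \<inter> elts K = elts ?A" "elts K \<inter> elts ?A = elts ?A" "elts W \<inter> elts K = elts ?A" by auto
  then show "?A \<sqinter> W = ?A" "W \<sqinter> ?A = ?A" "?A \<sqinter> K = ?A" "K \<sqinter> ?A = ?A" "W \<sqinter> K = ?A" by (metis mk_elts)+
 qed
 have "chain {?A, W, K}" unfolding chain_def
 proof (intro conjI nodes)
  have "ll {?A, W, K} ?A W" "ll {?A, W, K} W K" "ll {?A, W, K} ?A K" unfolding ll_def using AW W mem_lt by blast+
  then show "ALL N:{?A, W, K}. ALL M:{?A, W, K}. N = M | ll {?A, W, K} N M | ll {?A, W, K} M N" by blast
 qed simp
 moreover have "M \<sqinter> N : {?A, W, K}" if "M : {?A, W, K}" "N : {?A, W, K}" for M N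
 proof -
  have "?A \<sqinter> ?A = ?A" "W \<sqinter> W = W" "K \<sqinter> K = K" by (simp_all only: Int_absorb mk_elts)
  with that c show ?thesis by (elim insertE emptyE) (simp_all only:, simp_all)
 qed
 ultimately have "nice {?A, W, K}" unfolding nice_def by blast
 moreover have "star {?A, W, K}"
 proof (rule starI)
  fix M N assume M: "M : {?A, W, K}" "M : SS" and N: "N : {?A, W, K}" "N : SS" and d: "dl N : elts (dl M)"
  have "W ~: SS" using SS_TT_disj W(1) by blast
  then have "dl M = dl K" "dl N = dl K" using M N dl_cap[OF W(1), of K] by auto
  then show "ot N : elts (dl M)" using d mem_irrefl by metis
 qed
 moreover have "deco {?A, W, K} (%_. zero)" unfolding deco_def isucc_def
  using thVth[OF zero_th] el_zero[OF node_el] nodes by auto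
 ultimately show ?thesis unfolding cond_def by blast
qed

text \<open>This is a promise about all stronger conditions: decorations only grow and are finite
  elements of the successor, so every later successor of \<open>Y\<close> must contain
  \<open>x\<close>.\<close>

lemma cond_decorate: assumes c: "cond m d" and Y: "Y : m" and x: "x : Vth" "!!N. isucc m Y N ==> x : elts N"
 shows "cle m (d(Y := mk (insert x (elts (d Y))))) m d"
proof -
 let ?d = "d(Y := mk (insert x (elts (d Y))))"
 have dd: "deco m d" by (rule condD(4)[OF c])
 have e: "elts (mk (insert x (elts (d Y)))) = insert x (elts (d Y))" by (simp add: small_insert)
 have "deco m ?d" unfolding deco_def
 proof (intro ballI conjI allI impI)
  fix M assume M: "M : m"
  have dY: "finite (elts (d Y))" "d Y : Vth" using dd Y unfolding deco_def by blast+
  show "finite (elts (?d M))" using dd M dY e unfolding deco_def by auto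
  have "mk (insert x (elts (d Y))) : Vth" by (rule Vth_finite) (use dY x(1) Vth_trans in auto)
  then show "?d M : Vth" using dd M unfolding deco_def by auto
  fix N assume s: "isucc m M N"
  have "el N" using node_el[OF chain_node[OF condD(2)[OF c]]] s unfolding isucc_def by blast
  then show "?d M : elts N" using el_insert x(2) s dd M unfolding deco_def by auto
 qed
 then have "cond m ?d" using c unfolding cond_def by blast
 moreover have "hle m m" unfolding hle_def by blast
 ultimately show ?thesis unfolding cle_def using c e by auto
qed

lemma hle_refl: "hle m m" unfolding hle_def by blast
lemma cle_trans: assumes "cle r dr q dq" "cle q dq p dp" shows "cle r dr p dp"
proof -
 have "hle p r" unfolding hle_def
 proof (intro ballI impI)
  fix N a assume N: "N : r \<inter> SS" "a : elts N \<inter> elts th" and ex: "EX K:p \<inter> SS. a : elts K & dl K = dl N"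
  have pq: "p \<subseteq> q" "hle q r" "hle p q" using assms unfolding cle_def by blast+
  then obtain L where L: "L : q \<inter> SS" "a : elts L" "dl L = dl N" "elts (ot N) \<subseteq> elts (ot L)" using N ex unfolding hle_def by blast
  have "EX K:p \<inter> SS. a : elts K & dl K = dl L" unfolding L(3) by (rule ex)
  then obtain K where K: "K : p \<inter> SS" "a : elts K" "dl K = dl L" "elts (ot L) \<subseteq> elts (ot K)" using pq(3) L(1,2) N(2) unfolding hle_def by blast
  then show "EX K:p \<inter> SS. a : elts K & dl K = dl N & elts (ot N) \<subseteq> elts (ot K)" using L(3,4) by (intro bexI[of _ K]) auto
 qed
 then show ?thesis using assms unfolding cle_def by blast
qed

end

section \<open>The forcing as a set, and traces of conditions on a countable node\<close>

context inacc begin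

text \<open>The elements of \<open>om\<close> are exactly the numerals, so finiteness from outside
  is injectability into an element of \<open>om\<close>.\<close>

lemma D_finite[dfn_intros]: assumes "F t" shows "D (%e. finite (elts (t e)))"
proof -
 have "finite X \<longleftrightarrow> (EX k:elts om. lep X (elts k))" if X: "small X" for X
 proof
  assume "finite X"
  then obtain n :: nat and f where f: "X = f ` {i. i < n}" "inj_on f {i. i < n}" using finite_imp_nat_seg_image_inj_on by blast
  define h where "h x = num (the_inv_into {i. i < n} f x)" for x
  have hf: "h (f i) = num i" if "i < n" for i unfolding h_def using the_inv_into_f_f[OF f(2)] that by simp
  have "small (graph h X)" by (rule small_finite) (simp add: graph_def \<open>finite X\<close>)
  then obtain g where g: "F (%e. g (e 0))" "!!x. x : X ==> g x = h x" by (rule graph_dt) (rule that)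
  have "inj_on g X" unfolding inj_on_def f(1) using g(2) hf f(1) by (auto simp: num_inj)
  moreover have "g ` X \<subseteq> elts (num n)" using g(2) hf f(1) by (auto simp: num_mem)
  ultimately have "lep X (elts (num n))" by (rule lepI[OF g(1)])
  then show "EX k:elts om. lep X (elts k)" by (rule bexI) simp
 next
  assume "EX k:elts om. lep X (elts k)"
  then obtain k where k: "k : elts om" "lep X (elts k)" by blast
  obtain n where n: "k = num n" using k(1) unfolding elts_omega by blast
  obtain f where "inj_on f X" "f ` X \<subseteq> elts k" using k(2) by (rule lepE) (rule that)
  moreover have "elts k = num ` {..<n}" unfolding n by (auto simp: num_mem)
  ultimately show "finite X" by (metis finite_imageI finite_lessThan finite_subset finite_imageD)
 qed
 then have e: "(%e. finite (elts (t e))) = (%e. EX k:elts om. lep (elts (t e)) (elts k))" by auto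
 show ?thesis unfolding e by (intro dfn_intros assms dt_shift UNIV_I)
qed

lemma ds_SS[dfn_intros]: "DS (%e. SS)" by (rule ds_small[OF small_SS])
lemma ds_TT[dfn_intros]: "DS (%e. TT)" by (rule ds_small[OF small_TT])

definition "nd p = elts (pfst p)"
definition "dc p N = ap (psnd p) N"

lemma ds_nd[dfn_intros]: "F t ==> DS (%e. nd (t e))" unfolding nd_def by (intro dfn_intros)
lemma dt_dc[dfn_intros]: "F t ==> F s ==> F (%e. dc (t e) (s e))" unfolding dc_def by (intro dfn_intros)
lemma small_nd[simp]: "small (nd p)" unfolding nd_def by simp

lemma cond_cong: assumes "!!M. M : m ==> d M = d' M" shows "cond m d \<longleftrightarrow> cond m d'"
 unfolding cond_def deco_def using assms by auto

lemma nd_cd[simp]: "finite m ==> nd (cd m d) = m" unfolding nd_def cd_def by (simp add: small_finite)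
lemma dc_cd[simp]: "finite m ==> M : m ==> dc (cd m d) M = d M" unfolding dc_def cd_def by (simp add: ap_fgraph)

lemma PP_cd: "cond m d ==> cd m d : PP" using PP_iff by blast

lemma PP_nd: "p : PP \<longleftrightarrow> cond (nd p) (dc p) & p = cd (nd p) (dc p)"
proof
 assume "p : PP"
 then obtain m d where md: "cond m d" "p = cd m d" using PP_iff by blast
 have f: "finite m" by (rule condD(5)[OF md(1)])
 have "cond (nd p) (dc p) \<longleftrightarrow> cond m d" unfolding md(2) nd_cd[OF f] by (rule cond_cong) (simp add: f)
 moreover have "cd (nd p) (dc p) = cd m d" unfolding md(2) nd_cd[OF f] by (subst cd_inj[OF f f]) (simp add: f)
 ultimately show "cond (nd p) (dc p) & p = cd (nd p) (dc p)" using md by simp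
next
 assume "cond (nd p) (dc p) & p = cd (nd p) (dc p)" then show "p : PP" using PP_iff by blast
qed

lemma PPD: assumes "p : PP" shows "cond (nd p) (dc p)" "p = cd (nd p) (dc p)" "finite (nd p)" "chain (nd p)" "nice (nd p)" "nd p \<subseteq> SS \<union> TT"
 using assms PP_nd condD chain_node by blast+

definition "PLe q p \<longleftrightarrow> q : PP & p : PP & nd p \<subseteq> nd q & (ALL M:nd p. elts (dc p M) \<subseteq> elts (dc q M)) & hle (nd p) (nd q)"

lemma PL_PLe: "PL = PLe"
proof (intro ext)
 fix q p
 show "PL q p = PLe q p"
 proof (cases "q : PP & p : PP")
  case True
  then have q: "cond (nd q) (dc q)" "q = cd (nd q) (dc q)" and p: "cond (nd p) (dc p)" "p = cd (nd p) (dc p)" using PPD by blast+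
  have "PL q p = PL (cd (nd q) (dc q)) (cd (nd p) (dc p))" by (simp only: q(2)[symmetric] p(2)[symmetric])
  also have "\<dots> = cle (nd q) (dc q) (nd p) (dc p)" by (rule PL_iff[OF q(1) p(1)])
  finally show ?thesis unfolding cle_def PLe_def using True q(1) p(1) by blast
 next
  case False then show ?thesis unfolding PLe_def Mstar_le_def by blast
 qed
qed

lemma PLe_cle: "q : PP ==> p : PP ==> PLe q p \<longleftrightarrow> cle (nd q) (dc q) (nd p) (dc p)"
 unfolding PLe_def cle_def using PPD by blast
lemma PLe_cd: assumes "cle m d m' d'" shows "PLe (cd m d) (cd m' d')"
proof -
 have c: "cond m d" "cond m' d'" using assms unfolding cle_def by blast+
 show ?thesis using PL_iff[OF c] assms unfolding PL_PLe by blast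
qed
lemma PLe_PP: "PLe q p ==> q : PP" "PLe q p ==> p : PP" unfolding PLe_def by blast+
lemma PLe_refl: "p : PP ==> PLe p p" unfolding PLe_def using hle_refl by blast
lemma PLe_trans: "PLe r q ==> PLe q p ==> PLe r p" using PLe_PP[of r q] PLe_PP[of q p] PLe_cle[of r q] PLe_cle[of q p] PLe_cle[of r p]
  cle_trans[of "nd r" "dc r" "nd q" "dc q" "nd p" "dc p"] by simp

lemma D_cap[dfn_intros]: "F s ==> F t ==> F (%e. s e \<sqinter> t e)" by (intro dfn_intros)

lemma D_cond: "D (%e. cond (elts (pfst (e 0))) (ap (psnd (e 0))))"
 unfolding cond_def nice_def chain_def ll_def star_def deco_def isucc_def
 by (intro dfn_intros ds_small[OF small_elts] UNIV_I)

lemma PP_Vth: assumes p: "p : PP" shows "p : Vth"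
proof -
 note f = PPD(3)[OF p]
 have n: "nd p \<subseteq> Vth" using PPD(6)[OF p] node_Vth by blast
 have d: "dc p M : Vth" if "M : nd p" for M using condD(4)[OF PPD(1)[OF p]] that unfolding deco_def by blast
 have "mk (nd p) : Vth" by (rule Vth_finite[OF f n])
 moreover have "mk (graph (dc p) (nd p)) : Vth"
  by (rule Vth_finite) (use f n d in \<open>auto simp: graph_def Vth_pr\<close>)
 ultimately have "cd (nd p) (dc p) : Vth" unfolding cd_def Vth_pr by blast
 then show ?thesis using PPD(2)[OF p] by simp
qed

lemma small_PP: "small PP"
proof -
 have e: "PP = {p : Vth. cond (elts (pfst p)) (ap (psnd p)) & p = pr (mk (nd p)) (mk ((%x. pr x (ap (psnd p) x)) ` nd p))}"
  using PP_nd PP_Vth unfolding cd_def graph_def dc_def nd_def by blast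
 show ?thesis unfolding e by (rule small_sep[OF small_elts]) (intro dfn_intros D_cond)
qed

lemma ds_PP[dfn_intros]: "DS (%e. PP)" by (rule ds_small[OF small_PP])

lemma D_PLe[dfn_intros]: assumes "F s" "F t" shows "D (%e. PLe (s e) (t e))"
proof (rule dfn_rel2[OF _ assms])
 show "D (%e. PLe (e 0) (e 1))" unfolding PLe_def hle_def by (intro dfn_intros ds_small[OF small_elts] UNIV_I)
qed

lemma PP_nonempty: assumes "M : SS \<union> TT" shows "cd {M} (%_. zero) : PP" by (rule PP_cd[OF cond_single[OF assms]])

text \<open>Guarantees that a condition in \<open>K\<close> has the traces and order types of its
  nodes in \<open>K\<close>; the closure is built in when \<open>K\<close> is chosen.\<close>

definition "closed2 K \<longleftrightarrow> (ALL N:elts K \<inter> SS. dl N : elts K & ot N : elts K)"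

text \<open>\<open>Q\<close> will be a statement about forcing, not about
  \<open>V\<^sub>\<theta>\<close>, so its Skolem function is added to the hull by hand.\<close>

lemma SS_good: assumes a: "a : Vth" and Q: "D (%e. Q (e 0) (e 1))"
 obtains K where "K : SS" "a : elts K" "closed2 K" "!!x y. x : elts K ==> y : Vth ==> Q x y ==> EX y:elts K. Q x y"
proof -
 obtain f where f: "F (%e. f (e 0))" "!!x y. x : Vth ==> y : Vth & Q x y ==> f x : Vth & Q x (f x)"
  by (rule choice[of "Vth" "%x y. y : Vth & Q x y"]) (rule small_elts, intro dfn_intros Q UNIV_I, rule that)
 define g where "g x = pr (if f x : Vth then f x else zero) (if x : SS then pr (dl x) (ot x) else zero)" for x
 have g: "F (%e. g (e 0))" unfolding g_def by (intro dfn_intros dt_1[OF f(1)] UNIV_I)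
 have "g x : Vth" if "x : Vth" for x
 proof -
  have "zero : Vth" by (rule thVth[OF zero_th])
  moreover have "dl x : Vth" "ot x : Vth" if "x : SS" using dl_om1[OF that] ot_om1[OF that] thVth th_trans[OF _ om1th] by blast+
  ultimately show ?thesis unfolding g_def by (simp add: Vth_pr)
 qed
 from loewenheim_skolem[OF g this a] obtain K where K: "K : SS" "a : elts K" "!!x. x : elts K ==> g x : elts K" by blast
 note el = SS_el[OF K(1)]
 show thesis
 proof (rule that[OF K(1,2)])
  show "closed2 K" unfolding closed2_def
  proof
   fix N assume N: "N : elts K \<inter> SS"
   then have "pr (dl N) (ot N) : elts K" using K(3)[of N] el_prD(2)[OF el] unfolding g_def by auto
   then show "dl N : elts K & ot N : elts K" using el_prD[OF el] by blast
  qed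
  fix x y assume x: "x : elts K" and y: "y : Vth" "Q x y"
  have "x : Vth" using el_sub[OF el] x by blast
  then have "f x : Vth & Q x (f x)" using f(2)[of x y] y by blast
  moreover from this have "f x : elts K" using K(3)[OF x] el_prD(1)[OF el] unfolding g_def by auto
  ultimately show "EX y:elts K. Q x y" by blast
 qed
qed

lemma el_ap: assumes el: "el K" and g: "g : elts K" "elts g = graph f X" and x: "x : elts K" "x : X" shows "f x : elts K"
proof -
 interpret K: cls2 elts "Vth" "elts K" by (rule el_cls2[OF el])
 have gV: "g : Vth" using g(1) el_sub[OF el] by blast
 have m: "pr x (f x) : elts g" using g(2) x(2) by simp
 then have "pr x (f x) : Vth" using Vth_trans[OF gV] by blast
 then have "f x : Vth" unfolding Vth_pr by blast
 then have "EX y:Vth. pr x y : elts g" using m by blast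
 moreover have "dfn elts Vth (elts K) (%e. pr x (e 0) : elts g)" by (intro K.dfn_mem K.dt_pr K.dt_const K.dt_var K.ds_elts x g)
 ultimately have "EX y:elts K. pr x y : elts g" by (rule el_ex[OF el, rotated])
 then show ?thesis using g(2) by auto
qed

text \<open>What \<open>K\<close> may know about \<open>s\<close>. The third part concerns nodes
  that are usually outside \<open>K\<close>: for a node \<open>X\<close> with trace in
  \<open>K\<close> it keeps \<open>X \<inter> K\<close> as the set of points, but the order type of
  the whole \<open>X\<close>.\<close>

definition "trc s K = pr (mk (nd s \<inter> elts K)) (pr (mk (graph (dc s) (nd s \<inter> elts K)))
  (mk ((%X. pr (X \<sqinter> K) (pr (dl X) (ot X))) ` {X : nd s \<inter> SS. dl X : elts K})))"

text \<open>The two height clauses together say that at every point covered by a record, the height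
  of \<open>q\<close> is the greatest order type recorded there.\<close>

definition "mt z q \<longleftrightarrow> q : PP & elts (pfst z) \<subseteq> nd q & (ALL N:elts (pfst z). elts (ap (pfst (psnd z)) N) \<subseteq> elts (dc q N)) &
  (ALL t:elts (psnd (psnd z)). ALL a:elts (pfst t) \<inter> elts th. EX N:nd q \<inter> SS. a : elts N & dl N = pfst (psnd t) & elts (psnd (psnd t)) \<subseteq> elts (ot N)) &
  (ALL N:nd q \<inter> SS. ALL a:elts N \<inter> elts th. (EX t:elts (psnd (psnd z)). a : elts (pfst t) & dl N = pfst (psnd t)) -->
   (EX t:elts (psnd (psnd z)). a : elts (pfst t) & dl N = pfst (psnd t) & elts (ot N) \<subseteq> elts (psnd (psnd t))))"

lemma D_mt[dfn_intros]: assumes "F s" "F t" shows "D (%e. mt (s e) (t e))"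
proof (rule dfn_rel2[OF _ assms])
 show "D (%e. mt (e 0) (e 1))" unfolding mt_def by (intro dfn_intros ds_small[OF small_elts] UNIV_I)
qed

lemma trc_simps: assumes s: "s : PP"
 shows "elts (pfst (trc s K)) = nd s \<inter> elts K" "N : nd s \<inter> elts K ==> ap (pfst (psnd (trc s K))) N = dc s N"
  "elts (psnd (psnd (trc s K))) = (%X. pr (X \<sqinter> K) (pr (dl X) (ot X))) ` {X : nd s \<inter> SS. dl X : elts K}"
 using PPD(3)[OF s] unfolding trc_def by (simp_all add: small_finite ap_fgraph)

lemma trc_mt: assumes s: "s : PP" shows "mt (trc s K) s"
 unfolding mt_def trc_simps[OF s] using s
 by (auto simp: trc_simps(2)[OF s])

text \<open>Stronger conditions keep existing heights, so a match is never lost.\<close>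

lemma mt_le: assumes m: "mt z q" and le: "PLe q' q" shows "mt z q'"
proof -
 have m1: "elts (pfst z) \<subseteq> nd q" "!!N. N:elts (pfst z) ==> elts (ap (pfst (psnd z)) N) \<subseteq> elts (dc q N)" using m unfolding mt_def by blast+
 have m3: "EX N:nd q \<inter> SS. a : elts N & dl N = pfst (psnd t) & elts (psnd (psnd t)) \<subseteq> elts (ot N)" if "t:elts (psnd (psnd z))" "a:elts (pfst t) \<inter> elts th" for t a
  using m that unfolding mt_def by blast
 have m4: "EX t:elts (psnd (psnd z)). a : elts (pfst t) & dl N = pfst (psnd t) & elts (ot N) \<subseteq> elts (psnd (psnd t))"
  if "N:nd q \<inter> SS" "a:elts N \<inter> elts th" "t:elts (psnd (psnd z))" "a : elts (pfst t)" "dl N = pfst (psnd t)" for N a t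
  using m that unfolding mt_def by blast
 have l: "q' : PP" "nd q \<subseteq> nd q'" "!!M. M : nd q ==> elts (dc q M) \<subseteq> elts (dc q' M)" "hle (nd q) (nd q')" using le unfolding PLe_def by blast+
 show ?thesis unfolding mt_def
 proof (intro conjI ballI impI l(1))
  show "elts (pfst z) \<subseteq> nd q'" using m1 l by blast
  fix N assume "N : elts (pfst z)" then show "elts (ap (pfst (psnd z)) N) \<subseteq> elts (dc q' N)" using m1 l(3)[of N] by blast
 next
  fix t a assume "t : elts (psnd (psnd z))" "a : elts (pfst t) \<inter> elts th"
  from m3[OF this] show "EX N:nd q' \<inter> SS. a : elts N & dl N = pfst (psnd t) & elts (psnd (psnd t)) \<subseteq> elts (ot N)" using l(2) by blast
 next
  fix N a assume N: "N : nd q' \<inter> SS" "a : elts N \<inter> elts th" and "EX t:elts (psnd (psnd z)). a : elts (pfst t) & dl N = pfst (psnd t)"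
  then obtain t where t: "t : elts (psnd (psnd z))" "a : elts (pfst t)" "dl N = pfst (psnd t)" by blast
  then obtain N0 where "N0 : nd q \<inter> SS" "a : elts N0" "dl N0 = dl N" using m3[of t a] N by auto
  then obtain N1 where N1: "N1 : nd q \<inter> SS" "a : elts N1" "dl N1 = dl N" "elts (ot N) \<subseteq> elts (ot N1)" using l(4) N unfolding hle_def by blast
  have "a : elts N1 \<inter> elts th" "dl N1 = pfst (psnd t)" using N1 N t by auto
  from m4[OF N1(1) this(1) t(1,2) this(2)] show "EX t:elts (psnd (psnd z)). a : elts (pfst t) & dl N = pfst (psnd t) & elts (ot N) \<subseteq> elts (psnd (psnd t))"
   using N1 by fastforce
 qed
qed

text \<open>The decoration lies in the successor of \<open>N\<close>. By \<open>gap\<close> this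
  successor is \<open>K\<close>, some \<open>K \<inter> U\<close>, or an element of
  \<open>K\<close>; in the last case it must be countable, since below a transitive
  \<open>N'\<close> the node \<open>K \<inter> N'\<close> would come in between.\<close>

lemma dc_in: assumes s: "s : PP" and K: "K : nd s" "K : SS" and N: "N : nd s" "N : elts K" shows "dc s N : elts K"
proof -
 note nn = PPD(5)[OF s] and ch = PPD(4)[OF s]
 have "K : {M:nd s. lt N M}" using K N mem_lt by blast
 with wfRp obtain N' where "N' : {M:nd s. lt N M}" "!!y. lt y N' ==> y ~: {M:nd s. lt N M}" by (rule wfE_min) (rule that)
 then have isu: "isucc (nd s) N N'" unfolding isucc_def by blast
 then have d: "dc s N : elts N'" and N': "N' : nd s" "lt N N'" and no: "!!B. B : nd s ==> lt N B ==> ~ lt B N'"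
  using condD(4)[OF PPD(1)[OF s]] N(1) unfolding deco_def isucc_def by blast+
 have "N' = K | lt N' K" using no[OF K(1) mem_lt[OF N(2)]] chain_lin[OF ch N'(1) K(1)] by blast
 moreover have ?thesis if l: "lt N' K" and nK: "N' ~: elts K"
 proof -
  obtain U where U: "U : nd s" "U : TT" "U : elts K" "N' : elts U" "N' = K \<sqinter> U | lt (K \<sqinter> U) N'"
   using gap[OF nn _ N'(1) l nK] K by blast
  have "N : elts (K \<sqinter> U)" using N(2) lt_TT[OF U(2)] lt_trans[OF N'(2) mem_lt[OF U(4)]] by simp
  then have "N' = K \<sqinter> U" using no[of "K \<sqinter> U"] niceD(2)[OF nn K(1) U(1)] U(5) mem_lt by blast
  then show ?thesis using d by simp
 qed
 moreover have ?thesis if m: "N' : elts K"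
 proof (cases "N' : SS")
  case True then show ?thesis using SS_sub[of K N'] K m d by blast
 next
  case False
  then have T: "N' : TT" using chain_node[OF ch N'(1)] by blast
  have "N : elts (K \<sqinter> N')" using N(2) lt_TT[OF T] N'(2) by simp
  moreover have "lt (K \<sqinter> N') N'" by (rule cap_lt(2)[OF K(2) T])
  moreover have "K \<sqinter> N' : nd s" by (rule niceD(2)[OF nn K(1) N'(1)])
  ultimately show ?thesis using no[of "K \<sqinter> N'"] mem_lt by blast
 qed
 ultimately show ?thesis using d by blast
qed

text \<open>The trace of \<open>X \<inter> K\<close> is that of \<open>X\<close>, strictly below
  that of \<open>K\<close>; this excludes \<open>K\<close> and all \<open>K \<inter> U\<close> in
  \<open>subset_node\<close>.\<close>

lemma cap_in: assumes s: "s : PP" and K: "K : nd s" "K : SS" and X: "X : nd s" "X : SS" "dl X : elts K" shows "X \<sqinter> K : elts K"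
proof -
 note nn = PPD(5)[OF s]
 have d: "dl X : elts (dl K)" using X dl_mem by blast
 have Z: "X \<sqinter> K : nd s" by (rule niceD(2)[OF nn X(1) K(1)])
 have "elts (dl X) \<subseteq> elts (dl K)" using Ord_trans[OF dl_Or[OF K(2)] _ d] by blast
 then have "elts (dl (X \<sqinter> K)) = elts (dl X)" unfolding elts_dl elts_cap by blast
 then have dlZ: "dl (X \<sqinter> K) = dl X" by simp
 have "dl X ~= dl K" using d mem_irrefl by metis
 then have "X \<sqinter> K ~= K" "!!U. U : TT ==> X \<sqinter> K ~= K \<sqinter> U" using dlZ dl_cap by metis+
 then show ?thesis using subset_node[OF nn _ Z, of K] K by auto
qed

text \<open>The order-type clause of the forcing is used here: it puts \<open>ot X\<close> into
  \<open>K\<close> once \<open>dl X\<close> is there.\<close>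

lemma trc_in: assumes s: "s : PP" and K: "K : nd s" "K : SS" shows "trc s K : elts K"
proof -
 note el = SS_el[OF K(2)]
 note f = PPD(3)[OF s]
 have "pr (X \<sqinter> K) (pr (dl X) (ot X)) : elts K" if X: "X : nd s" "X : SS" "dl X : elts K" for X
 proof -
  have "ot X : elts (dl K)" using starD[OF condD(3)[OF PPD(1)[OF s]] K X(1,2)] X(3) dl_mem[OF X(2)] by blast
  then have "ot X : elts K" unfolding elts_dl by blast
  then show ?thesis using el_pr[OF el] cap_in[OF s K X] X(3) by blast
 qed
 then have "mk ((%X. pr (X \<sqinter> K) (pr (dl X) (ot X))) ` {X : nd s \<inter> SS. dl X : elts K}) : elts K" by (intro el_finite[OF el]) (use f in auto)
 moreover have "mk (nd s \<inter> elts K) : elts K" by (rule el_finite[OF el]) (use f in auto)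
 moreover have "mk (graph (dc s) (nd s \<inter> elts K)) : elts K" by (rule el_finite[OF el]) (use f dc_in[OF s K] el_pr[OF el] in \<open>auto simp: graph_def\<close>)
 ultimately show ?thesis unfolding trc_def by (intro el_pr[OF el])
qed

lemma PP_el: assumes el: "el K" and q: "q : PP" "q : elts K" and N: "N : nd q" shows "N : elts K" "dc q N : elts K"
proof -
 note f = PPD(3)[OF q(1)]
 have "pr (mk (nd q)) (mk (graph (dc q) (nd q))) : elts K" using q PPD(2)[OF q(1)] unfolding cd_def by simp
 then have a: "mk (nd q) : elts K" "mk (graph (dc q) (nd q)) : elts K" using el_prD[OF el] by blast+
 show "N : elts K" using el_finite_sub[OF el a(1)] f N by (auto simp: small_finite)
 have "graph (dc q) (nd q) \<subseteq> elts K" using el_finite_sub[OF el a(2)] f by (simp add: elts_fgraph graph_def small_finite)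
 then have "pr N (dc q N) : elts K" using N by (auto simp: graph_def)
 then show "dc q N : elts K" using el_prD[OF el] by blast
qed

text \<open>A strong form of genericity of \<open>K\<close>: compatibility with \<open>s\<close>
  depends only on its trace, an element of \<open>K\<close>. A statement about \<open>s\<close> can
  thus be reflected to a condition in \<open>K\<close> and recombined with \<open>s\<close>.\<close>

theorem amalg: assumes s: "s : PP" and K: "K : nd s" "K : SS" "closed2 K" and q: "q : elts K" "mt (trc s K) q"
 obtains r where "PLe r s" "PLe r q"
proof -
 have qP: "q : PP" using q(2) unfolding mt_def by blast
 note el = SS_el[OF K(2)]
 have m1: "nd s \<inter> elts K \<subseteq> nd q" "!!N. N : nd s \<inter> elts K ==> elts (dc s N) \<subseteq> elts (dc q N)"
  using q(2) unfolding mt_def trc_simps(1)[OF s] by (auto simp: trc_simps(2)[OF s])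
 have m3: "EX N:nd q \<inter> SS. a : elts N & dl N = dl X & elts (ot X) \<subseteq> elts (ot N)"
  if "X : nd s" "X : SS" "dl X : elts K" "a : elts th" "a : elts X" "a : elts K" for X a
  using q(2) that unfolding mt_def trc_simps(3)[OF s] by fastforce
 have m4: "EX X:nd s \<inter> SS. dl X : elts K & a : elts X & dl X = dl N & elts (ot N) \<subseteq> elts (ot X)"
  if N: "N : nd q" "N : SS" "X : nd s" "X : SS" "a : elts th" "a : elts N" "a : elts X" "dl X = dl N" for N X a
 proof -
  have NK: "N : elts K" by (rule PP_el(1)[OF el qP q(1) N(1)])
  then have dK: "dl N : elts K" using K(3) N(2) unfolding closed2_def by blast
  have aK: "a : elts K" using SS_sub[of K N] K N NK by blast
  let ?t = "pr (X \<sqinter> K) (pr (dl X) (ot X))"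
  have t: "?t : elts (psnd (psnd (trc s K)))" unfolding trc_simps(3)[OF s] by (rule imageI) (use N dK in auto)
  have t2: "a : elts (pfst ?t)" "dl N = pfst (psnd ?t)" using N dK aK by auto
  have "EX t:elts (psnd (psnd (trc s K))). a : elts (pfst t) & dl N = pfst (psnd t) & elts (ot N) \<subseteq> elts (psnd (psnd t))"
   using q(2) N t t2 unfolding mt_def by blast
  then show ?thesis unfolding trc_simps(3)[OF s] by auto
 qed
 have "EX r dr. cle r dr (nd s) (dc s) & cle r dr (nd q) (dc q)"
 proof (rule amalgamate_countable[OF PPD(1)[OF s] K(1,2) PPD(1)[OF qP]])
  fix N assume N: "N : nd q"
  show "N : elts K & dc q N : elts K" using PP_el[OF el qP q(1) N] by blast
  then show "dl N : elts K & ot N : elts K" if "N : SS" using that K(3) unfolding closed2_def by blast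
 next
  fix N assume "N : nd s" "N : elts K" then show "N : nd q & elts (dc s N) \<subseteq> elts (dc q N)" using m1 by blast
 next
  fix X a assume "X : nd s" "X : SS" "dl X : elts K" "a : elts th" "a : elts X" "a : elts K"
  from m3[OF this] show "EX N:nd q \<inter> SS. a : elts N & dl N = dl X & elts (ot X) \<subseteq> elts (ot N)" .
 next
  fix N X a assume "N : nd q" "N : SS" "X : nd s" "X : SS" "a : elts th" "a : elts N" "a : elts X" "dl X = dl N"
  from m4[OF this] show "EX Y:nd s \<inter> SS. a : elts Y & dl Y = dl N & elts (ot N) \<subseteq> elts (ot Y)" by blast
 qed
 then obtain r dr where r: "cle r dr (nd s) (dc s)" "cle r dr (nd q) (dc q)" by blast
 have "PLe (cd r dr) s" "PLe (cd r dr) q" using PLe_cd[OF r(1)] PLe_cd[OF r(2)] by (simp_all only: PPD(2)[OF s, symmetric] PPD(2)[OF qP, symmetric])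
 then show thesis by (rule that)
qed

text \<open>The one-node condition with node \<open>K\<close> has an empty trace, which every
  condition matches.\<close>

lemma add_countable: assumes q: "q : PP" "q : elts K" and K: "K : SS" "closed2 K"
 obtains r where "PLe r q" "K : nd r"
proof -
 let ?s = "cd {K} (%_. zero)"
 have s: "?s : PP" by (rule PP_nonempty) (use K in blast)
 have K1: "K : nd ?s" by simp
 have dK: "dl K ~: elts K" using dl_mem[OF K(1), of K] mem_irrefl by metis
 have n: "nd ?s = {K}" by simp
 have "nd ?s \<inter> elts K = {}" unfolding n using mem_irrefl by simp
 moreover have "{X : nd ?s \<inter> SS. dl X : elts K} = {}" unfolding n using dK by blast
 ultimately have "mt (trc ?s K) q" unfolding mt_def trc_simps(1)[OF s] trc_simps(3)[OF s] using q by (simp only: image_empty empty_subsetI ball_empty bex_empty) simp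
 then obtain r where "PLe r ?s" "PLe r q" by (rule amalg[OF s K1 K q(2)])
 then show thesis using that K1 unfolding PLe_def by blast
qed

lemma add_transitive: assumes p: "cond p dp" and W: "W : p" "W : TT" and q: "q : PP" "q : elts W"
 and pq: "!!N. N : p ==> N : elts W ==> N : nd q" and st: "star (p \<union> nd q)"
 and h: "!!N a X. N : p ==> N : SS ==> a : elts N ==> a : elts th ==> X : nd q ==> X : SS ==> a : elts X ==> dl X = dl N ==>
  EX Y:nd q \<inter> SS. a : elts Y & dl Y = dl N & elts (ot N) \<subseteq> elts (ot Y)"
 obtains r where "PLe r q" "nd r = p \<union> nd q" "!!M. M : nd q ==> dc r M = dc q M" "!!M. M : p ==> M ~: nd q ==> dc r M = dp M"
proof -
 let ?d = "%M. if M : nd q then dc q M else dp M"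
 have c: "cond (p \<union> nd q) ?d"
  by (rule amalgamate_transitive[OF p W PPD(1)[OF q(1)] _ pq st]) (use PP_el[OF TT_el[OF W(2)] q] in blast)
 note f = condD(5)[OF c]
 let ?r = "cd (p \<union> nd q) ?d"
 have r: "?r : PP" by (rule PP_cd[OF c])
 have n: "nd ?r = p \<union> nd q" by (rule nd_cd[OF f])
 have d: "dc ?r M = ?d M" if "M : p \<union> nd q" for M by (rule dc_cd[OF f that])
 have "hle (nd q) (p \<union> nd q)" unfolding hle_def
 proof (intro ballI impI)
  fix N a assume N: "N : (p \<union> nd q) \<inter> SS" "a : elts N \<inter> elts th" and ex: "EX K:nd q \<inter> SS. a : elts K & dl K = dl N"
  show "EX K:nd q \<inter> SS. a : elts K & dl K = dl N & elts (ot N) \<subseteq> elts (ot K)"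
  proof (cases "N : nd q")
   case True then show ?thesis using N by blast
  next
   case False then show ?thesis using h[of N a] N ex by blast
  qed
 qed
 then have "PLe ?r q" unfolding PLe_def n using r q(1) d by auto
 moreover have "dc ?r M = dc q M" if "M : nd q" for M using d[of M] that by simp
 moreover have "dc ?r M = dp M" if "M : p" "M ~: nd q" for M using d[of M] that by simp
 ultimately show thesis using that n by blast
qed

end

section \<open>Check names and the definability of atomic forcing\<close>

context zfc begin

text \<open>As with \<open>Vr\<close>, a copy with recursion along \<open>R\<^sup>+\<close>, to
  which \<open>recursion\<close> applies.\<close>

definition ck :: "'a set => 'a => 'a" where
 "ck P = wfrec (R\<^sup>+) (%f x. mk {y. EX z:elts x. EX q:P. y = pr (ap (mk (graph f (below x))) z) q})"

lemma dt_ck: assumes "small P" shows "F (%e. ck P (e 0))"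
proof (rule recursion)
 show "F (%e. mk {y. EX z:elts (e 0). EX q:P. y = pr (ap (e 1) z) q})" by (intro dfn_intros ds_small[OF assms])
qed (rule rec_def[OF ck_def])

lemma ck: assumes P: "small P" shows "ck P x = mk {y. EX z:elts x. EX q:P. y = pr (ck P z) q}"
proof -
 have "ck P x = mk {y. EX z:elts x. EX q:P. y = pr (ap (mk (graph (ck P) (below x))) z) q}" by (rule rec_def[OF ck_def])
 also have "{y. EX z:elts x. EX q:P. y = pr (ap (mk (graph (ck P) (below x))) z) q} = {y. EX z:elts x. EX q:P. y = pr (ck P z) q}"
  using ap_rec[OF dt_ck[OF P] elts_below] by auto
 finally show ?thesis .
qed

lemma check_ck: assumes P: "small P" shows "check elts P x = ck P x"
proof (induction x rule: wf_induct_rule[OF wfR])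
 case (1 x)
 have IH: "z : elts x ==> check elts P z = ck P z" for z by (rule 1) (simp add: R_iff)
 have "check elts P x = mk {pr (check elts P z) q | z q. z : elts x & q : P}"
  unfolding check_def by (subst wfrec[OF wfR]) (auto simp: cut_def R_iff intro!: arg_cong[where f=mk])
 also have "{pr (check elts P z) q | z q. z : elts x & q : P} = {y. EX z:elts x. EX q:P. y = pr (check elts P z) q}" by blast
 also have "\<dots> = {y. EX z:elts x. EX q:P. y = pr (ck P z) q}" using IH by (simp cong: bex_cong)
 finally show ?case unfolding ck[OF P, of x] .
qed

lemma dt_check: "small P ==> F t ==> F (%e. check elts P (t e))" using dt_1[OF dt_ck] check_ck by simp

lemma elts_check: assumes P: "small P" shows "elts (check elts P x) = {y. EX z:elts x. EX q:P. y = pr (check elts P z) q}"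
proof -
 have e: "{y. EX z:elts x. EX q:P. y = pr (ck P z) q} = {y : prod (ck P ` elts x) P. EX z:elts x. EX q:P. y = pr (ck P z) q}" unfolding prod_def by blast
 have "small {y. EX z:elts x. EX q:P. y = pr (ck P z) q}" unfolding e
  by (rule small_sep[OF small_prod[OF small_image[OF small_elts dt_ck[OF P]] P]]) (intro dfn_intros dt_1[OF dt_ck[OF P]] ds_small[OF P] UNIV_I)
 then show ?thesis unfolding check_ck[OF P] by (subst ck[OF P]) simp
qed

lemma pr_check: "small P ==> pr y q : elts (check elts P x) \<longleftrightarrow> (EX z:elts x. y = check elts P z & q : P)"
 unfolding elts_check by auto

end

locale poset = zfc elts for elts :: "'v => 'v set" +
 fixes P :: "'v set" and le :: "'v => 'v => bool"
 assumes small_P: "small P" and D_le0: "D (%e. le (e 0) (e 1))"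
  and leP: "le q p ==> q : P & p : P" and le_refl: "p : P ==> le p p" and le_trans: "le r q ==> le q p ==> le r p"
begin

abbreviation "feq \<equiv> forces_eq elts P le"
abbreviation "fmem \<equiv> forces_mem elts P le"
abbreviation "chk \<equiv> check elts P"

lemma D_le[dfn_intros]: "F s ==> F t ==> D (%e. le (s e) (t e))" by (rule dfn_rel2[OF D_le0])
lemma ds_P[dfn_intros]: "DS (%e. P)" by (rule ds_small[OF small_P])
lemma dt_chk[dfn_intros]: "F t ==> F (%e. chk (t e))" by (rule dt_check[OF small_P])

lemma fmem_iff: "fmem p pi ta \<longleftrightarrow> p : P & (ALL q. le q p --> (EX r. le r q & (EX rh s. pr rh s : elts ta & le r s & feq r pi rh)))"
proof -
 have "fmem p pi ta \<longleftrightarrow> p : P & (ALL q:P. le q p --> (EX r:P. le r q & (EX rh s. pr rh s : elts ta & s : P & le r s & feq r pi rh)))"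
  by (subst forces_mem.simps) simp
 moreover have "(EX r:P. le r q & (EX rh s. pr rh s : elts ta & s : P & le r s & feq r pi rh)) \<longleftrightarrow> (EX r. le r q & (EX rh s. pr rh s : elts ta & le r s & feq r pi rh))" for q
  using leP by blast
 ultimately show ?thesis using leP by auto
qed
lemma feq_iff: "feq p sg ta \<longleftrightarrow> p : P & (ALL pi s q. pr pi s : elts sg & le q p & le q s --> fmem q pi ta)
  & (ALL pi s q. pr pi s : elts ta & le q p & le q s --> fmem q pi sg)"
 by (subst forces_eq.simps) (use leP in blast)

lemma feq_sym: "feq p sg ta ==> feq p ta sg" unfolding feq_iff[of p sg ta] feq_iff[of p ta sg] by blast

lemma pr_Rp: assumes "pr a b : elts x" shows "(a, x) : R\<^sup>+"
proof -
 have p: "elts (pr a b) = {mk {a}, mk {a, b}}" "elts (mk {a}) = {a}" using pr_in[OF UNIV_I UNIV_I, of a b] by auto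
 then have "(a, mk {a}) : R\<^sup>+" "(mk {a}, pr a b) : R\<^sup>+" using elts_Rp by auto
 then show ?thesis using elts_Rp[OF assms] trancl_trans by metis
qed

lemma feq_refl: "p : P ==> feq p sg sg"
proof (induction sg arbitrary: p rule: wf_induct_rule[OF wfRp])
 case (1 sg)
 have "fmem q pi sg" if "pr pi s : elts sg" "le q s" for pi s q
  unfolding fmem_iff
 proof (intro conjI allI impI)
  show "q : P" using that leP by blast
  fix q' assume q': "le q' q"
  have P: "q' : P" using q' leP by blast
  have "feq q' pi pi" by (rule 1(1)[OF pr_Rp[OF that(1)] P])
  then show "EX r. le r q' & (EX rh s. pr rh s : elts sg & le r s & feq r pi rh)" using le_refl[OF P] that le_trans[OF q'] by blast
 qed
 then show ?case unfolding feq_iff[of p] using 1(2) by blast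
qed

lemma fmem_I: assumes "p : P" "pr sg s : elts ta" "le p s" shows "fmem p sg ta"
 unfolding fmem_iff
proof (intro conjI allI impI assms(1))
 fix q assume q: "le q p"
 then have "q : P" using leP by blast
 then show "EX r. le r q & (EX rh s. pr rh s : elts ta & le r s & feq r sg rh)" using le_refl feq_refl assms le_trans[OF q] by blast
qed

lemma feq_check: "feq p (chk a) (chk b) ==> a = b"
proof (induction a arbitrary: b p rule: wf_induct_rule[OF wfR])
 case (1 a)
 have p: "p : P" and 1: "!!pi s q. pr pi s : elts (chk a) ==> le q p ==> le q s ==> fmem q pi (chk b)"
  and 2: "!!pi s q. pr pi s : elts (chk b) ==> le q p ==> le q s ==> fmem q pi (chk a)" and IH: "!!y c q. y : elts a ==> feq q (chk y) (chk c) ==> y = c"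
  using 1 R_iff unfolding feq_iff[of p] by blast+
 have ex: "EX r. EX z':elts c. feq r (chk z) (chk z')" if "fmem p (chk z) (chk c)" for z c
  using that le_refl[OF p] unfolding fmem_iff pr_check[OF small_P] by blast
 have "elts a = elts b"
 proof (intro equalityI subsetI)
  fix z assume z: "z : elts a"
  then have "pr (chk z) p : elts (chk a)" using p pr_check[OF small_P] by blast
  from ex[OF 1[OF this le_refl[OF p] le_refl[OF p]]] show "z : elts b" using IH[OF z] by blast
 next
  fix z assume z: "z : elts b"
  then have "pr (chk z) p : elts (chk b)" using p pr_check[OF small_P] by blast
  from ex[OF 2[OF this le_refl[OF p] le_refl[OF p]]] obtain r z' where "z' : elts a" "feq r (chk z') (chk z)" using feq_sym by blast
  then show "z : elts a" using IH by blast
 qed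
 then show ?case by simp
qed

lemma fmem_check: "p : P ==> fmem p (chk a) (chk b) \<longleftrightarrow> a : elts b"
proof
 assume p: "p : P" "fmem p (chk a) (chk b)"
 then obtain r z where "z : elts b" "feq r (chk a) (chk z)" using le_refl[OF p(1)] unfolding fmem_iff pr_check[OF small_P] by blast
 then show "a : elts b" using feq_check by blast
next
 assume "p : P" "a : elts b" then show "fmem p (chk a) (chk b)" using fmem_I[of p "chk a" p] pr_check[OF small_P] le_refl by blast
qed

text \<open>The clauses for atomic forcing with a parameter \<open>E\<close> in place of forced
  equality of smaller names; this turns the inductive definition into a recursion along levels of
  the hierarchy.\<close>

definition "CM E p pi ta \<longleftrightarrow> (ALL q:P. le q p --> (EX r:P. le r q & (EX rh s. pr rh s : elts ta & le r s & E r pi rh)))"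
definition "CE E p sg ta \<longleftrightarrow> (ALL pi s. pr pi s : elts sg --> (ALL q:P. le q p & le q s --> CM E q pi ta))
  & (ALL pi s. pr pi s : elts ta --> (ALL q:P. le q p & le q s --> CM E q pi sg))"

lemma feq_CE: "feq p sg ta \<longleftrightarrow> p : P & CE feq p sg ta"
 and fmem_CM: "fmem p sg ta \<longleftrightarrow> p : P & CM feq p sg ta"
proof -
 have m: "fmem p sg ta \<longleftrightarrow> p : P & CM feq p sg ta" for p sg ta unfolding fmem_iff[of p] CM_def using leP by blast
 then show "fmem p sg ta \<longleftrightarrow> p : P & CM feq p sg ta" .
 show "feq p sg ta \<longleftrightarrow> p : P & CE feq p sg ta" unfolding feq_iff[of p] CE_def m using leP by blast
qed

lemma CM_cong: assumes "!!r rh s. r : P ==> pr rh s : elts ta ==> E r pi rh ==> E' r pi rh" "CM E p pi ta" shows "CM E' p pi ta"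
 unfolding CM_def
proof (intro ballI impI)
 fix q assume "q : P" "le q p"
 then obtain r rh s where "r : P" "le r q" "pr rh s : elts ta" "le r s" "E r pi rh" using assms(2) unfolding CM_def by metis
 moreover from this have "E' r pi rh" using assms(1) by metis
 ultimately show "EX r:P. le r q & (EX rh s. pr rh s : elts ta & le r s & E' r pi rh)" by metis
qed

lemma CE_cong: assumes "!!r pi rh s s'. r : P ==> pr pi s : elts sg ==> pr rh s' : elts ta ==> E r pi rh = E' r pi rh & E r rh pi = E' r rh pi"
 shows "CE E p sg ta = CE E' p sg ta"
proof -
 have 1: "CM E q pi ta = CM E' q pi ta" if "pr pi s : elts sg" for q pi s
  using CM_cong[of ta E pi E' q] CM_cong[of ta E' pi E q] assms that by metis
 have 2: "CM E q pi sg = CM E' q pi sg" if "pr pi s : elts ta" for q pi s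
  using CM_cong[of sg E pi E' q] CM_cong[of sg E' pi E q] assms that by metis
 show ?thesis unfolding CE_def by (intro conj_cong all_cong1 imp_cong ball_cong refl) (erule 1, erule 2)
qed

text \<open>At an ordinal \<open>x\<close> this is the set of triples of a condition and two names
  in level \<open>x\<close> whose equality the condition forces. Being a recursion on sets it is
  definable, which the inductively defined \<open>forces_eq\<close> is not by its form.\<close>

definition "FX = wfrec (R\<^sup>+) (%f x. mk {t : prod P (prod (elts (Vs x)) (elts (Vs x))).
  CE (%p sg ta. EX y:elts x. pr p (pr sg ta) : elts (ap (mk (graph f (below x))) y)) (pfst t) (pfst (psnd t)) (psnd (psnd t))})"

lemma D_CE: assumes "D (%e. E (e 0) (e 1) (e 2) (e 3) (e 4))"
 shows "D (%e. CE (E (e 0) (e 1)) (e 2) (e 3) (e 4))"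
proof -
 have E: "D (%e. E (e a) (e b) (e c) (e d) (e f))" for a b c d f
  using dfn_ren[OF assms, of "%n. [a,b,c,d,f] ! n"] by (simp add: numeral_3_eq_3 numeral_2_eq_2 eval_nat_numeral)
 show ?thesis unfolding CE_def CM_def by (intro dfn_intros E)
qed

lemma ds_prod[dfn_intros]: "DS X ==> DS Y ==> DS (%e. prod (X e) (Y e))"
proof -
 assume X: "DS X" and Y: "DS Y"
 have e: "prod A B = {t. EX x:A. EX y:B. t = pr x y}" for A B unfolding prod_def by blast
 show ?thesis unfolding e by (intro dfn_intros ds_shift X Y)
qed

lemma dt_FX: "F (%e. FX (e 0))"
proof (rule recursion)
 have E: "D (%e. EX y:elts (e 0). pr (e 2) (pr (e 3) (e 4)) : elts (ap (e 1) y))" by (intro dfn_intros)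
 have C: "D (%e. CE (%p sg ta. EX y:elts (s e). pr p (pr sg ta) : elts (ap (t e) y)) (u e) (v e) (w e))"
  if "F s" "F t" "F u" "F v" "F w" for s t u v w
 proof -
  have 0: "D (%e. CE (%p sg ta. EX y:elts (e 0). pr p (pr sg ta) : elts (ap (e 1) y)) (e 2) (e 3) (e 4))"
   by (rule D_CE[of "%a b p sg ta. EX y:elts a. pr p (pr sg ta) : elts (ap b y)"]) (rule E)
  have e: "(%e. CE (%p sg ta. EX y:elts (s e). pr p (pr sg ta) : elts (ap (t e) y)) (u e) (v e) (w e)) =
   (%e. (%a b c d. CE (%p sg ta. EX y:elts a. pr p (pr sg ta) : elts (ap b y)) c (pfst d) (psnd d)) (s e) (t e) (u e) (pr (v e) (w e)))" by simp
  have "D (%e. CE (%p sg ta. EX y:elts (e 0). pr p (pr sg ta) : elts (ap (e 1) y)) (e 2) (pfst (e 3)) (psnd (e 3)))"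
  proof -
   have 1: "D (%e. CE (%p sg ta. EX y:elts (e 1). pr p (pr sg ta) : elts (ap (e 2) y)) (e 3) (e 0) (psnd (e 4)))"
   proof -
    have "D (%e. CE (%p sg ta. EX y:elts (e 2). pr p (pr sg ta) : elts (ap (e 3) y)) (e 4) (e 1) (e 0))"
     using dfn_ren[OF 0, of "%n. [2,3,4,1,0] ! n"] by (simp add: numeral_3_eq_3 numeral_2_eq_2 eval_nat_numeral)
    then have "D (%e. CE (%p sg ta. EX y:elts (e (Suc 1)). pr p (pr sg ta) : elts (ap (e (Suc 2)) y)) (e (Suc 3)) (e (Suc 0)) (e 0))" by (simp add: numeral_3_eq_3 numeral_2_eq_2 eval_nat_numeral)
    from dfn_let[OF dt_psnd[OF dt_var[of 4]] this] show ?thesis .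
   qed
   then have "D (%e. CE (%p sg ta. EX y:elts (e (Suc 0)). pr p (pr sg ta) : elts (ap (e (Suc 1)) y)) (e (Suc 2)) (e 0) (psnd (e (Suc 3))))" by (simp add: numeral_3_eq_3 numeral_2_eq_2 eval_nat_numeral)
   from dfn_let[OF dt_pfst[OF dt_var[of 3]] this] show ?thesis .
  qed
  from dfn_rel4[OF this that(1-3), of "%e. pr (v e) (w e)"] show ?thesis using that by (simp add: dt_pr)
 qed
 show "F (%e. mk {t : prod P (prod (elts (Vs (e 0))) (elts (Vs (e 0)))).
  CE (%p sg ta. EX y:elts (e 0). pr p (pr sg ta) : elts (ap (e 1) y)) (pfst t) (pfst (psnd t)) (psnd (psnd t))})"
  by (intro dfn_intros C)
qed (rule rec_def[OF FX_def])

lemma FX: "elts (FX x) = {t : prod P (prod (elts (Vs x)) (elts (Vs x))).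
  CE (%p sg ta. EX y:elts x. pr p (pr sg ta) : elts (FX y)) (pfst t) (pfst (psnd t)) (psnd (psnd t))}"
proof -
 have "FX x = mk {t : prod P (prod (elts (Vs x)) (elts (Vs x))).
   CE (%p sg ta. EX y:elts x. pr p (pr sg ta) : elts (ap (mk (graph FX (below x))) y)) (pfst t) (pfst (psnd t)) (psnd (psnd t))}" by (rule rec_def[OF FX_def])
 also have "(%p sg ta. EX y:elts x. pr p (pr sg ta) : elts (ap (mk (graph FX (below x))) y)) = (%p sg ta. EX y:elts x. pr p (pr sg ta) : elts (FX y))"
  by (intro ext bex_cong refl) (simp add: ap_rec[OF dt_FX elts_below])
 finally have e: "FX x = mk {t : prod P (prod (elts (Vs x)) (elts (Vs x))).
  CE (%p sg ta. EX y:elts x. pr p (pr sg ta) : elts (FX y)) (pfst t) (pfst (psnd t)) (psnd (psnd t))}" .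
 have "D (%e. e 0 : {t : prod P (prod (elts (Vs x)) (elts (Vs x))).
  CE (%p sg ta. EX y:elts x. pr p (pr sg ta) : elts (FX y)) (pfst t) (pfst (psnd t)) (psnd (psnd t))})"
 proof -
  have "D (%e. CE (%p sg ta. EX y:elts x. pr p (pr sg ta) : elts (FX y)) (e 2) (e 3) (e 4))"
   by (rule D_CE[of "%a b p sg ta. EX y:elts x. pr p (pr sg ta) : elts (FX y)"]) (intro dfn_intros dt_1[OF dt_FX] UNIV_I)
  then have "D (%e. CE (%p sg ta. EX y:elts x. pr p (pr sg ta) : elts (FX y)) (e 0) (e 1) (e 2))"
   using dfn_ren[of _ _ _ "%e. CE (%p sg ta. EX y:elts x. pr p (pr sg ta) : elts (FX y)) (e 2) (e 3) (e 4)" "%n. n - 2"] by (simp add: numeral_3_eq_3 numeral_2_eq_2 eval_nat_numeral)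
  from dfn_rel3[where R="CE (%p sg ta. EX y:elts x. pr p (pr sg ta) : elts (FX y))", OF this dt_pfst[OF dt_var[of 0]] dt_pfst[OF dt_psnd[OF dt_var[of 0]]] dt_psnd[OF dt_psnd[OF dt_var[of 0]]]]
  have "D (%e. CE (%p sg ta. EX y:elts x. pr p (pr sg ta) : elts (FX y)) (pfst (e 0)) (pfst (psnd (e 0))) (psnd (psnd (e 0))))" .
  from dfn_conj[OF dfn_mem[OF dt_var[of 0] ds_small[OF small_prod[OF small_P small_prod[OF small_elts small_elts]]]] this] show ?thesis unfolding mem_Collect_eq .
 qed
 then have "small {t : prod P (prod (elts (Vs x)) (elts (Vs x))).
  CE (%p sg ta. EX y:elts x. pr p (pr sg ta) : elts (FX y)) (pfst t) (pfst (psnd t)) (psnd (psnd t))}"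
  by (rule small_subset[OF small_prod[OF small_P small_prod[OF small_elts small_elts]], rotated]) blast
 then show ?thesis unfolding e[symmetric] by (subst e) simp
qed

lemma FX_feq: "Or a ==> sg : elts (Vs a) ==> ta : elts (Vs a) ==> p : P ==> pr p (pr sg ta) : elts (FX a) \<longleftrightarrow> feq p sg ta"
proof (induction a arbitrary: sg ta p rule: wf_induct_rule[OF wfR])
 case (1 a)
 note Oa = 1(2) and st = 1(3,4) and p = 1(5)
 have IH: "pr r (pr pi rh) : elts (FX y) \<longleftrightarrow> feq r pi rh" if "y : elts a" "pi : elts (Vs y)" "rh : elts (Vs y)" "r : P" for y r pi rh
  using 1(1)[of y pi rh r] that Ord_mem[OF Oa that(1)] R_iff by blast
 let ?E = "%p sg ta. EX y:elts a. pr p (pr sg ta) : elts (FX y)"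
 have E: "?E r pi rh \<longleftrightarrow> feq r pi rh" if r: "r : P" and d: "rk pi : elts (rk x)" "rk rh : elts (rk x')" "rk x : elts a" "rk x' : elts a" for r pi rh x x'
 proof
  assume "?E r pi rh" then obtain y where y: "y : elts a" "pr r (pr pi rh) : elts (FX y)" by blast
  then have "pi : elts (Vs y)" "rh : elts (Vs y)" unfolding FX[of y] by simp_all
  then show "feq r pi rh" using IH y r by blast
 next
  assume f: "feq r pi rh"
  \<comment> \<open>The larger of the two ranks is a level below \<open>a\<close> that contains both
    subnames.\<close>
  obtain y where y: "y : elts a" "Or y" "rk pi : elts y" "rk rh : elts y"
  proof (cases "elts (rk x) \<subseteq> elts (rk x')")
   case True then show thesis using that[of "rk x'"] d Ord_rk by blast
  next
   case False then have "elts (rk x') \<subseteq> elts (rk x)" using Ord_subset[OF Ord_rk Ord_rk] Ord_linear[OF Ord_rk Ord_rk, of x x'] by blast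
   then show thesis using that[of "rk x"] d Ord_rk by blast
  qed
  then have "pi : elts (Vs y)" "rh : elts (Vs y)" using Vs_iff by blast+
  then show "?E r pi rh" using IH[OF y(1)] r f y(1) by blast
 qed
 have rks: "rk sg : elts a" "rk ta : elts a" using st Vs_iff[OF Oa] by blast+
 have "CE ?E p sg ta = CE feq p sg ta"
 proof (rule CE_cong)
  fix r pi rh s s' assume r: "r : P" and m: "pr pi s : elts sg" "pr rh s' : elts ta"
  have k: "rk pi : elts (rk sg)" "rk rh : elts (rk ta)" using rk_Rp pr_Rp m by blast+
  show "?E r pi rh = feq r pi rh & ?E r rh pi = feq r rh pi" using E[OF r k rks] E[OF r k(2,1) rks(2,1)] by (intro conjI)
 qed
 then show ?case unfolding FX[of a] feq_CE[of p sg ta] using st p by simp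
qed

lemma D_feq[dfn_intros]: assumes "F s" "F t" "F u" shows "D (%e. feq (s e) (t e) (u e))"
proof (rule dfn_rel3[OF _ assms])
 have m: "sg : elts (Vs (rk (mk {sg, ta})))" "ta : elts (Vs (rk (mk {sg, ta})))" for sg ta
  unfolding Vs_iff[OF Ord_rk] by (rule rk_mem, simp)+
 have e: "(%e. feq (e 0) (e 1) (e 2)) = (%e. e 0 : P & pr (e 0) (pr (e 1) (e 2)) : elts (FX (rk (mk {e 1, e 2}))))"
  using FX_feq[OF Ord_rk m] feq_iff by blast
 show "D (%e. feq (e 0) (e 1) (e 2))" unfolding e by (intro dfn_intros dt_1[OF dt_FX])
qed

lemma D_fmem[dfn_intros]: assumes "F s" "F t" "F u" shows "D (%e. fmem (s e) (t e) (u e))"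
proof (rule dfn_rel3[OF _ assms])
 have e: "(%e. fmem (e 0) (e 1) (e 2)) = (%e. e 0 : P & CM feq (e 0) (e 1) (e 2))" using fmem_CM by blast
 show "D (%e. fmem (e 0) (e 1) (e 2))" unfolding e CM_def by (intro dfn_intros)
qed

end

section \<open>The forcing theorem and ZFC in the extension\<close>

locale forcing = poset elts P le for elts :: "'v => 'v set" and P le +
 fixes G :: "'v set" and eltsW :: "'w => 'w set" and val :: "'v => 'w"
 assumes gen: "generic elts P le G" and ext: "generic_extension elts G eltsW val"
begin

lemma generic_conds: "G \<subseteq> P" "G ~= {}" "ALL q:G. ALL p:P. le q p --> p : G" "ALL p:G. ALL q:G. EX r:G. le r p & le r q"
  "ALL D. elts D \<subseteq> P & (ALL p:P. EX q:elts D. le q p) --> G \<inter> elts D ~= {}"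
 using gen unfolding generic_def by - (elim conjE, assumption)+

lemma G_P: "p : G ==> p : P" and G_ne: "EX p. p : G" and G_up: "q : G ==> le q p ==> p : G"
 and G_dir: "p : G ==> q : G ==> EX r:G. le r p & le r q"
 using generic_conds(1-4) leP by blast+

lemma G_dense: assumes Q: "D (%e. Q (e 0))" and d: "!!p. p : P ==> EX q. le q p & Q q" shows "EX p:G. Q p"
proof -
 have e: "elts (mk {p:P. Q p}) = {p:P. Q p}" by (rule elts_mk[OF small_sep[OF small_P Q]])
 have "ALL p:P. EX q:elts (mk {p:P. Q p}). le q p" unfolding e using d leP by blast
 moreover have "elts (mk {p:P. Q p}) \<subseteq> P" unfolding e by blast
 ultimately have "G \<inter> elts (mk {p:P. Q p}) ~= {}" using spec[OF generic_conds(5), of "mk {p:P. Q p}"] by blast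
 then show ?thesis unfolding e by blast
qed

text \<open>Conditions incompatible with \<open>p\<close> are added to make the set dense;
  \<open>G\<close> contains none of them.\<close>

lemma G_below: assumes Q: "D (%e. Q (e 0))" and p: "p : G" and d: "!!q. le q p ==> EX r. le r q & Q r" shows "EX r:G. le r p & Q r"
proof -
 have "EX r:G. le r p & Q r | (ALL s. ~ (le s r & le s p))"
 proof (rule G_dense)
  show "D (%e. le (e 0) p & Q (e 0) | (ALL s. ~ (le s (e 0) & le s p)))" by (intro dfn_intros Q UNIV_I)
  fix t assume t: "t : P"
  show "EX q. le q t & (le q p & Q q | (ALL s. ~ (le s q & le s p)))"
  proof (cases "EX s. le s t & le s p")
   case True
   then obtain s r where "le s t" "le s p" "le r s" "Q r" using d by blast
   then show ?thesis using le_trans by blast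
  next
   case False then show ?thesis using le_refl[OF t] by blast
  qed
 qed
 then show ?thesis using G_dir[OF p] by blast
qed

definition "down ph \<longleftrightarrow> (ALL p. ph p --> p : P) & (ALL p q. ph p --> le q p --> ph q)"
definition "wsem ph B \<longleftrightarrow> down ph & (B \<longleftrightarrow> (EX p:G. ph p))"
text \<open>\<open>ph\<close> acts as the forcing relation of a sentence with truth value
  \<open>B\<close> in the extension. The clause on density below \<open>p\<close>, missing from
  \<open>wsem\<close>, is what universal quantification needs; \<open>sem_ex\<close> restores
  it.\<close>

definition "sem ph B \<longleftrightarrow> wsem ph B & (ALL p:P. (ALL q. le q p --> (EX r. le r q & ph r)) --> ph p)"
definition "fnot ph p \<longleftrightarrow> p : P & (ALL q. le q p --> ~ ph q)"

lemma D_fnot[dfn_intros]: assumes "D (%e. ph (e 0) (%n. e (Suc n)))" "F s" shows "D (%e. fnot (%p. ph p e) (s e))"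
 unfolding fnot_def by (intro dfn_intros dt_shift assms)

lemma semD: "sem ph B ==> ph p ==> p : P" "sem ph B ==> ph p ==> le q p ==> ph q" "sem ph B ==> B \<longleftrightarrow> (EX p:G. ph p)"
 "sem ph B ==> p : P ==> (ALL q. le q p --> (EX r. le r q & ph r)) ==> ph p" "sem ph B ==> wsem ph B"
 unfolding sem_def wsem_def down_def by blast+
lemma semI: assumes "!!p. ph p ==> p : P" "!!p q. ph p ==> le q p ==> ph q" "!!p. p : G ==> ph p ==> B" "B ==> EX p:G. ph p"
  "!!p. p : P ==> (ALL q. le q p --> (EX r. le r q & ph r)) ==> ph p" shows "sem ph B"
 unfolding sem_def wsem_def down_def using assms by blast

lemma sem_cong: "(!!p. ph p = ps p) ==> sem ph B ==> sem ps B" by presburger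

lemma sem_not: assumes D: "D (%e. ph (e 0))" and s: "sem ph B" shows "sem (fnot ph) (~ B)"
proof (rule semI)
 fix p assume "fnot ph p" then show "p : P" unfolding fnot_def by blast
next
 fix p q assume "fnot ph p" "le q p" then show "fnot ph q" unfolding fnot_def using le_trans leP by blast
next
 fix p assume p: "p : G" "fnot ph p" show "~ B"
 proof
  assume B then obtain q where q: "q : G" "ph q" using semD(3)[OF s] by blast
  obtain r where "le r p" "le r q" using G_dir[OF p(1) q(1)] by blast
  then show False using p(2) semD(2)[OF s q(2)] unfolding fnot_def by blast
 qed
next
 assume B: "~ B"
 have "EX p:G. ph p | fnot ph p"
 proof (rule G_dense)
  show "D (%e. ph (e 0) | fnot ph (e 0))" unfolding fnot_def by (intro dfn_intros D dfn_rel1[where R=ph])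
  fix p assume "p : P" then show "EX q. le q p & (ph q | fnot ph q)" unfolding fnot_def using le_refl by blast
 qed
 then show "EX p:G. fnot ph p" using B semD(3)[OF s] by blast
next
 fix p assume p: "p : P" "ALL q. le q p --> (EX r. le r q & fnot ph r)"
 show "fnot ph p" unfolding fnot_def
 proof (intro conjI allI impI p(1) notI)
  fix q assume q: "le q p" "ph q"
  then obtain r where r: "le r q" "fnot ph r" using p(2) by blast
  then have "ph r" using semD(2)[OF s q(2)] by blast
  then show False using r le_refl leP unfolding fnot_def by blast
 qed
qed

lemma sem_conj: assumes s: "sem ph B" and t: "sem ps C" shows "sem (%p. ph p & ps p) (B & C)"
proof (rule semI)
 fix p assume "ph p & ps p" then show "p : P" using semD(1)[OF s] by blast
next
 fix p q assume "ph p & ps p" "le q p" then show "ph q & ps q" using semD(2)[OF s] semD(2)[OF t] by blast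
next
 fix p assume "p : G" "ph p & ps p" then show "B & C" using semD(3)[OF s] semD(3)[OF t] by blast
next
 assume "B & C"
 then obtain p q where pq: "p : G" "q : G" "ph p" "ps q" using semD(3)[OF s] semD(3)[OF t] by blast
 obtain r where "r : G" "le r p" "le r q" using G_dir[OF pq(1,2)] by blast
 then show "EX p:G. ph p & ps p" using semD(2)[OF s pq(3)] semD(2)[OF t pq(4)] by blast
next
 fix p assume p: "p : P" "ALL q. le q p --> (EX r. le r q & ph r & ps r)"
 then show "ph p & ps p" using semD(4)[OF s p(1)] semD(4)[OF t p(1)] by blast
qed

lemma sem_all: assumes D: "D (%e. ph (e 0) (e 1))" and A: "DS (%e. A)" and s: "!!x. x : A ==> sem (ph x) (B x)"
 shows "sem (%p. p : P & (ALL x:A. ph x p)) (ALL x:A. B x)"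
proof (rule semI)
 fix p q assume "p : P & (ALL x:A. ph x p)" "le q p" then show "q : P & (ALL x:A. ph x q)" using semD(2)[OF s] leP by blast
next
 fix p assume "p : G" "p : P & (ALL x:A. ph x p)" then show "ALL x:A. B x" using semD(3)[OF s] by blast
next
 assume B: "ALL x:A. B x"
 have "EX p:G. (ALL x:A. ph x p) | (EX x:A. fnot (ph x) p)"
 proof (rule G_dense)
  have D': "F f ==> F g ==> D (%e. ph (f e) (g e))" for f g by (rule dfn_rel2[OF D])
  show "D (%e. (ALL x:A. ph x (e 0)) | (EX x:A. fnot (ph x) (e 0)))" unfolding fnot_def by (intro dfn_intros D' A)
  fix p assume p: "p : P"
  show "EX q. le q p & ((ALL x:A. ph x q) | (EX x:A. fnot (ph x) q))"
  proof (cases "ALL x:A. ph x p")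
   case True then show ?thesis using le_refl[OF p] by blast
  next
   case False
   then obtain x where x: "x : A" "~ ph x p" by blast
   then obtain q where q: "le q p" "!!r. le r q ==> ~ ph x r" using semD(4)[OF s[OF x(1)] p] by blast
   then have "fnot (ph x) q" unfolding fnot_def using leP by blast
   then show ?thesis using x q by blast
  qed
 qed
 then obtain p where p: "p : G" "(ALL x:A. ph x p) | (EX x:A. fnot (ph x) p)" by blast
 have False if x: "x : A" and f: "fnot (ph x) p" for x
 proof -
  obtain q where q: "q : G" "ph x q" using semD(3)[OF s[OF x]] B x by blast
  obtain r where "le r p" "le r q" using G_dir[OF p(1) q(1)] by blast
  then show False using f semD(2)[OF s[OF x] q(2)] unfolding fnot_def by blast
 qed
 then show "EX p:G. p : P & (ALL x:A. ph x p)" using p G_P by blast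
next
 fix p assume p: "p : P" "ALL q. le q p --> (EX r. le r q & r : P & (ALL x:A. ph x r))"
 then show "p : P & (ALL x:A. ph x p)" using semD(4)[OF s p(1)] by blast
qed blast

lemma sem_ex: assumes D: "D (%e. ph (e 0) (e 1))" and A: "DS (%e. A)" and s: "!!x. x : A ==> wsem (ph x) (B x)"
 shows "sem (%p. p : P & (ALL q. le q p --> (EX r. le r q & (EX x:A. ph x r)))) (EX x:A. B x)"
proof (rule semI)
 fix p q assume "p : P & (ALL q. le q p --> (EX r. le r q & (EX x:A. ph x r)))" "le q p"
 then show "q : P & (ALL q'. le q' q --> (EX r. le r q' & (EX x:A. ph x r)))" using le_trans leP by blast
next
 fix p assume p: "p : G" "p : P & (ALL q. le q p --> (EX r. le r q & (EX x:A. ph x r)))"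
 have "EX r:G. le r p & (EX x:A. ph x r)"
 proof (rule G_below[OF _ p(1)])
  show "D (%e. EX x:A. ph x (e 0))" by (intro dfn_intros A dfn_rel2[OF D])
 qed (use p(2) in blast)
 then show "EX x:A. B x" using s unfolding wsem_def by blast
next
 assume "EX x:A. B x"
 then obtain x p where x: "x : A" "p : G" "ph x p" using s unfolding wsem_def by blast
 have "ALL q. le q p --> (EX r. le r q & (EX x:A. ph x r))" using s[OF x(1)] x le_refl leP unfolding wsem_def down_def by blast
 then show "EX p:G. p : P & (ALL q. le q p --> (EX r. le r q & (EX x:A. ph x r)))" using x G_P by blast
next
 fix p assume p: "p : P" "ALL q. le q p --> (EX r. le r q & r : P & (ALL q. le q r --> (EX r. le r q & (EX x:A. ph x r))))"
 show "p : P & (ALL q. le q p --> (EX r. le r q & (EX x:A. ph x r)))"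
 proof (intro conjI allI impI p(1))
  fix q assume "le q p"
  then obtain r where "le r q" "r : P" "ALL q. le q r --> (EX r. le r q & (EX x:A. ph x r))" using p(2) by blast
  then show "EX r. le r q & (EX x:A. ph x r)" using le_refl le_trans by blast
 qed
qed blast

text \<open>A pair in a name contributes an element only if its condition \<open>t\<close> is in
  \<open>G\<close>; this clause handles that proviso.\<close>

lemma sem_inG: assumes s: "sem ph B" shows "sem (%p. p : P & (ALL q. le q p & le q t --> ph q)) (t : G --> B)"
proof (rule semI)
 fix p q assume "p : P & (ALL q. le q p & le q t --> ph q)" "le q p"
 then show "q : P & (ALL r. le r q & le r t --> ph r)" using le_trans leP by blast
next
 fix p assume p: "p : G" "p : P & (ALL q. le q p & le q t --> ph q)"
 show "t : G --> B"
 proof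
  assume "t : G" then obtain r where "r : G" "le r p" "le r t" using G_dir p by blast
  then show B using p(2) semD(3)[OF s] by blast
 qed
next
 assume B: "t : G --> B"
 show "EX p:G. p : P & (ALL q. le q p & le q t --> ph q)"
 proof (cases "t : G")
  case True then show ?thesis using B semD(3)[OF s] semD(2)[OF s] G_P by blast
 next
  case False
  have "EX p:G. le p t | (ALL q. ~ (le q p & le q t))"
  proof (rule G_dense)
   show "D (%e. le (e 0) t | (ALL q. ~ (le q (e 0) & le q t)))" by (intro dfn_intros UNIV_I)
   fix p assume "p : P" then show "EX q. le q p & (le q t | (ALL r. ~ (le r q & le r t)))" using le_refl by blast
  qed
  then show ?thesis using False G_up G_P by blast
 qed
next
 fix p assume p: "p : P" "ALL q. le q p --> (EX r. le r q & r : P & (ALL q. le q r & le q t --> ph q))"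
 show "p : P & (ALL q. le q p & le q t --> ph q)"
 proof (intro conjI allI impI p(1))
  fix q assume q: "le q p & le q t"
  show "ph q"
  proof (rule semD(4)[OF s])
   show "q : P" using q leP by blast
   show "ALL q'. le q' q --> (EX r. le r q' & ph r)"
   proof (intro allI impI)
    fix q' assume q': "le q' q"
    have "le q' p" "le q' t" using le_trans[OF q'] q by blast+
    then obtain r where r: "le r q'" "r : P" "ALL q. le q r & le q t --> ph q" using p(2) by blast
    have "ph r" using r(3) le_refl[OF r(2)] le_trans[OF r(1) \<open>le q' t\<close>] by blast
    then show "EX r. le r q' & ph r" using r(1) by blast
   qed
  qed
 qed
qed blast

lemma eltsW_val: "eltsW (val ta) = {val sg | sg p. p : G & pr sg p : elts ta}"
 and inj_W: "inj eltsW" and surj_val: "surj val"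
 using ext unfolding generic_extension_def by - (elim conjE, erule spec, elim conjE, assumption, elim conjE, assumption)

lemma valE: obtains ta where "x = val ta" using surj_val by (rule surjE)

definition "domn ta = {sg. EX p. pr sg p : elts ta}"
lemma domn_below: "sg : domn ta ==> (sg, ta) : R\<^sup>+" unfolding domn_def using pr_Rp by blast
lemma ds_domn[dfn_intros]: "F t ==> DS (%e. domn (t e))" unfolding domn_def by (intro dfn_intros dt_shift)
lemma small_domn: "small (domn ta)"
 by (rule small_subset[OF small_below[of ta]]) (use domn_below in \<open>auto simp: below_def\<close>, intro dfn_intros UNIV_I)
lemma W_domn: "x : eltsW (val ta) ==> EX sg:domn ta. x = val sg" unfolding eltsW_val domn_def by blast

definition "ispr x \<longleftrightarrow> x = pr (pfst x) (psnd x)"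
lemma ispr[simp]: "ispr (pr a b)" unfolding ispr_def by simp
lemma isprD: "ispr x ==> pr (pfst x) (psnd x) = x" unfolding ispr_def by (rule sym)
lemma D_ispr[dfn_intros]: "F t ==> D (%e. ispr (t e))" unfolding ispr_def by (intro dfn_intros)

lemma sem_mem0: assumes s: "!!rh. rh : domn ta ==> sem (%p. feq p pi rh) (val pi = val rh)"
 shows "sem (%p. fmem p pi ta) (val pi : eltsW (val ta))"
proof -
 let ?ph = "%x p. pfst x : domn ta & le p (psnd x) & feq p pi (pfst x)"
 let ?A = "{x : elts ta. ispr x}"
 have "sem (%p. p : P & (ALL q. le q p --> (EX r. le r q & (EX x:?A. ?ph x r)))) (EX x:?A. psnd x : G & val pi = val (pfst x))"
 proof (rule sem_ex)
  show "D (%e. pfst (e 0) : domn ta & le (e 1) (psnd (e 0)) & feq (e 1) pi (pfst (e 0)))" by (intro dfn_intros UNIV_I)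
  show "DS (%e. ?A)" by (intro dfn_intros UNIV_I)
  fix x assume x: "x : ?A"
  then have "pr (pfst x) (psnd x) : elts ta" by (simp add: isprD)
  then have d: "pfst x : domn ta" unfolding domn_def by blast
  note S = s[OF d]
  show "wsem (%p. ?ph x p) (psnd x : G & val pi = val (pfst x))" unfolding wsem_def down_def
  proof (intro conjI allI impI)
   show "p : P" if "pfst x : domn ta & le p (psnd x) & feq p pi (pfst x)" for p using that leP by blast
   show "pfst x : domn ta" by (rule d)
   show "le q (psnd x)" if "pfst x : domn ta & le p (psnd x) & feq p pi (pfst x)" "le q p" for p q using that le_trans by blast
   show "feq q pi (pfst x)" if "pfst x : domn ta & le p (psnd x) & feq p pi (pfst x)" "le q p" for p q using that semD(2)[OF S] by blast
   show "(psnd x : G & val pi = val (pfst x)) = (EX p:G. pfst x : domn ta & le p (psnd x) & feq p pi (pfst x))"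
   proof
    assume a: "psnd x : G & val pi = val (pfst x)"
    then obtain p where p: "p : G" "feq p pi (pfst x)" using semD(3)[OF S] by blast
    obtain r where "r : G" "le r p" "le r (psnd x)" using G_dir[OF p(1)] a by blast
    then show "EX p:G. pfst x : domn ta & le p (psnd x) & feq p pi (pfst x)" using semD(2)[OF S p(2)] d by blast
   next
    assume "EX p:G. pfst x : domn ta & le p (psnd x) & feq p pi (pfst x)"
    then show "psnd x : G & val pi = val (pfst x)" using semD(3)[OF S] G_up by blast
   qed
  qed
 qed
 moreover have "(EX x:?A. psnd x : G & val pi = val (pfst x)) = (val pi : eltsW (val ta))" unfolding eltsW_val
 proof
  assume "EX x:?A. psnd x : G & val pi = val (pfst x)"
  then obtain x where x: "x : elts ta" "ispr x" "psnd x : G" "val pi = val (pfst x)" by blast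
  then have "pr (pfst x) (psnd x) : elts ta" by (simp add: isprD)
  then show "val pi : {val sg |sg p. p : G & pr sg p : elts ta}" using x(3,4) by blast
 next
  assume "val pi : {val sg |sg p. p : G & pr sg p : elts ta}"
  then obtain sg p where "val pi = val sg" "p : G" "pr sg p : elts ta" by blast
  then show "EX x:?A. psnd x : G & val pi = val (pfst x)" by (intro bexI[of _ "pr sg p"]) auto
 qed
 moreover have "(EX x:?A. ?ph x r) = (EX rh s. pr rh s : elts ta & le r s & feq r pi rh)" for r
 proof
  assume "EX x:?A. ?ph x r"
  then obtain x where x: "x : elts ta" "ispr x" "le r (psnd x)" "feq r pi (pfst x)" by blast
  then have "pr (pfst x) (psnd x) : elts ta" by (simp add: isprD)
  then show "EX rh s. pr rh s : elts ta & le r s & feq r pi rh" using x by blast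
 next
  assume "EX rh s. pr rh s : elts ta & le r s & feq r pi rh"
  then obtain rh s where "pr rh s : elts ta" "le r s" "feq r pi rh" by blast
  then show "EX x:?A. ?ph x r" by (intro bexI[of _ "pr rh s"]) (auto simp: domn_def)
 qed
 ultimately show ?thesis unfolding fmem_iff[of _ pi ta] by simp
qed

text \<open>Quantification over pairs in a name becomes quantification over the elements of a set,
  the shape that \<open>sem_all\<close> and \<open>sem_conj\<close> handle.\<close>

lemma feq_alt: "feq p sg ta \<longleftrightarrow> (p : P & (ALL x:elts sg. p : P & (ispr x --> (ALL q. le q p & le q (psnd x) --> fmem q (pfst x) ta))))
  & (p : P & (ALL x:elts ta. p : P & (ispr x --> (ALL q. le q p & le q (psnd x) --> fmem q (pfst x) sg))))" (is "?L \<longleftrightarrow> ?R")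
proof -
 have "(ALL x:elts sg. ispr x --> (ALL q. le q p & le q (psnd x) --> fmem q (pfst x) ta)) \<longleftrightarrow>
   (ALL pi s q. pr pi s : elts sg & le q p & le q s --> fmem q pi ta)" for sg ta
 proof (intro iffI allI impI ballI)
  fix pi s q assume a: "ALL x:elts sg. ispr x --> (ALL q. le q p & le q (psnd x) --> fmem q (pfst x) ta)"
   "pr pi s : elts sg & le q p & le q s"
  then show "fmem q pi ta" using bspec[OF a(1), of "pr pi s"] by simp
 next
  fix x q assume a: "ALL pi s q. pr pi s : elts sg & le q p & le q s --> fmem q pi ta" "x : elts sg" "ispr x" "le q p & le q (psnd x)"
  have "pr (pfst x) (psnd x) : elts sg" using a(2,3) by (simp add: isprD)
  then show "fmem q (pfst x) ta" using a(1,4) by blast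
 qed
 note h = this
 show ?thesis unfolding feq_iff[of p sg ta] h[symmetric] by (cases "p : P") (simp_all only: simp_thms)
qed

lemma sem_eq0: assumes s: "!!pi. pi : domn sg ==> sem (%p. fmem p pi ta) (val pi : eltsW (val ta))"
  "!!pi. pi : domn ta ==> sem (%p. fmem p pi sg) (val pi : eltsW (val sg))"
 shows "sem (%p. feq p sg ta) (val sg = val ta)"
proof -
 have 1: "sem (%p. p : P & (ALL x:elts sg. p : P & (ispr x --> (ALL q. le q p & le q (psnd x) --> fmem q (pfst x) ta))))
   (ALL x:elts sg. ispr x --> psnd x : G --> val (pfst x) : eltsW (val ta))"
  if s: "!!pi. pi : domn sg ==> sem (%p. fmem p pi ta) (val pi : eltsW (val ta))" for sg ta
 proof (rule sem_all)
  show "D (%e. e 1 : P & (ispr (e 0) --> (ALL q. le q (e 1) & le q (psnd (e 0)) --> fmem q (pfst (e 0)) ta)))" by (intro dfn_intros UNIV_I)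
  show "DS (%e. elts sg)" by (intro dfn_intros UNIV_I)
  fix x assume x: "x : elts sg"
  show "sem (%p. p : P & (ispr x --> (ALL q. le q p & le q (psnd x) --> fmem q (pfst x) ta)))
    (ispr x --> psnd x : G --> val (pfst x) : eltsW (val ta))"
  proof (cases "ispr x")
   case True
   then have "pr (pfst x) (psnd x) : elts sg" using x by (simp add: isprD)
   then have "pfst x : domn sg" unfolding domn_def by blast
   from sem_inG[OF s[OF this], of "psnd x"] show ?thesis using True by (rule_tac sem_cong[rotated]) auto
  next
   case False
   have "sem (%p. p : P) True" by (rule semI) (use G_ne G_P leP in blast)+
   then show ?thesis using False by simp
  qed
 qed
 have sub: "(ALL x:elts sg. ispr x --> psnd x : G --> val (pfst x) : eltsW (val ta)) \<longleftrightarrow> eltsW (val sg) \<subseteq> eltsW (val ta)" for sg ta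
 proof
  assume a: "ALL x:elts sg. ispr x --> psnd x : G --> val (pfst x) : eltsW (val ta)"
  show "eltsW (val sg) \<subseteq> eltsW (val ta)"
  proof
   fix y assume "y : eltsW (val sg)"
   then obtain pi p where "y = val pi" "p : G" "pr pi p : elts sg" unfolding eltsW_val[of sg] by blast
   then show "y : eltsW (val ta)" using bspec[OF a, of "pr pi p"] by simp
  qed
 next
  assume a: "eltsW (val sg) \<subseteq> eltsW (val ta)"
  show "ALL x:elts sg. ispr x --> psnd x : G --> val (pfst x) : eltsW (val ta)"
  proof (intro ballI impI)
   fix x assume x: "x : elts sg" "ispr x" "psnd x : G"
   then have "pr (pfst x) (psnd x) : elts sg" by (simp add: isprD)
   then have "val (pfst x) : eltsW (val sg)" using x(3) unfolding eltsW_val[of sg] by blast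
   then show "val (pfst x) : eltsW (val ta)" using a by blast
  qed
 qed
 have "(eltsW (val sg) \<subseteq> eltsW (val ta) & eltsW (val ta) \<subseteq> eltsW (val sg)) = (val sg = val ta)"
  by (metis injD[OF inj_W] subset_antisym order_refl)
 note e = this
 have "sem (%p. feq p sg ta) (eltsW (val sg) \<subseteq> eltsW (val ta) & eltsW (val ta) \<subseteq> eltsW (val sg))"
  unfolding feq_alt[of _ sg ta] sub[symmetric] by (rule sem_conj; rule 1; rule s; assumption)
 then show ?thesis unfolding e .
qed

text \<open>Equality reduces to membership of subnames, and membership back to equality with
  subnames. Symmetry of forced equality lets the induction run on one of the two names
  alone.\<close>

lemma sem_eq: "sem (%p. feq p sg ta) (val sg = val ta)"
proof -
 have "ALL ta. sem (%p. feq p sg ta) (val sg = val ta)"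
 proof (induction sg rule: wf_induct_rule[OF wfRp])
  case (1 sg)
  have IH: "sem (%p. feq p pi ta) (val pi = val ta)" if "pi : domn sg" for pi ta using 1 domn_below[OF that] by blast
  have IH': "sem (%p. feq p ta pi) (val ta = val pi)" if "pi : domn sg" for pi ta
  proof -
   have e: "feq p ta pi = feq p pi ta" for p using feq_sym by blast
   show ?thesis unfolding e[of _ ] eq_commute[of "val ta"] by (rule IH[OF that])
  qed
  show ?case by (rule allI, rule sem_eq0; rule sem_mem0; (rule IH, assumption | rule IH', assumption))
 qed
 then show ?thesis by blast
qed

lemma sem_mem: "sem (%p. fmem p sg ta) (val sg : eltsW (val ta))" by (rule sem_mem0[OF sem_eq])

primrec fo :: "fm => (nat => 'v) => 'v => bool" where
 "fo (Mem i j) e p = fmem p (e i) (e j)"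
| "fo (Eq i j) e p = feq p (e i) (e j)"
| "fo (Neg ph) e p = fnot (fo ph e) p"
| "fo (Conj ph ps) e p = (fo ph e p & fo ps e p)"
| "fo (All ph) e p = (p : P & (ALL x:UNIV. fo ph (case_nat x e) p))"

lemma D_fo: "(!!n. F (%e. t e n)) ==> F s ==> D (%e. fo ph (t e) (s e))"
proof (induction ph arbitrary: t s)
 case (Mem i j) show ?case unfolding fo.simps by (intro dfn_intros Mem)
next
 case (Eq i j) show ?case unfolding fo.simps by (intro dfn_intros Eq)
next
 case (Conj ph ps) show ?case unfolding fo.simps by (rule dfn_conj[OF Conj(1)[OF Conj(3,4)] Conj(2)[OF Conj(3,4)]])
next
 case (Neg ph)
 have "D (%e. fo ph (t (%n. e (Suc n))) (e 0))" by (rule Neg(1)) (intro dt_shift Neg(2), rule dt_var)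
 then show ?case unfolding fo.simps by (intro dfn_intros Neg(3))
next
 case (All ph)
 have "D (%e. fo ph (case_nat (e 0) (t (%n. e (Suc n)))) (s (%n. e (Suc n))))"
 proof (rule All(1))
  fix n show "F (%e. case_nat (e 0) (t (%n. e (Suc n))) n)"
  proof (cases n)
   case 0 then show ?thesis by (simp add: dt_var)
  next
   case (Suc m) then show ?thesis using dt_shift[OF All(2)[of m]] by simp
  qed
 qed (rule dt_shift[OF All(3)])
 then show ?case unfolding fo.simps by (intro dfn_intros All(3))
qed

lemma fo_sem: "sem (fo ph e) (sat eltsW UNIV (%n. val (e n)) ph)"
proof (induction ph arbitrary: e)
 case (Mem i j) then show ?case using sem_mem by simp
next
 case (Eq i j) then show ?case using sem_eq by simp
next
 case (Neg ph)
 have "D (%e'. fo ph e (e' 0))" by (rule D_fo) (intro dfn_intros UNIV_I)+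
 from sem_not[OF this Neg] show ?case by simp
next
 case (Conj ph ps) then show ?case using sem_conj by simp
next
 case (All ph)
 have c: "(%n. val (case_nat x e n)) = case_nat (val x) (%n. val (e n))" for x by (auto split: nat.split)
 have "sem (%p. p : P & (ALL x:UNIV. fo ph (case_nat x e) p)) (ALL x:UNIV. sat eltsW UNIV (case_nat (val x) (%n. val (e n))) ph)"
 proof (rule sem_all)
  show "D (%e'. fo ph (case_nat (e' 0) e) (e' 1))"
  proof (rule D_fo)
   fix n show "F (%e'. case_nat (e' 0) e n)" by (cases n) (simp_all add: dt_var dt_const)
  qed (rule dt_var)
  show "DS (%e. UNIV)" by (rule ds_UNIV)
 qed (use All[of "case_nat _ e"] c in simp)
 moreover have "(ALL x:UNIV. sat eltsW UNIV (case_nat (val x) (%n. val (e n))) ph) = (ALL x:UNIV. sat eltsW UNIV (case_nat x (%n. val (e n))) ph)"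
  using surj_val by (metis surjD UNIV_I)
 ultimately show ?case by simp
qed

lemma name_of: assumes A: "small A" and D: "D (%e. ph (e 0) (e 1))" and s: "!!sg. sg : A ==> sem (ph sg) (B sg)"
 shows "EX b. eltsW b = {val sg | sg. sg : A & B sg}"
proof -
 let ?N = "{t : prod A P. ph (pfst t) (psnd t)}"
 have N: "elts (mk ?N) = ?N" by (intro elts_mk small_sep small_prod A small_P dfn_rel2[OF D] dfn_intros)
 have m: "pr sg p : ?N \<longleftrightarrow> sg : A & p : P & ph sg p" for sg p by simp
 have "eltsW (val (mk ?N)) = {val sg | sg p. p : G & sg : A & p : P & ph sg p}" unfolding eltsW_val N m by blast
 also have "\<dots> = {val sg | sg. sg : A & B sg}" using semD(3)[OF s] G_P by blast
 finally show ?thesis by blast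
qed

lemma name_of_small: assumes A: "small A" shows "EX b. eltsW b = val ` A"
proof -
 have "sem (%p. p : P) True" by (rule semI) (use G_ne G_P leP in blast)+
 note S = this
 have "D (%e. e 1 : P)" by (intro dfn_intros)
 from name_of[where ph="%sg p. p : P" and B="%_. True", OF A this S] have "EX b. eltsW b = {val sg | sg. sg : A & True}" .
 moreover have "{val sg | sg. sg : A & True} = val ` A" by blast
 ultimately show ?thesis by simp
qed

abbreviation "vc x \<equiv> val (chk x)"

lemma eltsW_vc: "eltsW (vc x) = vc ` elts x"
 unfolding eltsW_val pr_check[OF small_P] using G_P G_ne by blast

lemma vc_inj: "vc x = vc y \<longleftrightarrow> x = y"
proof
 show "vc x = vc y ==> x = y"
 proof (induction x arbitrary: y rule: wf_induct_rule[OF wfR])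
  case (1 x)
  have "vc ` elts x = vc ` elts y" using 1(2) eltsW_vc by metis
  then have "elts x = elts y" using 1(1) R_iff by (auto simp: set_eq_iff image_iff) metis+
  then show ?case by simp
 qed
qed simp

lemma vc_mem: "vc x : eltsW (vc y) \<longleftrightarrow> x : elts y" unfolding eltsW_vc using vc_inj by auto

lemma wf_W: "wf (memrel eltsW)"
proof (rule wfI_min)
 fix x and Q :: "'w set" assume "x : Q"
 then obtain ta where "ta : {ta. val ta : Q}" using valE[of x] by blast
 with wfRp obtain ta where t: "ta : {ta. val ta : Q}" "!!y. (y, ta) : R\<^sup>+ ==> y ~: {ta. val ta : Q}" by (rule wfE_min) (rule that)
 have "y ~: Q" if yv: "y : eltsW (val ta)" for y
 proof -
  obtain sg where "sg : domn ta" "y = val sg" using W_domn[OF yv] by blast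
  then show ?thesis using t(2)[OF domn_below, of sg] by simp
 qed
 then have "ALL y. (y, val ta) : memrel eltsW --> y ~: Q" by (simp add: memrel_def)
 then show "EX z:Q. ALL y. (y, z) : memrel eltsW --> y ~: Q" using t(1) by blast
qed

lemma env_val: fixes e :: "nat => 'w" obtains e' where "e = (%n. val (e' n))"
proof -
 have "ALL n. EX ta. e n = val ta" using surj_val by (metis surjD)
 then obtain e' where "ALL n. e n = val (e' n)" by (rule Hilbert_Choice.choice[THEN exE])
 then show thesis using that[of e'] by blast
qed

lemma val_case_nat: "(%n. val (case_nat x e n)) = case_nat (val x) (%n. val (e n))" by (auto split: nat.split)

lemma D_fo_case: "D (%e'. fo ph (case_nat (e' 0) e) (e' 1))"
proof (rule D_fo)
 fix n show "F (%e'. case_nat (e' 0) e n)" by (cases n) (simp_all add: dt_var dt_const)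
qed (rule dt_var)

lemma W_sep: "EX b. eltsW b = {x : eltsW a. sat eltsW UNIV (case_nat x e) ph}"
proof -
 obtain ta where t: "a = val ta" by (rule valE)
 obtain e' where e: "e = (%n. val (e' n))" by (rule env_val)
 have "EX b. eltsW b = {val sg | sg. sg : domn ta & (val sg : eltsW (val ta) & sat eltsW UNIV (case_nat (val sg) e) ph)}"
 proof (rule name_of[OF small_domn])
  show "D (%f. fmem (f 1) (f 0) ta & fo ph (case_nat (f 0) e') (f 1))" by (intro dfn_intros D_fo_case UNIV_I)
  fix sg show "sem (%p. fmem p sg ta & fo ph (case_nat sg e') p) (val sg : eltsW (val ta) & sat eltsW UNIV (case_nat (val sg) e) ph)"
   using sem_conj[OF sem_mem fo_sem[of ph "case_nat sg e'"]] unfolding val_case_nat e .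
 qed
 moreover have "{val sg | sg. sg : domn ta & (val sg : eltsW (val ta) & sat eltsW UNIV (case_nat (val sg) e) ph)} = {x : eltsW a. sat eltsW UNIV (case_nat x e) ph}"
  unfolding t using W_domn by blast
 ultimately show ?thesis by simp
qed

text \<open>Each subset of the value of \<open>ta\<close> has a name that is a subset of
  \<open>domn ta \<times> P\<close>, and these names form a set.\<close>

lemma W_pow: "EX b. eltsW b = {x. eltsW x \<subseteq> eltsW a}"
proof -
 obtain ta where t: "a = val ta" by (rule valE)
 let ?Y = "{y. elts y \<subseteq> prod (domn ta) P}"
 have sY: "small ?Y" by (intro small_Pow small_prod small_domn small_P)
 obtain c where c: "eltsW c = val ` ?Y" using name_of_small[OF sY] by blast
 have sub: "x : eltsW c" if xa: "eltsW x \<subseteq> eltsW a" for x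
 proof -
  obtain rh where r: "x = val rh" by (rule valE)
  let ?N = "{t : prod (domn ta) P. fmem (psnd t) (pfst t) rh}"
  have N: "elts (mk ?N) = ?N" by (intro elts_mk small_sep small_prod small_domn small_P dfn_intros UNIV_I)
  have m: "pr sg p : ?N \<longleftrightarrow> sg : domn ta & p : P & fmem p sg rh" for sg p by simp
  have "eltsW (val (mk ?N)) = {val sg | sg p. p : G & sg : domn ta & p : P & fmem p sg rh}" unfolding eltsW_val N m by blast
  also have "\<dots> = eltsW x"
  proof (intro equalityI subsetI)
   fix y assume "y : {val sg | sg p. p : G & sg : domn ta & p : P & fmem p sg rh}"
   then show "y : eltsW x" unfolding r using semD(3)[OF sem_mem] by blast
  next
   fix y assume y: "y : eltsW x"
   then obtain sg where s: "sg : domn ta" "y = val sg" using xa W_domn[of y ta] unfolding t by blast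
   then obtain p where "p : G" "fmem p sg rh" using semD(3)[OF sem_mem] y unfolding r by blast
   then show "y : {val sg | sg p. p : G & sg : domn ta & p : P & fmem p sg rh}" using s G_P by blast
  qed
  finally have "val (mk ?N) = x" using injD[OF inj_W] by blast
  moreover have "mk ?N : ?Y" using N by auto
  ultimately show ?thesis using c by blast
 qed
 obtain b where b: "eltsW b = {x : eltsW c. sat eltsW UNIV (case_nat x (%_. a)) (All (Neg (Conj (Mem 0 1) (Neg (Mem 0 2)))))}" using W_sep by blast
 have "sat eltsW UNIV (case_nat x (%_. a)) (All (Neg (Conj (Mem 0 1) (Neg (Mem 0 2))))) \<longleftrightarrow> eltsW x \<subseteq> eltsW a" for x
  by (auto simp: numeral_2_eq_2)
 then have "eltsW b = {x. eltsW x \<subseteq> eltsW a}" using b sub by auto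
 then show ?thesis by blast
qed

lemma W_union: "EX b. eltsW b = \<Union> (eltsW ` eltsW a)"
proof -
 obtain ta where t: "a = val ta" by (rule valE)
 have sX: "small (below ta)" by simp
 obtain c where c: "eltsW c = val ` below ta" using name_of_small[OF sX] by blast
 have "\<Union> (eltsW ` eltsW a) \<subseteq> eltsW c"
 proof
  fix x assume "x : \<Union> (eltsW ` eltsW a)"
  then obtain y where y: "y : eltsW (val ta)" "x : eltsW y" unfolding t by blast
  obtain sg where s: "sg : domn ta" "y = val sg" using W_domn[OF y(1)] by blast
  obtain pi where p: "pi : domn sg" "x = val pi" using W_domn[OF y(2)[unfolded s(2)]] by blast
  have "pi : below ta" using trancl_trans[OF domn_below[OF p(1)] domn_below[OF s(1)]] unfolding below_def by simp
  then show "x : eltsW c" unfolding c p(2) by (rule imageI)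
 qed
 moreover obtain b where b: "eltsW b = {x : eltsW c. sat eltsW UNIV (case_nat x (%_. a)) (Neg (All (Neg (Conj (Mem 0 2) (Mem 1 0)))))}" using W_sep by blast
 moreover have "sat eltsW UNIV (case_nat x (%_. a)) (Neg (All (Neg (Conj (Mem 0 2) (Mem 1 0))))) \<longleftrightarrow> x : \<Union> (eltsW ` eltsW a)" for x
  by (auto simp: numeral_2_eq_2)
 ultimately have "eltsW b = \<Union> (eltsW ` eltsW a)" by auto
 then show ?thesis by blast
qed

lemma W_pair: "EX c. eltsW c = {a, b}"
proof -
 obtain sg where s: "a = val sg" by (rule valE)
 obtain ta where t: "b = val ta" by (rule valE)
 show ?thesis using name_of_small[of "{sg, ta}"] s t by simp
qed

text \<open>Collection in \<open>V\<close>, over pairs of a subname and a condition, bounds the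
  names of all values; Separation in the extension then cuts out the image.\<close>

lemma W_rep: assumes u: "ALL x:eltsW a. EX! y. sat eltsW UNIV (case_nat x (case_nat y e)) ph"
 shows "EX b. eltsW b = {y. EX x:eltsW a. sat eltsW UNIV (case_nat x (case_nat y e)) ph}"
proof -
 obtain ta where t: "a = val ta" by (rule valE)
 obtain e' where e: "e = (%n. val (e' n))" by (rule env_val)
 let ?ph = "%x nu. fo ph (case_nat (pfst x) (case_nat nu e')) (psnd x)"
 have Dc: "D (%f. ?ph (f 0) (f 1))"
 proof (rule D_fo)
  fix n show "F (%f. case_nat (pfst (f 0)) (case_nat (f 1) e') n)"
   by (cases n; cases "n - 1") (simp_all add: dt_pfst dt_var dt_const)
 qed (intro dfn_intros)
 obtain Y where Y: "small Y" "ALL x:prod (domn ta) P. (EX nu. ?ph x nu) --> (EX nu:Y. ?ph x nu)"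
  using collection[OF small_prod[OF small_domn small_P] Dc, of ta] by blast
 obtain c where c: "eltsW c = val ` Y" using name_of_small[OF Y(1)] by blast
 have sm: "sem (fo ph (case_nat sg (case_nat nu e'))) (sat eltsW UNIV (case_nat (val sg) (case_nat (val nu) e)) ph)" for sg nu
  using fo_sem[of ph "case_nat sg (case_nat nu e')"] unfolding val_case_nat e .
 have sub: "y : eltsW c" if x: "x : eltsW a" and y: "sat eltsW UNIV (case_nat x (case_nat y e)) ph" for x y
 proof -
  obtain sg where s: "sg : domn ta" "x = val sg" using W_domn x unfolding t by blast
  obtain nu where n: "y = val nu" by (rule valE)
  obtain p where p: "p : G" "fo ph (case_nat sg (case_nat nu e')) p" using semD(3)[OF sm] y unfolding s(2) n by blast
  have "pr sg p : prod (domn ta) P" using s p G_P by simp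
  from bspec[OF Y(2) this] obtain nu' where v: "nu' : Y" "fo ph (case_nat sg (case_nat nu' e')) p" using p(2) by auto
  have "sat eltsW UNIV (case_nat x (case_nat (val nu') e)) ph" using semD(3)[OF sm] v(2) p(1) unfolding s(2) by blast
  then have "y = val nu'" using u x y by blast
  then show ?thesis using v c by blast
 qed
 obtain b where b: "eltsW b = {y : eltsW c. sat eltsW UNIV (case_nat y (case_nat a e)) (Neg (All (Neg (Conj (Mem 0 2)
   (ren (%n. if n = 0 then 0 else if n = 1 then 1 else Suc n) ph)))))}" using W_sep by blast
 have s: "sat eltsW UNIV (case_nat y (case_nat a e)) (Neg (All (Neg (Conj (Mem 0 2) (ren (%n. if n = 0 then 0 else if n = 1 then 1 else Suc n) ph)))))
  \<longleftrightarrow> (EX x:eltsW a. sat eltsW UNIV (case_nat x (case_nat y e)) ph)" for y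
 proof -
  have "(%n. case_nat x (case_nat y (case_nat a e)) (if n = 0 then 0 else if n = 1 then 1 else Suc n)) = case_nat x (case_nat y e)" for x
  proof (rule HOL.ext)
   fix n show "case_nat x (case_nat y (case_nat a e)) (if n = 0 then 0 else if n = 1 then 1 else Suc n) = case_nat x (case_nat y e) n"
    by (cases n; cases "n - 1") auto
  qed
  then show ?thesis unfolding sat.simps sat_ren by (auto simp: numeral_2_eq_2)
 qed
 have "eltsW b = {y. EX x:eltsW a. sat eltsW UNIV (case_nat x (case_nat y e)) ph}" unfolding b s using sub by blast
 then show ?thesis by blast
qed

lemma W_inf: "EX w z. eltsW z = {} & z : eltsW w & (ALL x:eltsW w. EX y:eltsW w. eltsW y = insert x (eltsW x))"
proof (intro exI conjI ballI)
 show "eltsW (vc zero) = {}" unfolding eltsW_vc by simp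
 show "vc zero : eltsW (vc om)" unfolding vc_mem using num_in[of 0] by simp
 fix x assume "x : eltsW (vc om)"
 then obtain n where n: "x = vc (num n)" unfolding eltsW_vc elts_omega by blast
 show "EX y:eltsW (vc om). eltsW y = insert x (eltsW x)"
 proof
  show "vc (num (Suc n)) : eltsW (vc om)" unfolding vc_mem by (rule num_in)
  show "eltsW (vc (num (Suc n))) = insert x (eltsW x)" unfolding n eltsW_vc by simp
 qed
qed

text \<open>A well-ordering of the subnames in \<open>V\<close> selects from each member of
  \<open>a\<close> the element with the least name. \<open>?in nu xi\<close> says that
  \<open>nu\<close> is this name for the member named by \<open>xi\<close>; disjointness of the
  members makes the set of selected elements a transversal.\<close>

lemma W_ac: assumes "(ALL x:eltsW a. eltsW x ~= {}) & (ALL x:eltsW a. ALL y:eltsW a. x ~= y --> eltsW x \<inter> eltsW y = {})"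
 shows "EX c. ALL x:eltsW a. EX! y. y : eltsW x \<inter> eltsW c"
proof -
 obtain ta where t: "a = val ta" by (rule valE)
 let ?B = "below ta"
 obtain al f where f: "Or al" "F (%e. f (e 0))" "inj_on f ?B" "f ` ?B \<subseteq> elts al" by (rule wellorder[OF small_below])
 let ?C = "%nu. {mu:?B. f mu : elts (f nu)}"
 let ?in = "%nu xi. (val xi : eltsW a & val nu : eltsW (val xi)) & (ALL mu:?C nu. ~ val mu : eltsW (val xi))"
 let ?fi = "%nu xi p. (fmem p xi ta & fmem p nu xi) & (p : P & (ALL mu:?C nu. fnot (%p. fmem p mu xi) p))"
 have Df: "D (%e. fnot (%p. fmem p (e 0) (e 1)) (e 2))" unfolding fnot_def by (intro dfn_intros)
 have Dfi: "D (%e. ?fi (e 0) (e 1) (e 2))"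
  by (intro dfn_conj dfn_ball ds_sep dfn_mem ds_elts ds_below dt_1[OF f(2)] D_fmem ds_P dt_var dt_const dfn_rel3[OF Df] UNIV_I)
 have si: "sem (?fi nu xi) (?in nu xi)" for nu xi
 proof -
  have 1: "sem (%p. fmem p xi ta) (val xi : eltsW a)" unfolding t by (rule sem_mem)
  have 2: "sem (%p. p : P & (ALL mu:?C nu. fnot (%p. fmem p mu xi) p)) (ALL mu:?C nu. ~ val mu : eltsW (val xi))"
  proof (rule sem_all[where ph="%mu. fnot (%p. fmem p mu xi)"])
   show "D (%e. fnot (%p. fmem p (e 0) xi) (e 1))" unfolding fnot_def by (intro dfn_intros UNIV_I)
   show "DS (%e. ?C nu)" by (intro ds_sep dfn_mem ds_elts ds_below dt_1[OF f(2)] dt_var dt_const UNIV_I)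
   fix mu have "D (%e. fmem (e 0) mu xi)" by (intro dfn_intros UNIV_I)
   then show "sem (fnot (%p. fmem p mu xi)) (~ val mu : eltsW (val xi))" by (rule sem_not[OF _ sem_mem])
  qed
  show ?thesis by (rule sem_conj[OF sem_conj[OF 1 sem_mem] 2])
 qed
 have "EX c. eltsW c = {val nu | nu. nu : ?B & (EX xi:UNIV. ?in nu xi)}"
 proof (rule name_of[OF small_below])
  show "D (%e. e 1 : P & (ALL q. le q (e 1) --> (EX r. le r q & (EX xi:UNIV. ?fi (e 0) xi r))))"
   by (intro dfn_conj dfn_allU dfn_exU dfn_imp dfn_bex ds_UNIV D_le dfn_mem ds_P dt_var dfn_rel3[where R="?fi", OF Dfi])
  fix nu show "sem (%p. p : P & (ALL q. le q p --> (EX r. le r q & (EX xi:UNIV. ?fi nu xi r)))) (EX xi:UNIV. ?in nu xi)"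
  proof (rule sem_ex[where ph="?fi nu"])
   show "D (%e. ?fi nu (e 0) (e 1))" by (rule dfn_rel3[where R="?fi", OF Dfi dt_const[OF UNIV_I] dt_var dt_var])
  qed (rule ds_UNIV, rule semD(5)[OF si])
 qed
 then obtain c where c: "eltsW c = {val nu | nu. nu : ?B & (EX xi. ?in nu xi)}" by auto
 have "EX! y. y : eltsW x \<inter> eltsW c" if x: "x : eltsW a" for x
 proof -
  obtain sg where s: "sg : domn ta" "x = val sg" using W_domn x unfolding t by blast
  have nm: "EX nu:?B. y = val nu" if yx: "y : eltsW x" for y
  proof -
   obtain pi where p: "pi : domn sg" "y = val pi" using W_domn[OF yx[unfolded s(2)]] by blast
   have "pi : below ta" using trancl_trans[OF domn_below[OF p(1)] domn_below[OF s(1)]] unfolding below_def by simp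
   then show ?thesis using p(2) by (rule rev_bexI)
  qed
  have only: "val xi = x" if "?in nu xi" "val nu : eltsW x" for nu xi using assms x that by blast
  obtain y where "y : eltsW x" using assms x by blast
  then obtain nu0 where "nu0 : ?B" "val nu0 : eltsW x" using nm by blast
  then have "f nu0 : f ` {nu:?B. val nu : eltsW x}" by blast
  with wfR obtain z where z: "z : f ` {nu:?B. val nu : eltsW x}" "!!y. (y, z) : R ==> y ~: f ` {nu:?B. val nu : eltsW x}" by (rule wfE_min) (rule that)
  then obtain nu where n: "nu : ?B" "val nu : eltsW x" "z = f nu" by blast
  have "ALL mu:?C nu. ~ val mu : eltsW x" using z(2) n(3) R_iff by blast
  then have "?in nu sg" using n x s(2) by blast
  then have "val nu : eltsW c" unfolding c using n(1) by blast
  moreover have "y = val nu" if y: "y : eltsW x \<inter> eltsW c" for y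
  proof -
   obtain mu xi where m: "y = val mu" "mu : ?B" "?in mu xi" using y unfolding c by blast
   have xx: "val xi = x" using only[OF m(3)] y m(1) by blast
   have 1: "f nu ~: elts (f mu)" using m(3) n xx by blast
   have 2: "f mu ~: elts (f nu)" using z(2)[of "f mu"] n(3) R_iff m y by blast
   have "Or (f nu)" "Or (f mu)" using f(4) n(1) m(2) Ord_mem[OF f(1)] by blast+
   then have "f mu = f nu" using Ord_linear 1 2 by blast
   then show ?thesis using f(3) n(1) m(1,2) by (metis inj_onD)
  qed
  ultimately show ?thesis using n(2) by blast
 qed
 then show ?thesis by blast
qed

theorem zfc_W: "zfc_model eltsW"
 unfolding zfc_model_def
 by (intro conjI allI impI) (rule inj_W wf_W W_pair W_union W_pow W_inf W_sep | erule W_rep W_ac)+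

theorem forcing_theorem: assumes "dfn eltsW UNIV UNIV (%e. Q (e 0) (e 1))"
 obtains Ph where "D (%e. Ph (e 0) (e 1) (e 2))" "!!x y. sem (Ph x y) (Q (val x) (val y))"
proof -
 obtain ph m c where c: "!!e :: nat => 'w. Q (e 0) (e 1) \<longleftrightarrow> sat eltsW UNIV (%k. if k < (m::nat) then c k else e (k - m)) ph"
  using assms unfolding dfn_def by auto
 obtain c' where c': "c = (%n. val (c' n))" by (rule env_val)
 let ?e = "%x y k. if k < m then c' k else case_nat x (%_. y) (k - m)"
 have "D (%e. fo ph (?e (e 0) (e 1)) (e 2))"
 proof (rule D_fo)
  fix n show "F (%e. ?e (e 0) (e 1) n)" by (cases "n < m"; cases "n - m") (simp_all add: dt_var dt_const)
 qed (rule dt_var)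
 moreover have "sem (fo ph (?e x y)) (Q (val x) (val y))" for x y
 proof -
  have "(%n. val (?e x y n)) = (%k. if k < m then c k else case_nat (val x) (%_. val y) (k - m))"
   unfolding c' by (rule HOL.ext) (auto split: nat.split)
  then show ?thesis using fo_sem[of ph "?e x y"] c[of "case_nat (val x) (%_. val y)"] by simp
 qed
 ultimately show thesis by (rule that[of "%x y. fo ph (?e x y)"])
qed

end

section \<open>Coding of ordinals, clubs, and intervals of the generic chain\<close>

context zfc begin

text \<open>For an ordinal \<open>y\<close>, the largest non-successor ordinal that is at most
  \<open>y\<close>.\<close>

definition "lim y = mk (\<Union>(elts ` {z:elts (sc y). ~ (EX w. z = sc w)}))"

text \<open>Reads an ordinal \<open>d + n\<close>, with \<open>d\<close> not a successor, as the
  pair of \<open>d\<close> and \<open>n\<close>. Traces of countable nodes are such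
  \<open>d\<close>, so pairs of a trace and a number are coded below \<open>\<omega>\<^sub>1\<close>
  without cardinal arithmetic.\<close>

lemma limit_pairs: obtains k where "F (%e. k (e 0))" "!!d n. Or d ==> ~ (EX w. d = sc w) ==> k ((sc ^^ n) d) = pr d (num n)"
proof
 \<comment> \<open>What lies between the limit part and \<open>y\<close> has \<open>n\<close>
   elements, and the set of numbers it does not inject into is the numeral \<open>n\<close>.\<close>
 define k where "k y = pr (lim y) (mk {m:elts om. ~ lep (elts (mk (elts y - elts (lim y)))) (elts m)})" for y
 have dl: "F (%e. lim (e 0))"
 proof -
  have e: "lim y = mk {x. EX z:elts (sc y). ~ (EX w. z = sc w) & x : elts z}" for y unfolding lim_def by (rule arg_cong[where f=mk]) blast
  show ?thesis unfolding e by (intro dfn_intros)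
 qed
 show "F (%e. k (e 0))" unfolding k_def by (intro dfn_intros dt_1[OF dl] UNIV_I)
 fix d n assume d: "Or d" "~ (EX w. d = sc w)"
 have E: "elts ((sc ^^ n) d) = elts d \<union> {(sc ^^ i) d | i. i < n}" for n
  by (induction n) (auto simp: less_Suc_eq)
 have O: "Or ((sc ^^ n) d)" for n by (induction n) (simp_all add: d Ord_sc)
 have inj: "(sc ^^ i) d : elts ((sc ^^ n) d)" if "i < n" for i n using E[of n] that by blast
 have L: "lim ((sc ^^ n) d) = d"
 proof -
  have sub: "elts z \<subseteq> elts d" if z: "z : elts (sc ((sc ^^ n) d))" "~ (EX w. z = sc w)" for z
  proof -
   have "z : elts ((sc ^^ Suc n) d)" using z(1) by simp
   then consider "z : elts d" | i where "z = (sc ^^ i) d" unfolding E by blast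
   then show ?thesis
   proof cases
    case 1 then show ?thesis using Ord_trans[OF d(1) _ 1] by blast
   next
    case 2 then show ?thesis using z(2) by (cases i) auto
   qed
  qed
  have "d : elts (sc ((sc ^^ n) d))" using inj[of 0 "Suc n"] by simp
  then have "\<Union>(elts ` {z:elts (sc ((sc ^^ n) d)). ~ (EX w. z = sc w)}) = elts d" using d(2) sub by blast
  then show ?thesis unfolding lim_def by simp
 qed
 let ?A = "elts ((sc ^^ n) d) - elts d"
 have nd: "(sc ^^ i) d ~: elts d" for i
 proof (cases i)
  case 0 then show ?thesis using mem_irrefl by simp
 next
  case (Suc j)
  have "d : elts ((sc ^^ i) d)" using inj[of 0 i] Suc by simp
  then show ?thesis using Ord_trans[OF d(1)] mem_irrefl by blast
 qed
 have A: "?A = (%i. (sc ^^ i) d) ` {..<n}" using E[of n] nd by blast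
 have ii: "inj_on (%i. (sc ^^ i) d) {..<n}" unfolding inj_on_def using inj mem_irrefl by (metis linorder_neqE_nat)
 have sA: "small ?A" by (intro small_Diff small_elts)
 have l: "lep ?A (elts (num m)) \<longleftrightarrow> n \<le> m" for m
 proof
  assume "lep ?A (elts (num m))"
  then obtain f where f: "inj_on f ?A" "f ` ?A \<subseteq> elts (num m)" by (rule lepE) (rule that)
  have c: "elts (num m) = num ` {..<m}" by (auto simp: num_mem)
  have "card ?A \<le> card (elts (num m))" by (rule card_inj_on_le[OF f]) (simp add: c)
  moreover have "card (elts (num m)) \<le> m" unfolding c using card_image_le[of "{..<m}" num] by simp
  moreover have "card ?A = n" unfolding A using card_image[OF ii] by simp
  ultimately show "n \<le> m" by simp
 next
  assume nm: "n \<le> m"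
  have "small (graph (%x. num (the_inv_into {..<n} (%i. (sc ^^ i) d) x)) ?A)" by (rule small_finite) (simp add: graph_def A)
  then obtain g where g: "F (%e. g (e 0))" "!!x. x : ?A ==> g x = num (the_inv_into {..<n} (%i. (sc ^^ i) d) x)" by (rule graph_dt) (rule that)
  have gi: "g ((sc ^^ i) d) = num i" if "i < n" for i using g(2)[of "(sc ^^ i) d"] that the_inv_into_f_f[OF ii, of i] A by auto
  show "lep ?A (elts (num m))"
  proof (rule lepI[OF g(1)])
   show "inj_on g ?A" unfolding A by (rule inj_onI) (use gi num_inj in auto)
   show "g ` ?A \<subseteq> elts (num m)" unfolding A
   proof (rule image_subsetI)
    fix x assume "x : (%i. (sc ^^ i) d) ` {..<n}"
    then obtain i where "x = (sc ^^ i) d" "i < n" by blast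
    then show "g x : elts (num m)" using gi[of i] nm num_less[of i m] by simp
   qed
  qed
 qed
 have "{m:elts om. ~ lep (elts (mk ?A)) (elts m)} = elts (num n)" unfolding elts_mk[OF sA] elts_omega
 proof (intro equalityI subsetI)
  fix x assume "x : {m : range num. ~ lep ?A (elts m)}"
  then obtain m where "x = num m" "~ lep ?A (elts (num m))" by blast
  then show "x : elts (num n)" unfolding l using num_less[of m n] by simp
 next
  fix x assume "x : elts (num n)"
  then obtain m where "x = num m" "m < n" unfolding num_mem by blast
  then show "x : {m : range num. ~ lep ?A (elts m)}" using l[of m] by simp
 qed
 then show "k ((sc ^^ n) d) = pr d (num n)" unfolding k_def L by simp
qed

lemma D_club[dfn_intros]: assumes "F t" shows "D (%e. club elts (t e))"
proof -
 have "D (%e. club elts (e 0))" unfolding club_def Limit_def by (intro dfn_intros UNIV_I)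
 from dfn_rel1[OF this assms] show ?thesis .
qed

lemma ds_positive: "DS (%e. positive elts (NS_omega1 elts))"
proof -
 have e: "positive elts (NS_omega1 elts) = {x. elts x \<subseteq> elts (omega1 elts) & ~ (EX c. club elts c & elts c \<inter> elts x = {})}"
  unfolding positive_def NS_omega1_def by blast
 show ?thesis unfolding e by (intro dfn_intros UNIV_I)
qed

lemma small_positive: "small (positive elts (NS_omega1 elts))"
proof -
 have "positive elts (NS_omega1 elts) \<subseteq> {x. elts x \<subseteq> elts (omega1 elts)}" unfolding positive_def by blast
 then show ?thesis by (rule small_subset[OF small_Pow[OF small_elts], of _ "omega1 elts"]) (intro dfn_intros ds_positive)
qed

end

context inacc begin

text \<open>Unlike \<open>SS_good\<close> this returns the Skolem function itself. Closure can then
  pass to a cut node \<open>M \<inter> U\<close>, where \<open>U\<close> is closed under the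
  function and \<open>M\<close> contains its restriction to \<open>U\<close>.\<close>

lemma good_fun: assumes Q: "D (%e. Q (e 0) (e 1))"
 obtains ph where "F (%e. ph (e 0))" "!!x. x : Vth ==> ph x : Vth"
  "!!K. el K ==> ALL x:elts K. ph x : elts K ==> closed2 K & (ALL x:elts K. ALL y:Vth. Q x y --> (EX y:elts K. Q x y))"
proof -
 obtain f where f: "F (%e. f (e 0))" "!!x y. x : Vth ==> y : Vth & Q x y ==> f x : Vth & Q x (f x)"
  by (rule choice[of "Vth" "%x y. y : Vth & Q x y"]) (rule small_elts, intro dfn_intros Q UNIV_I, rule that)
 define g where "g x = pr (if f x : Vth then f x else zero) (if x : SS then pr (dl x) (ot x) else zero)" for x
 have g: "F (%e. g (e 0))" unfolding g_def by (intro dfn_intros dt_1[OF f(1)] UNIV_I)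
 have gV: "g x : Vth" if "x : Vth" for x
 proof -
  have "zero : Vth" by (rule thVth[OF zero_th])
  moreover have "dl x : Vth" "ot x : Vth" if "x : SS" using dl_om1[OF that] ot_om1[OF that] thVth th_trans[OF _ om1th] by blast+
  ultimately show ?thesis unfolding g_def by (simp add: Vth_pr)
 qed
 have cl: "closed2 K & (ALL x:elts K. ALL y:Vth. Q x y --> (EX y:elts K. Q x y))" if el: "el K" and K: "ALL x:elts K. g x : elts K" for K
 proof (intro conjI ballI impI)
  show "closed2 K" unfolding closed2_def
  proof
   fix N assume N: "N : elts K \<inter> SS"
   then have "pr (dl N) (ot N) : elts K" using bspec[OF K, of N] el_prD(2)[OF el] unfolding g_def by auto
   then show "dl N : elts K & ot N : elts K" using el_prD[OF el] by blast
  qed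
  fix x y assume x: "x : elts K" and y: "y : Vth" "Q x y"
  have "x : Vth" using el_sub[OF el] x by blast
  then have fx: "f x : Vth & Q x (f x)" using f(2)[of x y] y by blast
  then have "f x : elts K" using bspec[OF K x] el_prD(1)[OF el] unfolding g_def by auto
  then show "EX y:elts K. Q x y" using fx by blast
 qed
 show thesis by (rule that[OF g gV cl])
qed

lemma el_nonsucc: assumes N: "N : SS" shows "Or (dl N)" "~ (EX w. dl N = sc w)" "Limit elts (dl N)" "zero : elts (dl N)"
proof -
 note el = SS_el[OF N]
 show O: "Or (dl N)" by (rule dl_Or[OF N])
 have om: "sc x : elts om1" if "x : elts om1" for x
 proof -
  have x: "Or x" "ctb (elts x)" using that om1_iff by blast+
  have "ctb (elts x \<union> {x})" by (rule ctb_Un[OF small_elts small_single x(2) ctb_finite]) simp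
  then show ?thesis unfolding om1_iff using Ord_sc[OF x(1)] by simp
 qed
 have s: "sc x : elts (dl N)" if "x : elts (dl N)" for x using that om el_sc[OF el] unfolding elts_dl by blast
 show "~ (EX w. dl N = sc w)"
 proof
  assume "EX w. dl N = sc w" then obtain w where w: "dl N = sc w" by blast
  then have "sc w : elts (dl N)" using s[of w] by simp
  then show False using w mem_irrefl by metis
 qed
 have "zero : elts om1" unfolding om1_iff using Ord_zero ctb_finite by simp
 then show z: "zero : elts (dl N)" unfolding elts_dl using el_zero[OF el] by blast
 show "Limit elts (dl N)" unfolding Limit_def
 proof (intro conjI ballI O)
  show "elts (dl N) ~= {}" using z by blast
  fix x assume "x : elts (dl N)" from s[OF this] show "EX y:elts (dl N). x : elts y" by (rule rev_bexI) simp
 qed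
qed

lemma star_TT: assumes "star m" "X \<subseteq> TT" shows "star (X \<union> m)"
proof (rule starI)
 fix M N assume "M : X \<union> m" "M : SS" "N : X \<union> m" "N : SS" "dl N : elts (dl M)"
 moreover from this have "M : m" "N : m" using assms(2) SS_TT_disj by blast+
 ultimately show "ot N : elts (dl M)" using starD[OF assms(1)] by blast
qed

lemma add_TTs: assumes X: "finite X" "X \<subseteq> TT" "U : X" "!!N. N : X ==> N ~: elts U" and q: "q : PP" "q : elts U"
 obtains r where "PLe r q" "X \<subseteq> nd r"
proof -
 have lin: "N = M | ll X N M | ll X M N" if "N : X" "M : X" for N M
  using TT_linear[of N M] that X(2) unfolding ll_def by blast
 have "chain X" unfolding chain_def using X(1,2) lin by blast
 moreover have "M \<sqinter> N : X" if "M : X" "N : X" for M N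
 proof -
  have "M \<sqinter> N = M | M \<sqinter> N = N" by (rule TT_cap) (use that X(2) in blast)+
  then show ?thesis using that by (elim disjE) simp_all
 qed
 ultimately have n: "nice X" unfolding nice_def by blast
 have st: "star X" by (rule starI) (use X(2) SS_TT_disj in blast)
 have "deco X (%_. zero)" unfolding deco_def isucc_def using thVth[OF zero_th] el_zero[OF TT_el] X(2) by auto
 then have c: "cond X (%_. zero)" unfolding cond_def using n st by blast
 have UT: "U : TT" using X by blast
 obtain r where "PLe r q" "nd r = X \<union> nd q"
 proof (rule add_transitive[OF c X(3) UT q])
  show "star (X \<union> nd q)" by (rule star_TT[OF condD(3)[OF PPD(1)[OF q(1)]] X(2)])
 qed (use X(2,4) SS_TT_disj in blast)+
 then show thesis using that by blast
qed

text \<open>No transitive node can ever enter between \<open>N0\<close> and \<open>W\<close>, so in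
  every condition the nodes of this interval are countable and linearly ordered by membership;
  \<open>om1 : elts N0\<close> makes their traces strictly increasing.\<close>

definition "cons0 N0 W \<longleftrightarrow> N0 : SS & W : TT & N0 : elts W & om1 : elts N0 & (ALL Z:TT. N0 : elts Z --> Z ~: elts W)"

text \<open>\<open>W\<close> is the \<open>lt\<close>-least member of \<open>TT\<close> with
  \<open>U\<close> as an element, and \<open>N0\<close> is \<open>K \<inter> W\<close> for a node
  \<open>K\<close> containing \<open>U\<close>. A member of \<open>TT\<close> between
  \<open>N0\<close> and \<open>W\<close> would contain \<open>U\<close>, against the choice of
  \<open>W\<close>.\<close>

lemma base: assumes p: "p : PP" and x: "x : Vth"
 obtains s N0 W where "PLe s p" "N0 : nd s" "W : nd s" "cons0 N0 W" "x : elts N0"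
proof -
 have om1V: "om1 : Vth" by (rule thVth[OF om1th])
 have aV: "pr p (pr x om1) : Vth" using PP_Vth[OF p] x om1V by (simp add: Vth_pr)
 have F0: "F (%e. e 0)" by (rule dt_var)
 obtain U where U: "U : TT" "pr p (pr x om1) : elts U" by (rule TT_reflect[OF F0 _ aV]) (assumption, rule that)
 note elU = TT_el[OF U(1)]
 have pU: "p : elts U" "x : elts U" "om1 : elts U" using el_prD[OF elU U(2)] el_prD[OF elU] by blast+
 obtain W' where "W' : TT" "U : elts W'" by (rule TT_reflect[OF F0 _ TT_Vth[OF U(1)]]) (assumption, rule that)
 then have "W' : {W:TT. U : elts W}" by blast
 with wfRp obtain W where W0: "W : {W:TT. U : elts W}" "!!y. lt y W ==> y ~: {W:TT. U : elts W}" by (rule wfE_min) (rule that)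
 then have W: "W : TT" "U : elts W" by blast+
 have WU: "N ~: elts U" if "N : {U, W}" for N using that W mem_irrefl lt_asym mem_lt by blast
 obtain r where r: "PLe r p" "{U, W} \<subseteq> nd r" by (rule add_TTs[of "{U, W}" U p]) (use U W WU p pU in auto)
 have rP: "r : PP" by (rule PLe_PP(1)[OF r(1)])
 have bV: "pr r (pr x (pr om1 U)) : Vth" using PP_Vth[OF rP] x om1V TT_Vth[OF U(1)] by (simp add: Vth_pr)
 have DT: "D (%e. e 0 = e 1)" by (intro dfn_intros)
 obtain K where K: "K : SS" "pr r (pr x (pr om1 U)) : elts K" "closed2 K" by (rule SS_good[OF bV DT]) (rule that)
 note elK = SS_el[OF K(1)]
 have i: "r : elts K" "x : elts K" "om1 : elts K" "U : elts K" using el_prD[OF elK] K(2) by blast+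
 obtain s where s: "PLe s r" "K : nd s" by (rule add_countable[OF rP i(1) K(1,3)])
 have sP: "s : PP" by (rule PLe_PP(1)[OF s(1)])
 have Ws: "W : nd s" using s(1) r(2) unfolding PLe_def by blast
 let ?N = "K \<sqinter> W"
 have N: "?N : nd s \<inter> SS" by (rule cap_SS(1)[OF PPD(5)[OF sP] s(2) Ws K(1)])
 have UW: "elts U \<subseteq> elts W" by (rule TT_trans[OF W])
 have iN: "x : elts ?N" "om1 : elts ?N" "U : elts ?N" using i pU UW W by auto
 have "cons0 ?N W" unfolding cons0_def
 proof (intro conjI ballI impI notI)
  fix Z assume Z: "Z : TT" "?N : elts Z" "Z : elts W"
  have "U : elts Z" using TT_trans[OF Z(1,2)] iN(3) by blast
  then show False using W0(2)[OF mem_lt[OF Z(3)]] Z(1) by blast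
 qed (use N W iN cap_lt(1)[OF K(1) W(1)] in auto)
 then show thesis using that[of s ?N W] PLe_trans[OF s(1) r(1)] N Ws iN by blast
qed

lemma between_in: assumes c: "cons0 N0 W" and p: "p : PP" "M : nd p" "N : nd p" and M: "M = N0 | N0 : elts M" "M : SS" "N : elts W" and lt: "lt M N"
 shows "M : elts N" "N : SS" "N0 : elts N"
proof -
 have c': "W : TT" "N0 : SS" "!!Z. Z : TT ==> N0 : elts Z ==> Z ~: elts W" using c unfolding cons0_def by blast+
 have noZ: False if Z: "Z : TT" "M : elts Z" "Z : elts W" for Z
 proof -
  have "N0 : elts Z" using M(1) Z(2) TT_trans[OF Z(1,2)] by blast
  then show False using c'(3) Z by blast
 qed
 have "ll (nd p) M N" by (rule chain_ll[OF PPD(4)[OF p(1)] p(2,3) lt])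
 moreover have "~ lt Z N" if "Z : TT" "M : elts Z" for Z using noZ[OF that] lt_TT[OF c'(1)] lt_trans[OF _ mem_lt[OF M(3)]] by blast
 ultimately show MN: "M : elts N" unfolding ll_def by blast
 then show N: "N : SS" using noZ[of N] M(3) PPD(6)[OF p(1)] p(3) by blast
 show "N0 : elts N" using M(1) MN SS_sub[of N M] N M(2) by blast
qed

lemma between_lin: assumes c: "cons0 N0 W" and p: "p : PP" "M : nd p" "N : nd p" and M: "N0 : elts M" "M : SS" "M : elts W" and N: "N0 : elts N" "N : SS" "N : elts W"
 shows "M = N | M : elts N | N : elts M"
 using chain_lin[OF PPD(4)[OF p(1)] p(2,3)] between_in(1)[OF c p _ M(2) N(3)] between_in(1)[OF c p(1,3,2) _ N(2) M(3)] M N by blast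

lemma above_base: assumes c: "cons0 N0 W" and N: "N0 : elts N" "N : SS" shows "elts N0 \<subseteq> elts N" "om1 : elts N"
 using SS_sub[of N N0] c N unfolding cons0_def by blast+

lemma dl_less: assumes "N : SS" "N' : SS" "N : elts N'" "om1 : elts N'" shows "dl N : elts (dl N')"
proof -
 have "dl N : elts N'" unfolding dl_def by (rule el_Int[OF SS_el[OF assms(2)] assms(3,4)])
 then show ?thesis using dl_om1[OF assms(1)] unfolding elts_dl by blast
qed

lemma finite_lt_max: assumes "finite X" "X ~= {}" obtains Y where "Y : X" "!!N. N : X ==> ~ lt Y N"
proof -
 have "EX m:rk ` X. ALL x:rk ` X. elts x \<subseteq> elts m" by (rule fin_max) (use assms Ord_rk in auto)
 then obtain Y where Y: "Y : X" "!!N. N : X ==> elts (rk N) \<subseteq> elts (rk Y)" by blast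
 have "~ lt Y N" if "N : X" for N
 proof
  assume "lt Y N" then have "rk Y : elts (rk N)" by (rule rk_Rp)
  then show False using Y(2)[OF that] mem_irrefl by blast
 qed
 then show thesis using that Y(1) by blast
qed

end

section \<open>Cardinals of the extension\<close>

locale ext = inacc elts th + forcing elts "Mstar elts th (countable_submodels elts th) (transitive_submodels elts th)" "inacc.PLe elts th" G eltsW val
 for elts :: "'v => 'v set" and th :: 'v and G and eltsW :: "'w => 'w set" and val
begin

sublocale W: zfc eltsW by unfold_locales (rule zfc_W)

lemma vc_mk: "small A ==> vc (mk A) = W.mk (vc ` A)" by (metis eltsW_vc elts_mk W.mk_elts)
lemma vc_pr: "vc (pr a b) = W.pr (vc a) (vc b)" by (simp add: opair_def vc_mk)
lemma vc_zero: "vc zero = W.zero" unfolding zero_def W.zero_def by (simp add: vc_mk)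
lemma vc_sc: "vc (sc x) = W.sc (vc x)" unfolding sc_def W.sc_def by (simp add: vc_mk small_insert eltsW_vc)
lemma vc_num: "vc (num n) = W.num n" by (induction n) (simp_all add: vc_zero vc_sc)
lemma vc_om: "vc om = W.om"
proof -
 have "eltsW (vc om) = eltsW W.om" unfolding eltsW_vc elts_omega W.elts_omega image_image vc_num ..
 then show ?thesis by simp
qed
lemma vc_Or: assumes "Or a" shows "W.Or (vc a)"
 unfolding Ord_def eltsW_vc
proof (intro ballI conjI)
 fix x assume "x : vc ` elts a"
 then obtain z where z: "x = vc z" "z : elts a" by blast
 have "elts z \<subseteq> elts a" using assms z(2) unfolding Ord_def by blast
 then show "eltsW x \<subseteq> vc ` elts a" unfolding z(1) eltsW_vc by (rule image_mono)
 fix y assume "y : eltsW x"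
 then obtain u where u: "y = vc u" "u : elts z" unfolding z(1) eltsW_vc by blast
 have "elts u \<subseteq> elts z" using assms z(2) u(2) unfolding Ord_def by blast
 then show "eltsW y \<subseteq> eltsW x" unfolding z(1) u(1) eltsW_vc by (rule image_mono)
qed

lemma vc_fun: assumes f: "F (%e. f (e 0))" obtains g where "!!z. z : elts x ==> W.ap g (vc z) = vc (f z)"
proof -
 define h where "h w = vc (f (THE z. vc z = w))" for w
 have h: "h (vc z) = vc (f z)" for z unfolding h_def by (simp add: vc_inj)
 have "eltsW (vc (mk (graph f (elts x)))) = W.graph h (vc ` elts x)"
  unfolding eltsW_vc elts_mk[OF small_graph[OF small_elts f]] unfolding graph_def W.graph_def image_image vc_pr h ..
 from W.ap_graph[OF this] have "W.ap (vc (mk (graph f (elts x)))) (vc z) = vc (f z)" if "z : elts x" for z using that h by simp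
 then show thesis by (rule that)
qed

lemma vc_lepI: assumes f: "inj_on f X" "f ` X \<subseteq> Y" and g: "!!z. z : X ==> W.ap g (vc z) = vc (f z)"
 shows "W.lep (vc ` X) (vc ` Y)"
proof (rule W.lepI)
 show "W.F (%e. W.ap g (e 0))" by (intro W.dt_ap W.dt_const W.dt_var UNIV_I)
 show "inj_on (W.ap g) (vc ` X)"
 proof (rule inj_onI)
  fix a b assume "a : vc ` X" "b : vc ` X" and e: "W.ap g a = W.ap g b"
  then obtain u w where u: "u : X" "w : X" "a = vc u" "b = vc w" by blast
  have "vc (f u) = vc (f w)" using e g[OF u(1)] g[OF u(2)] unfolding u(3,4) by metis
  then have "u = w" using inj_onD[OF f(1) _ u(1,2)] vc_inj by blast
  then show "a = b" using u by simp
 qed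
 show "W.ap g ` vc ` X \<subseteq> vc ` Y"
 proof
  fix y assume "y : W.ap g ` vc ` X"
  then obtain u where u: "u : X" "y = W.ap g (vc u)" by blast
  have "f u : Y" using f(2) u(1) by blast
  then show "y : vc ` Y" unfolding u(2) g[OF u(1)] by (rule imageI)
 qed
qed

lemma vc_lep: assumes "lep (elts x) (elts y)" shows "W.lep (eltsW (vc x)) (eltsW (vc y))"
proof -
 obtain f where f: "F (%e. f (e 0))" "inj_on f (elts x)" "f ` elts x \<subseteq> elts y" using assms by (rule lepE) (rule that)
 obtain g where g: "!!z. z : elts x ==> W.ap g (vc z) = vc (f z)" by (rule vc_fun[OF f(1)]) (rule that)
 show ?thesis unfolding eltsW_vc by (rule vc_lepI[OF f(2,3) g])
qed

lemma forcing_rel: assumes "dfn eltsW UNIV UNIV (%e. Q (e 0) (e 1))"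
 obtains b where "!!s t u. F s ==> F t ==> F u ==> D (%e. b (s e) (t e) (u e))" "!!x y. sem (b x y) (Q (vc x) (vc y))"
proof -
 obtain Ph where Ph: "D (%e. Ph (e 0) (e 1) (e 2))" "!!x y. sem (Ph x y) (Q (val x) (val y))" by (rule forcing_theorem[OF assms]) (rule that)
 show thesis
 proof (rule that[of "%x y. Ph (chk x) (chk y)"])
  show "D (%e. Ph (chk (s e)) (chk (t e)) (u e))" if "F s" "F t" "F u" for s t u
   by (rule dfn_rel3[where R=Ph, OF Ph(1) dt_chk[OF that(1)] dt_chk[OF that(2)] that(3)])
  show "sem (Ph (chk x) (chk y)) (Q (vc x) (vc y))" for x y by (rule Ph(2))
 qed
qed

lemma nd_mono: "PLe r q ==> nd q \<subseteq> nd r" unfolding PLe_def by blast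
lemma G_PP: "p : G ==> p : PP" by (rule G_P)

text \<open>Suppose a condition \<open>s\<close> with node \<open>K\<close> decides the value of an
  injection into \<open>\<omega>\<close> at \<open>dl K\<close>. Inside \<open>K\<close> there is a
  match of its trace that decides the same value for an ordinal in \<open>K\<close>. The two
  conditions amalgamate, but \<open>dl K\<close> is not in \<open>K\<close>.\<close>

lemma om1_preserved: "~ W.lep (eltsW (vc om1)) (eltsW (vc om))"
proof
 assume "W.lep (eltsW (vc om1)) (eltsW (vc om))"
 then obtain f where f: "W.F (%e. f (e 0))" "inj_on f (eltsW (vc om1))" "f ` eltsW (vc om1) \<subseteq> eltsW (vc om)" by (rule W.lepE) (rule that)
 have Df: "dfn eltsW UNIV UNIV (%e. f (e 0) = e 1)" by (intro W.dfn_eq W.dt_1[OF f(1)] W.dt_var)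
 obtain b where Db: "!!s t u. F s ==> F t ==> F u ==> D (%e. b (s e) (t e) (u e))" and b: "!!x y. sem (b x y) (f (vc x) = vc y)"
  by (rule forcing_rel[OF Df]) (rule that)
 \<comment> \<open>The two ways a condition can refute that \<open>b\<close> describes an injection:
   a repeated value, or an argument that never gets a value. Density of the two together
   suffices.\<close>
 let ?Q = "%r. (EX al:elts om1. EX al':elts om1. EX n:elts om. al ~= al' & b al n r & b al' n r) | (EX al:elts om1. ALL n:elts om. ALL s. PLe s r --> ~ b al n s)"
 have "EX p:G. ?Q p"
 proof (rule G_dense)
  show "D (%e. ?Q (e 0))" by (intro dfn_intros Db UNIV_I)
  fix p assume p: "p : PP"
  show "EX q. PLe q p & ?Q q"
  proof (rule ccontr)
   assume "~ ?thesis"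
   then have no1: "!!r al al' n. PLe r p ==> al : elts om1 ==> al' : elts om1 ==> n : elts om ==> b al n r ==> b al' n r ==> al = al'"
    and no2: "!!r al. PLe r p ==> al : elts om1 ==> EX n:elts om. EX s. PLe s r & b al n s" by blast+
   \<comment> \<open>\<open>x\<close> carries the trace and the decided value, \<open>y\<close> a
     matching condition together with the argument at which it decides that value.\<close>
   let ?R = "%x y. mt (pfst x) (pfst y) & PLe (pfst y) p & psnd y : elts om1 & b (psnd y) (psnd x) (pfst y) & ispr y"
   have DR: "D (%e. ?R (e 0) (e 1))" by (intro dfn_intros Db UNIV_I)
   obtain K where K: "K : SS" "p : elts K" "closed2 K" "!!x y. x : elts K ==> y : Vth ==> ?R x y ==> EX y:elts K. ?R x y"
    by (rule SS_good[OF PP_Vth[OF p] DR]) (rule that)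
   note el = SS_el[OF K(1)]
   obtain r where r: "PLe r p" "K : nd r" by (rule add_countable[OF p K(2,1,3)])
   have dK: "dl K : elts om1" by (rule dl_om1[OF K(1)])
   obtain n s where s: "n : elts om" "PLe s r" "b (dl K) n s" using no2[OF r(1) dK] by blast
   have sP: "s : PP" by (rule PLe_PP(1)[OF s(2)])
   have Ks: "K : nd s" using nd_mono[OF s(2)] r(2) by blast
   have sp: "PLe s p" by (rule PLe_trans[OF s(2) r(1)])
   have nK: "n : elts K" using s(1) el_num[OF el] unfolding elts_omega by blast
   have xK: "pr (trc s K) n : elts K" by (rule el_pr[OF el trc_in[OF sP Ks K(1)] nK])
   have yV: "pr s (dl K) : Vth" using PP_Vth[OF sP] thVth[OF th_trans[OF dK om1th]] by (simp add: Vth_pr)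
   have "?R (pr (trc s K) n) (pr s (dl K))" using trc_mt[OF sP] sp dK s(3) by simp
   then obtain y where y: "y : elts K" "?R (pr (trc s K) n) y" using K(4)[OF xK yV] by blast
   have yp: "pr (pfst y) (psnd y) : elts K" using y isprD by simp
   have qz: "pfst y : elts K" "psnd y : elts K" using el_prD[OF el yp] by blast+
   have ym: "mt (trc s K) (pfst y)" using y(2) by simp
   obtain t where t: "PLe t s" "PLe t (pfst y)" by (rule amalg[OF sP Ks K(1,3) qz(1) ym])
   have "b (psnd y) n t" using semD(2)[OF b _ t(2)] y(2) by simp
   moreover have "b (dl K) n t" by (rule semD(2)[OF b s(3) t(1)])
   ultimately have "psnd y = dl K" using no1[OF PLe_trans[OF t(1) sp] _ dK s(1)] y(2) by blast
   moreover have "psnd y : elts (dl K)" unfolding elts_dl using qz(2) y(2) by blast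
   ultimately show False using mem_irrefl by metis
  qed
 qed
 then obtain p where p: "p : G" "?Q p" by blast
 from p(2) show False
 proof
  assume "EX al:elts om1. EX al':elts om1. EX n:elts om. al ~= al' & b al n p & b al' n p"
  then obtain al al' n where a: "al : elts om1" "al' : elts om1" "al ~= al'" "b al n p" "b al' n p" by blast
  then have "f (vc al) = vc n" "f (vc al') = vc n" using semD(3)[OF b] p(1) by blast+
  then have "vc al = vc al'" using f(2) a(1,2) vc_mem by (metis inj_onD)
  then show False using a(3) vc_inj by blast
 next
  assume "EX al:elts om1. ALL n:elts om. ALL s. PLe s p --> ~ b al n s"
  then obtain al where a: "al : elts om1" "!!n s. n : elts om ==> PLe s p ==> ~ b al n s" by blast
  have "f (vc al) : eltsW (vc om)" using f(3) a(1) vc_mem by blast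
  then obtain n where n: "n : elts om" "f (vc al) = vc n" unfolding eltsW_vc by blast
  then obtain q where q: "q : G" "b al n q" using semD(3)[OF b] by blast
  obtain r where "PLe r p" "PLe r q" using G_dir[OF p(1) q(1)] by blast
  then show False using a(2)[OF n(1)] semD(2)[OF b q(2)] by blast
 qed
qed

lemma W_om1: "omega1 eltsW = vc om1"
 unfolding omega1_def[of eltsW]
proof (rule W.least_ordI)
 show "W.Or (vc om1)" by (rule vc_Or[OF O1])
 show "~ injects eltsW (vc om1) W.om" unfolding W.injects_lep vc_om[symmetric] by (rule om1_preserved)
 fix y assume "y : eltsW (vc om1)"
 then obtain z where z: "y = vc z" "z : elts om1" unfolding eltsW_vc by blast
 then have "ctb (elts z)" using om1_iff by blast
 from vc_lep[OF this] show "~ ~ injects eltsW y W.om" unfolding W.injects_lep vc_om z(1) by simp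
qed

text \<open>What must agree for two conditions to be united over a transitive node: the nodes below
  \<open>W\<close> with their decorations, the types \<open>(dl N, ot N)\<close> of all countable
  nodes, and their intersections with nodes below \<open>W\<close>. The decided value
  \<open>et\<close> is carried along; all of it is an element of \<open>W\<close>.\<close>

definition "dat W q et = pr (pr (pr (mk (nd q \<inter> elts W)) et) (mk ((%M. pr M (dc q M)) ` (nd q \<inter> elts W))))
 (pr (mk ((%N. pr (dl N) (ot N)) ` (nd q \<inter> SS))) (mk (UN N:nd q \<inter> SS. (%Y. pr (N \<sqinter> Y) (pr (dl N) (ot N))) ` (nd q \<inter> elts W))))"

lemma dt_dat: assumes "F s" "F t" "F u" shows "F (%e. dat (s e) (t e) (u e))"
proof (rule dt_3[OF _ assms])
 show "F (%e. dat (e 0) (e 1) (e 2))" unfolding dat_def by (intro dfn_intros UNIV_I)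
qed

lemma dat_parts: assumes e: "dat W q et = dat W' q' et'" and q: "q : PP" "q' : PP"
 shows "nd q \<inter> elts W = nd q' \<inter> elts W'" "et = et'" "!!M. M : nd q \<inter> elts W ==> dc q M = dc q' M"
  "!!N. N : nd q \<inter> SS ==> EX N':nd q' \<inter> SS. dl N' = dl N & ot N' = ot N"
  "!!N Y. N : nd q \<inter> SS ==> Y : nd q \<inter> elts W ==> EX N':nd q' \<inter> SS. dl N' = dl N & ot N' = ot N & elts (N \<sqinter> Y) \<subseteq> elts N'"
proof -
 note f = PPD(3)[OF q(1)] PPD(3)[OF q(2)]
 have i: "mk A = mk B \<longleftrightarrow> A = B" if "finite A" "finite B" for A B using small_finite[OF that(1)] small_finite[OF that(2)] elts_mk by metis
 have "dat W q et = dat W' q' et' \<longleftrightarrow> ((nd q \<inter> elts W = nd q' \<inter> elts W') &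
  (et = et') &
  ((%M. pr M (dc q M)) ` (nd q \<inter> elts W) = (%M. pr M (dc q' M)) ` (nd q' \<inter> elts W')) &
  ((%N. pr (dl N) (ot N)) ` (nd q \<inter> SS) = (%N. pr (dl N) (ot N)) ` (nd q' \<inter> SS)) &
  ((UN N:nd q \<inter> SS. (%Y. pr (N \<sqinter> Y) (pr (dl N) (ot N))) ` (nd q \<inter> elts W)) = (UN N:nd q' \<inter> SS. (%Y. pr (N \<sqinter> Y) (pr (dl N) (ot N))) ` (nd q' \<inter> elts W'))))"
  unfolding dat_def pr_eq conj_assoc using f by (simp add: i)
 note C = iffD1[OF this e]
 note e5 = C[THEN conjunct1] C[THEN conjunct2, THEN conjunct1] C[THEN conjunct2, THEN conjunct2, THEN conjunct1]
  C[THEN conjunct2, THEN conjunct2, THEN conjunct2, THEN conjunct1] C[THEN conjunct2, THEN conjunct2, THEN conjunct2, THEN conjunct2]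
 show "nd q \<inter> elts W = nd q' \<inter> elts W'" "et = et'" by (fact e5)+
 show "dc q M = dc q' M" if "M : nd q \<inter> elts W" for M
 proof -
  have "pr M (dc q M) : (%M. pr M (dc q' M)) ` (nd q' \<inter> elts W')" unfolding e5(3)[symmetric] using that by (rule imageI)
  then show ?thesis by auto
 qed
 show "EX N':nd q' \<inter> SS. dl N' = dl N & ot N' = ot N" if "N : nd q \<inter> SS" for N
 proof -
  have "pr (dl N) (ot N) : (%N. pr (dl N) (ot N)) ` (nd q' \<inter> SS)" unfolding e5(4)[symmetric] using that by (rule imageI)
  then show ?thesis by auto
 qed
 show "EX N':nd q' \<inter> SS. dl N' = dl N & ot N' = ot N & elts (N \<sqinter> Y) \<subseteq> elts N'" if "N : nd q \<inter> SS" "Y : nd q \<inter> elts W" for N Y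
 proof -
  have "pr (N \<sqinter> Y) (pr (dl N) (ot N)) : (UN N:nd q' \<inter> SS. (%Y. pr (N \<sqinter> Y) (pr (dl N) (ot N))) ` (nd q' \<inter> elts W'))"
   unfolding e5(5)[symmetric] using that by blast
  then obtain N' Y' where N': "N' : nd q' \<inter> SS" "pr (N \<sqinter> Y) (pr (dl N) (ot N)) = pr (N' \<sqinter> Y') (pr (dl N') (ot N'))" by blast
  then have eqs: "N \<sqinter> Y = N' \<sqinter> Y'" "dl N = dl N'" "ot N = ot N'" by (simp_all only: pr_eq)
  have "elts (N \<sqinter> Y) \<subseteq> elts N'" unfolding eqs(1) elts_cap by blast
  then show ?thesis using N'(1) eqs(2,3) by metis
 qed
qed

lemma dat_in: assumes W: "W : TT" "W : nd q" and q: "q : PP" and et: "et : elts om1" shows "dat W q et : elts W"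
proof -
 note el = TT_el[OF W(1)] and f = PPD(3)[OF q] and o = TT_om1[OF W(1)]
 have d: "dc q M : elts W" if M: "M : nd q" "M : elts W" for M
 proof -
  have "W : {N:nd q. lt M N}" using W M mem_lt by blast
  with wfRp obtain N' where "N' : {N:nd q. lt M N}" "!!y. lt y N' ==> y ~: {N:nd q. lt M N}" by (rule wfE_min) (rule that)
  then have isu: "isucc (nd q) M N'" unfolding isucc_def by blast
  have dN: "dc q M : elts N'" using condD(4)[OF PPD(1)[OF q]] M isu unfolding deco_def by blast
  have "N' : nd q" "~ lt W N'" using isu W mem_lt[OF M(2)] unfolding isucc_def by blast+
  then have "N' = W | N' : elts W" using chain_lin[OF PPD(4)[OF q] _ W(2)] lt_TT[OF W(1)] by blast
  then show ?thesis using dN TT_trans[OF W(1)] by blast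
 qed
 have s: "dl N : elts W" "ot N : elts W" if "N : SS" for N using dl_om1[OF that] ot_om1[OF that] o by blast+
 have c: "N \<sqinter> Y : elts W" if "Y : elts W" for N Y by (rule TT_sub[OF W(1) that]) simp
 have U: "(UN N:nd q \<inter> SS. (%Y. pr (N \<sqinter> Y) (pr (dl N) (ot N))) ` (nd q \<inter> elts W)) \<subseteq> elts W"
 proof (intro UN_least image_subsetI)
  fix N Y assume "N : nd q \<inter> SS" "Y : nd q \<inter> elts W"
  then show "pr (N \<sqinter> Y) (pr (dl N) (ot N)) : elts W" by (intro el_pr[OF el] c s) simp_all
 qed
 have 1: "mk (UN N:nd q \<inter> SS. (%Y. pr (N \<sqinter> Y) (pr (dl N) (ot N))) ` (nd q \<inter> elts W)) : elts W" by (rule el_finite[OF el _ U]) (simp add: f)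
 have 2: "mk ((%N. pr (dl N) (ot N)) ` (nd q \<inter> SS)) : elts W"
 proof (rule el_finite[OF el])
  show "(%N. pr (dl N) (ot N)) ` (nd q \<inter> SS) \<subseteq> elts W" by (rule image_subsetI, intro el_pr[OF el] s) simp_all
 qed (simp add: f)
 have 3: "mk ((%M. pr M (dc q M)) ` (nd q \<inter> elts W)) : elts W"
 proof (rule el_finite[OF el])
  show "(%M. pr M (dc q M)) ` (nd q \<inter> elts W) \<subseteq> elts W" by (rule image_subsetI, intro el_pr[OF el] d) simp_all
 qed (simp add: f)
 have 4: "mk (nd q \<inter> elts W) : elts W" by (rule el_finite[OF el]) (simp_all add: f)
 have 5: "et : elts W" using et o by blast
 show ?thesis unfolding dat_def by (intro el_pr[OF el] 1 2 3 4 5)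
qed

text \<open>A point common to \<open>N\<close> in \<open>q2\<close> and \<open>X\<close> in
  \<open>q1\<close> lies in \<open>E\<close>, hence in the node \<open>N \<inter> E\<close> of
  \<open>q2\<close>. The record for this intersection provides a node of \<open>q1\<close> of the
  same type through that point; the other direction is symmetric. So neither condition raises the
  heights of the other.\<close>

lemma dat_amalg: assumes E: "E : TT" "E : nd q2" and q: "q2 : PP" "q1 : PP" "q1 : elts E" and e: "dat E q2 et = dat U q1 et'"
 obtains r where "PLe r q1" "PLe r q2"
proof -
 note P = dat_parts[OF e q(1,2)] and P' = dat_parts[OF e[symmetric] q(2,1)]
 note nn = PPD(5)[OF q(1)]
 have q1E: "N : elts E" if "N : nd q1" for N by (rule PP_el(1)[OF TT_el[OF E(1)] q(2,3) that])
 have cap: "N \<sqinter> E : nd q2 \<inter> elts E" if "N : nd q2 \<inter> SS" for N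
  using niceD(2)[OF nn _ E(2), of N] cap_lt(1)[OF _ E(1), of N] that by blast
 obtain r where r: "PLe r q1" "nd r = nd q2 \<union> nd q1" "!!M. M : nd q1 ==> dc r M = dc q1 M" "!!M. M : nd q2 ==> M ~: nd q1 ==> dc r M = dc q2 M"
 proof (rule add_transitive[OF PPD(1)[OF q(1)] E(2,1) q(2,3)])
  show "N : nd q1" if "N : nd q2" "N : elts E" for N using P(1) that by blast
  show "star (nd q2 \<union> nd q1)"
  proof (rule starI)
   fix M N assume M: "M : nd q2 \<union> nd q1" "M : SS" and N: "N : nd q2 \<union> nd q1" "N : SS" and d: "dl N : elts (dl M)"
   have tr: "EX X':nd q2 \<inter> SS. dl X' = dl X & ot X' = ot X" if "X : nd q2 \<union> nd q1" "X : SS" for X using that P'(4)[of X] by blast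
   obtain M' where M': "M' : nd q2" "M' : SS" "dl M' = dl M" using tr[OF M] by blast
   obtain N' where N': "N' : nd q2" "N' : SS" "dl N' = dl N" "ot N' = ot N" using tr[OF N] by blast
   show "ot N : elts (dl M)" using starD[OF condD(3)[OF PPD(1)[OF q(1)]] M'(1,2) N'(1,2)] d M'(3) N'(3,4) by simp
  qed
  fix N a X assume N: "N : nd q2" "N : SS" "a : elts N" "a : elts th" and X: "X : nd q1" "X : SS" "a : elts X" "dl X = dl N"
  have "a : elts E" using TT_trans[OF E(1) q1E[OF X(1)]] X(3) by blast
  then have a: "a : elts (N \<sqinter> (N \<sqinter> E))" using N by simp
  have "N \<sqinter> E : nd q2 \<inter> elts E" using cap N by blast
  from P(5)[OF _ this, of N] N obtain N' where "N' : nd q1 \<inter> SS" "dl N' = dl N" "ot N' = ot N" "elts (N \<sqinter> (N \<sqinter> E)) \<subseteq> elts N'" by blast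
  then show "EX Y:nd q1 \<inter> SS. a : elts Y & dl Y = dl N & elts (ot N) \<subseteq> elts (ot Y)" using a by (intro bexI[of _ N']) auto
 qed (rule that)
 have "hle (nd q2) (nd q2 \<union> nd q1)" unfolding hle_def
 proof (intro ballI impI)
  fix N a assume N: "N : (nd q2 \<union> nd q1) \<inter> SS" "a : elts N \<inter> elts th" and ex: "EX K:nd q2 \<inter> SS. a : elts K & dl K = dl N"
  show "EX K:nd q2 \<inter> SS. a : elts K & dl K = dl N & elts (ot N) \<subseteq> elts (ot K)"
  proof (cases "N : nd q2")
   case True then show ?thesis using N by blast
  next
   case False
   then have N1: "N : nd q1 \<inter> SS" using N by blast
   obtain X where X: "X : nd q2 \<inter> SS" "a : elts X" "dl X = dl N" using ex by blast
   have "N : elts E" using q1E N1 by blast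
   then have "a : elts E" using TT_trans[OF E(1)] N(2) by blast
   then have a: "a : elts (N \<sqinter> (X \<sqinter> E))" using N(2) X(2) by (simp add: small_Int)
   have "X \<sqinter> E : nd q1 \<inter> elts U" using cap[OF X(1)] P(1) by blast
   from P'(5)[OF N1 this] obtain N' where "N' : nd q2 \<inter> SS" "dl N' = dl N" "ot N' = ot N" "elts (N \<sqinter> (X \<sqinter> E)) \<subseteq> elts N'" by blast
   then show ?thesis using a by (intro bexI[of _ N']) auto
  qed
 qed
 moreover have "elts (dc q2 M) \<subseteq> elts (dc r M)" if "M : nd q2" for M
 proof (cases "M : nd q1")
  case True then show ?thesis using r(3)[OF True] P(3)[of M] q1E[OF True] that by simp
 next
  case False then show ?thesis using r(4)[OF that] by simp
 qed
 ultimately have "PLe r q2" unfolding PLe_def r(2) using PLe_PP(1)[OF r(1)] q(1) by blast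
 then show thesis using that r(1) by blast
qed

lemma rk_TT: assumes "U : TT" shows "rk U : elts th" "U = Vs (rk U)"
proof -
 obtain al where a: "al : elts th" "U = Vs al" "Or al" using assms by (rule TT_E) (rule that)
 then show "rk U : elts th" "U = Vs (rk U)" using rk_Vs by simp_all
qed

text \<open>A reflection form of the pressing-down argument: some \<open>E\<close> has the same data as an element of itself.\<close>

lemma pigeonhole: assumes f: "F (%e. f (e 0))" and g: "F (%e. g (e 0))" and p: "a : Vth"
 and fin: "!!E. E : TT ==> a : elts E ==> f E : elts E" and gV: "!!E. E : TT ==> a : elts E ==> g E : Vth"
 obtains E U where "E : TT" "U : TT" "a : elts E" "a : elts U" "U : elts E" "g U : elts E" "f U = f E"
proof -
 have DQ: "D (%e. e 1 : TT & a : elts (e 1) & f (e 1) = e 0)" by (intro dfn_intros dt_1[OF f] UNIV_I)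
 obtain h where h: "F (%e. h (e 0))" "!!x y. x : Vth ==> y : TT & a : elts y & f y = x ==> h x : TT & a : elts (h x) & f (h x) = x"
  by (rule choice[of "Vth" "%x y. y : TT & a : elts y & f y = x"]) (rule small_elts, rule DQ, rule that)
 define Ph where "Ph x = (if pr (h x) (g (h x)) : Vth then pr (h x) (g (h x)) else zero)" for x
 have FPh: "F (%e. Ph (e 0))" unfolding Ph_def by (intro dfn_intros dt_1[OF h(1)] dt_1[OF g] UNIV_I)
 have PhV: "Ph x : Vth" for x unfolding Ph_def using thVth[OF zero_th] by simp
 obtain E where E: "E : TT" "a : elts E" "!!x. x : elts E ==> Ph x : elts E" by (rule TT_reflect[OF FPh PhV p]) (rule that)
 have z: "f E : elts E" by (rule fin[OF E(1,2)])
 then have zV: "f E : Vth" using el_sub[OF TT_el[OF E(1)]] by blast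
 let ?U = "h (f E)"
 have U: "?U : TT" "a : elts ?U" "f ?U = f E" using h(2)[OF zV, of E] E by blast+
 have "pr ?U (g ?U) : Vth" using TT_Vth[OF U(1)] gV[OF U(1,2)] by (simp add: Vth_pr)
 then have "pr ?U (g ?U) : elts E" using E(3)[OF z] unfolding Ph_def by simp
 then have "?U : elts E" "g ?U : elts E" using el_prD[OF TT_el[OF E(1)]] by blast+
 then show thesis using that E U by blast
qed

text \<open>To each \<open>U\<close> in \<open>TT\<close> containing \<open>p\<close> belongs a
  condition with node \<open>U\<close> that decides the value at \<open>rk U\<close>. By
  \<open>pigeonhole\<close> some \<open>U \<in> E\<close> have equal data, so their conditions are
  compatible and force the same value at two different arguments.\<close>

lemma th_preserved: "~ W.lep (eltsW (vc th)) (eltsW (vc om1))"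
proof
 assume "W.lep (eltsW (vc th)) (eltsW (vc om1))"
 then obtain f where f: "W.F (%e. f (e 0))" "inj_on f (eltsW (vc th))" "f ` eltsW (vc th) \<subseteq> eltsW (vc om1)" by (rule W.lepE) (rule that)
 have Df: "dfn eltsW UNIV UNIV (%e. f (e 0) = e 1)" by (intro W.dfn_eq W.dt_1[OF f(1)] W.dt_var)
 obtain b where Db: "!!s t u. F s ==> F t ==> F u ==> D (%e. b (s e) (t e) (u e))" and b: "!!x y. sem (b x y) (f (vc x) = vc y)"
  by (rule forcing_rel[OF Df]) (rule that)
 let ?Q = "%r. (EX al:elts th. EX al':elts th. EX n:elts om1. al ~= al' & b al n r & b al' n r) | (EX al:elts th. ALL n:elts om1. ALL s. PLe s r --> ~ b al n s)"
 have "EX p:G. ?Q p"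
 proof (rule G_dense)
  show "D (%e. ?Q (e 0))" by (intro dfn_intros Db UNIV_I)
  fix p assume p: "p : PP"
  show "EX q. PLe q p & ?Q q"
  proof (rule ccontr)
   assume "~ ?thesis"
   then have no1: "!!r al al' n. PLe r p ==> al : elts th ==> al' : elts th ==> n : elts om1 ==> b al n r ==> b al' n r ==> al = al'"
    and no2: "!!r al. PLe r p ==> al : elts th ==> EX n:elts om1. EX s. PLe s r & b al n s" by blast+
   let ?R = "%U y. PLe (pfst y) p & U : nd (pfst y) & psnd y : elts om1 & b (rk U) (psnd y) (pfst y)"
   have DR: "D (%e. ?R (e 0) (e 1))" by (intro dfn_intros Db UNIV_I)
   obtain k where k: "F (%e. k (e 0))" "!!x y. x : TT ==> ?R x y ==> ?R x (k x)" by (rule choice[OF small_TT DR]) (rule that)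
   have R: "?R U (k U)" if U: "U : TT" "p : elts U" for U
   proof -
    obtain r where r: "PLe r p" "{U} \<subseteq> nd r" by (rule add_TTs[of "{U}" U p]) (use U p mem_irrefl in auto)
    obtain n s where s: "n : elts om1" "PLe s r" "b (rk U) n s" using no2[OF r(1) rk_TT(1)[OF U(1)]] by blast
    have "PLe s p" "U : nd s" using PLe_trans[OF s(2) r(1)] nd_mono[OF s(2)] r(2) by blast+
    then have "?R U (pr s n)" using s by simp
    then show ?thesis by (rule k(2)[OF U(1)])
   qed
   have Fd: "F (%e. dat (e 0) (pfst (k (e 0))) (psnd (k (e 0))))" by (intro dt_dat dfn_intros k(1))
   have Fq: "F (%e. pfst (k (e 0)))" by (intro dfn_intros k(1))
   obtain E U where EU: "E : TT" "U : TT" "p : elts E" "p : elts U" "U : elts E" "pfst (k U) : elts E" "dat U (pfst (k U)) (psnd (k U)) = dat E (pfst (k E)) (psnd (k E))"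
   proof (rule pigeonhole[OF Fd Fq PP_Vth[OF p]])
    fix E assume E: "E : TT" "p : elts E"
    note RE = R[OF E]
    have P: "pfst (k E) : PP" using RE PLe_PP(1) by blast
    show "dat E (pfst (k E)) (psnd (k E)) : elts E" by (rule dat_in[OF E(1)]) (use RE P in blast)+
    show "pfst (k E) : Vth" by (rule PP_Vth[OF P])
   qed
   note RE = R[OF EU(1,3)] and RU = R[OF EU(2,4)]
   have P: "pfst (k E) : PP" "pfst (k U) : PP" using RE RU PLe_PP(1) by blast+
   obtain r where r: "PLe r (pfst (k U))" "PLe r (pfst (k E))" by (rule dat_amalg[OF EU(1) _ P EU(6) EU(7)[symmetric]]) (use RE in blast)
   have et: "psnd (k E) = psnd (k U)" by (rule dat_parts(2)[OF EU(7)[symmetric] P])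
   have "b (rk E) (psnd (k E)) r" using semD(2)[OF b _ r(2)] RE by blast
   moreover have "b (rk U) (psnd (k E)) r" unfolding et using semD(2)[OF b _ r(1)] RU by blast
   moreover have "PLe r p" using PLe_trans[OF r(1)] RU by blast
   ultimately have "rk E = rk U" using no1[of r "rk E" "rk U" "psnd (k E)"] rk_TT(1)[OF EU(1)] rk_TT(1)[OF EU(2)] RE by blast
   then have "E = U" using rk_TT(2)[OF EU(1)] rk_TT(2)[OF EU(2)] by simp
   then show False using EU(5) mem_irrefl by blast
  qed
 qed
 then obtain p where p: "p : G" "?Q p" by blast
 from p(2) show False
 proof
  assume "EX al:elts th. EX al':elts th. EX n:elts om1. al ~= al' & b al n p & b al' n p"
  then obtain al al' n where a: "al : elts th" "al' : elts th" "al ~= al'" "b al n p" "b al' n p" by blast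
  then have "f (vc al) = vc n" "f (vc al') = vc n" using semD(3)[OF b] p(1) by blast+
  then have "vc al = vc al'" using f(2) a(1,2) vc_mem by (metis inj_onD)
  then show False using a(3) vc_inj by blast
 next
  assume "EX al:elts th. ALL n:elts om1. ALL s. PLe s p --> ~ b al n s"
  then obtain al where a: "al : elts th" "!!n s. n : elts om1 ==> PLe s p ==> ~ b al n s" by blast
  have "f (vc al) : eltsW (vc om1)" using f(3) a(1) vc_mem by blast
  then obtain n where n: "n : elts om1" "f (vc al) = vc n" unfolding eltsW_vc by blast
  then obtain q where q: "q : G" "b al n q" using semD(3)[OF b] by blast
  obtain r where "PLe r p" "PLe r q" using G_dir[OF p(1) q(1)] by blast
  then show False using a(2)[OF n(1)] semD(2)[OF b q(2)] by blast
 qed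
qed

definition "H N0 W = {N:SS. N0 : elts N & N : elts W & (EX p:G. N : nd p)}"

lemma name_check: assumes D: "D (%e. Q (e 0) (e 1))" shows "EX c. eltsW c = vc ` {x : elts a. EX p:G. Q x p}"
proof -
 let ?N = "{t. EX x:elts a. EX p:PP. t = pr (chk x) p & Q x p}"
 have sub: "?N \<subseteq> prod (chk ` elts a) PP" unfolding prod_def by blast
 have Fc: "F (%e. chk (e 0))" by (intro dfn_intros)
 have "D (%e. e 0 : ?N)" unfolding mem_Collect_eq by (intro dfn_intros dfn_rel2[OF D] UNIV_I)
 then have "small ?N" by (rule small_subset[OF small_prod[OF small_image[OF small_elts Fc] small_PP] sub])
 then have N: "elts (mk ?N) = ?N" by (rule elts_mk)
 have m: "pr sg p : ?N \<longleftrightarrow> (EX x:elts a. sg = chk x & p : PP & Q x p)" for sg p by auto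
 have "eltsW (val (mk ?N)) = {val sg | sg p. p : G & (EX x:elts a. sg = chk x & p : PP & Q x p)}" unfolding eltsW_val N m by blast
 also have "\<dots> = vc ` {x : elts a. EX p:G. Q x p}" using G_PP by blast
 finally show ?thesis by blast
qed

lemma H_name: "EX c. eltsW c = vc ` H N0 W"
proof -
 have "D (%e. e 0 : SS & N0 : elts (e 0) & e 0 : nd (e 1))" by (intro dfn_intros UNIV_I)
 from name_check[OF this, of W] obtain c where "eltsW c = vc ` {x : elts W. EX p:G. x : SS & N0 : elts x & x : nd p}" by blast
 moreover have "{x : elts W. EX p:G. x : SS & N0 : elts x & x : nd p} = H N0 W" unfolding H_def by blast
 ultimately show ?thesis by metis
qed

lemma H_lin: assumes c: "cons0 N0 W" and M: "M : H N0 W" "N : H N0 W" shows "M = N | M : elts N | N : elts M"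
proof -
 obtain p q where pq: "p : G" "q : G" "M : nd p" "N : nd q" using M unfolding H_def by blast
 obtain r where r: "r : G" "PLe r p" "PLe r q" using G_dir[OF pq(1,2)] by blast
 have "M : nd r" "N : nd r" using r(2,3) pq nd_mono by blast+
 from between_lin[OF c G_PP[OF r(1)] this] M show ?thesis unfolding H_def by blast
qed

lemma H_inj: assumes c: "cons0 N0 W" shows "inj_on dl (H N0 W)"
proof (rule inj_onI)
 have l: "dl M ~= dl N" if "M : H N0 W" "N : H N0 W" "M : elts N" for M N
 proof -
  have "dl M : elts (dl N)" by (rule dl_less) (use that above_base[OF c] in \<open>auto simp: H_def\<close>)
  then show ?thesis using mem_irrefl by metis
 qed
 fix M N assume "M : H N0 W" "N : H N0 W" "dl M = dl N"
 then show "M = N" using H_lin[OF c, of M N] l[of M N] l[of N M] by metis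
qed

text \<open>A node \<open>K\<close> containing \<open>x\<close>, \<open>N0\<close> and the given
  condition can be added, and then \<open>K \<inter> W\<close> is a node of the interval with
  \<open>x\<close> in it.\<close>

lemma H_cover: assumes c: "cons0 N0 W" and p: "p : G" "W : nd p" and x: "x : elts W" shows "EX N:H N0 W. x : elts N"
proof -
 have W: "W : TT" "N0 : elts W" using c unfolding cons0_def by blast+
 have "EX r:G. PLe r p & (EX N:nd r \<inter> SS. N0 : elts N & N : elts W & x : elts N)"
 proof (rule G_below[OF _ p(1)])
  show "D (%e. EX N:nd (e 0) \<inter> SS. N0 : elts N & N : elts W & x : elts N)" by (intro dfn_intros UNIV_I)
  fix q assume q: "PLe q p"
  have qP: "q : PP" by (rule PLe_PP(1)[OF q])
  have sub: "elts W \<subseteq> Vth" by (rule el_sub[OF TT_el[OF W(1)]])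
  have bV: "pr q (pr x N0) : Vth" using PP_Vth[OF qP] x W(2) sub by (simp add: Vth_pr subset_iff)
  have DT: "D (%e. e 0 = e 1)" by (intro dfn_intros)
  obtain K where K: "K : SS" "pr q (pr x N0) : elts K" "closed2 K" by (rule SS_good[OF bV DT]) (rule that)
  note elK = SS_el[OF K(1)]
  have i: "q : elts K" "x : elts K" "N0 : elts K" using el_prD[OF elK] K(2) by blast+
  obtain s where s: "PLe s q" "K : nd s" by (rule add_countable[OF qP i(1) K(1,3)])
  have sP: "s : PP" by (rule PLe_PP(1)[OF s(1)])
  have Ws: "W : nd s" using nd_mono[OF s(1)] nd_mono[OF q] p(2) by blast
  have N: "K \<sqinter> W : nd s \<inter> SS" by (rule cap_SS(1)[OF PPD(5)[OF sP] s(2) Ws K(1)])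
  have "N0 : elts (K \<sqinter> W)" "x : elts (K \<sqinter> W)" using i x W by simp_all
  then show "EX r. PLe r q & (EX N:nd r \<inter> SS. N0 : elts N & N : elts W & x : elts N)" using s(1) N cap_lt(1)[OF K(1) W(1)] by blast
 qed
 then show ?thesis unfolding H_def by blast
qed

lemma G_base: assumes x: "x : Vth" obtains p N0 W where "p : G" "N0 : nd p" "W : nd p" "cons0 N0 W" "x : elts N0"
proof -
 have "EX p:G. EX N0:nd p. EX W:nd p. cons0 N0 W & x : elts N0"
 proof (rule G_dense)
  show "D (%e. EX N0:nd (e 0). EX W:nd (e 0). cons0 N0 W & x : elts N0)" unfolding cons0_def by (intro dfn_intros UNIV_I)
  fix p assume p: "p : PP"
  obtain s N0 W where "PLe s p" "N0 : nd s" "W : nd s" "cons0 N0 W" "x : elts N0" by (rule base[OF p x]) (rule that)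
  then show "EX q. PLe q p & (EX N0:nd q. EX W:nd q. cons0 N0 W & x : elts N0)" by blast
 qed
 then show thesis using that by blast
qed

text \<open>\<open>ga\<close> is covered by the nodes of an interval, each of them countable. Their
  traces inject the interval into \<open>\<omega>\<^sub>1\<close>, and \<open>limit_pairs\<close>
  codes a trace together with a number below \<open>\<omega>\<^sub>1\<close>.\<close>

lemma collapse: assumes ga: "ga : elts th" shows "W.lep (eltsW (vc ga)) (eltsW (vc om1))"
proof -
 obtain p N0 W where B: "p : G" "N0 : nd p" "W : nd p" and c: "cons0 N0 W" and x: "ga : elts N0" by (rule G_base[OF thVth[OF ga]]) (rule that)
 have W: "W : TT" "N0 : elts W" "N0 : SS" using c unfolding cons0_def by blast+
 have "ga : elts W" using TT_trans[OF W(1,2)] x by blast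
 then have gW: "elts ga \<subseteq> elts W" by (rule TT_trans[OF W(1)])
 obtain A where A: "eltsW A = vc ` H N0 W" using H_name by blast
 have "eltsW (vc ga) \<subseteq> (UN y:eltsW A. eltsW y)" unfolding A eltsW_vc[of ga]
 proof
  fix z assume "z : vc ` elts ga"
  then obtain u where u: "z = vc u" "u : elts ga" by blast
  obtain N where "N : H N0 W" "u : elts N" using H_cover[OF c B(1,3), of u] u(2) gW by blast
  then show "z : (UN y:vc ` H N0 W. eltsW y)" using u(1) vc_mem by blast
 qed
 moreover have "W.lep (UN y:eltsW A. eltsW y) (W.prod (eltsW A) (eltsW (vc om)))"
 proof (rule W.lep_UN[of "eltsW A" "%y. y"])
  show "W.F (%e. e 0)" by (rule W.dt_var)
  fix y assume "y : eltsW A" then obtain N where N: "N : SS" "y = vc N" unfolding A H_def by blast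
  show "W.lep (eltsW y) (eltsW (vc om))" unfolding N(2) by (rule vc_lep[OF SS_ctb[OF N(1)]])
 qed simp
 moreover have "W.lep (W.prod (eltsW A) (eltsW (vc om))) (W.prod (vc ` dl ` H N0 W) (eltsW (vc om)))"
 proof (rule W.lep_prod)
  have Fdl: "F (%e. dl (e 0))" by (intro dfn_intros)
  obtain g where g: "!!z. z : elts W ==> W.ap g (vc z) = vc (dl z)" by (rule vc_fun[OF Fdl]) (rule that)
  have gH: "W.ap g (vc N) = vc (dl N)" if "N : H N0 W" for N using g that unfolding H_def by blast
  show "W.lep (eltsW A) (vc ` dl ` H N0 W)" unfolding A by (rule vc_lepI[OF H_inj[OF c] subset_refl gH])
  show "W.lep (eltsW (vc om)) (eltsW (vc om))" by (rule W.lep_id) simp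
 qed
 moreover obtain k where k: "F (%e. k (e 0))" "!!d n. Or d ==> ~ (EX w. d = sc w) ==> k ((sc ^^ n) d) = pr d (num n)" by (rule limit_pairs) (rule that)
 have sk: "small (k ` elts om1)" by (rule small_image[OF small_elts k(1)])
 have "W.prod (vc ` dl ` H N0 W) (eltsW (vc om)) \<subseteq> eltsW (vc (mk (k ` elts om1)))"
 proof
  fix t assume "t : W.prod (vc ` dl ` H N0 W) (eltsW (vc om))"
  then obtain N n where N: "N : SS" "t = W.pr (vc (dl N)) (vc (num n))" unfolding W.prod_def eltsW_vc elts_omega H_def by blast
  have s: "(sc ^^ n) (dl N) : elts om1"
  proof (induction n)
   case (Suc n)
   then have x: "Or ((sc ^^ n) (dl N))" "ctb (elts ((sc ^^ n) (dl N)))" using om1_iff by blast+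
   have "ctb (elts ((sc ^^ n) (dl N)) \<union> {(sc ^^ n) (dl N)})" by (rule ctb_Un[OF small_elts small_single x(2) ctb_finite]) simp
   then show ?case unfolding om1_iff using Ord_sc[OF x(1)] by simp
  qed (simp add: dl_om1[OF N(1)])
  have "k ((sc ^^ n) (dl N)) = pr (dl N) (num n)" by (rule k(2)[OF el_nonsucc(1,2)[OF N(1)]])
  then have "pr (dl N) (num n) : k ` elts om1" using s by (metis imageI)
  then show "t : eltsW (vc (mk (k ` elts om1)))" unfolding N(2) vc_pr[symmetric] vc_mem elts_mk[OF sk] .
 qed
 moreover have "lep (elts (mk (k ` elts om1))) (elts om1)" unfolding elts_mk[OF sk] by (rule lep_image[OF small_elts k(1)])
 then have "W.lep (eltsW (vc (mk (k ` elts om1)))) (eltsW (vc om1))" by (rule vc_lep)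
 ultimately show ?thesis using W.lep_mono[OF _ _ subset_refl] W.lep_mono[OF subset_refl] W.lep_trans by meson
qed

theorem W_om2: "omega2 eltsW = vc th"
 unfolding omega2_def[of eltsW] W_om1
proof (rule W.least_ordI)
 show "W.Or (vc th)" by (rule vc_Or[OF Oth])
 show "~ injects eltsW (vc th) (vc om1)" unfolding W.injects_lep by (rule th_preserved)
 fix y assume "y : eltsW (vc th)"
 then obtain z where z: "y = vc z" "z : elts th" unfolding eltsW_vc by blast
 then show "~ ~ injects eltsW y (vc om1)" unfolding W.injects_lep using collapse by simp
qed

end

section \<open>Heights along the generic chain and the failure of precipitousness\<close>

context ext begin

lemma omega_limit_V: assumes d: "d : elts om1" and L: "Limit eltsW (vc d)" shows "Limit elts d"
proof -
 have O: "Or d" using d om1_iff by blast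
 have L': "eltsW (vc d) ~= {}" "ALL be:eltsW (vc d). EX ga:eltsW (vc d). be : eltsW ga" using L unfolding Limit_def by blast+
 show ?thesis unfolding Limit_def
 proof (intro conjI ballI O)
  show "elts d ~= {}" using L'(1) unfolding eltsW_vc by blast
  fix x assume "x : elts d"
  then have "vc x : eltsW (vc d)" using vc_mem by blast
  then obtain y where y: "y : eltsW (vc d)" "vc x : eltsW y" using L'(2) by blast
  obtain z where z: "y = vc z" "z : elts d" using y(1) unfolding eltsW_vc by blast
  then show "EX ga:elts d. x : elts ga" using y(2) vc_mem by blast
 qed
qed

text \<open>This is what decorations are for. If \<open>d\<close> is not yet a trace, adding
  \<open>d\<close> to the decoration of the last node \<open>Y\<close> with trace below
  \<open>d\<close> forces every later successor of \<open>Y\<close> to contain \<open>d\<close>; no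
  node can then have its trace strictly between that of \<open>Y\<close> and \<open>d\<close>,
  against \<open>lim\<close>.\<close>

lemma closure_point: assumes c: "cons0 N0 W" and p: "p : G" "N0 : nd p" "W : nd p"
 and d: "d : elts om1" "zero : elts d" and lim: "!!e. e : elts d ==> EX N:H N0 W. e : elts (dl N) & dl N : elts d"
 shows "EX N:H N0 W. dl N = d"
proof -
 have W: "W : TT" "N0 : elts W" "N0 : SS" using c unfolding cons0_def by blast+
 have Od: "Or d" using d(1) om1_iff by blast
 have dW: "d : elts Z" if "Z : TT" for Z using TT_om1[OF that] d(1) by blast
 have dV: "d : Vth" by (rule thVth[OF th_trans[OF d(1) om1th]])
 let ?in = "%q N. N : nd q & N : SS & N0 : elts N & N : elts W"
 let ?Q = "%r. (EX N:nd r \<inter> SS. N0 : elts N & N : elts W & dl N = d) |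
  (EX e:elts d. ALL s. PLe s r --> (ALL N:nd s \<inter> SS. N0 : elts N & N : elts W --> ~ (e : elts (dl N) & dl N : elts d)))"
 have "EX r:G. PLe r p & ?Q r"
 proof (rule G_below[OF _ p(1)])
  show "D (%e. ?Q (e 0))" by (intro dfn_intros UNIV_I)
  fix q assume qp: "PLe q p"
  have q: "q : PP" by (rule PLe_PP(1)[OF qp])
  have N0q: "N0 : nd q" and Wq: "W : nd q" using nd_mono[OF qp] p by blast+
  show "EX r. PLe r q & ?Q r"
  proof (cases "EX N:nd q \<inter> SS. N0 : elts N & N : elts W & dl N = d")
   case True then show ?thesis using PLe_refl[OF q] by blast
  next
   case none: False
   let ?S = "{N : nd q. N = N0 | ?in q N & dl N : elts d}"
   have "finite ?S" "?S ~= {}" using PPD(3)[OF q] N0q by auto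
   then obtain Y where Y: "Y : ?S" "!!N. N : ?S ==> ~ lt Y N" by (rule finite_lt_max) (rule that)
   have Yq: "Y : nd q" "Y = N0 | N0 : elts Y" "Y : SS" "Y : elts W" using Y(1) W by blast+
   have dN: "d : elts N" if isu: "isucc (nd q) Y N" for N
   proof -
    have N: "N : nd q" "lt Y N" "~ lt W N" using isu Wq mem_lt[OF Yq(4)] unfolding isucc_def by blast+
    have "N = W | N : elts W" using chain_lin[OF PPD(4)[OF q] N(1) Wq] N(3) lt_TT[OF W(1)] by blast
    moreover have ?thesis if NW: "N : elts W"
    proof -
     note b = between_in[OF c q Yq(1) N(1) Yq(2,3) NW N(2)]
     have "N ~: ?S" using Y(2) N(2) by blast
     then have "dl N ~: elts d" using N(1) b(2,3) NW by blast
     moreover have "dl N ~= d" using none N(1) b(2,3) NW by blast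
     ultimately have "d : elts (dl N)" using Ord_linear[OF dl_Or[OF b(2)] Od] by blast
     then show ?thesis unfolding elts_dl by blast
    qed
    ultimately show ?thesis using dW[OF W(1)] by blast
   qed
   let ?dd = "(dc q)(Y := mk (insert d (elts (dc q Y))))"
   have cl: "cle (nd q) ?dd (nd q) (dc q)" by (rule cond_decorate[OF PPD(1)[OF q] Yq(1) dV dN])
   let ?r = "cd (nd q) ?dd"
   have "PLe ?r (cd (nd q) (dc q))" by (rule PLe_cd[OF cl])
   then have rq: "PLe ?r q" using PPD(2)[OF q] by simp
   have ndr: "nd ?r = nd q" by (rule nd_cd[OF PPD(3)[OF q]])
   have "dc ?r Y = mk (insert d (elts (dc q Y)))" using dc_cd[OF PPD(3)[OF q] Yq(1), of ?dd] by simp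
   then have dr: "d : elts (dc ?r Y)" by (simp add: small_insert)
   \<comment> \<open>If \<open>Y\<close> is \<open>N0\<close>, its trace is not known to be below
     \<open>d\<close>; every node above \<open>N0\<close> has \<open>zero\<close> in its trace, so
     \<open>zero\<close> then serves as the lower bound.\<close>
   define e where "e = (if Y = N0 then zero else dl Y)"
   have ed: "e : elts d" unfolding e_def using Y(1) d(2) by auto
   have False if s: "PLe s ?r" and N: "N : nd s" "N : SS" "N0 : elts N" "N : elts W" and eN: "e : elts (dl N)" "dl N : elts d" for s N
   proof -
    have sP: "s : PP" by (rule PLe_PP(1)[OF s])
    have Ys: "Y : nd s" using nd_mono[OF s] ndr Yq(1) by blast
    have YN: "Y : elts N"
    proof (cases "Y = N0")
     case True then show ?thesis using N(3) by simp
    next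
     case False
     then have Y0: "N0 : elts Y" and e': "e = dl Y" using Yq(2) unfolding e_def by auto
     have "Y ~= N" using eN(1) e' mem_irrefl by metis
     moreover have "N ~: elts Y"
     proof
      assume "N : elts Y"
      then have "dl N : elts (dl Y)" using dl_less[OF N(2) Yq(3)] above_base(2)[OF c Y0 Yq(3)] by blast
      then show False using eN(1) e' lt_asym mem_lt by metis
     qed
     ultimately show ?thesis using between_lin[OF c sP Ys N(1) Y0 Yq(3,4) N(3,2,4)] by blast
    qed
    have "N : {M:nd s. lt Y M}" using N(1) mem_lt[OF YN] by blast
    with wfRp obtain N' where "N' : {M:nd s. lt Y M}" "!!y. lt y N' ==> y ~: {M:nd s. lt Y M}" by (rule wfE_min) (rule that)
    then have isu: "isucc (nd s) Y N'" and N': "N' : nd s" "lt Y N'" "~ lt N N'" unfolding isucc_def using N(1) mem_lt[OF YN] by blast+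
    have dcN: "dc s Y : elts N'" and fin: "finite (elts (dc s Y))" using condD(4)[OF PPD(1)[OF sP]] Ys isu unfolding deco_def by blast+
    have "elts (dc ?r Y) \<subseteq> elts (dc s Y)" using s Yq(1) ndr unfolding PLe_def by blast
    then have ds: "d : elts (dc s Y)" using dr by blast
    have le: "N' = N | lt N' N" using chain_lin[OF PPD(4)[OF sP] N'(1) N(1)] N'(3) by blast
    then have N'W: "N' : elts W" using N(4) lt_trans[OF _ mem_lt[OF N(4)]] lt_TT[OF W(1)] by blast
    note b = between_in[OF c sP Ys N'(1) Yq(2,3) N'W N'(2)]
    have dN': "d : elts N'" using el_finite_sub[OF SS_el[OF b(2)] dcN fin] ds by blast
    have "elts N' \<subseteq> elts N"
    proof (cases "N' = N")
     case False
     then have "N' : elts N" using between_in(1)[OF c sP N'(1) N(1) _ b(2) N(4)] le b(3) by blast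
     then show ?thesis using SS_sub[of N N'] N(2) b(2) by blast
    qed simp
    then have "d : elts (dl N)" using dN' d(1) unfolding elts_dl by blast
    then show False using eN(2) lt_asym mem_lt by metis
   qed
   then have "?Q ?r" using ed by blast
   then show ?thesis using rq by blast
  qed
 qed
 then obtain r where r: "r : G" "?Q r" by blast
 from r(2) show ?thesis
 proof
  assume "EX N:nd r \<inter> SS. N0 : elts N & N : elts W & dl N = d"
  then show ?thesis using r(1) unfolding H_def by blast
 next
  assume "EX e:elts d. ALL s. PLe s r --> (ALL N:nd s \<inter> SS. N0 : elts N & N : elts W --> ~ (e : elts (dl N) & dl N : elts d))"
  then obtain e where e: "e : elts d" "!!s N. PLe s r ==> N : nd s ==> N : SS ==> N0 : elts N ==> N : elts W ==> e : elts (dl N) ==> dl N ~: elts d" by blast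
  obtain N where N: "N : H N0 W" "e : elts (dl N)" "dl N : elts d" using lim[OF e(1)] by blast
  obtain q where q: "q : G" "N : nd q" using N(1) unfolding H_def by blast
  obtain s where "PLe s r" "PLe s q" using G_dir[OF r(1) q(1)] by blast
  then have False using e(2)[of s N] nd_mono[of s q] q(2) N unfolding H_def by blast
  then show ?thesis ..
 qed
qed

text \<open>The set is unbounded by \<open>H_cover\<close> and closed by
  \<open>closure_point\<close>.\<close>

lemma node_club: assumes c: "cons0 N0 W" and p: "p : G" "N0 : nd p" "W : nd p"
 obtains C where "eltsW C = vc ` dl ` H N0 W" "club eltsW C"
proof -
 have W: "W : TT" using c unfolding cons0_def by blast
 have "D (%e. EX N:SS. N0 : elts N & N : elts W & N : nd (e 1) & dl N = e 0)" by (intro dfn_intros UNIV_I)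
 from name_check[OF this, of om1] obtain C where "eltsW C = vc ` {x : elts om1. EX p:G. EX N:SS. N0 : elts N & N : elts W & N : nd p & dl N = x}" by blast
 moreover have "{x : elts om1. EX p:G. EX N:SS. N0 : elts N & N : elts W & N : nd p & dl N = x} = dl ` H N0 W"
  unfolding H_def using dl_om1 by blast
 ultimately have C: "eltsW C = vc ` dl ` H N0 W" by simp
 have HS: "N : SS" if "N : H N0 W" for N using that unfolding H_def by blast
 have "club eltsW C" unfolding club_def W_om1
 proof (intro conjI ballI impI)
  show "eltsW C \<subseteq> eltsW (vc om1)" unfolding C eltsW_vc using dl_om1 HS by blast
  fix al assume "al : eltsW (vc om1)"
  then obtain a where a: "al = vc a" "a : elts om1" unfolding eltsW_vc by blast
  have "a : elts W" using TT_om1[OF W] a(2) by blast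
  then obtain N where N: "N : H N0 W" "a : elts N" using H_cover[OF c p(1,3)] by blast
  then have "a : elts (dl N)" unfolding elts_dl using a(2) by blast
  then show "EX be:eltsW C. al : eltsW be" unfolding C a(1) using N(1) vc_mem by blast
 next
  fix al assume "al : eltsW (vc om1)" and L: "Limit eltsW al & (ALL be:eltsW al. EX ga:eltsW C \<inter> eltsW al. be : eltsW ga)"
  then obtain d where d: "al = vc d" "d : elts om1" unfolding eltsW_vc by blast
  have lim: "EX N:H N0 W. e : elts (dl N) & dl N : elts d" if e: "e : elts d" for e
  proof -
   have "vc e : eltsW al" unfolding d(1) vc_mem by (rule e)
   then obtain ga where g: "ga : eltsW C" "ga : eltsW al" "vc e : eltsW ga" using L by blast
   obtain N where N: "N : H N0 W" "ga = vc (dl N)" using g(1) unfolding C by blast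
   show ?thesis using g(2,3) N(1) unfolding N(2) d(1) vc_mem by blast
  qed
  have "Limit elts d" using omega_limit_V[OF d(2)] L unfolding d(1) by blast
  then have "elts d ~= {}" unfolding Limit_def by blast
  then obtain e where "e : elts d" by blast
  then have "EX N:H N0 W. dl N : elts d" using lim by blast
  then obtain N where N: "N : SS" "dl N : elts d" using HS by blast
  have Od: "Or d" using d(2) om1_iff by blast
  have "zero : elts d" by (rule Ord_trans[OF Od el_nonsucc(4)[OF N(1)] N(2)])
  from closure_point[OF c p d(2) this lim] obtain N where "N : H N0 W" "dl N = d" by blast
  then show "al : eltsW C" unfolding C d(1) by blast
 qed
 then show thesis using that C by blast
qed

definition "ht p al xi et \<longleftrightarrow> (EX N:nd p \<inter> SS. al : elts N & dl N = xi & ot N = et) & (ALL N:nd p \<inter> SS. al : elts N & dl N = xi --> elts (ot N) \<subseteq> elts et)"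

lemma D_ht: "F s ==> F t ==> F u ==> F v ==> D (%e. ht (s e) (t e) (u e) (v e))"
proof (rule dfn_rel4[where R=ht])
 show "D (%e. ht (e 0) (e 1) (e 2) (e 3))" unfolding ht_def by (intro dfn_intros UNIV_I)
qed

lemma ht_unique: assumes "p : PP" "ht p al xi et" "ht p al xi et'" shows "et = et'"
proof -
 obtain N where N: "N : nd p \<inter> SS" "al : elts N" "dl N = xi" "ot N = et" using assms(2) unfolding ht_def by blast
 obtain M where M: "M : nd p \<inter> SS" "al : elts M" "dl M = xi" "ot M = et'" using assms(3) unfolding ht_def by blast
 have 1: "!!N. N : nd p \<inter> SS ==> al : elts N & dl N = xi ==> elts (ot N) \<subseteq> elts et"
  and 2: "!!N. N : nd p \<inter> SS ==> al : elts N & dl N = xi ==> elts (ot N) \<subseteq> elts et'" using assms(2,3) unfolding ht_def by simp_all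
 have "elts et = elts et'" using 1[OF M(1)] 2[OF N(1)] M N by (intro subset_antisym) simp_all
 then show ?thesis by simp
qed

text \<open>The requirement that stronger conditions extend the height function freezes a height
  once it is defined.\<close>

lemma ht_mono: assumes le: "PLe q p" and h: "ht p al xi et" and a: "al : elts th" shows "ht q al xi et"
proof -
 obtain N where N: "N : nd p \<inter> SS" "al : elts N" "dl N = xi" "ot N = et" and mx: "!!N. N : nd p \<inter> SS ==> al : elts N ==> dl N = xi ==> elts (ot N) \<subseteq> elts et"
  using h unfolding ht_def by blast
 have hl: "hle (nd p) (nd q)" using le unfolding PLe_def by blast
 have "elts (ot M) \<subseteq> elts et" if M: "M : nd q \<inter> SS" "al : elts M" "dl M = xi" for M
 proof -
  have ex: "EX K:nd p \<inter> SS. al : elts K & dl K = dl M" by (rule bexI[OF _ N(1)]) (simp add: N M)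
  have "al : elts M \<inter> elts th" using M(2) a by simp
  from mp[OF bspec[OF bspec[OF hl[unfolded hle_def] M(1)] this] ex]
  obtain K where K: "K : nd p \<inter> SS" "al : elts K" "dl K = dl M" "elts (ot M) \<subseteq> elts (ot K)" by blast
  have "elts (ot K) \<subseteq> elts et" by (rule mx[OF K(1,2)]) (simp add: K(3) M(3))
  then show ?thesis using K(4) by (rule subset_trans[rotated])
 qed
 note mq = this
 have "N : nd q \<inter> SS" using N(1) nd_mono[OF le] by blast
 then show ?thesis unfolding ht_def using N(2-4) mq by (intro conjI ballI impI) (rule bexI[of _ N], simp_all)
qed

lemma ht_exists: assumes p: "p : PP" and N: "N : nd p \<inter> SS" "al : elts N" obtains ze where "ht p al (dl N) ze" "elts (ot N) \<subseteq> elts ze"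
proof -
 let ?X = "ot ` {M : nd p \<inter> SS. al : elts M & dl M = dl N}"
 have "EX m:?X. ALL x:?X. elts x \<subseteq> elts m" by (rule fin_max) (use PPD(3)[OF p] N ot_Or in auto)
 then obtain M where M: "M : nd p \<inter> SS" "al : elts M" "dl M = dl N" and z: "ALL x:?X. elts x \<subseteq> elts (ot M)" by blast
 have mx: "elts (ot L) \<subseteq> elts (ot M)" if "L : nd p \<inter> SS" "al : elts L" "dl L = dl N" for L
  by (rule bspec[OF z], rule imageI) (use that in simp)
 have "ht p al (dl N) (ot M)" unfolding ht_def using M mx by (intro conjI ballI impI) (rule bexI[of _ M], simp_all)
 moreover have "elts (ot N) \<subseteq> elts (ot M)" by (rule mx[OF N refl])
 ultimately show thesis by (rule that)
qed

text \<open>The union of the height functions of the conditions in \<open>G\<close>, as a set of the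
  extension; a point and its height are coded by nested pairs.\<close>

definition "HH = (SOME c. eltsW c = vc ` {x : Vth. EX p:G. ht p (pfst (pfst x)) (psnd (pfst x)) (psnd x) & ispr x & ispr (pfst x)})"

lemma HH: "eltsW HH = vc ` {x : Vth. EX p:G. ht p (pfst (pfst x)) (psnd (pfst x)) (psnd x) & ispr x & ispr (pfst x)}"
proof -
 have "D (%e. ht (e 1) (pfst (pfst (e 0))) (psnd (pfst (e 0))) (psnd (e 0)) & ispr (e 0) & ispr (pfst (e 0)))" by (intro dfn_intros D_ht UNIV_I)
 from someI_ex[OF name_check[OF this, of "Vs th"]] show ?thesis unfolding HH_def .
qed

definition "hf a x = W.ap HH (W.pr a x)"
lemma dt_hf: "W.F s ==> W.F t ==> W.F (%e. hf (s e) (t e))" unfolding hf_def by (intro W.dt_ap W.dt_pr W.dt_const UNIV_I)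

lemma hf_value: assumes p: "p : G" "ht p al xi et" and a: "al : elts th" shows "hf (vc al) (vc xi) = vc et"
proof -
 have m: "W.pr (W.pr (vc al) (vc xi)) y : eltsW HH \<longleftrightarrow> y = vc et" for y
 proof
  assume "W.pr (W.pr (vc al) (vc xi)) y : eltsW HH"
  then obtain x q where x: "q : G" "ht q (pfst (pfst x)) (psnd (pfst x)) (psnd x)" "ispr x" "ispr (pfst x)" "W.pr (W.pr (vc al) (vc xi)) y = vc x"
   unfolding HH by blast
  have "vc x = vc (pr (pr (pfst (pfst x)) (psnd (pfst x))) (psnd x))" using isprD[OF x(3)] isprD[OF x(4)] by simp
  then have "W.pr (W.pr (vc al) (vc xi)) y = W.pr (W.pr (vc (pfst (pfst x))) (vc (psnd (pfst x)))) (vc (psnd x))" using x(5) unfolding vc_pr by simp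
  then have y: "pfst (pfst x) = al" "psnd (pfst x) = xi" "y = vc (psnd x)" unfolding W.pr_eq vc_inj by blast+
  obtain r where r: "r : G" "PLe r p" "PLe r q" using G_dir[OF p(1) x(1)] by blast
  have "ht r al xi (psnd x)" using ht_mono[OF r(3) _ a] x(2) unfolding y by blast
  then have "psnd x = et" using ht_unique[OF G_PP[OF r(1)]] ht_mono[OF r(2) p(2) a] by blast
  then show "y = vc et" using y(3) by simp
 next
  assume y: "y = vc et"
  obtain N where N: "N : nd p \<inter> SS" "dl N = xi" "ot N = et" using p(2) unfolding ht_def by blast
  have "pr (pr al xi) et : Vth" using dl_om1[of N] ot_om1[of N] N thVth th_trans[OF _ om1th] a by (auto simp: Vth_pr)
  then have "vc (pr (pr al xi) et) : eltsW HH" unfolding HH using p by (intro imageI) auto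
  then show "W.pr (W.pr (vc al) (vc xi)) y : eltsW HH" unfolding y vc_pr .
 qed
 have "hf (vc al) (vc xi) = W.mk (eltsW (vc et))" unfolding hf_def W.ap_def m by simp
 then show ?thesis by simp
qed

abbreviation "PO \<equiv> positive eltsW (NS_omega1 eltsW)"

lemma PO_iff: "E : PO \<longleftrightarrow> eltsW E \<subseteq> eltsW (vc om1) & (ALL c. club eltsW c --> eltsW c \<inter> eltsW E ~= {})"
 unfolding positive_def NS_omega1_def W_om1 by blast

text \<open>Otherwise there are clubs \<open>C\<^sub>\<beta>\<close>, the sets
  \<open>f (vc be)\<close>, on which \<open>h\<^sub>\<beta> < h\<^sub>\<alpha>\<close> fails
  throughout \<open>E\<close>. The contradiction is a condition that puts some \<open>d\<close> into
  both \<open>E\<close> and \<open>C\<^sub>\<beta>\<close> and fixes the height at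
  \<open>\<beta>\<close> below that at \<open>\<alpha>\<close>. A node with trace \<open>d\<close>
  and \<open>\<alpha>\<close> in it takes care of \<open>E\<close> and \<open>\<alpha>\<close>; a
  cut-down node with the same trace but smaller order type takes care of
  \<open>C\<^sub>\<beta>\<close> and \<open>\<beta>\<close>.\<close>

theorem descend: assumes E: "E : PO" and al: "al : elts th"
 shows "EX be:elts th. W.mk {xi:eltsW E. hf (vc be) xi : eltsW (hf (vc al) xi)} : PO"
proof (rule ccontr)
 assume no: "~ ?thesis"
 let ?Y = "%x y. club eltsW y & eltsW y \<inter> {xi:eltsW E. hf x xi : eltsW (hf (vc al) xi)} = {}"
 have DY: "dfn eltsW UNIV UNIV (%e. ?Y (e 0) (e 1))"
  by (intro dfn_conj W.D_club W.dfn_seteq W.ds_Int W.ds_elts W.ds_sep W.dfn_mem dt_hf W.ds_empty W.dt_var W.dt_const UNIV_I)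
 have exY: "EX y. ?Y (vc be) y" if b: "be : elts th" for be
 proof -
  let ?E = "{xi:eltsW E. hf (vc be) xi : eltsW (hf (vc al) xi)}"
  have "W.small ?E" by (rule W.small_sep[OF W.small_elts]) (intro W.dfn_mem W.ds_elts dt_hf W.dt_var W.dt_const UNIV_I)
  then have e: "eltsW (W.mk ?E) = ?E" by (rule W.elts_mk)
  have "W.mk ?E ~: PO" using no b by blast
  moreover have "eltsW (W.mk ?E) \<subseteq> eltsW (vc om1)" unfolding e using E PO_iff by blast
  ultimately obtain c where "club eltsW c" "eltsW c \<inter> eltsW (W.mk ?E) = {}" unfolding PO_iff by blast
  then show ?thesis unfolding e by blast
 qed
 obtain f where f: "W.F (%e. f (e 0))" "!!x y. x : eltsW (vc th) ==> ?Y x y ==> ?Y x (f x)"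
  by (rule W.choice[OF W.small_elts DY]) (rule that)
 have C: "club eltsW (f (vc be))" "!!xi. xi : eltsW (f (vc be)) ==> xi : eltsW E ==> hf (vc be) xi ~: eltsW (hf (vc al) xi)" if b: "be : elts th" for be
 proof -
  have "vc be : eltsW (vc th)" using b vc_mem by blast
  then have "?Y (vc be) (f (vc be))" using exY[OF b] f(2) by blast
  then show "club eltsW (f (vc be))" "!!xi. xi : eltsW (f (vc be)) ==> xi : eltsW E ==> hf (vc be) xi ~: eltsW (hf (vc al) xi)" by blast+
 qed
 have Dc: "dfn eltsW UNIV UNIV (%e. e 1 : eltsW (f (e 0)))" by (intro W.dfn_mem W.ds_elts W.dt_1[OF f(1)] W.dt_var)
 obtain c where DC: "!!s t u. F s ==> F t ==> F u ==> D (%e. c (s e) (t e) (u e))" and c: "!!x y. sem (c x y) (vc y : eltsW (f (vc x)))"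
  by (rule forcing_rel[OF Dc]) (rule that)
 have De: "dfn eltsW UNIV UNIV (%e. e 1 : eltsW E)" by (intro W.dfn_mem W.ds_elts W.dt_const W.dt_var UNIV_I)
 obtain g where DG: "!!s t u. F s ==> F t ==> F u ==> D (%e. g (s e) (t e) (u e))" and g: "!!x y. sem (g x y) (vc y : eltsW E)"
  by (rule forcing_rel[OF De]) (rule that)
 \<comment> \<open>\<open>?Q1\<close> is the wanted configuration. The others are failures excluded
   in the extension: \<open>C\<^sub>\<beta>\<close> is bounded (\<open>?Q2\<close>),
   \<open>C\<^sub>\<beta>\<close> accumulates at a trace but omits it (\<open>?Q3\<close>), or
   \<open>E\<close> misses the club of traces of an interval (\<open>?Q4\<close>). It is shown that
   the four together are dense.\<close>
 let ?Q1 = "%r. EX be:elts th. EX d. EX et. EX ze. ht r be d et & ht r al d ze & et : elts ze & c be d r & g zero d r"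
 let ?Q2 = "%r. EX be:elts th. EX ep:elts om1. ALL xi:elts om1. ep : elts xi --> (ALL s. PLe s r --> ~ c be xi s)"
 let ?Q3 = "%r. EX be:elts th. EX N:SS. (ALL ep:elts (dl N). ALL s. PLe s r --> (EX s'. PLe s' s & (EX xi:elts (dl N). ep : elts xi & c be xi s'))) & (ALL s. PLe s r --> ~ c be (dl N) s)"
 let ?Q4 = "%r. EX N0:nd r. EX W:nd r. cons0 N0 W & (ALL s. PLe s r --> (ALL N:nd s \<inter> SS. N0 : elts N & N : elts W --> ~ g zero (dl N) s))"
 have "EX r:G. ?Q1 r | ?Q2 r | ?Q3 r | ?Q4 r"
 proof (rule G_dense)
  have 1: "D (%e. ?Q1 (e 0))" by (intro dfn_intros D_ht DC DG UNIV_I)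
  have 2: "D (%e. ?Q2 (e 0))" by (intro dfn_intros DC UNIV_I)
  have 3: "D (%e. ?Q3 (e 0))" by (intro dfn_intros DC UNIV_I)
  have 4: "D (%e. ?Q4 (e 0))" unfolding cons0_def by (intro dfn_intros DG UNIV_I)
  show "D (%e. ?Q1 (e 0) | ?Q2 (e 0) | ?Q3 (e 0) | ?Q4 (e 0))" by (rule dfn_disj[OF 1 dfn_disj[OF 2 dfn_disj[OF 3 4]]])
  fix p assume p: "p : PP"
  show "EX q. PLe q p & (?Q1 q | ?Q2 q | ?Q3 q | ?Q4 q)"
  proof (rule ccontr)
   assume "~ ?thesis"
   then have n1: "!!r. PLe r p ==> ~ ?Q1 r" and n2: "!!r. PLe r p ==> ~ ?Q2 r" and n3: "!!r. PLe r p ==> ~ ?Q3 r" and n4: "!!r. PLe r p ==> ~ ?Q4 r" by blast+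
   \<comment> \<open>\<open>x\<close> carries a trace and an ordinal, \<open>y\<close> a matching
     condition that puts a larger ordinal into the club with index \<open>b\<close>. A node closed
     under such witnesses has its own trace as a limit of that club.\<close>
   let ?B = "%b x y. mt (pfst x) (pfst y) & psnd y : elts om1 & psnd x : elts (psnd y) & c b (psnd y) (pfst y) & ispr y"
   let ?ok = "%b K. closed2 K & (ALL x:elts K. ALL y:Vth. ?B b x y --> (EX y:elts K. ?B b x y))"
   \<comment> \<open>The choice made for a transitive \<open>B\<close>: a condition with node
     \<open>B\<close> and a countable node \<open>M\<close> whose trace it forces into
     \<open>E\<close>, and a transitive element of \<open>M\<close> such that the cut of
     \<open>M\<close> by it contains \<open>B\<close>, \<open>rk B\<close> and \<open>al\<close> and
     is closed under witnesses for the club with index \<open>rk B\<close>.\<close>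
   let ?R = "%U y. PLe (pfst y) p & U : nd (pfst y) & pfst (psnd y) : nd (pfst y) & pfst (psnd y) : SS & psnd (psnd y) : TT
     & psnd (psnd y) : elts (pfst (psnd y)) & rk (psnd (psnd y)) : elts (pfst (psnd y)) & pr U (pr (rk U) al) : elts (pfst (psnd y) \<sqinter> psnd (psnd y))
     & g zero (dl (pfst (psnd y))) (pfst y) & ?ok (rk U) (pfst (psnd y) \<sqinter> psnd (psnd y))"
   have DR: "D (%e. ?R (e 0) (e 1))" unfolding closed2_def by (intro dfn_intros DC DG UNIV_I)
   obtain k where k: "F (%e. k (e 0))" "!!x y. x : TT ==> ?R x y ==> ?R x (k x)" by (rule choice[OF small_TT DR]) (rule that)
   have R: "?R B (k B)" if B: "B : TT" "p : elts B" for B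
   proof -
    obtain q0 where q0: "PLe q0 p" "{B} \<subseteq> nd q0" by (rule add_TTs[of "{B}" B p]) (use B p mem_irrefl in auto)
    have q0P: "q0 : PP" by (rule PLe_PP(1)[OF q0(1)])
    have DB: "D (%e. ?B (rk B) (e 0) (e 1))" by (intro dfn_intros DC UNIV_I)
    obtain ph where ph: "F (%e. ph (e 0))" "!!x. x : Vth ==> ph x : Vth" "!!K. el K ==> ALL x:elts K. ph x : elts K ==> ?ok (rk B) K"
     by (rule good_fun[OF DB]) (rule that)
    have aV: "pr B (pr (rk B) al) : Vth" using TT_Vth[OF B(1)] thVth[OF rk_TT(1)[OF B(1)]] thVth[OF al] by (simp add: Vth_pr)
    obtain U where U: "U : TT" "pr B (pr (rk B) al) : elts U" "!!x. x : elts U ==> ph x : elts U" by (rule TT_reflect[OF ph(1,2) aV]) (assumption, rule that)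
    have UV: "U : Vth" by (rule TT_Vth[OF U(1)])
    \<comment> \<open>The graph of \<open>ph\<close> on \<open>U\<close> will be an element of
      \<open>M\<close>; as \<open>U\<close> is closed under \<open>ph\<close>, so is
      \<open>M \<inter> U\<close>.\<close>
    let ?g = "mk (graph ph (elts U))"
    have sg: "small (graph ph (elts U))" by (rule small_graph[OF small_elts ph(1)])
    have gV: "?g : Vth"
    proof (rule Vth_mk[OF sg])
     have "F (%e. pr (e 0) (ph (e 0)))" by (intro dfn_intros ph(1))
     from lep_image[OF small_elts this] have "lep (graph ph (elts U)) (elts U)" unfolding graph_def .
     then show "tiny (graph ph (elts U))" by (rule tiny_lep[OF _ tiny_Vth[OF UV]])
     show "graph ph (elts U) \<subseteq> Vth" unfolding graph_def using Vth_trans[OF UV] ph(2) by (auto simp: Vth_pr)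
    qed
    have xV: "pr ?g (pr (pr U (rk U)) (pr B (pr (rk B) al))) : Vth" using gV UV aV thVth[OF rk_TT(1)[OF U(1)]] by (simp only: Vth_pr)
    obtain s N0 W where s: "PLe s q0" "N0 : nd s" "W : nd s" "cons0 N0 W" "pr ?g (pr (pr U (rk U)) (pr B (pr (rk B) al))) : elts N0" by (rule base[OF q0P xV]) (rule that)
    have sp: "PLe s p" by (rule PLe_trans[OF s(1) q0(1)])
    \<comment> \<open>Since \<open>?Q4\<close> fails, some node of the interval above
      \<open>N0\<close> can be given a trace in \<open>E\<close>; containing \<open>N0\<close>, it
      inherits all the chosen parameters.\<close>
    obtain s' M where M: "PLe s' s" "M : nd s'" "M : SS" "N0 : elts M" "M : elts W" "g zero (dl M) s'" using n4[OF sp] s(2,3,4) by blast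
    note elM = SS_el[OF M(3)]
    have xM: "pr ?g (pr (pr U (rk U)) (pr B (pr (rk B) al))) : elts M" using above_base(1)[OF s(4) M(4,3)] s(5) by blast
    have i: "?g : elts M" "U : elts M" "rk U : elts M" "pr B (pr (rk B) al) : elts M"
     using el_prD[OF elM xM] el_prD[OF elM] by blast+
    have elK: "el (M \<sqinter> U)" by (rule SS_el[OF SS_inter[OF M(3) U(1) i(2)]])
    have "ALL x:elts (M \<sqinter> U). ph x : elts (M \<sqinter> U)"
    proof
     fix x assume "x : elts (M \<sqinter> U)"
     then have x: "x : elts M" "x : elts U" by simp_all
     have "ph x : elts M" by (rule el_ap[OF elM i(1) elts_mk[OF sg] x])
     then show "ph x : elts (M \<sqinter> U)" using U(3)[OF x(2)] by simp
    qed
    from ph(3)[OF elK this] have ok: "?ok (rk B) (M \<sqinter> U)" .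
    have Bs: "B : nd s'" using nd_mono[OF M(1)] nd_mono[OF s(1)] q0(2) by blast
    have aK: "pr B (pr (rk B) al) : elts (M \<sqinter> U)" using i(4) U(2) by simp
    have "?R B (pr s' (pr M U))" unfolding pfst psnd by (intro conjI PLe_trans[OF M(1) sp] Bs M(2,3,6) U(1) i(2,3) aK conjunct1[OF ok] conjunct2[OF ok])
    then show ?thesis by (rule k(2)[OF B(1)])
   qed
   let ?q = "%B. pfst (k B)" and ?M = "%B. pfst (psnd (k B))"
   have Fd: "F (%e. pr (?M (e 0) \<sqinter> e 0) (pr (dl (?M (e 0))) (ot (?M (e 0)))))" by (intro dfn_intros k(1))
   have Fq: "F (%e. ?q (e 0))" by (intro dfn_intros k(1))
   \<comment> \<open>The condition chosen for \<open>B\<close> cannot be used for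
     \<open>\<beta> = rk B\<close>, because its node \<open>M2\<close> contains \<open>rk B\<close>
     and would make the height there too large. The condition for \<open>A\<close> is an element of
     \<open>B\<close>, so no node of it contains \<open>rk B\<close>, yet its node \<open>M1\<close>
     has the trace and the order type of \<open>M2\<close>.\<close>
   obtain B A where BA: "B : TT" "A : TT" "p : elts B" "p : elts A" "A : elts B" "?q A : elts B"
     "pr (?M A \<sqinter> A) (pr (dl (?M A)) (ot (?M A))) = pr (?M B \<sqinter> B) (pr (dl (?M B)) (ot (?M B)))"
   proof (rule pigeonhole[OF Fd Fq PP_Vth[OF p]])
    fix E assume E: "E : TT" "p : elts E"
    note RE = R[OF E]
    have S: "?M E : SS" using RE by blast
    have "?M E \<sqinter> E : elts E" by (rule cap_lt(1)[OF S E(1)])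
    moreover have "dl (?M E) : elts E" "ot (?M E) : elts E" using dl_om1[OF S] ot_om1[OF S] TT_om1[OF E(1)] by blast+
    ultimately show "pr (?M E \<sqinter> E) (pr (dl (?M E)) (ot (?M E))) : elts E" by (intro el_pr[OF TT_el[OF E(1)]])
    show "?q E : Vth" using RE PLe_PP(1) PP_Vth by blast
   qed
   define M1 M2 U q1 d where "M1 = ?M A" and "M2 = ?M B" and "U = psnd (psnd (k B))" and "q1 = ?q A" and "d = dl M1"
   have e: "M1 \<sqinter> A = M2 \<sqinter> B" "dl M2 = d" "ot M2 = ot M1" using BA(7) unfolding M1_def M2_def d_def pr_eq by simp_all
   define K where "K = M2 \<sqinter> U"
   have RB: "M2 : SS" "U : TT" "U : elts M2" "rk U : elts M2" "pr B (pr (rk B) al) : elts K" "?ok (rk B) K"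
    using R[OF BA(1,3)] unfolding M2_def U_def K_def by blast+
   have RA: "PLe q1 p" "A : nd q1" "M1 : nd q1" "M1 : SS" "g zero d q1" "pr A (pr (rk A) al) : elts M1"
    using R[OF BA(2,4)] unfolding M1_def q1_def d_def elts_cap by blast+
   have q1P: "q1 : PP" by (rule PLe_PP(1)[OF RA(1)])
   have q1B: "q1 : elts B" using BA(6) unfolding q1_def .
   have aM1: "al : elts M1" using el_prD[OF SS_el[OF RA(4)] RA(6)] el_prD[OF SS_el[OF RA(4)]] by blast
   have KS: "K : SS" unfolding K_def by (rule SS_inter[OF RB(1,2,3)])
   note elK = SS_el[OF KS]
   have KB: "B : elts K" "rk B : elts K" using el_prD[OF elK RB(5)] el_prD[OF elK] by blast+
   have BU: "elts B \<subseteq> elts U" by (rule TT_trans[OF RB(2)]) (use KB(1) in \<open>simp add: K_def\<close>)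
   have dlK: "dl K = d" unfolding K_def using dl_cap[OF RB(2)] e(2) by simp
   have "elts (K \<sqinter> B) = elts (M1 \<sqinter> A)" unfolding e(1) using BU unfolding K_def by (auto simp: small_Int)
   then have KBM: "K \<sqinter> B = M1 \<sqinter> A" by (simp only: elts_inject)
   \<comment> \<open>\<open>rk U\<close> is an ordinal of \<open>M2\<close> that lies above all
     ordinals of \<open>K\<close>, so cutting by \<open>U\<close> lowers the order type
     strictly.\<close>
   have otK: "ot K : elts (ot M1)"
   proof -
    have "ot K : elts (ot M2)"
    proof (rule ot_less[OF _ RB(4) rk_TT(1)[OF RB(2)]])
     show "elts K \<subseteq> elts M2" unfolding K_def by simp
     show "elts K \<inter> elts th \<subseteq> elts (rk U)"
     proof
      fix z assume z: "z : elts K \<inter> elts th"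
      then have "z : elts U" unfolding K_def by simp
      then have "rk z : elts (rk U)" by (rule rk_mem)
      then show "z : elts (rk U)" using rk_Ord th_Or z by auto
     qed
    qed
    then show ?thesis using e(3) by simp
   qed
   have otK': "elts (ot K) \<subseteq> elts (ot M1)" using Ord_trans[OF ot_Or _ otK] by blast
   have KBq: "K \<sqinter> B : nd q1" unfolding KBM by (rule niceD(2)[OF PPD(5)[OF q1P] RA(3,2)])
   have nB: "N : elts B" if "N : nd q1" for N by (rule PP_el(1)[OF TT_el[OF BA(1)] q1P q1B that])
   have KnB: "K ~: elts B" using KB(1) mem_lt lt_asym by blast
   have BS: "B ~: SS" using SS_TT_disj BA(1) by blast
   have aK1: "a : elts M1" if "a : elts K" "X : nd q1" "a : elts X" for a X
   proof -
    have "a : elts B" using TT_trans[OF BA(1) nB[OF that(2)]] that(3) by blast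
    then have "a : elts (K \<sqinter> B)" using that(1) by simp
    then show ?thesis unfolding KBM by simp
   qed
   \<comment> \<open>Only \<open>B\<close> and \<open>K\<close> are new, because
     \<open>K \<inter> B\<close> is \<open>M1 \<inter> A\<close>, a node of \<open>q1\<close>. The
     heights of \<open>q1\<close> survive: a point of \<open>K\<close> that lies in a node of
     \<open>q1\<close> belongs to \<open>B\<close>, hence to \<open>M1\<close>, which has the trace
     of \<open>K\<close> and a larger order type.\<close>
   obtain r where r: "PLe r q1" "nd r = {K \<sqinter> B, B, K} \<union> nd q1"
   proof (rule add_transitive[OF cond_triple[OF KS BA(1) KB(1)] _ BA(1) q1P q1B])
    show "B : {K \<sqinter> B, B, K}" by blast
    show "N : nd q1" if "N : {K \<sqinter> B, B, K}" "N : elts B" for N using that KBq KnB mem_irrefl by blast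
    show "star ({K \<sqinter> B, B, K} \<union> nd q1)"
    proof (rule starI)
     fix M N assume M: "M : {K \<sqinter> B, B, K} \<union> nd q1" "M : SS" and N: "N : {K \<sqinter> B, B, K} \<union> nd q1" "N : SS" and l: "dl N : elts (dl M)"
     have rep: "EX X':nd q1 \<inter> SS. dl X' = dl X & elts (ot X) \<subseteq> elts (ot X')" if "X : {K \<sqinter> B, B, K} \<union> nd q1" "X : SS" for X
     proof (cases "X : nd q1")
      case True then show ?thesis using that(2) by blast
     next
      case False
      then have "X = K" using that KBq BS by blast
      then show ?thesis using RA(3,4) dlK otK' unfolding d_def by (intro bexI[of _ M1]) auto
     qed
     obtain M' where M': "M' : nd q1" "M' : SS" "dl M' = dl M" using rep[OF M] by blast
     obtain N' where N': "N' : nd q1" "N' : SS" "dl N' = dl N" "elts (ot N) \<subseteq> elts (ot N')" using rep[OF N] by blast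
     have "ot N' : elts (dl M)" using starD[OF condD(3)[OF PPD(1)[OF q1P]] M'(1,2) N'(1,2)] l M'(3) N'(3) by simp
     then show "ot N : elts (dl M)" by (rule ot_down[OF N(2) M(2) N'(4)])
    qed
    fix N a X assume N: "N : {K \<sqinter> B, B, K}" "N : SS" "a : elts N" "a : elts th" and X: "X : nd q1" "X : SS" "a : elts X" "dl X = dl N"
    show "EX Y:nd q1 \<inter> SS. a : elts Y & dl Y = dl N & elts (ot N) \<subseteq> elts (ot Y)"
    proof (cases "N : nd q1")
     case True then show ?thesis using N by blast
    next
     case False
     then have NK: "N = K" using N(1,2) KBq BS by blast
     then show ?thesis using aK1[of a X] N(3) X RA(3,4) dlK otK' unfolding d_def by (intro bexI[of _ M1]) auto
    qed
   qed (rule that)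
   have rp: "PLe r p" by (rule PLe_trans[OF r(1) RA(1)])
   have Kr: "K : nd r" using r(2) by blast
   have beth: "rk B : elts th" by (rule rk_TT(1)[OF BA(1)])
   \<comment> \<open>Reflecting into \<open>K\<close> an extension that puts a large ordinal into
     the club, and amalgamating back, shows that the club is forced to be unbounded in
     \<open>dl K\<close>. As \<open>?Q3\<close> fails, some extension forces \<open>dl K\<close>
     into it.\<close>
   have forc: "EX s'. PLe s' s & (EX xi:elts (dl K). ep : elts xi & c (rk B) xi s')" if ep: "ep : elts (dl K)" and s: "PLe s r" for ep s
   proof -
    have sP: "s : PP" by (rule PLe_PP(1)[OF s])
    have Ks: "K : nd s" using nd_mono[OF s] Kr by blast
    have ep1: "ep : elts om1" "ep : elts K" using ep unfolding elts_dl by blast+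
    obtain xi s2 where x: "xi : elts om1" "ep : elts xi" "PLe s2 s" "c (rk B) xi s2" using n2[OF PLe_trans[OF s rp]] beth ep1(1) by blast
    have xK: "pr (trc s K) ep : elts K" by (rule el_pr[OF elK trc_in[OF sP Ks KS] ep1(2)])
    have yV: "pr s2 xi : Vth" using PP_Vth[OF PLe_PP(1)[OF x(3)]] thVth[OF th_trans[OF x(1) om1th]] by (simp add: Vth_pr)
    have "?B (rk B) (pr (trc s K) ep) (pr s2 xi)" using mt_le[OF trc_mt[OF sP] x(3)] x(1,2,4) by simp
    then obtain y where y: "y : elts K" "?B (rk B) (pr (trc s K) ep) y" using conjunct2[OF RB(6)] xK yV by blast
    have "pr (pfst y) (psnd y) : elts K" using y isprD by simp
    then have qz: "pfst y : elts K" "psnd y : elts K" using el_prD[OF elK] by blast+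
    have ym: "mt (trc s K) (pfst y)" and yb: "ep : elts (psnd y)" "c (rk B) (psnd y) (pfst y)" "psnd y : elts om1" using y(2) by simp_all
    obtain t where t: "PLe t s" "PLe t (pfst y)" by (rule amalg[OF sP Ks KS conjunct1[OF RB(6)] qz(1) ym])
    have "c (rk B) (psnd y) t" by (rule semD(2)[OF c yb(2) t(2)])
    moreover have "psnd y : elts (dl K)" unfolding elts_dl using qz(2) yb(3) by blast
    ultimately show ?thesis using t(1) yb(1) by blast
   qed
   obtain t where t: "PLe t r" "c (rk B) (dl K) t" using n3[OF rp] beth KS forc by blast
   have tP: "t : PP" by (rule PLe_PP(1)[OF t(1)])
   have gt: "g zero d t" by (rule semD(2)[OF g RA(5) PLe_trans[OF t(1) r(1)]])
   \<comment> \<open>\<open>K\<close> is the only countable node of \<open>r\<close> containing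
     \<open>rk B\<close>: the nodes of \<open>q1\<close> are elements of the transitive
     \<open>B\<close>, and \<open>rk B\<close> is not in \<open>B\<close>.\<close>
   have hbe: "ht r (rk B) d (ot K)" unfolding ht_def
   proof (intro conjI ballI impI)
    show "EX N:nd r \<inter> SS. rk B : elts N & dl N = d & ot N = ot K" using Kr KS KB(2) dlK by blast
    fix N assume N: "N : nd r \<inter> SS" "rk B : elts N & dl N = d"
    have rB: "rk B ~: elts B"
    proof
     assume "rk B : elts B" then have "rk (rk B) : elts (rk B)" by (rule rk_mem)
     then show False using rk_Ord[OF th_Or[OF beth]] mem_irrefl by metis
    qed
    have "N ~: nd q1" using nB TT_trans[OF BA(1)] rB N(2) by blast
    moreover have "N : {K \<sqinter> B, B, K} \<union> nd q1" using N(1) unfolding r(2) by (rule IntD1)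
    then have "N = K \<sqinter> B | N = B | N = K | N : nd q1" by (elim UnE insertE emptyE) simp_all
    ultimately have "N = K" using KBq BS N(1) by (elim disjE) (metis, metis IntD2, assumption, metis)
    then show "elts (ot N) \<subseteq> elts (ot K)" by simp
   qed
   have M1t: "M1 : nd t \<inter> SS" using nd_mono[OF t(1)] nd_mono[OF r(1)] RA(3,4) by blast
   obtain ze where z: "ht t al (dl M1) ze" "elts (ot M1) \<subseteq> elts ze" by (rule ht_exists[OF tP M1t aM1]) (rule that)
   have "ht t (rk B) d (ot K)" by (rule ht_mono[OF t(1) hbe beth])
   moreover have "ot K : elts ze" using z(2) otK by blast
   moreover have "ht t al d ze" using z(1) unfolding d_def .
   moreover have "c (rk B) d t" using t(2) unfolding dlK .
   ultimately have "?Q1 t" using beth gt by blast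
   then show False using n1[OF PLe_trans[OF t(1) rp]] by blast
  qed
 qed
 then obtain r where r: "r : G" "?Q1 r | ?Q2 r | ?Q3 r | ?Q4 r" by blast
 from r(2) show False
 proof (elim disjE)
  assume "?Q1 r"
  then obtain be d et ze where q: "be : elts th" "ht r be d et" "ht r al d ze" "et : elts ze" "c be d r" "g zero d r" by blast
  have "hf (vc be) (vc d) = vc et" "hf (vc al) (vc d) = vc ze" using hf_value[OF r(1) q(2) q(1)] hf_value[OF r(1) q(3) al] by blast+
  moreover have "vc d : eltsW (f (vc be))" using semD(3)[OF c] q(5) r(1) by blast
  moreover have "vc d : eltsW E" using semD(3)[OF g] q(6) r(1) by blast
  ultimately show False using C(2)[OF q(1), of "vc d"] q(4) vc_mem by simp
 next
  assume "?Q2 r"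
  then obtain be ep where q: "be : elts th" "ep : elts om1" "!!xi s. xi : elts om1 ==> ep : elts xi ==> PLe s r ==> ~ c be xi s" by blast
  have "vc ep : eltsW (vc om1)" using q(2) vc_mem by blast
  then obtain y where y: "y : eltsW (f (vc be))" "vc ep : eltsW y" "y : eltsW (vc om1)" using C(1)[OF q(1)] unfolding club_def W_om1 by blast
  obtain xi where x: "y = vc xi" "xi : elts om1" using y(3) unfolding eltsW_vc by blast
  have "ep : elts xi" using y(2) unfolding x(1) vc_mem .
  obtain q' where q': "q' : G" "c be xi q'" using semD(3)[OF c] y(1) unfolding x(1) by blast
  obtain s where "PLe s r" "PLe s q'" using G_dir[OF r(1) q'(1)] by blast
  then show False using q(3)[OF x(2) \<open>ep : elts xi\<close>] semD(2)[OF c q'(2)] by blast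
 next
  assume "?Q3 r"
  then obtain be N where q: "be : elts th" "N : SS" "!!ep s. ep : elts (dl N) ==> PLe s r ==> EX s'. PLe s' s & (EX xi:elts (dl N). ep : elts xi & c be xi s')" "!!s. PLe s r ==> ~ c be (dl N) s" by blast
  have "EX xi:elts (dl N). ep : elts xi & vc xi : eltsW (f (vc be))" if e: "ep : elts (dl N)" for ep
  proof -
   have "EX s:G. PLe s r & (EX xi:elts (dl N). ep : elts xi & c be xi s)"
   proof (rule G_below[OF _ r(1)])
    show "D (%e. EX xi:elts (dl N). ep : elts xi & c be xi (e 0))" by (intro dfn_intros DC UNIV_I)
   qed (rule q(3)[OF e])
   then show ?thesis using semD(3)[OF c] by blast
  qed
  note cl = this
  have O: "Limit elts (dl N)" "Or (dl N)" by (rule el_nonsucc[OF q(2)])+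
  have "Limit eltsW (vc (dl N))" unfolding Limit_def
  proof (intro conjI ballI)
   show "W.Or (vc (dl N))" by (rule vc_Or[OF O(2)])
   show "eltsW (vc (dl N)) ~= {}" unfolding eltsW_vc using O(1) unfolding Limit_def by blast
   fix y assume "y : eltsW (vc (dl N))"
   then obtain z where z: "y = vc z" "z : elts (dl N)" unfolding eltsW_vc by blast
   then obtain u where "u : elts (dl N)" "z : elts u" using O(1) unfolding Limit_def by blast
   then show "EX ga:eltsW (vc (dl N)). y : eltsW ga" using z(1) vc_mem by blast
  qed
  moreover have "EX ga:eltsW (f (vc be)) \<inter> eltsW (vc (dl N)). y : eltsW ga" if "y : eltsW (vc (dl N))" for y
  proof -
   obtain z where z: "y = vc z" "z : elts (dl N)" using \<open>y : eltsW (vc (dl N))\<close> unfolding eltsW_vc by blast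
   then show ?thesis using cl[OF z(2)] vc_mem by blast
  qed
  moreover have "vc (dl N) : eltsW (vc om1)" using dl_om1[OF q(2)] vc_mem by blast
  ultimately have "vc (dl N) : eltsW (f (vc be))" using C(1)[OF q(1)] unfolding club_def W_om1 by blast
  then obtain q' where q': "q' : G" "c be (dl N) q'" using semD(3)[OF c] by blast
  obtain s where "PLe s r" "PLe s q'" using G_dir[OF r(1) q'(1)] by blast
  then show False using q(4) semD(2)[OF c q'(2)] by blast
 next
  assume "?Q4 r"
  then obtain N0 W where q: "N0 : nd r" "W : nd r" "cons0 N0 W" "!!s N. PLe s r ==> N : nd s ==> N : SS ==> N0 : elts N ==> N : elts W ==> ~ g zero (dl N) s" by blast
  obtain Cl where Cl: "eltsW Cl = vc ` dl ` H N0 W" "club eltsW Cl" by (rule node_club[OF q(3) r(1) q(1,2)]) (rule that)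
  have "eltsW Cl \<inter> eltsW E ~= {}" using E Cl(2) unfolding PO_iff by blast
  then obtain N where N: "N : H N0 W" "vc (dl N) : eltsW E" unfolding Cl(1) by blast
  obtain q1 where q1: "q1 : G" "g zero (dl N) q1" using semD(3)[OF g] N(2) by blast
  obtain q2 where q2: "q2 : G" "N : nd q2" using N(1) unfolding H_def by blast
  obtain s1 where s1: "s1 : G" "PLe s1 q1" "PLe s1 q2" using G_dir[OF q1(1) q2(1)] by blast
  obtain s where s: "PLe s r" "PLe s s1" using G_dir[OF r(1) s1(1)] by blast
  have "N : nd s" using nd_mono[OF s(2)] nd_mono[OF s1(3)] q2(2) by blast
  moreover have "g zero (dl N) s" by (rule semD(2)[OF g q1(2) PLe_trans[OF s(2) s1(2)]])
  ultimately show False using q(4)[OF s(1), of N] N(1) unfolding H_def by blast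
 qed
qed

text \<open>The check name of the set \<open>Y\<close> of all functions
  \<open>h\<^sub>\<alpha>\<close> is a nonempty set of ultrapower elements without a minimal one:
  below any positive \<open>E\<close>, \<open>descend\<close> yields \<open>h\<^sub>\<beta>\<close>
  and a positive subset of \<open>E\<close> which forces \<open>h\<^sub>\<beta>\<close> below
  \<open>h\<^sub>\<alpha>\<close> in the ultrapower.\<close>

theorem not_precipitous: "~ precipitous eltsW (NS_omega1 eltsW)"
proof
 let ?le = "positive_le eltsW (NS_omega1 eltsW)"
 assume pre: "precipitous eltsW (NS_omega1 eltsW)"
 have leI: "?le q p \<longleftrightarrow> p : PO & q : PO & eltsW q \<subseteq> eltsW p" for q p unfolding positive_le_def by blast
 interpret Q: poset eltsW PO ?le
 proof
  show "W.small PO" by (rule W.small_positive)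
  show "W.D (%e. ?le (e 0) (e 1))" unfolding leI by (intro dfn_conj W.dfn_mem W.ds_positive W.dfn_subset W.ds_elts W.dt_var)
 qed (auto simp: leI)
 have top: "vc om1 : PO" unfolding PO_iff
 proof (intro conjI allI impI subset_refl)
  fix c assume cl: "club eltsW c"
  have "zero : elts om1" unfolding om1_iff using Ord_zero ctb_finite by simp
  then have "vc zero : eltsW (vc om1)" using vc_mem by blast
  then show "eltsW c \<inter> eltsW (vc om1) ~= {}" using cl unfolding club_def W_om1 by blast
 qed
 define hs where "hs a = W.mk ((%xi. W.pr xi (hf a xi)) ` eltsW (vc om1))" for a
 have Fh: "W.F (%e. hs (e 0))" unfolding hs_def by (intro W.dt_mk W.ds_image W.ds_elts W.dt_pr dt_hf W.dt_var W.dt_const UNIV_I)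
 have sh: "W.small ((%xi. W.pr xi (hf a xi)) ` eltsW (vc om1))" for a
  by (rule W.small_image[OF W.small_elts]) (intro W.dt_pr dt_hf W.dt_var W.dt_const UNIV_I)
 have eh: "eltsW (hs a) = (%xi. W.pr xi (hf a xi)) ` eltsW (vc om1)" for a unfolding hs_def by (rule W.elts_mk[OF sh])
 have uf: "hs a : ultrapower_fun eltsW" for a unfolding ultrapower_fun_def is_graph_def W_om1 using eh by blast
 have aph: "app eltsW (hs a) xi = hf a xi" if x: "xi : eltsW (vc om1)" for a xi
  unfolding app_def eh using x by (intro the_equality) auto
 have sY: "W.small (hs ` eltsW (vc th))" by (rule W.small_image[OF W.small_elts Fh])
 define Y where "Y = W.mk (hs ` eltsW (vc th))"
 have eY: "eltsW Y = hs ` eltsW (vc th)" unfolding Y_def by (rule W.elts_mk[OF sY])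
 have inX: "r : PO ==> Q.fmem r (Q.chk a) (Q.chk Y) \<longleftrightarrow> a : eltsW Y" for r a by (rule Q.fmem_check)
 have step: "EX b E'. b : eltsW Y & b : ultrapower_fun eltsW & ?le E' E & (ALL q. ?le q E' --> Q.fmem q (Q.chk (mem_set eltsW b a)) (ultrafilter_name eltsW (NS_omega1 eltsW)))"
  if E: "E : PO" and a: "a : eltsW Y" for E a
 proof -
  obtain al where al: "al : elts th" "a = hs (vc al)" using a unfolding eY eltsW_vc by blast
  obtain be where be: "be : elts th" "W.mk {xi:eltsW E. hf (vc be) xi : eltsW (hf (vc al) xi)} : PO" using descend[OF E al(1)] by blast
  let ?b = "hs (vc be)" and ?E = "W.mk {xi:eltsW E. hf (vc be) xi : eltsW (hf (vc al) xi)}"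
  have Dh: "W.D (%e. hf (vc be) (e 0) : eltsW (hf (vc al) (e 0)))" by (intro W.dfn_mem W.ds_elts dt_hf W.dt_var W.dt_const UNIV_I)
  have eE: "eltsW ?E = {xi:eltsW E. hf (vc be) xi : eltsW (hf (vc al) xi)}" by (rule W.elts_mk[OF W.small_sep[OF W.small_elts Dh]])
  have EE: "?le ?E E" unfolding leI using E be(2) eE by blast
  have Eo: "eltsW E \<subseteq> eltsW (vc om1)" using E PO_iff by blast
  let ?m = "mem_set eltsW ?b a"
  have "{xi : eltsW (vc om1). app eltsW ?b xi : eltsW (app eltsW a xi)} = {xi : eltsW (vc om1). hf (vc be) xi : eltsW (hf (vc al) xi)}"
   unfolding al(2) by (rule Collect_cong) (auto simp: aph)
  then have "?m = W.mk {xi : eltsW (vc om1). hf (vc be) xi : eltsW (hf (vc al) xi)}" unfolding mem_set_def W_om1 by simp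
  then have em: "eltsW ?m = {xi : eltsW (vc om1). hf (vc be) xi : eltsW (hf (vc al) xi)}" using W.elts_mk[OF W.small_sep[OF W.small_elts Dh]] by simp
  have Em: "eltsW ?E \<subseteq> eltsW ?m" unfolding em eE using Eo by blast
  have mP: "?m : PO" using be(2) Em em unfolding PO_iff by blast
  have "Q.fmem q (Q.chk ?m) (ultrafilter_name eltsW (NS_omega1 eltsW))" if q: "?le q ?E" for q
  proof (rule Q.fmem_I[where s="?m"])
   show "q : PO" "?le q ?m" using q Em mP unfolding leI by blast+
   have s: "{W.pr (Q.chk x) x | x. x : PO} = (%x. W.pr (Q.chk x) x) ` PO" by blast
   have "W.small ((%x. W.pr (Q.chk x) x) ` PO)" by (rule W.small_image[OF W.small_positive]) (intro W.dt_pr Q.dt_chk W.dt_var)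
   then have "eltsW (ultrafilter_name eltsW (NS_omega1 eltsW)) = (%x. W.pr (Q.chk x) x) ` PO" unfolding ultrafilter_name_def s by (rule W.elts_mk)
   then show "W.pr (Q.chk ?m) ?m : eltsW (ultrafilter_name eltsW (NS_omega1 eltsW))" using mP by blast
  qed
  moreover have "?b : eltsW Y" unfolding eY using be(1) vc_mem by blast
  ultimately show ?thesis using EE uf by blast
 qed
 have Y0: "hs (vc zero) : eltsW Y" unfolding eY using zero_th vc_mem by blast
 have "forces_ultrapower_wf eltsW (NS_omega1 eltsW) (vc om1)" using pre top unfolding precipitous_def by blast
 note wf = this[unfolded forces_ultrapower_wf_def Let_def f_all_def f_imp_def f_ex_def f_not_def f_and_def, THEN bspec, OF UNIV_I, of "Q.chk Y"]
 have rr: "?le r r" if "r : PO" for r using that leI by blast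
 from wf[THEN bspec, OF top, THEN mp, OF rr[OF top]]
 have "(EX q:PO. ?le q (vc om1) & (ALL a:ultrapower_fun eltsW. ALL r:PO. ?le r q --> ~ Q.fmem r (Q.chk a) (Q.chk Y))) |
  (EX r:PO. EX a:ultrapower_fun eltsW. Q.fmem r (Q.chk a) (Q.chk Y) & (ALL b:ultrapower_fun eltsW. ALL q:PO. ?le q r -->
    ~ (Q.fmem q (Q.chk b) (Q.chk Y) & (ALL q':PO. ?le q' q --> ~ (ALL q'':PO. ?le q'' q' --> ~ Q.fmem q'' (Q.chk (mem_set eltsW b a)) (ultrafilter_name eltsW (NS_omega1 eltsW)))))))"
  by blast
 then show False
 proof
  assume "EX q:PO. ?le q (vc om1) & (ALL a:ultrapower_fun eltsW. ALL r:PO. ?le r q --> ~ Q.fmem r (Q.chk a) (Q.chk Y))"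
  then obtain q where q: "q : PO" "!!a r. a : ultrapower_fun eltsW ==> r : PO ==> ?le r q ==> ~ Q.fmem r (Q.chk a) (Q.chk Y)" by blast
  show False using q(2)[OF uf q(1) rr[OF q(1)]] inX[OF q(1)] Y0 by blast
 next
  assume "EX r:PO. EX a:ultrapower_fun eltsW. Q.fmem r (Q.chk a) (Q.chk Y) & (ALL b:ultrapower_fun eltsW. ALL q:PO. ?le q r -->
    ~ (Q.fmem q (Q.chk b) (Q.chk Y) & (ALL q':PO. ?le q' q --> ~ (ALL q'':PO. ?le q'' q' --> ~ Q.fmem q'' (Q.chk (mem_set eltsW b a)) (ultrafilter_name eltsW (NS_omega1 eltsW))))))"
  then obtain r a where ra: "r : PO" "Q.fmem r (Q.chk a) (Q.chk Y)" and bad: "!!b q. b : ultrapower_fun eltsW ==> q : PO ==> ?le q r ==> Q.fmem q (Q.chk b) (Q.chk Y) ==>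
    EX q':PO. ?le q' q & (ALL q'':PO. ?le q'' q' --> ~ Q.fmem q'' (Q.chk (mem_set eltsW b a)) (ultrafilter_name eltsW (NS_omega1 eltsW)))" by blast
  have "a : eltsW Y" using inX[OF ra(1)] ra(2) by blast
  from step[OF ra(1) this] obtain b E' where b: "b : eltsW Y" "b : ultrapower_fun eltsW" "?le E' r"
   "!!q. ?le q E' ==> Q.fmem q (Q.chk (mem_set eltsW b a)) (ultrafilter_name eltsW (NS_omega1 eltsW))" by blast
  have E': "E' : PO" using b(3) leI by blast
  have "Q.fmem E' (Q.chk b) (Q.chk Y)" using inX[OF E'] b(1) by blast
  from bad[OF b(2) E' b(3) this] obtain q' where q': "q' : PO" "?le q' E'" "!!q''. q'' : PO ==> ?le q'' q' ==> ~ Q.fmem q'' (Q.chk (mem_set eltsW b a)) (ultrafilter_name eltsW (NS_omega1 eltsW))" by blast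
  show False using q'(3)[OF q'(1) rr[OF q'(1)]] b(4)[OF q'(2)] by blast
 qed
qed

end

theorem theorem3p9:
  fixes eltsV :: "'v \<Rightarrow> 'v set" and eltsW :: "'w \<Rightarrow> 'w set"
    and \<theta> :: 'v and S T G :: "'v set" and val :: "'v \<Rightarrow> 'w"
  assumes "zfc_model eltsV"
    and "inaccessible eltsV \<theta>"
    and "S = countable_submodels eltsV \<theta>"
    and "T = transitive_submodels eltsV \<theta>"
    and "generic eltsV (Mstar eltsV \<theta> S T) (Mstar_le eltsV \<theta> S T) G"
    and "generic_extension eltsV G eltsW val"
  shows "val (check eltsV (Mstar eltsV \<theta> S T) \<theta>) = omega2 eltsW \<and>
         \<not> precipitous eltsW (NS_omega1 eltsW)"
proof -
 interpret V: inacc eltsV \<theta> by unfold_locales (fact assms)+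
 interpret ext eltsV \<theta> G eltsW val
 proof
  show "V.small V.PP" by (rule V.small_PP)
  show "V.D (%e. V.PLe (e 0) (e 1))" by (intro V.D_PLe V.dt_var)
  show "generic eltsV V.PP V.PLe G" using assms(5) unfolding assms(3,4) V.PL_PLe .
 qed (use V.PLe_PP V.PLe_refl V.PLe_trans assms(6) in blast)+
 show ?thesis unfolding assms(3,4) using W_om2 not_precipitous by simp
qed

end
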